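(* Let $n\ge1$, $p\ge1$, $\epsilon>0$, $C>0$ and $N>0$. Let $\{f_k\,d\gamma\}_{k\ge1}$ be centered probability measures on $\mathbb{R}^n$ with $\sqrt{f_k}\in W^{1,2}(\mathbb{R}^n,d\gamma)$ and suppose that, for all $k$, $$\int_{\mathbb{R}^n} f_k\,e^{-\left(\frac12-\frac{\epsilon}{4\pi}\right)|x|^2}\,dx\le C\qquad\text{and}\qquad \int_{\mathbb{R}^n}|f_k|^{2p-1}\,d\gamma\le N.$$ If $\delta(f_k)\to0$ as $k\to\infty$, then $f_k\to1$ in $L^p(d\gamma)$.
   Context: On $\mathbb{R}^n$, $d\gamma=(2\pi)^{-n/2}e^{-|x|^2/2}dx$ is the standard Gaussian measure. For a probability measure $f\,d\gamma$ with $\sqrt f\in W^{1,2}(\mathbb{R}^n,d\gamma)$, the Fisher information is $\mathrm{I}(f)=\int \frac{|\nabla f|^2}{f}\,d\gamma$, the relative entropy is $\mathrm{H}(f)=\int f\log f\,d\gamma$, and the log-Sobolev deficit is $\delta(f)=\frac12 \mathrm{I}(f)-\mathrm{H}(f)\ge 0$. A probability measure $\mu$ is centered if $\int x\,d\mu=0$. *)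

theory Defs
  imports "HOL-Probability.Probability"
begin

definition gaussian_measure :: "(real^'n) measure" where
  "gaussian_measure =
     density lborel (\<lambda>x. ennreal ((2 * pi) powr (- real CARD('n) / 2) * exp (- (norm x)\<^sup>2 / 2)))"

definition Lp_space :: "'a measure \<Rightarrow> real \<Rightarrow> ('a \<Rightarrow> 'b::{banach,second_countable_topology}) \<Rightarrow> bool" where
  "Lp_space M p u \<longleftrightarrow> u \<in> borel_measurable M \<and> integrable M (\<lambda>x. norm (u x) powr p)"

definition Lp_norm :: "'a measure \<Rightarrow> real \<Rightarrow> ('a \<Rightarrow> 'b::{banach,second_countable_topology}) \<Rightarrow> real" where
  "Lp_norm M p u = (\<integral>x. norm (u x) powr p \<partial>M) powr (1 / p)"

definition tendsto_Lp ::
    "'a measure \<Rightarrow> real \<Rightarrow> (nat \<Rightarrow> 'a \<Rightarrow> real) \<Rightarrow> ('a \<Rightarrow> real) \<Rightarrow> bool" where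
  "tendsto_Lp M p u v \<longleftrightarrow>
     (\<forall>k. Lp_space M p (u k)) \<and> Lp_space M p v \<and>
     (\<lambda>k. Lp_norm M p (\<lambda>x. u k x - v x)) \<longlonglongrightarrow> 0"

definition partial_deriv :: "'n \<Rightarrow> (real^'n \<Rightarrow> real) \<Rightarrow> real^'n \<Rightarrow> real" where
  "partial_deriv i u x = frechet_derivative u (at x) (axis i 1)"

fun C_k :: "nat \<Rightarrow> (real^'n \<Rightarrow> real) \<Rightarrow> bool" where
  "C_k 0 u \<longleftrightarrow> continuous_on UNIV u"
| "C_k (Suc k) u \<longleftrightarrow> u differentiable_on UNIV \<and> (\<forall>i. C_k k (partial_deriv i u))"

definition test_function :: "(real^'n \<Rightarrow> real) \<Rightarrow> bool" where
  "test_function \<phi> \<longleftrightarrow> (\<forall>k. C_k k \<phi>) \<and> compact (closure {x. \<phi> x \<noteq> 0})"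

definition locally_integrable :: "(real^'n \<Rightarrow> 'b::{banach,second_countable_topology}) \<Rightarrow> bool" where
  "locally_integrable u \<longleftrightarrow> (\<forall>K. compact K \<longrightarrow> set_integrable lborel K u)"

text \<open>Weak derivatives are taken with respect to Lebesgue measure, also in the Gaussian Sobolev
  space below.\<close>

definition has_weak_gradient :: "(real^'n \<Rightarrow> real) \<Rightarrow> (real^'n \<Rightarrow> real^'n) \<Rightarrow> bool" where
  "has_weak_gradient u g \<longleftrightarrow>
     locally_integrable u \<and> locally_integrable g \<and>
     (\<forall>\<phi> i. test_function \<phi> \<longrightarrow>
        (\<integral>x. u x * partial_deriv i \<phi> x \<partial>lborel) = - (\<integral>x. g x $ i * \<phi> x \<partial>lborel))"

text \<open>A weak gradient is unique up to a null set, so integrals involving the following choice do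
  not depend on it. The value is meaningful only if some weak gradient exists.\<close>

definition weak_gradient :: "(real^'n \<Rightarrow> real) \<Rightarrow> real^'n \<Rightarrow> real^'n" where
  "weak_gradient u = (SOME g. has_weak_gradient u g)"

definition gaussian_W12 :: "(real^'n \<Rightarrow> real) \<Rightarrow> bool" where
  "gaussian_W12 u \<longleftrightarrow>
     Lp_space gaussian_measure 2 u \<and>
     (\<exists>g. has_weak_gradient u g \<and> Lp_space gaussian_measure 2 g)"

text \<open>The next two integrals are only used for probability densities \<open>f\<close> whose square root is in
  \<open>gaussian_W12\<close>. There \<open>f\<close> has the weak gradient \<open>2 \<surd>f \<nabla>\<surd>f\<close>, which vanishes almost everywhere on
  \<open>{f = 0}\<close>, so that \<open>x / 0 = 0\<close> gives the usual convention for the integrand and the Fisher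
  information is the finite number \<open>4 \<integral> \<bar>\<nabla>\<surd>f\<bar>\<^sup>2 d\<gamma>\<close>. By the logarithmic Sobolev inequality
  \<open>f log f\<close> is then integrable as well (with \<open>0 log 0 = 0\<close>, as \<open>0 * ln 0 = 0\<close>).\<close>

definition fisher_information :: "(real^'n \<Rightarrow> real) \<Rightarrow> real" where
  "fisher_information f = (\<integral>x. (norm (weak_gradient f x))\<^sup>2 / f x \<partial>gaussian_measure)"

definition relative_entropy :: "(real^'n \<Rightarrow> real) \<Rightarrow> real" where
  "relative_entropy f = (\<integral>x. f x * ln (f x) \<partial>gaussian_measure)"

definition log_sobolev_deficit :: "(real^'n \<Rightarrow> real) \<Rightarrow> real" where
  "log_sobolev_deficit f = fisher_information f / 2 - relative_entropy f"

text \<open>The sign condition is separate because \<open>ennreal\<close> truncates negative values to \<open>0\<close>.\<close>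

definition gaussian_prob_density :: "(real^'n \<Rightarrow> real) \<Rightarrow> bool" where
  "gaussian_prob_density f \<longleftrightarrow>
     f \<in> borel_measurable borel \<and> (AE x in gaussian_measure. 0 \<le> f x) \<and>
     prob_space (density gaussian_measure (\<lambda>x. ennreal (f x)))"

definition centered :: "(real^'n) measure \<Rightarrow> bool" where
  "centered M \<longleftrightarrow> integrable M (\<lambda>x. x) \<and> (\<integral>x. x \<partial>M) = 0"

end

theory Submission
  imports Defs "HOL-Computational_Algebra.Polynomial"
begin

text \<open>The deficit controls \<open>L\<^sup>1\<close> distance quantitatively: if \<open>f d\<gamma>\<close> is centered and
  \<open>Q = \<integral> f exp (a |x|\<^sup>2) d\<gamma>\<close> is finite for some \<open>0 < a < 1/2\<close>, then
  \<open>(\<integral> |f - 1| d\<gamma>)\<^sup>2 \<le> K Q \<delta>(f)\<close> with \<open>K\<close> depending only on \<open>a\<close> and the dimension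
  (\<open>log_sobolev_L1_stability\<close>). The moment hypothesis of the corollary bounds \<open>Q\<close> uniformly, so
  \<open>f\<^sub>k \<rightarrow> 1\<close> in \<open>L\<^sup>1\<close>; since \<open>p\<close> is the midpoint of \<open>1\<close> and \<open>2 p - 1\<close>, the bound
  in \<open>L\<close> to the power \<open>2 p - 1\<close> and the Cauchy-Schwarz inequality upgrade this to
  \<open>L\<^sup>p\<close>.

  The stability estimate is first proved for bounded \<open>C\<^sup>1\<close> functions \<open>F\<close> with a positive
  lower bound. Let \<open>c\<^sup>2 + s\<^sup>2 = 1\<close> and let
  \<open>A F (x) = E F (c x + s Z)\<close>, with \<open>Z\<close> standard Gaussian, be the Mehler average of
  \<open>F\<close>. The logarithmic Sobolev inequality, applied to \<open>z \<mapsto> F (c x + s z)\<close> for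
  each \<open>x\<close> and once more to \<open>A F\<close>, bounds the entropy of \<open>F\<close> by half of its Fisher information
  minus \<open>c\<^sup>2/2\<close> times the gap in Jensen's inequality
  \<open>|A \<nabla>F|\<^sup>2 / A F \<le> A (|\<nabla>F|\<^sup>2 / F)\<close>. That gap is the mean square distance,
  under the joint law with weight \<open>F\<close>, between the score \<open>w = \<nabla>F / F\<close> at \<open>U\<close> and the vector
  \<open>v = A \<nabla>F / A F\<close> at \<open>X\<close>, where \<open>U\<close> and \<open>X = c U - s Z\<close> are a pair of correlated
  Gaussians (\<open>log_sobolev_deficit_lower_bound\<close>). Hence a small deficit forces \<open>w (U)\<close> to be
  almost a function of \<open>X\<close>.

  Given \<open>U = u\<close>, the variable \<open>X\<close> is Gaussian with mean \<open>c u\<close>. Moving the mean to \<open>0\<close> by a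
  Cameron-Martin shift costs a density whose second moment is \<open>exp (a |u|\<^sup>2)\<close> with
  \<open>a = c\<^sup>2/s\<^sup>2\<close>, and after the shift the comparison value no longer depends on
  \<open>u\<close>. So \<open>w\<close> is close in \<open>L\<^sup>1(F d\<gamma>)\<close> to a constant vector, with an error given by the
  deficit and the exponential moment of order \<open>a\<close>; every \<open>a > 0\<close> belongs to some pair
  \<open>(c, s)\<close>, so an exponential moment of arbitrarily small order suffices. As
  \<open>\<integral> \<nabla>F d\<gamma> = \<integral> x F d\<gamma>\<close>, the constant vector is controlled by the barycentre of \<open>F\<close>, which
  gives a bound on \<open>\<integral> |\<nabla>F| d\<gamma>\<close> (\<open>gradient_L1_bound\<close>). The Gaussian Poincare inequality in
  \<open>L\<^sup>1\<close> turns it into a bound on the oscillation of \<open>F\<close> (\<open>gaussian_L1_poincare\<close>).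

  The logarithmic Sobolev inequality itself and the Poincare inequality both come from rotating a
  pair of independent Gaussians: the entropy of the Mehler average at angle \<open>\<theta>\<close> has derivative
  \<open>- sin \<theta> cos \<theta> \<integral> |A \<nabla>F|\<^sup>2 / A F d\<gamma>\<close>, which Jensen's inequality bounds below
  by \<open>- sin \<theta> cos \<theta>\<close> times the Fisher information.

  For a density \<open>f\<close> with \<open>\<surd>f\<close> in the Gaussian Sobolev space, \<open>\<surd>f\<close> is approximated by \<open>v\<^sub>k\<close>,
  cut off and then mollified (\<open>weak_gradient_approximation\<close>), and the smooth estimate is applied
  to \<open>v\<^sub>k\<^sup>2 + 1/(k+1)\<close>. Its Fisher information is at most
  \<open>4 \<integral> |\<nabla>v\<^sub>k|\<^sup>2 d\<gamma>\<close>, which tends to the Fisher information of \<open>f\<close>; the entropy is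
  lower semicontinuous by Fatou's lemma, and this is the direction needed. That
  \<open>4 \<integral> |\<nabla>\<surd>f|\<^sup>2 d\<gamma>\<close> equals the Fisher information requires uniqueness of weak gradients,
  a chain rule, and the fact that \<open>\<nabla>\<surd>f\<close> vanishes almost everywhere where \<open>f\<close> does.\<close>

section \<open>Gaussian measure: moments, shifts and rotations\<close>

abbreviation (input) \<gamma> :: "(real^'n) measure" where "\<gamma> \<equiv> gaussian_measure"

definition gauss_density :: "real^'n \<Rightarrow> real" where
  "gauss_density x = (2 * pi) powr (- real CARD('n) / 2) * exp (- (norm x)\<^sup>2 / 2)"

lemma gaussian_measure_gauss_density: "gaussian_measure = density lborel (\<lambda>x. ennreal (gauss_density x))"
  unfolding gaussian_measure_def gauss_density_def ..

lemma gauss_density_pos: "gauss_density x > 0"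
  by (simp add: gauss_density_def)

lemma gauss_density_nonneg [simp]: "gauss_density x \<ge> 0"
  using gauss_density_pos[of x] by simp

lemma continuous_gauss_density: "continuous_on S gauss_density"
  unfolding gauss_density_def by (intro continuous_intros) auto

lemma measurable_gauss_density [measurable]: "gauss_density \<in> borel_measurable borel"
  using continuous_gauss_density by (rule borel_measurable_continuous_onI)

lemma sets_gaussian [measurable_cong, simp]: "sets gaussian_measure = sets borel"
  by (simp add: gaussian_measure_def)

lemma space_gaussian [simp]: "space gaussian_measure = UNIV"
  by (simp add: gaussian_measure_def)

lemma nn_integral_gaussian:
  "f \<in> borel_measurable borel \<Longrightarrow> (\<integral>\<^sup>+x. f x \<partial>\<gamma>) = (\<integral>\<^sup>+x. ennreal (gauss_density x) * f x \<partial>lborel)"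
  unfolding gaussian_measure_gauss_density by (subst nn_integral_density) auto

lemma integral_gaussian:
  fixes f :: "real^'n \<Rightarrow> 'b::{banach,second_countable_topology}"
  shows "f \<in> borel_measurable borel \<Longrightarrow> (\<integral>x. f x \<partial>\<gamma>) = (\<integral>x. gauss_density x *\<^sub>R f x \<partial>lborel)"
  unfolding gaussian_measure_gauss_density by (subst integral_density) auto

lemma integrable_gaussian_iff:
  fixes f :: "real^'n \<Rightarrow> 'b::{banach,second_countable_topology}"
  shows "f \<in> borel_measurable borel \<Longrightarrow> integrable \<gamma> f \<longleftrightarrow> integrable lborel (\<lambda>x. gauss_density x *\<^sub>R f x)"
  unfolding gaussian_measure_gauss_density by (subst integrable_density) auto

lemma AE_gaussian_iff: "(AE x in \<gamma>. P x) \<longleftrightarrow> (AE x in lborel. P x)"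
  unfolding gaussian_measure_gauss_density
  by (subst AE_density) (auto simp: gauss_density_pos)

lemma nn_integral_exp_square_real:
  assumes "\<beta> > 0"
  shows "(\<integral>\<^sup>+x. ennreal (exp (- \<beta> * x\<^sup>2)) \<partial>lborel) = ennreal (sqrt (pi / \<beta>))"
proof -
  define \<sigma> where "\<sigma> = sqrt (1 / (2 * \<beta>))"
  have \<sigma>: "\<sigma> > 0" "2 * \<sigma>\<^sup>2 = 1 / \<beta>" using assms by (auto simp: \<sigma>_def)
  have "exp (- \<beta> * x\<^sup>2) = sqrt (pi / \<beta>) * normal_density 0 \<sigma> x" for x
  proof -
    have "2 * pi * \<sigma>\<^sup>2 = pi / \<beta>" using \<sigma>(2) by (simp add: field_simps)
    moreover have "- (x - 0)\<^sup>2 / (2 * \<sigma>\<^sup>2) = - \<beta> * x\<^sup>2" unfolding \<sigma>(2) by simp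
    ultimately show ?thesis using assms by (simp add: normal_density_def)
  qed
  then have "(\<integral>\<^sup>+x. ennreal (exp (- \<beta> * x\<^sup>2)) \<partial>lborel)
      = (\<integral>\<^sup>+x. ennreal (sqrt (pi / \<beta>)) * ennreal (normal_density 0 \<sigma> x) \<partial>lborel)"
    using assms by (simp add: ennreal_mult')
  also have "\<dots> = ennreal (sqrt (pi / \<beta>)) * (\<integral>\<^sup>+x. ennreal (normal_density 0 \<sigma> x) \<partial>lborel)"
    by (rule nn_integral_cmult) simp
  also have "(\<integral>\<^sup>+x. ennreal (normal_density 0 \<sigma> x) \<partial>lborel) = 1"
    using \<sigma> by (subst nn_integral_eq_integral) auto
  finally show ?thesis by simp
qed

text \<open>The square of the norm is the sum of the squared coordinates, so the integral factorizes over
  the coordinates.\<close>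

lemma nn_integral_exp_square:
  assumes "\<beta> > 0"
  shows "(\<integral>\<^sup>+x. ennreal (exp (- \<beta> * (norm (x::real^'n))\<^sup>2)) \<partial>lborel)
           = ennreal ((pi / \<beta>) powr (real CARD('n) / 2))"
proof -
  have "ennreal (exp (- \<beta> * (norm x)\<^sup>2)) = (\<Prod>b\<in>Basis. ennreal (exp (- \<beta> * (x \<bullet> b)\<^sup>2)))" for x :: "real^'n"
    unfolding power2_norm_eq_inner euclidean_inner[of x x]
    by (simp add: prod_ennreal exp_sum[symmetric] sum_distrib_left power2_eq_square)
  then have "(\<integral>\<^sup>+x. ennreal (exp (- \<beta> * (norm (x::real^'n))\<^sup>2)) \<partial>lborel)
      = (\<Prod>b\<in>(Basis :: (real^'n) set). ennreal (sqrt (pi / \<beta>)))"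
    using nn_integral_lborel_prod[where 'a = "real^'n" and f = "\<lambda>_ y. ennreal (exp (- \<beta> * y\<^sup>2))"]
      nn_integral_exp_square_real[OF assms] by simp
  also have "\<dots> = ennreal (sqrt (pi / \<beta>) ^ CARD('n))"
    using assms by (simp add: ennreal_power)
  also have "sqrt (pi / \<beta>) ^ CARD('n) = (pi / \<beta>) powr (real CARD('n) / 2)"
    using assms by (simp add: powr_half_sqrt[symmetric] powr_realpow[symmetric] powr_powr)
  finally show ?thesis .
qed

lemma nn_integral_gaussian_exp_square:
  assumes "a < 1 / 2"
  shows "(\<integral>\<^sup>+x. ennreal (exp (a * (norm (x::real^'n))\<^sup>2)) \<partial>\<gamma>) = ennreal ((1 - 2 * a) powr (- real CARD('n) / 2))"
proof -
  let ?C = "(2 * pi) powr (- real CARD('n) / 2)"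
  have "(\<integral>\<^sup>+x. ennreal (exp (a * (norm (x::real^'n))\<^sup>2)) \<partial>\<gamma>)
      = (\<integral>\<^sup>+x. ennreal ?C * ennreal (exp (- (1/2 - a) * (norm (x::real^'n))\<^sup>2)) \<partial>lborel)"
  proof -
    have "gauss_density x * exp (a * (norm x)\<^sup>2) = ?C * exp (- (1/2 - a) * (norm x)\<^sup>2)" for x :: "real^'n"
      by (simp add: gauss_density_def mult.assoc exp_add[symmetric] left_diff_distrib)
    then show ?thesis by (simp add: nn_integral_gaussian ennreal_mult'[symmetric])
  qed
  also have "\<dots> = ennreal ?C * ennreal ((pi / (1/2 - a)) powr (real CARD('n) / 2))"
    using assms by (subst nn_integral_cmult) (simp_all only: nn_integral_exp_square[of "1/2 - a"], auto)
  also have "\<dots> = ennreal ((1 - 2 * a) powr (- real CARD('n) / 2))"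
  proof -
    have "pi / (1/2 - a) = 2 * pi * (1 - 2 * a) powr (-1)"
      using assms by (simp add: powr_minus field_simps)
    then have "?C * (pi / (1/2 - a)) powr (real CARD('n) / 2) = (1 - 2 * a) powr (- real CARD('n) / 2)"
      using assms powr_mult[of "2 * pi" "inverse (1 - 2 * a)" "real CARD('n) / 2"]
      by (simp add: powr_minus inverse_powr del: powr_mult)
    then show ?thesis by (simp add: ennreal_mult'[symmetric])
  qed
  finally show ?thesis .
qed

lemma prob_space_gaussian: "prob_space (\<gamma> :: (real^'n) measure)"
  using nn_integral_gaussian_exp_square[of 0, where 'n = 'n]
  by (intro prob_spaceI) simp

interpretation gaussian: prob_space "\<gamma> :: (real^'n) measure"
  by (rule prob_space_gaussian)

interpretation gaussian2: pair_prob_space "\<gamma> :: (real^'n) measure" "\<gamma> :: (real^'n) measure" ..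

lemma integrable_gaussian_exp_square:
  "a < 1 / 2 \<Longrightarrow> integrable \<gamma> (\<lambda>x::real^'n. exp (a * (norm x)\<^sup>2))"
  by (intro integrableI_bounded) (simp_all add: nn_integral_gaussian_exp_square)

text \<open>Lets exponential moments of small order dominate the first moment.\<close>

lemma norm_le_exp_square: "t \<le> (1 + 1 / a) * exp (a * t\<^sup>2)" if "a > 0" for t a :: real
proof -
  have 1: "1 + a * t\<^sup>2 \<le> exp (a * t\<^sup>2)" by (rule exp_ge_add_one_self)
  have "t \<le> 1 + t\<^sup>2" using zero_le_power2[of "t - 1 / 2"] by (simp add: power2_eq_square algebra_simps)
  also have "\<dots> \<le> (1 + 1 / a) * (1 + a * t\<^sup>2)" using that by (simp add: field_simps)
  also have "\<dots> \<le> (1 + 1 / a) * exp (a * t\<^sup>2)" using 1 that by (intro mult_left_mono) auto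
  finally show ?thesis .
qed

lemma integrable_gaussian_norm: "integrable \<gamma> (\<lambda>x::real^'n. norm x)"
  by (rule Bochner_Integration.integrable_bound[OF integrable_mult_right[OF integrable_gaussian_exp_square[of "1/4"], of "1 + 1 / (1/4)"]])
     (use norm_le_exp_square[of "1/4"] in \<open>auto intro!: AE_I2\<close>)

lemma gauss_density_shift: "gauss_density (x - h) = gauss_density x * exp (h \<bullet> x - (norm h)\<^sup>2 / 2)"
proof -
  have "(norm (x - h))\<^sup>2 = (norm x)\<^sup>2 - 2 * (h \<bullet> x) + (norm h)\<^sup>2"
    by (simp add: power2_norm_eq_inner algebra_simps inner_commute)
  then show ?thesis by (simp add: gauss_density_def exp_add[symmetric] field_simps)
qed

text \<open>Shifting the Gaussian multiplies its density by \<open>exp (h \<bullet> x - |h|\<^sup>2/2)\<close>, while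
  Lebesgue measure is invariant under the shift.\<close>

theorem cameron_martin:
  "distr \<gamma> borel (\<lambda>x::real^'n. x + h) = density \<gamma> (\<lambda>x. ennreal (exp (h \<bullet> x - (norm h)\<^sup>2 / 2)))"
proof (rule measure_eqI)
  fix A assume "A \<in> sets (distr \<gamma> borel (\<lambda>x::real^'n. x + h))"
  then have [measurable]: "A \<in> sets borel" by simp
  let ?\<Phi> = "indicator A :: real^'n \<Rightarrow> ennreal"
  have "emeasure (distr \<gamma> borel (\<lambda>x::real^'n. x + h)) A = (\<integral>\<^sup>+x. ?\<Phi> x \<partial>distr \<gamma> borel (\<lambda>x::real^'n. x + h))"
    by simp
  also have "\<dots> = (\<integral>\<^sup>+x. ennreal (gauss_density x) * ?\<Phi> (x + h) \<partial>lborel)"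
    by (subst nn_integral_distr) (simp_all add: nn_integral_gaussian)
  also have "\<dots> = (\<integral>\<^sup>+x. ennreal (gauss_density ((h + x) - h)) * ?\<Phi> (h + x) \<partial>lborel)"
    by (simp add: add.commute)
  also have "\<dots> = (\<integral>\<^sup>+x. ennreal (gauss_density (x - h)) * ?\<Phi> x \<partial>distr lborel borel ((+) h))"
    by (subst nn_integral_distr) auto
  also have "\<dots> = (\<integral>\<^sup>+x. ennreal (gauss_density x) * (ennreal (exp (h \<bullet> x - (norm h)\<^sup>2 / 2)) * ?\<Phi> x) \<partial>lborel)"
    by (simp add: lborel_distr_plus gauss_density_shift ennreal_mult' mult.assoc)
  also have "\<dots> = emeasure (density \<gamma> (\<lambda>x. ennreal (exp (h \<bullet> x - (norm h)\<^sup>2 / 2)))) A"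
    by (simp add: emeasure_density nn_integral_gaussian)
  finally show "emeasure (distr \<gamma> borel (\<lambda>x::real^'n. x + h)) A
      = emeasure (density \<gamma> (\<lambda>x. ennreal (exp (h \<bullet> x - (norm h)\<^sup>2 / 2)))) A" .
qed simp

lemma integral_cameron_martin:
  fixes f :: "real^'n \<Rightarrow> 'b::{banach,second_countable_topology}"
  assumes [measurable]: "f \<in> borel_measurable borel"
  shows "(\<integral>x. f (x + h) \<partial>\<gamma>) = (\<integral>x. exp (h \<bullet> x - (norm h)\<^sup>2 / 2) *\<^sub>R f x \<partial>\<gamma>)"
proof -
  have "(\<integral>x. f (x + h) \<partial>\<gamma>) = integral\<^sup>L (distr \<gamma> borel (\<lambda>x. x + h)) f"
    by (subst integral_distr) auto
  also have "\<dots> = (\<integral>x. exp (h \<bullet> x - (norm h)\<^sup>2 / 2) *\<^sub>R f x \<partial>\<gamma>)"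
    unfolding cameron_martin by (subst integral_density) auto
  finally show ?thesis .
qed

lemma nn_integral_gaussian_exp_inner:
  "(\<integral>\<^sup>+x. ennreal (exp (h \<bullet> x - (norm h)\<^sup>2 / 2)) \<partial>\<gamma>) = 1" for h :: "real^'n"
proof -
  have "(\<integral>\<^sup>+x. ennreal (exp (h \<bullet> x - (norm h)\<^sup>2 / 2)) \<partial>\<gamma>) = emeasure (distr \<gamma> borel (\<lambda>x. x + h)) UNIV"
    unfolding cameron_martin by (simp add: emeasure_density)
  also have "\<dots> = 1"
    by (simp add: emeasure_distr gaussian.emeasure_space_1[simplified])
  finally show ?thesis .
qed

lemma integrable_gaussian_exp_inner: "integrable \<gamma> (\<lambda>x. exp (h \<bullet> x - (norm h)\<^sup>2 / 2))" for h :: "real^'n"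
  by (intro integrableI_bounded) (simp_all add: nn_integral_gaussian_exp_inner)

lemma nn_integral_lborel_scale:
  fixes f :: "real^'n \<Rightarrow> ennreal"
  assumes [measurable]: "f \<in> borel_measurable borel" and c: "c \<noteq> 0"
  shows "(\<integral>\<^sup>+x. f x \<partial>lborel) = ennreal (\<bar>c\<bar> ^ CARD('n)) * (\<integral>\<^sup>+x. f (t + c *\<^sub>R x) \<partial>lborel)"
  by (subst lborel_affine[OF c, of t])
     (simp add: nn_integral_density nn_integral_distr nn_integral_cmult ennreal_power[symmetric])

text \<open>The joint density depends only on \<open>|x|\<^sup>2 + |z|\<^sup>2\<close>, which the rotation preserves.
  The rotation is performed as two affine substitutions, \<open>x = (u - s z)/c\<close> for fixed \<open>z\<close>
  and then \<open>z = s u + c w\<close> for fixed \<open>u\<close>; the Jacobian factors cancel.\<close>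

lemma nn_integral_gaussian_rotate:
  fixes \<Phi> :: "(real^'n) \<times> (real^'n) \<Rightarrow> ennreal"
  assumes [measurable]: "\<Phi> \<in> borel_measurable (borel \<Otimes>\<^sub>M borel)" and cs: "c\<^sup>2 + s\<^sup>2 = 1" and c: "c \<noteq> 0"
  shows "(\<integral>\<^sup>+x. \<integral>\<^sup>+z. \<Phi> (c *\<^sub>R x + s *\<^sub>R z, c *\<^sub>R z - s *\<^sub>R x) \<partial>\<gamma> \<partial>\<gamma>) = (\<integral>\<^sup>+x. \<integral>\<^sup>+z. \<Phi> (x, z) \<partial>\<gamma> \<partial>\<gamma>)"
proof -
  let ?N = "CARD('n)"
  have lem: "(\<integral>\<^sup>+x. \<integral>\<^sup>+z. \<Psi> (x, z) \<partial>\<gamma> \<partial>\<gamma>)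
      = (\<integral>\<^sup>+x. \<integral>\<^sup>+z. ennreal (gauss_density x * gauss_density z) * \<Psi> (x, z) \<partial>lborel \<partial>lborel)"
    if [measurable]: "\<Psi> \<in> borel_measurable (borel \<Otimes>\<^sub>M borel)" for \<Psi> :: "(real^'n) \<times> (real^'n) \<Rightarrow> ennreal"
    by (simp add: nn_integral_gaussian nn_integral_cmult[symmetric] ennreal_mult' mult.assoc)
  have "c * c + s * s = 1" using cs by (simp add: power2_eq_square)
  then have split: "u = (c * c) *\<^sub>R u + (s * s) *\<^sub>R u" for u :: "real^'n"
    by (metis scaleR_add_left scaleR_one)
  have "(\<integral>\<^sup>+x. \<integral>\<^sup>+z. \<Phi> (c *\<^sub>R x + s *\<^sub>R z, c *\<^sub>R z - s *\<^sub>R x) \<partial>\<gamma> \<partial>\<gamma>)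
     = (\<integral>\<^sup>+x. \<integral>\<^sup>+z. ennreal (gauss_density x * gauss_density z) * \<Phi> (c *\<^sub>R x + s *\<^sub>R z, c *\<^sub>R z - s *\<^sub>R x) \<partial>lborel \<partial>lborel)"
    using lem[of "\<lambda>p. \<Phi> (c *\<^sub>R fst p + s *\<^sub>R snd p, c *\<^sub>R snd p - s *\<^sub>R fst p)"] by simp
  also have "\<dots> = (\<integral>\<^sup>+z. \<integral>\<^sup>+x. ennreal (gauss_density x * gauss_density z) * \<Phi> (c *\<^sub>R x + s *\<^sub>R z, c *\<^sub>R z - s *\<^sub>R x) \<partial>lborel \<partial>lborel)"
    by (rule lborel_pair.Fubini'[symmetric]) simp
  also have "\<dots> = (\<integral>\<^sup>+z. ennreal (\<bar>1/c\<bar> ^ ?N) * (\<integral>\<^sup>+u. ennreal (gauss_density ((1/c) *\<^sub>R (u - s *\<^sub>R z)) * gauss_density z) *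
       \<Phi> (u, (1/c) *\<^sub>R (z - s *\<^sub>R u)) \<partial>lborel) \<partial>lborel)"
  proof (rule nn_integral_cong)
    fix z :: "real^'n"
    have e: "- (s / c) *\<^sub>R z + (1/c) *\<^sub>R u = (1/c) *\<^sub>R (u - s *\<^sub>R z)" for u
      by (simp add: algebra_simps)
    have e2: "c *\<^sub>R ((1/c) *\<^sub>R (u - s *\<^sub>R z)) + s *\<^sub>R z = u" for u using c by simp
    have e3: "c *\<^sub>R z - s *\<^sub>R ((1/c) *\<^sub>R (u - s *\<^sub>R z)) = (1/c) *\<^sub>R (z - s *\<^sub>R u)" for u
    proof -
      have "c *\<^sub>R (c *\<^sub>R z - s *\<^sub>R ((1/c) *\<^sub>R (u - s *\<^sub>R z))) = (c * c) *\<^sub>R z + (s * s) *\<^sub>R z - s *\<^sub>R u"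
        using c by (simp add: algebra_simps)
      also have "\<dots> = c *\<^sub>R ((1/c) *\<^sub>R (z - s *\<^sub>R u))"
        using c split[of z] by simp
      finally show ?thesis using c by (metis real_vector.scale_left_imp_eq)
    qed
    show "(\<integral>\<^sup>+x. ennreal (gauss_density x * gauss_density z) * \<Phi> (c *\<^sub>R x + s *\<^sub>R z, c *\<^sub>R z - s *\<^sub>R x) \<partial>lborel)
      = ennreal (\<bar>1/c\<bar> ^ ?N) * (\<integral>\<^sup>+u. ennreal (gauss_density ((1/c) *\<^sub>R (u - s *\<^sub>R z)) * gauss_density z) *
       \<Phi> (u, (1/c) *\<^sub>R (z - s *\<^sub>R u)) \<partial>lborel)"
      using c by (subst nn_integral_lborel_scale[where c = "1/c" and t = "- (s / c) *\<^sub>R z"]) (auto simp only: e e2 e3, auto)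
  qed
  also have "\<dots> = (\<integral>\<^sup>+z. (\<integral>\<^sup>+u. ennreal (\<bar>1/c\<bar> ^ ?N) * (ennreal (gauss_density ((1/c) *\<^sub>R (u - s *\<^sub>R z)) * gauss_density z) *
       \<Phi> (u, (1/c) *\<^sub>R (z - s *\<^sub>R u))) \<partial>lborel) \<partial>lborel)"
    by (simp add: nn_integral_cmult)
  also have "\<dots> = (\<integral>\<^sup>+u. (\<integral>\<^sup>+z. ennreal (\<bar>1/c\<bar> ^ ?N) * (ennreal (gauss_density ((1/c) *\<^sub>R (u - s *\<^sub>R z)) * gauss_density z) *
       \<Phi> (u, (1/c) *\<^sub>R (z - s *\<^sub>R u))) \<partial>lborel) \<partial>lborel)"
    by (rule lborel_pair.Fubini') simp
  also have "\<dots> = (\<integral>\<^sup>+u. ennreal (\<bar>c\<bar> ^ ?N) * (\<integral>\<^sup>+w. ennreal (\<bar>1/c\<bar> ^ ?N) * (ennreal (gauss_density u * gauss_density w) *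
       \<Phi> (u, w)) \<partial>lborel) \<partial>lborel)"
  proof (rule nn_integral_cong)
    fix u :: "real^'n"
    have e2: "(1/c) *\<^sub>R ((s *\<^sub>R u + c *\<^sub>R w) - s *\<^sub>R u) = w" for w using c by simp
    have e3: "(1/c) *\<^sub>R (u - s *\<^sub>R (s *\<^sub>R u + c *\<^sub>R w)) = c *\<^sub>R u - s *\<^sub>R w" for w
    proof -
      have "u - s *\<^sub>R (s *\<^sub>R u + c *\<^sub>R w) = c *\<^sub>R (c *\<^sub>R u - s *\<^sub>R w)"
        by (subst (1) split[of u]) (simp add: algebra_simps)
      then show ?thesis using c by simp
    qed
    have "(norm (c *\<^sub>R u - s *\<^sub>R w))\<^sup>2 + (norm (s *\<^sub>R u + c *\<^sub>R w))\<^sup>2 = (c\<^sup>2 + s\<^sup>2) * ((norm u)\<^sup>2 + (norm w)\<^sup>2)" for w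
      unfolding power2_norm_eq_inner by (simp add: inner_simps inner_commute algebra_simps power2_eq_square)
    then have n: "(norm (c *\<^sub>R u - s *\<^sub>R w))\<^sup>2 + (norm (s *\<^sub>R u + c *\<^sub>R w))\<^sup>2 = (norm u)\<^sup>2 + (norm w)\<^sup>2" for w
      using cs by simp
    have e4: "gauss_density (c *\<^sub>R u - s *\<^sub>R w) * gauss_density (s *\<^sub>R u + c *\<^sub>R w) = gauss_density u * gauss_density w" for w
    proof -
      have "gauss_density x * gauss_density y = ((2 * pi) powr (- real CARD('n) / 2))\<^sup>2 * exp (- ((norm x)\<^sup>2 + (norm y)\<^sup>2) / 2)" for x y :: "real^'n"
        by (simp add: gauss_density_def exp_add[symmetric] power2_eq_square field_simps)
      then show ?thesis by (simp only: n)
    qed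
    show "(\<integral>\<^sup>+z. ennreal (\<bar>1/c\<bar> ^ ?N) * (ennreal (gauss_density ((1/c) *\<^sub>R (u - s *\<^sub>R z)) * gauss_density z) *
       \<Phi> (u, (1/c) *\<^sub>R (z - s *\<^sub>R u))) \<partial>lborel) = ennreal (\<bar>c\<bar> ^ ?N) * (\<integral>\<^sup>+w. ennreal (\<bar>1/c\<bar> ^ ?N) * (ennreal (gauss_density u * gauss_density w) *
       \<Phi> (u, w)) \<partial>lborel)"
      using c by (subst nn_integral_lborel_scale[where c = "c" and t = "s *\<^sub>R u"]) (auto simp only: e2 e3 e4, auto)
  qed
  also have "\<dots> = (\<integral>\<^sup>+u. (\<integral>\<^sup>+w. ennreal (gauss_density u * gauss_density w) * \<Phi> (u, w) \<partial>lborel) \<partial>lborel)"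
  proof -
    have "ennreal (\<bar>c\<bar> ^ ?N) * (ennreal (\<bar>1/c\<bar> ^ ?N) * A) = A" for A
      using c by (simp add: mult.assoc[symmetric] ennreal_mult'[symmetric] power_mult_distrib[symmetric] del: ennreal_power)
    then show ?thesis by (simp add: nn_integral_cmult)
  qed
  also have "\<dots> = (\<integral>\<^sup>+x. \<integral>\<^sup>+z. \<Phi> (x, z) \<partial>\<gamma> \<partial>\<gamma>)"
    by (subst lem) auto
  finally show ?thesis .
qed

theorem gaussian_rotation_invariant:
  assumes cs: "c\<^sup>2 + s\<^sup>2 = 1" and c: "c \<noteq> 0"
  shows "distr (\<gamma> \<Otimes>\<^sub>M \<gamma>) (\<gamma> \<Otimes>\<^sub>M \<gamma>) (\<lambda>(x, z). (c *\<^sub>R x + s *\<^sub>R z, c *\<^sub>R z - s *\<^sub>R x)) = (\<gamma> \<Otimes>\<^sub>M \<gamma> :: ((real^'n) \<times> (real^'n)) measure)"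
proof (rule measure_eqI)
  fix A assume "A \<in> sets (distr (\<gamma> \<Otimes>\<^sub>M \<gamma>) (\<gamma> \<Otimes>\<^sub>M \<gamma>) (\<lambda>(x, z). (c *\<^sub>R x + s *\<^sub>R z, c *\<^sub>R z - s *\<^sub>R (x::real^'n))))"
  then have A: "A \<in> sets (\<gamma> \<Otimes>\<^sub>M \<gamma> :: ((real^'n) \<times> (real^'n)) measure)" by simp
  then have [measurable]: "A \<in> sets (borel \<Otimes>\<^sub>M borel)"
    by (simp cong: sets_pair_measure_cong)
  let ?r = "\<lambda>(x, z). (c *\<^sub>R x + s *\<^sub>R z, c *\<^sub>R z - s *\<^sub>R (x::real^'n))"
  have "emeasure (distr (\<gamma> \<Otimes>\<^sub>M \<gamma>) (\<gamma> \<Otimes>\<^sub>M \<gamma>) ?r) A = (\<integral>\<^sup>+p. indicator A p \<partial>(distr (\<gamma> \<Otimes>\<^sub>M \<gamma>) (\<gamma> \<Otimes>\<^sub>M \<gamma>) ?r))"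
    using A by simp
  also have "\<dots> = (\<integral>\<^sup>+p. indicator A (?r p) \<partial>(\<gamma> \<Otimes>\<^sub>M \<gamma>))"
    by (subst nn_integral_distr) auto
  also have "\<dots> = (\<integral>\<^sup>+x. \<integral>\<^sup>+z. indicator A (?r (x, z)) \<partial>\<gamma> \<partial>\<gamma>)"
    by (rule gaussian.nn_integral_fst[symmetric]) measurable
  also have "\<dots> = (\<integral>\<^sup>+x. \<integral>\<^sup>+z. indicator A (x, z) \<partial>\<gamma> \<partial>\<gamma>)"
    using nn_integral_gaussian_rotate[OF _ cs c, of "indicator A"] by simp
  also have "\<dots> = emeasure (\<gamma> \<Otimes>\<^sub>M \<gamma>) A"
    by (simp add: gaussian.nn_integral_fst)
  finally show "emeasure (distr (\<gamma> \<Otimes>\<^sub>M \<gamma>) (\<gamma> \<Otimes>\<^sub>M \<gamma>) ?r) A = emeasure (\<gamma> \<Otimes>\<^sub>M \<gamma>) A" .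
qed simp

section \<open>Differentiation under the integral and Gaussian integration by parts\<close>

text \<open>Dominated convergence for difference quotients. The Lipschitz bound with an integrable constant
  \<open>b\<close> only has to hold near \<open>x0\<close>, which matters for exponential densities.\<close>

lemma has_derivative_integral:
  fixes f :: "'a::real_normed_vector \<Rightarrow> 'x \<Rightarrow> real"
  assumes int: "\<And>x. integrable M (f x)" and b: "integrable M b" and e: "e > 0"
    and der: "\<And>z. ((\<lambda>x. f x z) has_derivative f' z) (at x0)"
    and meas: "\<And>h. (\<lambda>z. f' z h) \<in> borel_measurable M"
    and lip: "\<And>x z. norm (x - x0) < e \<Longrightarrow> \<bar>f x z - f x0 z\<bar> \<le> b z * norm (x - x0)"
    and bd: "\<And>z h. \<bar>f' z h\<bar> \<le> b z * norm h"
  shows "((\<lambda>x. \<integral>z. f x z \<partial>M) has_derivative (\<lambda>h. \<integral>z. f' z h \<partial>M)) (at x0)"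
proof -
  have int': "integrable M (\<lambda>z. f' z h)" for h
    by (rule Bochner_Integration.integrable_bound[OF integrable_mult_left[OF b, of "norm h"]])
       (use meas bd in \<open>auto intro!: AE_I2 intro: order_trans[OF bd abs_ge_self]\<close>)
  have lin: "linear (f' z)" for z
    using der[of z] has_derivative_linear by blast
  have blin: "bounded_linear (\<lambda>h. \<integral>z. f' z h \<partial>M)"
  proof (rule bounded_linear_intro[where K = "\<integral>z. b z \<partial>M"])
    show "(\<integral>z. f' z (x + y) \<partial>M) = (\<integral>z. f' z x \<partial>M) + (\<integral>z. f' z y \<partial>M)" for x y
      using int' by (simp add: linear_add[OF lin])
    show "(\<integral>z. f' z (r *\<^sub>R x) \<partial>M) = r *\<^sub>R (\<integral>z. f' z x \<partial>M)" for r x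
      by (simp add: linear_cmul[OF lin])
    show "norm (\<integral>z. f' z x \<partial>M) \<le> norm x * (\<integral>z. b z \<partial>M)" for x
    proof -
      have "norm (\<integral>z. f' z x \<partial>M) \<le> (\<integral>z. b z * norm x \<partial>M)"
      proof (rule order_trans[OF integral_norm_bound integral_mono])
        show "norm (f' z x) \<le> b z * norm x" for z using bd[of z x] by simp
      qed (use b int' in simp_all)
      then show ?thesis by (simp add: mult.commute)
    qed
  qed
  have "((\<lambda>y. norm ((\<integral>z. f y z \<partial>M) - (\<integral>z. f x0 z \<partial>M) - (\<integral>z. f' z (y - x0) \<partial>M)) / norm (y - x0)) \<longlongrightarrow> 0) (at x0)"
    unfolding tendsto_at_iff_sequentially
  proof (intro allI impI)
    fix X assume X0: "\<forall>i. X i \<in> UNIV - {x0}" and X: "X \<longlonglongrightarrow> x0"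
    let ?q = "\<lambda>y z. norm (f y z - f x0 z - f' z (y - x0)) / norm (y - x0)"
    obtain N where N: "\<And>n. n \<ge> N \<Longrightarrow> norm (X n - x0) < e"
      using LIMSEQ_D[OF X e] by auto
    have "(\<lambda>n. \<integral>z. ?q (X (n + N)) z \<partial>M) \<longlonglongrightarrow> (\<integral>z. 0 \<partial>M)"
    proof (rule integral_dominated_convergence[where w = "\<lambda>z. 2 * b z"])
      show "AE z in M. (\<lambda>n. ?q (X (n + N)) z) \<longlonglongrightarrow> 0"
      proof (rule AE_I2)
        fix z
        have "((\<lambda>y. ?q y z) \<longlongrightarrow> 0) (at x0)"
          using der[of z] by (simp add: has_derivative_iff_norm)
        then have "((\<lambda>y. ?q y z) \<circ> X) \<longlonglongrightarrow> 0"
          using X0 X unfolding tendsto_at_iff_sequentially by blast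
        from LIMSEQ_ignore_initial_segment[OF this, of N] show "(\<lambda>n. ?q (X (n + N)) z) \<longlonglongrightarrow> 0"
          by (simp add: o_def)
      qed
      show "AE z in M. norm (?q (X (n + N)) z) \<le> 2 * b z" for n
      proof (rule AE_I2)
        fix z
        let ?y = "X (n + N)"
        have p: "norm (?y - x0) > 0" using X0 by simp
        have "norm (f ?y z - f x0 z - f' z (?y - x0)) \<le> 2 * b z * norm (?y - x0)"
          using lip[OF N[of "n + N"], of z] bd[of z "?y - x0"] by simp
        then show "norm (?q ?y z) \<le> 2 * b z" using p by (simp add: field_simps)
      qed
      show "(\<lambda>z. ?q (X (n + N)) z) \<in> borel_measurable M" for n
        using borel_measurable_diff[OF borel_measurable_diff[OF borel_measurable_integrable[OF int[of "X (n + N)"]]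
              borel_measurable_integrable[OF int[of x0]]] meas[of "X (n + N) - x0"]]
        by (rule borel_measurable_divide[OF measurable_compose[OF _ borel_measurable_norm] borel_measurable_const])
      show "integrable M (\<lambda>z. 2 * b z)" using b by simp
    qed simp
    then have lim: "(\<lambda>n. \<integral>z. ?q (X (n + N)) z \<partial>M) \<longlonglongrightarrow> 0"
      unfolding Bochner_Integration.integral_zero .
    have bnd: "norm ((\<integral>z. f y z \<partial>M) - (\<integral>z. f x0 z \<partial>M) - (\<integral>z. f' z (y - x0) \<partial>M)) / norm (y - x0)
       \<le> (\<integral>z. ?q y z \<partial>M)" for y
    proof -
      have "norm ((\<integral>z. f y z \<partial>M) - (\<integral>z. f x0 z \<partial>M) - (\<integral>z. f' z (y - x0) \<partial>M))
         = norm (\<integral>z. f y z - f x0 z - f' z (y - x0) \<partial>M)"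
        using int int' by simp
      also have "\<dots> \<le> (\<integral>z. norm (f y z - f x0 z - f' z (y - x0)) \<partial>M)" by (rule integral_norm_bound)
      finally show ?thesis by (simp add: divide_right_mono)
    qed
    have "((\<lambda>y. norm ((\<integral>z. f y z \<partial>M) - (\<integral>z. f x0 z \<partial>M) - (\<integral>z. f' z (y - x0) \<partial>M)) / norm (y - x0)) \<circ> (\<lambda>n. X (n + N))) \<longlonglongrightarrow> 0"
    proof (rule tendsto_sandwich[OF _ _ tendsto_const lim])
      show "\<forall>\<^sub>F n in sequentially. ((\<lambda>y. norm ((\<integral>z. f y z \<partial>M) - (\<integral>z. f x0 z \<partial>M) - (\<integral>z. f' z (y - x0) \<partial>M)) / norm (y - x0)) \<circ> (\<lambda>n. X (n + N))) n
          \<le> (\<integral>z. ?q (X (n + N)) z \<partial>M)"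
        unfolding o_def by (intro always_eventually allI bnd)
    qed simp
    from this show "((\<lambda>y. norm ((\<integral>z. f y z \<partial>M) - (\<integral>z. f x0 z \<partial>M) - (\<integral>z. f' z (y - x0) \<partial>M)) / norm (y - x0)) \<circ> X) \<longlonglongrightarrow> 0"
      unfolding o_def by (rule LIMSEQ_offset[of _ N])
  qed
  from conjI[OF blin this] show ?thesis unfolding has_derivative_iff_norm .
qed

text \<open>The gradient is a parameter rather than derived from \<open>F\<close>, so that the gradients of averages and
  mollifications can be given by explicit integrals.\<close>

definition bounded_C1 :: "('a::euclidean_space \<Rightarrow> real) \<Rightarrow> ('a \<Rightarrow> 'a) \<Rightarrow> bool" where
  "bounded_C1 F G \<longleftrightarrow> (\<forall>x. (F has_derivative (\<lambda>h. G x \<bullet> h)) (at x)) \<and> continuous_on UNIV G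
     \<and> (\<exists>B. \<forall>x. \<bar>F x\<bar> \<le> B \<and> norm (G x) \<le> B)"

lemma bounded_C1_has_derivative: "bounded_C1 F G \<Longrightarrow> (F has_derivative (\<lambda>h. G x \<bullet> h)) (at x)"
  by (simp add: bounded_C1_def)

lemma bounded_C1_continuous: "bounded_C1 F G \<Longrightarrow> continuous_on UNIV F"
  by (meson bounded_C1_has_derivative has_derivative_continuous continuous_at_imp_continuous_on)

lemma bounded_C1_continuous_grad: "bounded_C1 F G \<Longrightarrow> continuous_on UNIV G"
  by (simp add: bounded_C1_def)

lemma bounded_C1_measurable:
  assumes "bounded_C1 F G"
  shows "F \<in> borel_measurable borel" "G \<in> borel_measurable borel"
  using assms by (auto intro!: borel_measurable_continuous_onI bounded_C1_continuous bounded_C1_continuous_grad)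

lemma bounded_C1_bound:
  assumes "bounded_C1 F G"
  obtains B where "B > 0" "\<And>x. \<bar>F x\<bar> \<le> B" "\<And>x. norm (G x) \<le> B"
proof -
  obtain B where B: "\<And>x. \<bar>F x\<bar> \<le> B \<and> norm (G x) \<le> B"
    using assms by (auto simp: bounded_C1_def)
  have "\<bar>F x\<bar> \<le> \<bar>B\<bar> + 1 \<and> norm (G x) \<le> \<bar>B\<bar> + 1" for x
    using B[of x] by auto
  then show ?thesis by (intro that[of "\<bar>B\<bar> + 1"]) auto
qed

lemma bounded_C1_lipschitz:
  assumes "bounded_C1 F G" "\<And>x. norm (G x) \<le> B"
  shows "\<bar>F x - F y\<bar> \<le> B * norm (x - y)"
proof -
  have "norm (F x - F y) \<le> B * norm (x - y)"
  proof (rule differentiable_bound[where S = UNIV and f' = "\<lambda>x h. G x \<bullet> h"])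
    show "onorm (\<lambda>h. G z \<bullet> h) \<le> B" for z
    proof (rule onorm_le)
      fix h
      show "norm (G z \<bullet> h) \<le> B * norm h"
        using order_trans[OF Cauchy_Schwarz_ineq2[of "G z" h] mult_right_mono[OF assms(2)[of z], of "norm h"]] by simp
    qed
  qed (use assms(1) in \<open>auto simp: bounded_C1_def\<close>)
  then show ?thesis by simp
qed

lemma integrable_gaussian_bounded:
  fixes f :: "real^'n \<Rightarrow> 'b::{banach,second_countable_topology}"
  assumes "f \<in> borel_measurable borel" "\<And>x. norm (f x) \<le> B"
  shows "integrable \<gamma> f"
  by (rule gaussian.integrable_const_bound[where B = B]) (use assms in auto)

lemma integrable_gaussian2_bounded:
  fixes f :: "(real^'n) \<times> (real^'n) \<Rightarrow> 'b::{banach,second_countable_topology}"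
  assumes "f \<in> borel_measurable (borel \<Otimes>\<^sub>M borel)" "\<And>x. norm (f x) \<le> B"
  shows "integrable (\<gamma> \<Otimes>\<^sub>M \<gamma>) f"
  by (rule gaussian2.integrable_const_bound[where B = B]) (use assms in auto)

lemma integrable_gaussian2_norm:
  "integrable (\<gamma> \<Otimes>\<^sub>M \<gamma>) (\<lambda>p::(real^'n) \<times> (real^'n). norm (fst p) + norm (snd p))"
proof -
  have "integrable (\<gamma> \<Otimes>\<^sub>M \<gamma>) (\<lambda>p::(real^'n) \<times> (real^'n). norm (fst p))"
    "integrable (\<gamma> \<Otimes>\<^sub>M \<gamma>) (\<lambda>p::(real^'n) \<times> (real^'n). norm (snd p))"
    by (rule gaussian2.Fubini_integrable; simp add: integrable_gaussian_norm gaussian.prob_space[simplified])+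
  then show ?thesis by simp
qed

text \<open>Both sides of the Cameron-Martin formula
  \<open>E K (X + t h) = E K (X) exp (t h \<bullet> X - t\<^sup>2 |h|\<^sup>2/2)\<close> are
  differentiated at \<open>t = 0\<close>.\<close>

lemma gaussian_integration_by_parts:
  fixes K :: "real^'n \<Rightarrow> real"
  assumes K: "bounded_C1 K D"
  shows "(\<integral>w. K w * (h \<bullet> w) \<partial>\<gamma>) = (\<integral>w. D w \<bullet> h \<partial>\<gamma>)"
proof -
  obtain B where B: "B > 0" "\<And>x. \<bar>K x\<bar> \<le> B" "\<And>x. norm (D x) \<le> B"
    using bounded_C1_bound[OF K] by blast
  note [measurable] = bounded_C1_measurable[OF K]
  have 1: "((\<lambda>t::real. \<integral>w. K (w + t *\<^sub>R h) \<partial>\<gamma>) has_derivative (\<lambda>t. \<integral>w. t * (D w \<bullet> h) \<partial>\<gamma>)) (at 0)"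
  proof (rule has_derivative_integral[where b = "\<lambda>_. B * norm h" and e = 1])
    show "integrable \<gamma> (\<lambda>w. K (w + t *\<^sub>R h))" for t
      by (rule integrable_gaussian_bounded[of _ B]) (use B in auto)
    have "((\<lambda>t. K (z + t *\<^sub>R h)) has_derivative (\<lambda>t. D (z + 0 *\<^sub>R h) \<bullet> (t *\<^sub>R h))) (at 0)" for z
      by (rule has_derivative_compose[OF _ bounded_C1_has_derivative[OF K]]) (auto intro!: derivative_eq_intros)
    then show "((\<lambda>t. K (z + t *\<^sub>R h)) has_derivative (\<lambda>t. t * (D z \<bullet> h))) (at 0)" for z
      by simp
    show "\<bar>K (z + t *\<^sub>R h) - K (z + 0 *\<^sub>R h)\<bar> \<le> B * norm h * norm (t - 0)" for t z
      using bounded_C1_lipschitz[OF K B(3), of "z + t *\<^sub>R h" z] by (simp add: mult_ac)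
    show "\<bar>t * (D z \<bullet> h)\<bar> \<le> B * norm h * norm t" for z t
      using mult_left_mono[OF order_trans[OF Cauchy_Schwarz_ineq2[of "D z" h] mult_right_mono[OF B(3)[of z], of "norm h"]], of "\<bar>t\<bar>"]
      by (simp add: abs_mult mult_ac)
  qed auto
  let ?E = "\<lambda>t w. exp (t * (h \<bullet> w) - t\<^sup>2 * (norm h)\<^sup>2 / 2)"
  let ?M = "\<lambda>w. norm h * norm w + (norm h)\<^sup>2 / 2"
  have 2: "((\<lambda>t::real. \<integral>w. ?E t w * K w \<partial>\<gamma>) has_derivative (\<lambda>t. \<integral>w. t * (K w * (h \<bullet> w)) \<partial>\<gamma>)) (at 0)"
  proof (rule has_derivative_integral[where b = "\<lambda>w. B * (exp (5 * (norm h)\<^sup>2) * exp (1/4 * (norm w)\<^sup>2))" and e = 1])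
    show "integrable \<gamma> (\<lambda>w. ?E t w * K w)" for t
      by (rule Bochner_Integration.integrable_bound[OF integrable_mult_left[OF integrable_gaussian_exp_inner[of "t *\<^sub>R h"], of B]])
         (use B in \<open>auto intro!: AE_I2 simp: abs_mult power_mult_distrib\<close>)
    show "((\<lambda>t. ?E t z * K z) has_derivative (\<lambda>t. t * (K z * (h \<bullet> z)))) (at 0)" for z
      by (auto intro!: derivative_eq_intros)
    have M: "?M w * exp (?M w) \<le> exp (5 * (norm h)\<^sup>2) * exp (1/4 * (norm w)\<^sup>2)" for w :: "real^'n"
    proof -
      have "?M w * exp (?M w) \<le> exp (?M w) * exp (?M w)"
      proof (rule mult_right_mono)
        show "?M w \<le> exp (?M w)" using exp_ge_add_one_self[of "?M w"] by linarith
      qed simp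
      also have "\<dots> = exp (2 * ?M w)" by (simp add: exp_add[symmetric])
      also have "\<dots> \<le> exp (5 * (norm h)\<^sup>2 + 1/4 * (norm w)\<^sup>2)"
        proof -
          have "0 \<le> (2 * norm h - norm w / 2)\<^sup>2" by simp
          then have "2 * ?M w \<le> 5 * (norm h)\<^sup>2 + 1/4 * (norm w)\<^sup>2"
            by (simp add: power2_diff power_mult_distrib power_divide)
          then show ?thesis by (simp only: exp_le_cancel_iff)
        qed
      finally show ?thesis by (simp add: exp_add)
    qed
    have hw: "\<bar>h \<bullet> w\<bar> \<le> norm h * norm w" for w by (rule Cauchy_Schwarz_ineq2)
    show "\<bar>?E t w * K w - ?E 0 w * K w\<bar> \<le> B * (exp (5 * (norm h)\<^sup>2) * exp (1/4 * (norm w)\<^sup>2)) * norm (t - 0)"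
      if t: "norm (t - 0) < 1" for t w
    proof -
      let ?a = "t * (h \<bullet> w) - t\<^sup>2 * (norm h)\<^sup>2 / 2"
      have t1: "\<bar>t\<bar> < 1" using t by simp
      have "t\<^sup>2 \<le> \<bar>t\<bar>" using t1 mult_right_mono[of "\<bar>t\<bar>" 1 "\<bar>t\<bar>"] by (simp add: power2_eq_square)
      then have "t\<^sup>2 * (norm h)\<^sup>2 / 2 \<le> \<bar>t\<bar> * ((norm h)\<^sup>2 / 2)"
        using mult_right_mono[of "t\<^sup>2" "\<bar>t\<bar>" "(norm h)\<^sup>2 / 2"] by simp
      moreover have "\<bar>t * (h \<bullet> w)\<bar> \<le> \<bar>t\<bar> * (norm h * norm w)"
        using hw[of w] by (simp add: abs_mult mult_left_mono)
      moreover have "t\<^sup>2 * (norm h)\<^sup>2 / 2 \<ge> 0" by simp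
      ultimately have a: "\<bar>?a\<bar> \<le> \<bar>t\<bar> * ?M w" unfolding distrib_left by linarith
      have aM: "\<bar>?a\<bar> \<le> ?M w" using a t1 mult_right_mono[of "\<bar>t\<bar>" 1 "?M w"] by simp
      have exp1: "\<bar>exp a - 1\<bar> \<le> \<bar>a\<bar> * exp \<bar>a\<bar>" for a :: real
      proof (cases "a \<ge> 0")
        case True
        have "1 - a \<le> exp (- a)" using exp_ge_add_one_self[of "- a"] by simp
        then have "(1 - a) * exp a \<le> 1" using mult_right_mono[of "1 - a" "exp (- a)" "exp a"] by (simp add: exp_minus)
        then show ?thesis using True by (simp add: algebra_simps)
      next
        case False
        then have "1 - exp a \<le> \<bar>a\<bar>" using exp_ge_add_one_self[of a] by linarith
        also have "\<dots> \<le> \<bar>a\<bar> * exp \<bar>a\<bar>" using mult_left_mono[of 1 "exp \<bar>a\<bar>" "\<bar>a\<bar>"] by simp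
        finally show ?thesis using False by simp
      qed
      have "\<bar>?E t w * K w - ?E 0 w * K w\<bar> = \<bar>exp ?a - 1\<bar> * \<bar>K w\<bar>"
        by (simp add: abs_mult[symmetric] left_diff_distrib)
      also have "\<dots> \<le> (\<bar>?a\<bar> * exp \<bar>?a\<bar>) * B"
        using exp1 B by (intro mult_mono) auto
      also have "\<dots> \<le> ((\<bar>t\<bar> * ?M w) * exp (?M w)) * B"
      proof (rule mult_right_mono[OF mult_mono[OF a]])
        show "exp \<bar>?a\<bar> \<le> exp (?M w)" using aM by (simp only: exp_le_cancel_iff)
      qed (use B in auto)
      also have "\<dots> = (?M w * exp (?M w)) * (B * \<bar>t\<bar>)" by simp
      also have "\<dots> \<le> (exp (5 * (norm h)\<^sup>2) * exp (1/4 * (norm w)\<^sup>2)) * (B * \<bar>t\<bar>)"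
        by (rule mult_right_mono[OF M]) (use B in auto)
      finally show ?thesis by (simp only: mult_ac real_norm_def diff_zero)
    qed
    show "\<bar>t * (K w * (h \<bullet> w))\<bar> \<le> B * (exp (5 * (norm h)\<^sup>2) * exp (1/4 * (norm w)\<^sup>2)) * norm t" for w t
    proof -
      have "norm h * norm w \<le> ?M w * 1" by simp
      also have "\<dots> \<le> ?M w * exp (?M w)" by (intro mult_left_mono) auto
      finally have "\<bar>h \<bullet> w\<bar> \<le> exp (5 * (norm h)\<^sup>2) * exp (1/4 * (norm w)\<^sup>2)"
        using M[of w] hw[of w] by linarith
      then have "\<bar>K w\<bar> * \<bar>h \<bullet> w\<bar> \<le> B * (exp (5 * (norm h)\<^sup>2) * exp (1/4 * (norm w)\<^sup>2))"
        using B by (intro mult_mono) auto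
      from mult_left_mono[OF this, of "\<bar>t\<bar>"] show ?thesis by (simp add: abs_mult mult_ac)
    qed
    show "integrable \<gamma> (\<lambda>w. B * (exp (5 * (norm h)\<^sup>2) * exp (1/4 * (norm (w::real^'n))\<^sup>2)))"
      using integrable_gaussian_exp_square[of "1/4", where 'n='n] by simp
  qed auto
  have "(\<integral>w. K (w + t *\<^sub>R h) \<partial>\<gamma>) = (\<integral>w. ?E t w * K w \<partial>\<gamma>)" for t
    using integral_cameron_martin[of K "t *\<^sub>R h"] by (simp add: power_mult_distrib)
  then have "(\<lambda>t. \<integral>w. ?E t w * K w \<partial>\<gamma>) = (\<lambda>t. \<integral>w. K (w + t *\<^sub>R h) \<partial>\<gamma>)"
    by simp
  with 2 have "((\<lambda>t::real. \<integral>w. K (w + t *\<^sub>R h) \<partial>\<gamma>) has_derivative (\<lambda>t. \<integral>w. t * (K w * (h \<bullet> w)) \<partial>\<gamma>)) (at 0)"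
    by (simp only:)
  from fun_cong[OF has_derivative_unique[OF this 1], of 1] show ?thesis by simp
qed

section \<open>Mehler averages\<close>

text \<open>For \<open>c\<^sup>2 + s\<^sup>2 = 1\<close> this is the Ornstein-Uhlenbeck semigroup at the time \<open>t\<close>
  with \<open>c = exp (- t)\<close>.\<close>

definition mehler :: "real \<Rightarrow> real \<Rightarrow> (real^'n \<Rightarrow> 'b::{banach,second_countable_topology}) \<Rightarrow> real^'n \<Rightarrow> 'b" where
  "mehler c s F x = (\<integral>z. F (c *\<^sub>R x + s *\<^sub>R z) \<partial>\<gamma>)"

lemma continuous_mehler:
  fixes F :: "real^'n \<Rightarrow> 'b::{banach,second_countable_topology}"
  assumes F: "continuous_on UNIV F" and B: "\<And>x. norm (F x) \<le> B"
  shows "continuous_on UNIV (mehler c s F)"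
  unfolding continuous_on_sequentially
proof safe
  fix X :: "nat \<Rightarrow> real^'n" and a assume X: "X \<longlonglongrightarrow> a"
  have [measurable]: "F \<in> borel_measurable borel" by (rule borel_measurable_continuous_onI[OF F])
  have "(\<lambda>n. \<integral>z. F (c *\<^sub>R X n + s *\<^sub>R z) \<partial>\<gamma>) \<longlonglongrightarrow> (\<integral>z. F (c *\<^sub>R a + s *\<^sub>R z) \<partial>\<gamma>)"
  proof (rule integral_dominated_convergence[where w = "\<lambda>_. B"])
    show "AE z in \<gamma>. (\<lambda>n. F (c *\<^sub>R X n + s *\<^sub>R z)) \<longlonglongrightarrow> F (c *\<^sub>R a + s *\<^sub>R z)"
      by (rule AE_I2) (rule continuous_on_tendsto_compose[OF F], auto intro!: tendsto_intros X)
  qed (use B in auto)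
  then show "(mehler c s F \<circ> X) \<longlonglongrightarrow> mehler c s F a" by (simp add: mehler_def o_def)
qed

lemma measurable_mehler:
  fixes F :: "real^'n \<Rightarrow> 'b::{banach,second_countable_topology}"
  assumes "continuous_on UNIV F" and "\<And>x. norm (F x) \<le> B"
  shows "mehler c s F \<in> borel_measurable borel"
  by (rule borel_measurable_continuous_onI[OF continuous_mehler[OF assms]])

lemma norm_mehler_le:
  fixes F :: "real^'n \<Rightarrow> 'b::{banach,second_countable_topology}"
  assumes [measurable]: "F \<in> borel_measurable borel" and B: "\<And>x. norm (F x) \<le> B"
  shows "norm (mehler c s F x) \<le> B"
proof -
  have "norm (mehler c s F x) \<le> (\<integral>z. norm (F (c *\<^sub>R x + s *\<^sub>R z)) \<partial>\<gamma>)"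
    unfolding mehler_def by (rule integral_norm_bound)
  also have "\<dots> \<le> B"
    by (rule gaussian.integral_le_const[OF integrable_gaussian_bounded[of _ B]]) (use B in auto)
  finally show ?thesis .
qed

lemma mehler_ge:
  fixes F :: "real^'n \<Rightarrow> real"
  assumes [measurable]: "F \<in> borel_measurable borel" and B: "\<And>x. \<bar>F x\<bar> \<le> B" and m: "\<And>x. m \<le> F x"
  shows "m \<le> mehler c s F x"
  unfolding mehler_def
  by (rule gaussian.integral_ge_const[OF integrable_gaussian_bounded[of _ B]]) (use B m in auto)

text \<open>The commutation of the average with the gradient up to the factor \<open>c\<close> is the source of the
  contraction of Fisher information along the averages.\<close>

lemma bounded_C1_mehler:
  fixes F :: "real^'n \<Rightarrow> real"
  assumes FG: "bounded_C1 F G"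
  shows "bounded_C1 (mehler c s F) (\<lambda>x. c *\<^sub>R mehler c s G x)"
proof -
  obtain B where B: "B > 0" "\<And>x. \<bar>F x\<bar> \<le> B" "\<And>x. norm (G x) \<le> B"
    using bounded_C1_bound[OF FG] by blast
  note [measurable] = bounded_C1_measurable[OF FG]
  show ?thesis unfolding bounded_C1_def
  proof (intro conjI allI exI[of _ "(1 + \<bar>c\<bar>) * B"])
    fix x
    have "((\<lambda>x. \<integral>z. F (c *\<^sub>R x + s *\<^sub>R z) \<partial>\<gamma>) has_derivative (\<lambda>h. \<integral>z. G (c *\<^sub>R x + s *\<^sub>R z) \<bullet> (c *\<^sub>R h) \<partial>\<gamma>)) (at x)"
    proof (rule has_derivative_integral[where b = "\<lambda>_. B * \<bar>c\<bar>" and e = 1])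
      show "integrable \<gamma> (\<lambda>z. F (c *\<^sub>R y + s *\<^sub>R z))" for y
        by (rule integrable_gaussian_bounded[of _ B]) (use B in auto)
      show "((\<lambda>x. F (c *\<^sub>R x + s *\<^sub>R z)) has_derivative (\<lambda>h. G (c *\<^sub>R x + s *\<^sub>R z) \<bullet> (c *\<^sub>R h))) (at x)" for z
        by (rule has_derivative_compose[OF _ bounded_C1_has_derivative[OF FG]]) (auto intro!: derivative_eq_intros)
      show "\<bar>F (c *\<^sub>R y + s *\<^sub>R z) - F (c *\<^sub>R x + s *\<^sub>R z)\<bar> \<le> B * \<bar>c\<bar> * norm (y - x)" for y z
        using bounded_C1_lipschitz[OF FG B(3), of "c *\<^sub>R y + s *\<^sub>R z" "c *\<^sub>R x + s *\<^sub>R z"]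
        by (simp add: scaleR_diff_right[symmetric] mult.assoc)
      show "\<bar>G (c *\<^sub>R x + s *\<^sub>R z) \<bullet> (c *\<^sub>R h)\<bar> \<le> B * \<bar>c\<bar> * norm h" for z h
        using order_trans[OF Cauchy_Schwarz_ineq2[of "G (c *\<^sub>R x + s *\<^sub>R z)" "c *\<^sub>R h"]
            mult_right_mono[OF B(3)[of "c *\<^sub>R x + s *\<^sub>R z"], of "norm (c *\<^sub>R h)"]]
        by (simp add: mult.assoc)
    qed (auto simp del: inner_scaleR_right)
    moreover have "(\<integral>z. G (c *\<^sub>R x + s *\<^sub>R z) \<bullet> (c *\<^sub>R h) \<partial>\<gamma>) = (c *\<^sub>R mehler c s G x) \<bullet> h" for h
    proof -
      have "integrable \<gamma> (\<lambda>z. G (c *\<^sub>R x + s *\<^sub>R z))"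
        by (rule integrable_gaussian_bounded[of _ B]) (use B in auto)
      then show ?thesis unfolding mehler_def by (subst integral_inner_left) auto
    qed
    ultimately show "(mehler c s F has_derivative (\<lambda>h. (c *\<^sub>R mehler c s G x) \<bullet> h)) (at x)"
      unfolding mehler_def[abs_def] by (simp only:)
  next
    show "continuous_on UNIV (\<lambda>x. c *\<^sub>R mehler c s G x)"
      by (intro continuous_intros continuous_mehler[OF bounded_C1_continuous_grad[OF FG] B(3)])
    fix x
    have "\<bar>c\<bar> * B \<ge> 0" using B by simp
    moreover have "\<bar>mehler c s F x\<bar> \<le> B" "norm (mehler c s G x) \<le> B"
      using norm_mehler_le[of F B c s x] norm_mehler_le[of G B c s x] B by auto
    moreover have "norm (c *\<^sub>R mehler c s G x) \<le> \<bar>c\<bar> * B"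
      using \<open>norm (mehler c s G x) \<le> B\<close> by (simp add: mult_left_mono)
    ultimately show "\<bar>mehler c s F x\<bar> \<le> (1 + \<bar>c\<bar>) * B" "norm (c *\<^sub>R mehler c s G x) \<le> (1 + \<bar>c\<bar>) * B"
      unfolding distrib_right using B(1) by linarith+
  qed
qed

lemma integral_gaussian2_rotate:
  fixes \<Phi> :: "(real^'n) \<times> (real^'n) \<Rightarrow> 'b::{banach,second_countable_topology}"
  assumes \<Phi>[measurable]: "\<Phi> \<in> borel_measurable (borel \<Otimes>\<^sub>M borel)" and cs: "c\<^sup>2 + s\<^sup>2 = 1" "c \<noteq> 0"
  shows "(\<integral>p. \<Phi> (c *\<^sub>R fst p + s *\<^sub>R snd p, c *\<^sub>R snd p - s *\<^sub>R fst p) \<partial>(\<gamma> \<Otimes>\<^sub>M \<gamma>)) = (\<integral>p. \<Phi> p \<partial>(\<gamma> \<Otimes>\<^sub>M \<gamma>))"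
    and "integrable (\<gamma> \<Otimes>\<^sub>M \<gamma>) (\<lambda>p. \<Phi> (c *\<^sub>R fst p + s *\<^sub>R snd p, c *\<^sub>R snd p - s *\<^sub>R fst p)) \<longleftrightarrow> integrable (\<gamma> \<Otimes>\<^sub>M \<gamma>) \<Phi>"
proof -
  let ?r = "\<lambda>p. (c *\<^sub>R fst p + s *\<^sub>R snd p, c *\<^sub>R snd p - s *\<^sub>R (fst p::real^'n))"
  have r: "distr (\<gamma> \<Otimes>\<^sub>M \<gamma>) (\<gamma> \<Otimes>\<^sub>M \<gamma>) ?r = (\<gamma> \<Otimes>\<^sub>M \<gamma> :: ((real^'n) \<times> (real^'n)) measure)"
    using gaussian_rotation_invariant[OF cs] by (simp add: case_prod_beta')
  have rm: "?r \<in> measurable (\<gamma> \<Otimes>\<^sub>M \<gamma>) (\<gamma> \<Otimes>\<^sub>M \<gamma>)" by measurable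
  have \<Phi>': "\<Phi> \<in> borel_measurable (\<gamma> \<Otimes>\<^sub>M \<gamma>)" by measurable
  show "(\<integral>p. \<Phi> (?r p) \<partial>(\<gamma> \<Otimes>\<^sub>M \<gamma>)) = (\<integral>p. \<Phi> p \<partial>(\<gamma> \<Otimes>\<^sub>M \<gamma>))"
    using integral_distr[OF rm \<Phi>'] unfolding r by simp
  show "integrable (\<gamma> \<Otimes>\<^sub>M \<gamma>) (\<lambda>p. \<Phi> (?r p)) \<longleftrightarrow> integrable (\<gamma> \<Otimes>\<^sub>M \<gamma>) \<Phi>"
    using integrable_distr_eq[OF rm \<Phi>'] unfolding r by simp
qed

text \<open>The first component of the inverse rotation: it recovers \<open>X\<close> from \<open>U = c X + s Z\<close> and
  \<open>W = c Z - s X\<close>.\<close>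

lemma rotate_back:
  fixes x z :: "'a::real_vector"
  assumes "c\<^sup>2 + s\<^sup>2 = 1"
  shows "c *\<^sub>R (c *\<^sub>R x + s *\<^sub>R z) - s *\<^sub>R (c *\<^sub>R z - s *\<^sub>R x) = x"
proof -
  have "c *\<^sub>R (c *\<^sub>R x + s *\<^sub>R z) - s *\<^sub>R (c *\<^sub>R z - s *\<^sub>R x) = (c\<^sup>2 + s\<^sup>2) *\<^sub>R x"
    by (simp add: algebra_simps power2_eq_square)
  then show ?thesis using assms by simp
qed

text \<open>If \<open>X\<close> and \<open>Z\<close> are independent standard Gaussians then so is \<open>c X + s Z\<close>, by rotation
  invariance.\<close>

lemma integral_mehler:
  fixes K :: "real^'n \<Rightarrow> 'b::{banach,second_countable_topology}"
  assumes [measurable]: "K \<in> borel_measurable borel" and B: "\<And>x. norm (K x) \<le> B"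
    and cs: "c\<^sup>2 + s\<^sup>2 = 1" "c \<noteq> 0"
  shows "(\<integral>x. mehler c s K x \<partial>\<gamma>) = (\<integral>x. K x \<partial>\<gamma>)"
proof -
  have i: "integrable (\<gamma> \<Otimes>\<^sub>M \<gamma>) (\<lambda>p::(real^'n) \<times> (real^'n). K (fst p))"
    by (rule integrable_gaussian2_bounded[of _ B]) (use B in auto)
  have i2: "integrable (\<gamma> \<Otimes>\<^sub>M \<gamma>) (\<lambda>p. K (c *\<^sub>R fst p + s *\<^sub>R snd p))"
    by (rule integrable_gaussian2_bounded[of _ B]) (use B in auto)
  have "(\<integral>x. mehler c s K x \<partial>\<gamma>) = (\<integral>p. K (c *\<^sub>R fst p + s *\<^sub>R snd p) \<partial>(\<gamma> \<Otimes>\<^sub>M \<gamma>))"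
    using gaussian2.integral_fst'[OF i2] by (simp add: mehler_def)
  also have "\<dots> = (\<integral>p. K (fst (p::(real^'n) \<times> (real^'n))) \<partial>(\<gamma> \<Otimes>\<^sub>M \<gamma>))"
    using integral_gaussian2_rotate(1)[OF _ cs, of "\<lambda>p. K (fst p)"] by simp
  also have "\<dots> = (\<integral>x. K x \<partial>\<gamma>)"
    using gaussian2.integral_fst'[OF i] by (simp add: gaussian.prob_space[simplified])
  finally show ?thesis .
qed

lemma angle_curve_lipschitz:
  fixes x z :: "'a::real_normed_vector"
  shows "norm ((cos a *\<^sub>R x + sin a *\<^sub>R z) - (cos b *\<^sub>R x + sin b *\<^sub>R z)) \<le> (norm x + norm z) * \<bar>a - b\<bar>"
proof -
  have "norm ((cos a *\<^sub>R x + sin a *\<^sub>R z) - (cos b *\<^sub>R x + sin b *\<^sub>R z)) \<le> (norm x + norm z) * norm (a - b)"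
  proof (rule differentiable_bound[where S = UNIV and f' = "\<lambda>\<theta> t. t *\<^sub>R (cos \<theta> *\<^sub>R z - sin \<theta> *\<^sub>R x)"])
    show "((\<lambda>\<theta>. cos \<theta> *\<^sub>R x + sin \<theta> *\<^sub>R z) has_derivative (\<lambda>t. t *\<^sub>R (cos \<theta> *\<^sub>R z - sin \<theta> *\<^sub>R x))) (at \<theta> within UNIV)" for \<theta>
      by (auto intro!: derivative_eq_intros simp: algebra_simps)
    show "onorm (\<lambda>t. t *\<^sub>R (cos \<theta> *\<^sub>R z - sin \<theta> *\<^sub>R x)) \<le> norm x + norm z" for \<theta>
    proof (rule onorm_le)
      fix t :: real
      have "norm (cos \<theta> *\<^sub>R z - sin \<theta> *\<^sub>R x) \<le> \<bar>cos \<theta>\<bar> * norm z + \<bar>sin \<theta>\<bar> * norm x"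
        using norm_triangle_ineq4[of "cos \<theta> *\<^sub>R z" "sin \<theta> *\<^sub>R x"] by simp
      also have "\<dots> \<le> 1 * norm z + 1 * norm x"
        by (intro add_mono mult_right_mono) auto
      finally show "norm (t *\<^sub>R (cos \<theta> *\<^sub>R z - sin \<theta> *\<^sub>R x)) \<le> (norm x + norm z) * norm t"
        using mult_left_mono[of "norm (cos \<theta> *\<^sub>R z - sin \<theta> *\<^sub>R x)" "norm x + norm z" "\<bar>t\<bar>"] by (simp add: mult.commute add.commute)
    qed
  qed auto
  then show ?thesis by simp
qed

lemma norm_rotated_le: "norm (cos \<theta> *\<^sub>R z - sin \<theta> *\<^sub>R x) \<le> norm x + norm (z::'a::real_normed_vector)"
proof -
  have "norm (cos \<theta> *\<^sub>R z - sin \<theta> *\<^sub>R x) \<le> \<bar>cos \<theta>\<bar> * norm z + \<bar>sin \<theta>\<bar> * norm x"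
    using norm_triangle_ineq4[of "cos \<theta> *\<^sub>R z" "sin \<theta> *\<^sub>R x"] by simp
  also have "\<dots> \<le> 1 * norm z + 1 * norm x"
    by (intro add_mono mult_right_mono) auto
  finally show ?thesis by simp
qed

lemma has_derivative_along_angle:
  assumes "bounded_C1 F G"
  shows "((\<lambda>\<theta>. F (cos \<theta> *\<^sub>R x + sin \<theta> *\<^sub>R z)) has_derivative
     (\<lambda>t. t * (G (cos \<theta> *\<^sub>R x + sin \<theta> *\<^sub>R z) \<bullet> (cos \<theta> *\<^sub>R z - sin \<theta> *\<^sub>R x)))) (at \<theta>)"
proof -
  have "((\<lambda>\<theta>. F (cos \<theta> *\<^sub>R x + sin \<theta> *\<^sub>R z)) has_derivative
     (\<lambda>t. G (cos \<theta> *\<^sub>R x + sin \<theta> *\<^sub>R z) \<bullet> (t *\<^sub>R (cos \<theta> *\<^sub>R z - sin \<theta> *\<^sub>R x)))) (at \<theta>)"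
    by (rule has_derivative_compose[OF _ bounded_C1_has_derivative[OF assms]])
       (auto intro!: derivative_eq_intros simp: algebra_simps)
  then show ?thesis by simp
qed

text \<open>Along the path \<open>cos \<theta> x + sin \<theta> z\<close> the velocity is \<open>cos \<theta> z - sin \<theta> x\<close>, which has
  norm at most \<open>|x| + |z|\<close>; this makes all difference quotients dominated by an integrable
  function.\<close>

lemma mehler_has_derivative_angle:
  fixes F :: "real^'n \<Rightarrow> real"
  assumes FG: "bounded_C1 F G" and B: "\<And>x. norm (G x) \<le> B"
  shows "((\<lambda>\<theta>. mehler (cos \<theta>) (sin \<theta>) F x) has_derivative
      (\<lambda>t. t * (\<integral>z. G (cos \<theta> *\<^sub>R x + sin \<theta> *\<^sub>R z) \<bullet> (cos \<theta> *\<^sub>R z - sin \<theta> *\<^sub>R x) \<partial>\<gamma>))) (at \<theta>)"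
    and "\<bar>mehler (cos a) (sin a) F x - mehler (cos b) (sin b) F x\<bar> \<le> B * (norm x + (\<integral>z. norm (z::real^'n) \<partial>\<gamma>)) * \<bar>a - b\<bar>"
    and "\<bar>\<integral>z. G (cos a *\<^sub>R x + sin a *\<^sub>R z) \<bullet> (cos a *\<^sub>R z - sin a *\<^sub>R x) \<partial>\<gamma>\<bar> \<le> B * (norm x + (\<integral>z. norm (z::real^'n) \<partial>\<gamma>))"
proof -
  obtain B' where B': "B' > 0" "\<And>x. \<bar>F x\<bar> \<le> B'" "\<And>x. norm (G x) \<le> B'"
    using bounded_C1_bound[OF FG] by blast
  have B0: "B \<ge> 0" using order_trans[OF norm_ge_zero B] .
  note [measurable] = bounded_C1_measurable[OF FG]
  have ib: "integrable \<gamma> (\<lambda>z::real^'n. B * (norm x + norm z))"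
    by (simp add: integrable_gaussian_norm)
  have int: "integrable \<gamma> (\<lambda>z. F (cos \<theta> *\<^sub>R x + sin \<theta> *\<^sub>R z))" for \<theta>
    by (rule integrable_gaussian_bounded[of _ B']) (use B' in auto)
  have lip: "\<bar>F (cos a *\<^sub>R x + sin a *\<^sub>R z) - F (cos b *\<^sub>R x + sin b *\<^sub>R z)\<bar> \<le> B * (norm x + norm z) * \<bar>a - b\<bar>" for a b z
    using order_trans[OF bounded_C1_lipschitz[OF FG B] mult_left_mono[OF angle_curve_lipschitz B0]]
    by (simp add: mult.assoc)
  have bd: "\<bar>G (cos \<theta> *\<^sub>R x + sin \<theta> *\<^sub>R z) \<bullet> (cos \<theta> *\<^sub>R z - sin \<theta> *\<^sub>R x)\<bar> \<le> B * (norm x + norm z)" for \<theta> z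
    by (rule order_trans[OF Cauchy_Schwarz_ineq2 mult_mono[OF B norm_rotated_le]]) (use B0 in auto)
  have "((\<lambda>\<theta>. \<integral>z. F (cos \<theta> *\<^sub>R x + sin \<theta> *\<^sub>R z) \<partial>\<gamma>) has_derivative
      (\<lambda>t. \<integral>z. t * (G (cos \<theta> *\<^sub>R x + sin \<theta> *\<^sub>R z) \<bullet> (cos \<theta> *\<^sub>R z - sin \<theta> *\<^sub>R x)) \<partial>\<gamma>)) (at \<theta>)"
  proof (rule has_derivative_integral[where e = 1, OF int ib])
    show "\<bar>t * (G (cos \<theta> *\<^sub>R x + sin \<theta> *\<^sub>R z) \<bullet> (cos \<theta> *\<^sub>R z - sin \<theta> *\<^sub>R x))\<bar> \<le> B * (norm x + norm z) * norm t" for z t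
      using mult_left_mono[OF bd, of "\<bar>t\<bar>"] by (simp add: abs_mult mult_ac)
  qed (use lip has_derivative_along_angle[OF FG] in auto)
  then show "((\<lambda>\<theta>. mehler (cos \<theta>) (sin \<theta>) F x) has_derivative
      (\<lambda>t. t * (\<integral>z. G (cos \<theta> *\<^sub>R x + sin \<theta> *\<^sub>R z) \<bullet> (cos \<theta> *\<^sub>R z - sin \<theta> *\<^sub>R x) \<partial>\<gamma>))) (at \<theta>)"
    unfolding mehler_def[abs_def] by simp
  have eb: "(\<integral>z. B * (norm x + norm (z::real^'n)) \<partial>\<gamma>) = B * (norm x + (\<integral>z. norm (z::real^'n) \<partial>\<gamma>))"
    by (simp add: integrable_gaussian_norm gaussian.prob_space[simplified])
  have "\<bar>mehler (cos a) (sin a) F x - mehler (cos b) (sin b) F x\<bar>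
     = norm (\<integral>z. F (cos a *\<^sub>R x + sin a *\<^sub>R z) - F (cos b *\<^sub>R x + sin b *\<^sub>R z) \<partial>\<gamma>)"
    using int by (simp add: mehler_def)
  also have "\<dots> \<le> (\<integral>z. B * (norm x + norm (z::real^'n)) * \<bar>a - b\<bar> \<partial>\<gamma>)"
    by (rule order_trans[OF integral_norm_bound integral_mono]) (use int ib lip in auto)
  also have "\<dots> = B * (norm x + (\<integral>z. norm (z::real^'n) \<partial>\<gamma>)) * \<bar>a - b\<bar>"
    by (simp only: integral_mult_left_zero eb)
  finally show "\<bar>mehler (cos a) (sin a) F x - mehler (cos b) (sin b) F x\<bar> \<le> B * (norm x + (\<integral>z. norm (z::real^'n) \<partial>\<gamma>)) * \<bar>a - b\<bar>" .
  have "integrable \<gamma> (\<lambda>z. norm (G (cos a *\<^sub>R x + sin a *\<^sub>R z) \<bullet> (cos a *\<^sub>R z - sin a *\<^sub>R x)))"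
    by (rule Bochner_Integration.integrable_bound[OF ib]) (use bd B0 in \<open>auto intro!: AE_I2\<close>)
  then have "norm (\<integral>z. G (cos a *\<^sub>R x + sin a *\<^sub>R z) \<bullet> (cos a *\<^sub>R z - sin a *\<^sub>R x) \<partial>\<gamma>) \<le> (\<integral>z. B * (norm x + norm (z::real^'n)) \<partial>\<gamma>)"
    by (intro order_trans[OF integral_norm_bound integral_mono]) (use bd ib in auto)
  then show "\<bar>\<integral>z. G (cos a *\<^sub>R x + sin a *\<^sub>R z) \<bullet> (cos a *\<^sub>R z - sin a *\<^sub>R x) \<partial>\<gamma>\<bar> \<le> B * (norm x + (\<integral>z. norm (z::real^'n) \<partial>\<gamma>))"
    unfolding eb by simp
qed

lemma abs_ln_le: "m > 0 \<Longrightarrow> m \<le> y \<Longrightarrow> y \<le> M \<Longrightarrow> \<bar>ln y\<bar> \<le> \<bar>ln m\<bar> + \<bar>ln (M::real)\<bar>"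
  using ln_mono[of m y] ln_mono[of y M] by linarith

text \<open>The left-hand side is the derivative of the entropy of the Mehler average along the angle. In
  the rotated variables \<open>U = c X + s Z\<close> and \<open>W = c Z - s X\<close> the gradient is
  evaluated at \<open>U\<close> alone and \<open>X = c U - s W\<close>, so Gaussian integration by parts in \<open>W\<close>
  replaces the factor \<open>W\<close> by \<open>- s\<close> times the gradient of the logarithm of the average at \<open>X\<close>;
  rotating back gives the right-hand side.\<close>

lemma entropy_derivative_identity:
  fixes F :: "real^'n \<Rightarrow> real"
  assumes FG: "bounded_C1 F G" and m: "m > 0" "\<And>x. m \<le> F x" and cs: "c\<^sup>2 + s\<^sup>2 = 1" "c \<noteq> 0"
  shows "(\<integral>x. (ln (mehler c s F x) + 1) * (\<integral>z. G (c *\<^sub>R x + s *\<^sub>R z) \<bullet> (c *\<^sub>R z - s *\<^sub>R x) \<partial>\<gamma>) \<partial>\<gamma>)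
     = - (s * c) * (\<integral>x. (norm (mehler c s G x))\<^sup>2 / mehler c s F x \<partial>\<gamma>)"
proof -
  obtain B where B: "B > 0" "\<And>x. \<bar>F x\<bar> \<le> B" "\<And>x. norm (G x) \<le> B"
    using bounded_C1_bound[OF FG] by blast
  note [measurable] = bounded_C1_measurable[OF FG]
  let ?A = "mehler c s F" and ?A' = "mehler c s G"
  have [measurable]: "?A \<in> borel_measurable borel" "?A' \<in> borel_measurable borel"
    using measurable_mehler[of F B] measurable_mehler[of G B] bounded_C1_continuous[OF FG] bounded_C1_continuous_grad[OF FG] B
    by auto
  have A: "m \<le> ?A x" "?A x \<le> B" "norm (?A' x) \<le> B" for x
    using mehler_ge[of F B m] norm_mehler_le[of F B c s x] norm_mehler_le[of G B c s x] B m by auto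
  then have A0: "?A x > 0" for x using m(1) by (meson less_le_trans)
  \<comment> \<open>A bound for \<open>ln t + 1\<close>, the derivative of \<open>t ln t\<close>, on \<open>[m, B]\<close>.\<close>
  define L where "L = \<bar>ln m\<bar> + \<bar>ln B\<bar> + 1"
  have L: "\<bar>ln (?A x) + 1\<bar> \<le> L" for x
    using abs_ln_le[OF m(1) A(1)[of x] A(2)[of x]] by (simp add: L_def)
  have L0: "L \<ge> 0" by (simp add: L_def)
  define \<Phi>1 where "\<Phi>1 p = (ln (?A (c *\<^sub>R fst p - s *\<^sub>R snd p)) + 1) * (G (fst p) \<bullet> snd p)" for p :: "(real^'n) \<times> (real^'n)"
  define \<Phi>2 where "\<Phi>2 p = (- (s * c) / ?A (c *\<^sub>R fst p - s *\<^sub>R snd p)) * (?A' (c *\<^sub>R fst p - s *\<^sub>R snd p) \<bullet> G (fst p))" for p :: "(real^'n) \<times> (real^'n)"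
  have m1[measurable]: "\<Phi>1 \<in> borel_measurable (borel \<Otimes>\<^sub>M borel)" unfolding \<Phi>1_def by measurable
  have m2[measurable]: "\<Phi>2 \<in> borel_measurable (borel \<Otimes>\<^sub>M borel)" unfolding \<Phi>2_def by measurable
  have i1: "integrable (\<gamma> \<Otimes>\<^sub>M \<gamma>) \<Phi>1"
  proof (rule Bochner_Integration.integrable_bound[OF integrable_mult_right[OF integrable_gaussian2_norm, of "L * B"]])
    show "AE p in \<gamma> \<Otimes>\<^sub>M \<gamma>. norm (\<Phi>1 p) \<le> norm (L * B * (norm (fst p) + norm (snd p)))"
    proof (rule AE_I2)
      fix p :: "(real^'n) \<times> (real^'n)"
      have "\<bar>G (fst p) \<bullet> snd p\<bar> \<le> B * (norm (fst p) + norm (snd p))"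
        by (rule order_trans[OF Cauchy_Schwarz_ineq2 mult_mono[OF B(3)]]) (use B in auto)
      from mult_mono[OF L this L0] show "norm (\<Phi>1 p) \<le> norm (L * B * (norm (fst p) + norm (snd p)))"
        using L0 B(1) by (simp add: \<Phi>1_def abs_mult mult.assoc)
    qed
  qed simp
  have i2: "integrable (\<gamma> \<Otimes>\<^sub>M \<gamma>) \<Phi>2"
  proof (rule integrable_gaussian2_bounded[of _ "\<bar>s * c\<bar> / m * (B * B)"])
    fix p :: "(real^'n) \<times> (real^'n)"
    have a: "\<bar>- (s * c) / ?A (c *\<^sub>R fst p - s *\<^sub>R snd p)\<bar> \<le> \<bar>s * c\<bar> / m"
      using A[of "c *\<^sub>R fst p - s *\<^sub>R snd p"] A0[of "c *\<^sub>R fst p - s *\<^sub>R snd p"] m(1) by (simp add: abs_mult divide_left_mono)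
    have b: "\<bar>?A' (c *\<^sub>R fst p - s *\<^sub>R snd p) \<bullet> G (fst p)\<bar> \<le> B * B"
      by (rule order_trans[OF Cauchy_Schwarz_ineq2 mult_mono[OF A(3) B(3)]]) (use B in auto)
    show "norm (\<Phi>2 p) \<le> \<bar>s * c\<bar> / m * (B * B)"
      unfolding \<Phi>2_def real_norm_def abs_mult[of "_ / _"] by (rule mult_mono[OF a b]) (use m in auto)
  qed simp
  note rb = rotate_back[OF cs(1)]
  have r1: "\<Phi>1 (c *\<^sub>R x + s *\<^sub>R z, c *\<^sub>R z - s *\<^sub>R x) = (ln (?A x) + 1) * (G (c *\<^sub>R x + s *\<^sub>R z) \<bullet> (c *\<^sub>R z - s *\<^sub>R x))" for x z
    by (simp only: \<Phi>1_def fst_conv snd_conv rb)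
  have r2: "\<Phi>2 (c *\<^sub>R x + s *\<^sub>R z, c *\<^sub>R z - s *\<^sub>R x) = (- (s * c) / ?A x) * (?A' x \<bullet> G (c *\<^sub>R x + s *\<^sub>R z))" for x z
    by (simp only: \<Phi>2_def fst_conv snd_conv rb)
  have "(\<integral>x. (ln (?A x) + 1) * (\<integral>z. G (c *\<^sub>R x + s *\<^sub>R z) \<bullet> (c *\<^sub>R z - s *\<^sub>R x) \<partial>\<gamma>) \<partial>\<gamma>)
     = (\<integral>x. \<integral>z. \<Phi>1 (c *\<^sub>R x + s *\<^sub>R z, c *\<^sub>R z - s *\<^sub>R x) \<partial>\<gamma> \<partial>\<gamma>)"
    by (simp only: r1 integral_mult_right_zero)
  also have "\<dots> = (\<integral>p. \<Phi>1 (c *\<^sub>R fst p + s *\<^sub>R snd p, c *\<^sub>R snd p - s *\<^sub>R fst p) \<partial>(\<gamma> \<Otimes>\<^sub>M \<gamma>))"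
    using gaussian2.integral_fst'[OF iffD2[OF integral_gaussian2_rotate(2)[OF m1 cs] i1]] by simp
  also have "\<dots> = (\<integral>p. \<Phi>1 p \<partial>(\<gamma> \<Otimes>\<^sub>M \<gamma>))" by (rule integral_gaussian2_rotate(1)[OF m1 cs])
  also have "\<dots> = (\<integral>u. \<integral>w. \<Phi>1 (u, w) \<partial>\<gamma> \<partial>\<gamma>)"
    by (rule gaussian2.integral_fst'[OF i1, symmetric])
  also have "\<dots> = (\<integral>u. \<integral>w. \<Phi>2 (u, w) \<partial>\<gamma> \<partial>\<gamma>)"
  proof (rule Bochner_Integration.integral_cong[OF refl])
    fix u :: "real^'n"
    let ?y = "\<lambda>w. c *\<^sub>R u - s *\<^sub>R w"
    have KD: "bounded_C1 (\<lambda>w. ln (?A (?y w)) + 1) (\<lambda>w. (- (s * c) / ?A (?y w)) *\<^sub>R ?A' (?y w))"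
      unfolding bounded_C1_def
    proof (intro conjI allI exI[of _ "L + \<bar>s * c\<bar> / m * B"])
      fix w
      have d: "((\<lambda>w. ?A (?y w)) has_derivative (\<lambda>h. (c *\<^sub>R ?A' (?y w)) \<bullet> (- s *\<^sub>R h))) (at w)"
        by (rule has_derivative_compose[OF _ bounded_C1_has_derivative[OF bounded_C1_mehler[OF FG]]])
           (auto intro!: derivative_eq_intros)
      show "((\<lambda>w. ln (?A (?y w)) + 1) has_derivative (\<lambda>h. ((- (s * c) / ?A (?y w)) *\<^sub>R ?A' (?y w)) \<bullet> h)) (at w)"
        by (rule derivative_eq_intros d A0 refl)+ (auto simp: field_simps fun_eq_iff)
      have a: "\<bar>- (s * c) / ?A (?y w)\<bar> \<le> \<bar>s * c\<bar> / m"
        using A[of "?y w"] A0[of "?y w"] m(1) by (simp add: abs_mult divide_left_mono)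
      have "norm ((- (s * c) / ?A (?y w)) *\<^sub>R ?A' (?y w)) \<le> \<bar>s * c\<bar> / m * B"
        unfolding norm_scaleR by (rule mult_mono[OF a A(3)]) (use m in auto)
      then show "norm ((- (s * c) / ?A (?y w)) *\<^sub>R ?A' (?y w)) \<le> L + \<bar>s * c\<bar> / m * B" using L0 by linarith
      have "\<bar>s * c\<bar> / m * B \<ge> 0" using m B by simp
      then show "\<bar>ln (?A (?y w)) + 1\<bar> \<le> L + \<bar>s * c\<bar> / m * B" using L[of "?y w"] by linarith
    next
      have "continuous_on UNIV (\<lambda>w. ?A (?y w))" "continuous_on UNIV (\<lambda>w. ?A' (?y w))"
        using bounded_C1_continuous[OF FG] bounded_C1_continuous_grad[OF FG] B
        by (auto intro!: continuous_on_compose2[OF continuous_mehler[of _ B]] continuous_intros)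
      then show "continuous_on UNIV (\<lambda>w. (- (s * c) / ?A (?y w)) *\<^sub>R ?A' (?y w))"
        using A0 by (intro continuous_intros) (auto simp: less_imp_neq[symmetric])
    qed
    show "(\<integral>w. \<Phi>1 (u, w) \<partial>\<gamma>) = (\<integral>w. \<Phi>2 (u, w) \<partial>\<gamma>)"
      using gaussian_integration_by_parts[OF KD, of "G u"] by (simp add: \<Phi>1_def \<Phi>2_def)
  qed
  also have "\<dots> = (\<integral>p. \<Phi>2 p \<partial>(\<gamma> \<Otimes>\<^sub>M \<gamma>))"
    by (rule gaussian2.integral_fst'[OF i2])
  also have "\<dots> = (\<integral>p. \<Phi>2 (c *\<^sub>R fst p + s *\<^sub>R snd p, c *\<^sub>R snd p - s *\<^sub>R fst p) \<partial>(\<gamma> \<Otimes>\<^sub>M \<gamma>))"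
    by (rule integral_gaussian2_rotate(1)[OF m2 cs, symmetric])
  also have "\<dots> = (\<integral>x. \<integral>z. \<Phi>2 (c *\<^sub>R x + s *\<^sub>R z, c *\<^sub>R z - s *\<^sub>R x) \<partial>\<gamma> \<partial>\<gamma>)"
    using gaussian2.integral_fst'[OF iffD2[OF integral_gaussian2_rotate(2)[OF m2 cs] i2]] by simp
  also have "\<dots> = (\<integral>x. - (s * c) * ((norm (?A' x))\<^sup>2 / ?A x) \<partial>\<gamma>)"
  proof (rule Bochner_Integration.integral_cong[OF refl])
    fix x
    have "integrable \<gamma> (\<lambda>z. G (c *\<^sub>R x + s *\<^sub>R z))"
      by (rule integrable_gaussian_bounded[of _ B]) (use B in auto)
    then have "(\<integral>z. ?A' x \<bullet> G (c *\<^sub>R x + s *\<^sub>R z) \<partial>\<gamma>) = (norm (?A' x))\<^sup>2"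
      by (subst integral_inner_right) (auto simp: mehler_def power2_norm_eq_inner)
    then show "(\<integral>z. \<Phi>2 (c *\<^sub>R x + s *\<^sub>R z, c *\<^sub>R z - s *\<^sub>R x) \<partial>\<gamma>) = - (s * c) * ((norm (?A' x))\<^sup>2 / ?A x)"
      unfolding r2 integral_mult_right_zero by simp
  qed
  also have "\<dots> = - (s * c) * (\<integral>x. (norm (?A' x))\<^sup>2 / ?A x \<partial>\<gamma>)"
    by (simp only: integral_mult_right_zero)
  finally show ?thesis .
qed

section \<open>The logarithmic Sobolev inequality for smooth functions\<close>

lemma xlnx_lipschitz:
  fixes m M x y :: real
  assumes m: "m > 0" and x: "m \<le> x" "x \<le> M" and y: "m \<le> y" "y \<le> M"
  shows "\<bar>x * ln x - y * ln y\<bar> \<le> (\<bar>ln m\<bar> + \<bar>ln M\<bar> + 1) * \<bar>x - y\<bar>"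
proof -
  have "norm (x * ln x - y * ln y) \<le> (\<bar>ln m\<bar> + \<bar>ln M\<bar> + 1) * norm (x - y)"
  proof (rule field_differentiable_bound[where S = "{m..M}" and f' = "\<lambda>t. ln t + 1"])
    fix t assume t: "t \<in> {m..M}"
    then have "t > 0" using m by auto
    then show "((\<lambda>x. x * ln x) has_field_derivative ln t + 1) (at t within {m..M})"
      by (auto intro!: derivative_eq_intros)
    show "norm (ln t + 1) \<le> \<bar>ln m\<bar> + \<bar>ln M\<bar> + 1"
      using abs_ln_le[of m t M] t m by auto
  qed (use assms in auto)
  then show ?thesis by simp
qed

text \<open>The gap in Jensen's inequality is a variance: expand the square and use that \<open>v\<close> is the mean of
  \<open>\<nabla>F / F\<close> with respect to the weight \<open>F\<close>.\<close>

lemma mehler_gradient_jensen: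
  fixes F :: "real^'n \<Rightarrow> real"
  assumes FG: "bounded_C1 F G" and m: "m > 0" "\<And>x. m \<le> F x"
  shows "mehler c s (\<lambda>y. (norm (G y))\<^sup>2 / F y) x - (norm (mehler c s G x))\<^sup>2 / mehler c s F x
     = (\<integral>z. F (c *\<^sub>R x + s *\<^sub>R z) * (norm (G (c *\<^sub>R x + s *\<^sub>R z) /\<^sub>R F (c *\<^sub>R x + s *\<^sub>R z)
          - mehler c s G x /\<^sub>R mehler c s F x))\<^sup>2 \<partial>\<gamma>)"
proof -
  define v where "v x = mehler c s G x /\<^sub>R mehler c s F x" for x
  obtain B where B: "B > 0" "\<And>x. \<bar>F x\<bar> \<le> B" "\<And>x. norm (G x) \<le> B"
    using bounded_C1_bound[OF FG] by blast
  note [measurable] = bounded_C1_measurable[OF FG]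
  have F0: "F y > 0" for y using m by (meson less_le_trans)
  have A0: "mehler c s F x > 0" using mehler_ge[of F B m c s x] B m by auto
  let ?U = "\<lambda>z. c *\<^sub>R x + s *\<^sub>R z"
  have e: "F u * (norm (G u /\<^sub>R F u - w))\<^sup>2 = (norm (G u))\<^sup>2 / F u - 2 * (G u \<bullet> w) + F u * (norm w)\<^sup>2" for u w
    using F0[of u] unfolding power2_norm_eq_inner
    by (simp add: inner_simps inner_commute field_simps power2_eq_square)
  have i1: "integrable \<gamma> (\<lambda>z. (norm (G (?U z)))\<^sup>2 / F (?U z))"
  proof (rule integrable_gaussian_bounded[of _ "B\<^sup>2 / m"])
    fix z
    show "norm ((norm (G (?U z)))\<^sup>2 / F (?U z)) \<le> B\<^sup>2 / m"
      using F0[of "?U z"] m B by (auto intro!: frac_le power_mono simp: abs_of_pos)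
  qed simp
  have i2: "integrable \<gamma> (\<lambda>z. G (?U z))"
    by (rule integrable_gaussian_bounded[of _ B]) (use B in auto)
  have i3: "integrable \<gamma> (\<lambda>z. F (?U z))"
    by (rule integrable_gaussian_bounded[of _ B]) (use B in auto)
  have "(\<integral>z. F (?U z) * (norm (G (?U z) /\<^sub>R F (?U z) - v x))\<^sup>2 \<partial>\<gamma>)
     = (\<integral>z. (norm (G (?U z)))\<^sup>2 / F (?U z) \<partial>\<gamma>) - 2 * ((\<integral>z. G (?U z) \<partial>\<gamma>) \<bullet> v x) + (\<integral>z. F (?U z) \<partial>\<gamma>) * (norm (v x))\<^sup>2"
    unfolding e using i1 i2 i3 by simp
  also have "\<dots> = mehler c s (\<lambda>y. (norm (G y))\<^sup>2 / F y) x - 2 * (mehler c s G x \<bullet> v x) + mehler c s F x * (norm (v x))\<^sup>2"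
    by (simp only: mehler_def)
  also have "\<dots> = mehler c s (\<lambda>y. (norm (G y))\<^sup>2 / F y) x - (norm (mehler c s G x))\<^sup>2 / mehler c s F x"
    using A0 unfolding v_def power2_norm_eq_inner by (simp add: field_simps power2_eq_square)
  finally show ?thesis by (simp add: v_def)
qed

lemma fisher_bounds:
  fixes F :: "real^'n \<Rightarrow> real"
  assumes FG: "bounded_C1 F G" and m: "m > 0" "\<And>x. m \<le> F x"
    and B: "\<And>x. norm (G x) \<le> B"
  shows "(\<lambda>x. (norm (G x))\<^sup>2 / F x) \<in> borel_measurable borel" "\<bar>(norm (G x))\<^sup>2 / F x\<bar> \<le> B\<^sup>2 / m"
proof -
  note [measurable] = bounded_C1_measurable[OF FG]
  show "(\<lambda>x. (norm (G x))\<^sup>2 / F x) \<in> borel_measurable borel" by measurable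
  show "\<bar>(norm (G x))\<^sup>2 / F x\<bar> \<le> B\<^sup>2 / m"
    using less_le_trans[OF m(1) m(2)[of x]] m B[of x] by (auto intro!: frac_le power_mono simp: abs_of_pos)
qed

lemma integral_mehler_fisher_le:
  fixes F :: "real^'n \<Rightarrow> real"
  assumes FG: "bounded_C1 F G" and m: "m > 0" "\<And>x. m \<le> F x" and cs: "c\<^sup>2 + s\<^sup>2 = 1" "c \<noteq> 0"
  shows "(\<integral>x. (norm (mehler c s G x))\<^sup>2 / mehler c s F x \<partial>\<gamma>) \<le> (\<integral>x. (norm (G x))\<^sup>2 / F x \<partial>\<gamma>)"
proof -
  obtain B where B: "B > 0" "\<And>x. \<bar>F x\<bar> \<le> B" "\<And>x. norm (G x) \<le> B"
    using bounded_C1_bound[OF FG] by blast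
  note [measurable] = bounded_C1_measurable[OF FG]
  note fb = fisher_bounds[OF FG m B(3)]
  have F0: "F y > 0" for y using m by (meson less_le_trans)
  have Am: "m \<le> mehler c s F x" for x using mehler_ge[of F B m c s x] B m by auto
  have [measurable]: "mehler c s F \<in> borel_measurable borel" "mehler c s G \<in> borel_measurable borel"
    using measurable_mehler[of F B] measurable_mehler[of G B] bounded_C1_continuous[OF FG] bounded_C1_continuous_grad[OF FG] B
    by auto
  have cont: "continuous_on UNIV (\<lambda>x. (norm (G x))\<^sup>2 / F x)"
    using bounded_C1_continuous[OF FG] bounded_C1_continuous_grad[OF FG] F0
    by (intro continuous_intros) (auto simp: less_imp_neq[symmetric])
  have i1: "integrable \<gamma> (\<lambda>x. (norm (mehler c s G x))\<^sup>2 / mehler c s F x)"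
  proof (rule integrable_gaussian_bounded[of _ "B\<^sup>2 / m"])
    fix x
    have "mehler c s F x > 0" using Am[of x] m(1) by linarith
    then show "norm ((norm (mehler c s G x))\<^sup>2 / mehler c s F x) \<le> B\<^sup>2 / m"
      using Am[of x] m norm_mehler_le[of G B c s x] B by (auto intro!: frac_le power_mono simp: abs_of_pos)
  qed simp
  have i2: "integrable \<gamma> (mehler c s (\<lambda>y. (norm (G y))\<^sup>2 / F y))"
  proof (rule integrable_gaussian_bounded[of _ "B\<^sup>2 / m"])
    show "mehler c s (\<lambda>y. (norm (G y))\<^sup>2 / F y) \<in> borel_measurable borel"
      by (rule measurable_mehler[OF cont, of "B\<^sup>2 / m"]) (use fb in simp)
    show "norm (mehler c s (\<lambda>y. (norm (G y))\<^sup>2 / F y) x) \<le> B\<^sup>2 / m" for x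
      by (rule norm_mehler_le) (use fb in simp_all)
  qed
  have "(\<integral>x. (norm (mehler c s G x))\<^sup>2 / mehler c s F x \<partial>\<gamma>) \<le> (\<integral>x. mehler c s (\<lambda>y. (norm (G y))\<^sup>2 / F y) x \<partial>\<gamma>)"
  proof (rule integral_mono[OF i1 i2])
    fix x
    have "0 \<le> mehler c s (\<lambda>y. (norm (G y))\<^sup>2 / F y) x - (norm (mehler c s G x))\<^sup>2 / mehler c s F x"
      unfolding mehler_gradient_jensen[OF FG m] by (intro integral_nonneg_AE AE_I2 mult_nonneg_nonneg less_imp_le[OF F0] zero_le_power2)
    then show "(norm (mehler c s G x))\<^sup>2 / mehler c s F x \<le> mehler c s (\<lambda>y. (norm (G y))\<^sup>2 / F y) x" by simp
  qed
  also have "\<dots> = (\<integral>x. (norm (G x))\<^sup>2 / F x \<partial>\<gamma>)"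
    by (rule integral_mehler[OF _ _ cs, of _ "B\<^sup>2 / m"]) (use fb in simp_all)
  finally show ?thesis .
qed

text \<open>The function \<open>\<Psi>(\<theta>) = \<integral> A\<^sub>\<theta> F ln (A\<^sub>\<theta> F) d\<gamma> + (sin \<theta>)\<^sup>2/2 * I\<close>
  interpolates between the two sides: \<open>A\<^sub>0 F = F\<close> and \<open>A F\<close> at angle \<open>\<pi>/2\<close> is the
  constant \<open>\<integral> F d\<gamma>\<close>. Its derivative at interior angles is nonnegative, since the Fisher
  information of the average is at most \<open>(cos \<theta>)\<^sup>2 I\<close>.\<close>

theorem gaussian_log_sobolev:
  fixes F :: "real^'n \<Rightarrow> real"
  assumes FG: "bounded_C1 F G" and m: "m > 0" "\<And>x. m \<le> F x"
  shows "(\<integral>x. F x * ln (F x) \<partial>\<gamma>) - (\<integral>x. F x \<partial>\<gamma>) * ln (\<integral>x. F x \<partial>\<gamma>) \<le> (\<integral>x. (norm (G x))\<^sup>2 / F x \<partial>\<gamma>) / 2"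
proof -
  obtain B where B: "B > 0" "\<And>x. \<bar>F x\<bar> \<le> B" "\<And>x. norm (G x) \<le> B"
    using bounded_C1_bound[OF FG] by blast
  note [measurable] = bounded_C1_measurable[OF FG]
  let ?A = "\<lambda>\<theta>. mehler (cos \<theta>) (sin \<theta>) F"
  let ?A' = "\<lambda>\<theta> x. \<integral>z. G (cos \<theta> *\<^sub>R x + sin \<theta> *\<^sub>R z) \<bullet> (cos \<theta> *\<^sub>R z - sin \<theta> *\<^sub>R x) \<partial>\<gamma>"
  let ?I = "\<integral>x. (norm (G x))\<^sup>2 / F x \<partial>\<gamma>"
  define L where "L = \<bar>ln m\<bar> + \<bar>ln B\<bar> + 1"
  have L0: "L \<ge> 0" by (simp add: L_def)
  have A: "m \<le> ?A \<theta> x" "?A \<theta> x \<le> B" for \<theta> x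
    using mehler_ge[of F B m] norm_mehler_le[of F B "cos \<theta>" "sin \<theta>" x] B m by auto
  then have A0: "?A \<theta> x > 0" for \<theta> x using m(1) by (meson less_le_trans)
  have [measurable]: "?A \<theta> \<in> borel_measurable borel" for \<theta>
    using measurable_mehler[of F B] bounded_C1_continuous[OF FG] B by auto
  have [measurable]: "?A' \<theta> \<in> borel_measurable borel" for \<theta>
    by (rule gaussian.borel_measurable_lebesgue_integral) measurable
  define \<psi> where "\<psi> \<theta> = (\<integral>x. ?A \<theta> x * ln (?A \<theta> x) \<partial>\<gamma>)" for \<theta>
  let ?b = "\<lambda>x. L * (B * (norm x + (\<integral>z. norm (z::real^'n) \<partial>\<gamma>)))"
  have d: "(\<psi> has_derivative (\<lambda>t. \<integral>x. t * ((ln (?A \<theta> x) + 1) * ?A' \<theta> x) \<partial>\<gamma>)) (at \<theta>)" for \<theta>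
    unfolding \<psi>_def
  proof (rule has_derivative_integral[where e = 1 and b = ?b])
    show "integrable \<gamma> (\<lambda>x. ?A \<theta> x * ln (?A \<theta> x))" for \<theta>
    proof (rule integrable_gaussian_bounded[of _ "B * L"])
      fix x
      have "\<bar>ln (?A \<theta> x)\<bar> \<le> L"
        using abs_ln_le[OF m(1) A(1)[of \<theta> x] A(2)[of \<theta> x]] unfolding L_def by linarith
      then show "norm (?A \<theta> x * ln (?A \<theta> x)) \<le> B * L"
        unfolding norm_mult using A[of \<theta> x] A0[of \<theta> x] B by (intro mult_mono) auto
    qed simp
    show "integrable \<gamma> ?b" by (simp add: integrable_gaussian_norm)
    show "((\<lambda>\<theta>. ?A \<theta> x * ln (?A \<theta> x)) has_derivative (\<lambda>t. t * ((ln (?A \<theta> x) + 1) * ?A' \<theta> x))) (at \<theta>)" for x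
      by (rule derivative_eq_intros mehler_has_derivative_angle(1)[OF FG B(3)] A0 refl)+
         (use A0[of \<theta> x] in \<open>auto simp: field_simps fun_eq_iff\<close>)
    show "\<bar>?A t x * ln (?A t x) - ?A \<theta> x * ln (?A \<theta> x)\<bar> \<le> ?b x * norm (t - \<theta>)" for t x
    proof -
      have "\<bar>?A t x * ln (?A t x) - ?A \<theta> x * ln (?A \<theta> x)\<bar> \<le> L * \<bar>?A t x - ?A \<theta> x\<bar>"
        unfolding L_def by (rule xlnx_lipschitz[OF m(1) A A])
      also have "\<dots> \<le> L * (B * (norm x + (\<integral>z. norm (z::real^'n) \<partial>\<gamma>)) * \<bar>t - \<theta>\<bar>)"
        by (rule mult_left_mono[OF mehler_has_derivative_angle(2)[OF FG B(3)] L0])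
      finally show ?thesis by (simp add: mult.assoc)
    qed
    show "\<bar>t * ((ln (?A \<theta> x) + 1) * ?A' \<theta> x)\<bar> \<le> ?b x * norm t" for x t
    proof -
      have "\<bar>ln (?A \<theta> x) + 1\<bar> \<le> L"
        using abs_ln_le[OF m(1) A(1)[of \<theta> x] A(2)[of \<theta> x]] by (simp add: L_def)
      from mult_mono[OF this mehler_has_derivative_angle(3)[OF FG B(3)] L0]
      have "\<bar>ln (?A \<theta> x) + 1\<bar> * \<bar>?A' \<theta> x\<bar> \<le> ?b x" by simp
      from mult_right_mono[OF this, of "\<bar>t\<bar>"] show ?thesis by (simp add: abs_mult mult_ac)
    qed
  qed auto
  have der: "(\<psi> has_real_derivative (\<integral>x. (ln (?A \<theta> x) + 1) * ?A' \<theta> x \<partial>\<gamma>)) (at \<theta>)" for \<theta>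
    by (rule has_derivative_imp_has_field_derivative[OF d]) simp
  define \<Psi> where "\<Psi> \<theta> = \<psi> \<theta> + (sin \<theta>)\<^sup>2 / 2 * ?I" for \<theta>
  define \<Psi>' where "\<Psi>' \<theta> = (\<integral>x. (ln (?A \<theta> x) + 1) * ?A' \<theta> x \<partial>\<gamma>) + sin \<theta> * cos \<theta> * ?I" for \<theta>
  have "(\<Psi> has_real_derivative \<Psi>' \<theta>) (at \<theta>)" for \<theta>
  proof -
    have "((\<lambda>\<theta>. (sin \<theta>)\<^sup>2 / 2 * ?I) has_real_derivative sin \<theta> * cos \<theta> * ?I) (at \<theta>)"
      by (auto intro!: derivative_eq_intros)
    from DERIV_add[OF der this] show ?thesis unfolding \<Psi>_def \<Psi>'_def .
  qed
  \<comment> \<open>The mean value theorem provides an interior angle, so that \<open>cos \<theta> \<noteq> 0\<close> as the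
    identity for the derivative requires.\<close>
  then obtain \<theta> where \<theta>: "0 < \<theta>" "\<theta> < pi / 2" "\<Psi> (pi / 2) - \<Psi> 0 = (pi / 2 - 0) * \<Psi>' \<theta>"
    using MVT2[of 0 "pi / 2" \<Psi> \<Psi>'] by auto
  then have c: "cos \<theta> > 0" and s: "sin \<theta> > 0"
    by (auto intro: cos_gt_zero sin_gt_zero)
  have "\<Psi>' \<theta> \<ge> 0"
  proof -
    have "(\<integral>x. (norm (mehler (cos \<theta>) (sin \<theta>) G x))\<^sup>2 / ?A \<theta> x \<partial>\<gamma>) \<le> ?I"
      by (rule integral_mehler_fisher_le[OF FG m]) (use c in auto)
    then have "sin \<theta> * cos \<theta> * (\<integral>x. (norm (mehler (cos \<theta>) (sin \<theta>) G x))\<^sup>2 / ?A \<theta> x \<partial>\<gamma>) \<le> sin \<theta> * cos \<theta> * ?I"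
      using c s by (intro mult_left_mono) auto
    moreover have "(\<integral>x. (ln (?A \<theta> x) + 1) * ?A' \<theta> x \<partial>\<gamma>)
        = - (sin \<theta> * cos \<theta>) * (\<integral>x. (norm (mehler (cos \<theta>) (sin \<theta>) G x))\<^sup>2 / ?A \<theta> x \<partial>\<gamma>)"
      by (rule entropy_derivative_identity[OF FG m]) (use c in auto)
    ultimately show ?thesis by (simp add: \<Psi>'_def)
  qed
  then have "(pi / 2 - 0) * \<Psi>' \<theta> \<ge> 0" by simp
  then have "\<Psi> 0 \<le> \<Psi> (pi / 2)" using \<theta>(3) by linarith
  moreover have "\<psi> 0 = (\<integral>x. F x * ln (F x) \<partial>\<gamma>)"
    by (simp add: \<psi>_def mehler_def gaussian.prob_space[simplified])
  moreover have "\<psi> (pi / 2) = (\<integral>x. F x \<partial>\<gamma>) * ln (\<integral>x. F x \<partial>\<gamma>)"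
    by (simp add: \<psi>_def mehler_def gaussian.prob_space[simplified])
  ultimately show ?thesis by (simp add: \<Psi>_def)
qed

section \<open>Deficit, gradient and oscillation of smooth functions\<close>

lemma integrable_xlnx:
  fixes F :: "real^'n \<Rightarrow> real"
  assumes [measurable]: "F \<in> borel_measurable borel" and "m > 0" "\<And>x. m \<le> F x" "\<And>x. F x \<le> B"
  shows "\<bar>F x * ln (F x)\<bar> \<le> B * (\<bar>ln m\<bar> + \<bar>ln B\<bar>)" "integrable \<gamma> (\<lambda>x. F x * ln (F x))"
proof -
  have *: "\<bar>F x * ln (F x)\<bar> \<le> B * (\<bar>ln m\<bar> + \<bar>ln B\<bar>)" for x
  proof -
    have "0 < F x" "0 < B" using assms(2) assms(3)[of x] assms(4)[of x] by linarith+
    then show ?thesis unfolding abs_mult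
      using abs_ln_le[OF assms(2) assms(3)[of x] assms(4)[of x]] assms(4)[of x] by (intro mult_mono) auto
  qed
  then show "\<bar>F x * ln (F x)\<bar> \<le> B * (\<bar>ln m\<bar> + \<bar>ln B\<bar>)" .
  show "integrable \<gamma> (\<lambda>x. F x * ln (F x))"
    by (rule integrable_gaussian_bounded) (use * in auto)
qed

text \<open>The entropy of \<open>F\<close> splits into the average over \<open>x\<close> of the entropy of
  \<open>z \<mapsto> F (c x + s z)\<close> and the entropy of the Mehler average. The logarithmic
  Sobolev inequality bounds the first part by \<open>s\<^sup>2/2 * I\<close> and the second by
  \<open>c\<^sup>2/2 * \<integral> |A \<nabla>F|\<^sup>2 / A F d\<gamma>\<close>. Since \<open>s\<^sup>2 = 1 - c\<^sup>2\<close>, what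
  is left over compared with \<open>I/2\<close> is \<open>c\<^sup>2/2\<close> times the integrated Jensen gap.\<close>

theorem log_sobolev_deficit_lower_bound:
  fixes F :: "real^'n \<Rightarrow> real"
  assumes FG: "bounded_C1 F G" and m: "m > 0" "\<And>x. m \<le> F x" and cs: "c\<^sup>2 + s\<^sup>2 = 1" "c \<noteq> 0"
  defines "v \<equiv> \<lambda>x. mehler c s G x /\<^sub>R mehler c s F x"
  shows "(\<integral>x. F x * ln (F x) \<partial>\<gamma>) - (\<integral>x. F x \<partial>\<gamma>) * ln (\<integral>x. F x \<partial>\<gamma>)
    \<le> (\<integral>x. (norm (G x))\<^sup>2 / F x \<partial>\<gamma>) / 2
      - c\<^sup>2 / 2 * (\<integral>p. F (fst p) * (norm (G (fst p) /\<^sub>R F (fst p) - v (c *\<^sub>R fst p - s *\<^sub>R snd p)))\<^sup>2 \<partial>(\<gamma> \<Otimes>\<^sub>M \<gamma>))"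
    and "v \<in> borel_measurable borel" "\<exists>V. \<forall>x. norm (v x) \<le> V"
    and "integrable (\<gamma> \<Otimes>\<^sub>M \<gamma>) (\<lambda>p. F (fst p) * (norm (G (fst p) /\<^sub>R F (fst p) - v (c *\<^sub>R fst p - s *\<^sub>R snd p)))\<^sup>2)"
proof -
  obtain B where B: "B > 0" "\<And>x. \<bar>F x\<bar> \<le> B" "\<And>x. norm (G x) \<le> B"
    using bounded_C1_bound[OF FG] by blast
  note [measurable] = bounded_C1_measurable[OF FG]
  note fb = fisher_bounds[OF FG m B(3)]
  have F0: "F y > 0" for y using m by (meson less_le_trans)
  have FB: "F y \<le> B" for y using B(2)[of y] by simp
  let ?A = "mehler c s F" and ?A' = "mehler c s G"
  let ?J = "\<lambda>x. (norm (G x))\<^sup>2 / F x"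
  have [measurable]: "?A \<in> borel_measurable borel" "?A' \<in> borel_measurable borel"
    using measurable_mehler[of F B] measurable_mehler[of G B] bounded_C1_continuous[OF FG] bounded_C1_continuous_grad[OF FG] B
    by auto
  have A: "m \<le> ?A x" "?A x \<le> B" "norm (?A' x) \<le> B" for x
    using mehler_ge[of F B m] norm_mehler_le[of F B c s x] norm_mehler_le[of G B c s x] B m by auto
  have A0: "?A x > 0" for x using A(1) m(1) by (meson less_le_trans)
  show vm[measurable]: "v \<in> borel_measurable borel" unfolding v_def by measurable
  have V: "norm (v x) \<le> inverse m * B" for x
    unfolding v_def norm_scaleR using A[of x] A0[of x] m B by (intro mult_mono) auto
  then show "\<exists>V. \<forall>x. norm (v x) \<le> V" by blast
  define \<Phi> where "\<Phi> p = F (fst p) * (norm (G (fst p) /\<^sub>R F (fst p) - v (c *\<^sub>R fst p - s *\<^sub>R snd p)))\<^sup>2" for p :: "(real^'n) \<times> (real^'n)"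
  have \<Phi>m[measurable]: "\<Phi> \<in> borel_measurable (borel \<Otimes>\<^sub>M borel)" unfolding \<Phi>_def by measurable
  have \<Phi>i: "integrable (\<gamma> \<Otimes>\<^sub>M \<gamma>) \<Phi>"
  proof (rule integrable_gaussian2_bounded[of _ "B * (inverse m * B + inverse m * B)\<^sup>2"])
    fix p :: "(real^'n) \<times> (real^'n)"
    have "norm (G (fst p) /\<^sub>R F (fst p)) \<le> inverse m * B"
      unfolding norm_scaleR using m F0[of "fst p"] B by (intro mult_mono) (auto intro: le_imp_inverse_le)
    then have "norm (G (fst p) /\<^sub>R F (fst p) - v (c *\<^sub>R fst p - s *\<^sub>R snd p)) \<le> inverse m * B + inverse m * B"
      using norm_triangle_ineq4 V add_mono order_trans by meson
    from mult_mono[OF B(2)[of "fst p"] power_mono[OF this norm_ge_zero, of 2]]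
    show "norm (\<Phi> p) \<le> B * (inverse m * B + inverse m * B)\<^sup>2"
      unfolding \<Phi>_def norm_mult using B(1) by simp
  qed simp
  from \<Phi>i show "integrable (\<gamma> \<Otimes>\<^sub>M \<gamma>) (\<lambda>p. F (fst p) * (norm (G (fst p) /\<^sub>R F (fst p) - v (c *\<^sub>R fst p - s *\<^sub>R snd p)))\<^sup>2)"
    unfolding \<Phi>_def .
  note rb = rotate_back[OF cs(1)]
  have contJ: "continuous_on UNIV ?J"
    using bounded_C1_continuous[OF FG] bounded_C1_continuous_grad[OF FG] F0
    by (intro continuous_intros) (auto simp: less_imp_neq[symmetric])
  have contE: "continuous_on UNIV (\<lambda>x. F x * ln (F x))"
    using bounded_C1_continuous[OF FG] F0 by (intro continuous_intros) (auto simp: less_imp_neq[symmetric])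
  note xl = integrable_xlnx[of F, OF _ m FB, simplified]
  note xlA = integrable_xlnx[of ?A, OF _ m(1) A(1) A(2), simplified]
  let ?LB = "B * (\<bar>ln m\<bar> + \<bar>ln B\<bar>)"
  have iE: "integrable \<gamma> (mehler c s (\<lambda>x. F x * ln (F x)))"
  proof (rule integrable_gaussian_bounded[of _ ?LB])
    show "mehler c s (\<lambda>x. F x * ln (F x)) \<in> borel_measurable borel"
      by (rule measurable_mehler[OF contE, of ?LB]) (use xl in simp)
    show "norm (mehler c s (\<lambda>x. F x * ln (F x)) x) \<le> ?LB" for x
      by (rule norm_mehler_le) (use xl in simp_all)
  qed
  have iJ: "integrable \<gamma> (mehler c s ?J)"
  proof (rule integrable_gaussian_bounded[of _ "B\<^sup>2 / m"])
    show "mehler c s ?J \<in> borel_measurable borel"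
      by (rule measurable_mehler[OF contJ, of "B\<^sup>2 / m"]) (use fb in simp)
    show "norm (mehler c s ?J x) \<le> B\<^sup>2 / m" for x
      by (rule norm_mehler_le) (use fb in simp_all)
  qed
  have iA: "integrable \<gamma> (\<lambda>x. (norm (?A' x))\<^sup>2 / ?A x)"
    by (rule integrable_gaussian_bounded[of _ "B\<^sup>2 / m"])
       (use A A0 m B in \<open>auto intro!: frac_le power_mono simp: abs_of_pos\<close>)
  \<comment> \<open>The map \<open>z \<mapsto> c x + s z\<close> sends \<gamma> to the Gaussian of covariance \<open>s\<^sup>2\<close>
    centred at \<open>c x\<close>; differentiating the composition brings out the factor \<open>s\<^sup>2\<close>.\<close>
  have loc: "mehler c s (\<lambda>x. F x * ln (F x)) x - ?A x * ln (?A x) \<le> s\<^sup>2 / 2 * mehler c s ?J x" for x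
  proof -
    have "bounded_C1 (\<lambda>z. F (c *\<^sub>R x + s *\<^sub>R z)) (\<lambda>z. s *\<^sub>R G (c *\<^sub>R x + s *\<^sub>R z))"
      unfolding bounded_C1_def
    proof (intro conjI allI exI[of _ "B + \<bar>s\<bar> * B"])
      fix z
      show "((\<lambda>z. F (c *\<^sub>R x + s *\<^sub>R z)) has_derivative (\<lambda>h. (s *\<^sub>R G (c *\<^sub>R x + s *\<^sub>R z)) \<bullet> h)) (at z)"
      proof -
        have "((\<lambda>z. F (c *\<^sub>R x + s *\<^sub>R z)) has_derivative (\<lambda>h. G (c *\<^sub>R x + s *\<^sub>R z) \<bullet> (s *\<^sub>R h))) (at z)"
          by (rule has_derivative_compose[OF _ bounded_C1_has_derivative[OF FG]]) (auto intro!: derivative_eq_intros)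
        then show ?thesis by simp
      qed
      have "\<bar>s\<bar> * B \<ge> 0" using B by simp
      then show "\<bar>F (c *\<^sub>R x + s *\<^sub>R z)\<bar> \<le> B + \<bar>s\<bar> * B" using B(2)[of "c *\<^sub>R x + s *\<^sub>R z"] by linarith
      have "norm (s *\<^sub>R G (c *\<^sub>R x + s *\<^sub>R z)) \<le> \<bar>s\<bar> * B"
        using B(3) by (simp add: mult_left_mono)
      then show "norm (s *\<^sub>R G (c *\<^sub>R x + s *\<^sub>R z)) \<le> B + \<bar>s\<bar> * B" using B(1) by linarith
    next
      show "continuous_on UNIV (\<lambda>z. s *\<^sub>R G (c *\<^sub>R x + s *\<^sub>R z))"
        by (intro continuous_intros continuous_on_compose2[OF bounded_C1_continuous_grad[OF FG]]) auto
    qed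
    from gaussian_log_sobolev[OF this m(1)] m(2)
    have "(\<integral>z. F (c *\<^sub>R x + s *\<^sub>R z) * ln (F (c *\<^sub>R x + s *\<^sub>R z)) \<partial>\<gamma>)
        - (\<integral>z. F (c *\<^sub>R x + s *\<^sub>R z) \<partial>\<gamma>) * ln (\<integral>z. F (c *\<^sub>R x + s *\<^sub>R z) \<partial>\<gamma>)
        \<le> (\<integral>z. (norm (s *\<^sub>R G (c *\<^sub>R x + s *\<^sub>R z)))\<^sup>2 / F (c *\<^sub>R x + s *\<^sub>R z) \<partial>\<gamma>) / 2" by blast
    also have "(\<integral>z. (norm (s *\<^sub>R G (c *\<^sub>R x + s *\<^sub>R z)))\<^sup>2 / F (c *\<^sub>R x + s *\<^sub>R z) \<partial>\<gamma>)
        = (\<integral>z. s\<^sup>2 * ?J (c *\<^sub>R x + s *\<^sub>R z) \<partial>\<gamma>)"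
      by (simp add: power_mult_distrib)
    also have "\<dots> = s\<^sup>2 * mehler c s ?J x" by (simp only: integral_mult_right_zero mehler_def)
    finally show ?thesis by (simp add: mehler_def)
  qed
  have eE: "(\<integral>x. mehler c s (\<lambda>x. F x * ln (F x)) x \<partial>\<gamma>) = (\<integral>x. F x * ln (F x) \<partial>\<gamma>)"
    by (rule integral_mehler[OF _ _ cs, of _ ?LB]) (use xl in simp_all)
  have eJ: "(\<integral>x. mehler c s ?J x \<partial>\<gamma>) = (\<integral>x. ?J x \<partial>\<gamma>)"
    by (rule integral_mehler[OF _ _ cs, of _ "B\<^sup>2 / m"]) (use fb in simp_all)
  have eF: "(\<integral>x. ?A x \<partial>\<gamma>) = (\<integral>x. F x \<partial>\<gamma>)"
    by (rule integral_mehler[OF _ _ cs, of _ B]) (use B in simp_all)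
  have s1: "(\<integral>x. F x * ln (F x) \<partial>\<gamma>) - (\<integral>x. ?A x * ln (?A x) \<partial>\<gamma>) \<le> s\<^sup>2 / 2 * (\<integral>x. ?J x \<partial>\<gamma>)"
  proof -
    have "(\<integral>x. mehler c s (\<lambda>x. F x * ln (F x)) x - ?A x * ln (?A x) \<partial>\<gamma>) \<le> (\<integral>x. s\<^sup>2 / 2 * mehler c s ?J x \<partial>\<gamma>)"
      by (rule integral_mono) (use iE xlA(2) iJ loc in auto)
    then show ?thesis using iE xlA(2) iJ by (simp add: eE eJ)
  qed
  have s2: "(\<integral>x. ?A x * ln (?A x) \<partial>\<gamma>) - (\<integral>x. F x \<partial>\<gamma>) * ln (\<integral>x. F x \<partial>\<gamma>)
     \<le> c\<^sup>2 / 2 * (\<integral>x. (norm (?A' x))\<^sup>2 / ?A x \<partial>\<gamma>)"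
  proof -
    have "(\<integral>x. (norm (c *\<^sub>R ?A' x))\<^sup>2 / ?A x \<partial>\<gamma>) = (\<integral>x. c\<^sup>2 * ((norm (?A' x))\<^sup>2 / ?A x) \<partial>\<gamma>)"
      by (simp add: power_mult_distrib)
    also have "\<dots> = c\<^sup>2 * (\<integral>x. (norm (?A' x))\<^sup>2 / ?A x \<partial>\<gamma>)" by (simp only: integral_mult_right_zero)
    finally show ?thesis
      using gaussian_log_sobolev[OF bounded_C1_mehler[OF FG] m(1) A(1)] by (simp add: eF)
  qed
  have "(\<integral>x. ?J x \<partial>\<gamma>) - (\<integral>x. (norm (?A' x))\<^sup>2 / ?A x \<partial>\<gamma>) = (\<integral>x. mehler c s ?J x - (norm (?A' x))\<^sup>2 / ?A x \<partial>\<gamma>)"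
    using iJ iA by (simp add: eJ)
  also have "\<dots> = (\<integral>x. \<integral>z. \<Phi> (c *\<^sub>R x + s *\<^sub>R z, c *\<^sub>R z - s *\<^sub>R x) \<partial>\<gamma> \<partial>\<gamma>)"
    unfolding mehler_gradient_jensen[OF FG m] \<Phi>_def fst_conv snd_conv rb v_def ..
  also have "\<dots> = (\<integral>p. \<Phi> p \<partial>(\<gamma> \<Otimes>\<^sub>M \<gamma>))"
    using gaussian2.integral_fst'[OF iffD2[OF integral_gaussian2_rotate(2)[OF \<Phi>m cs] \<Phi>i]]
      integral_gaussian2_rotate(1)[OF \<Phi>m cs] by simp
  finally have \<Phi>e: "(\<integral>p. \<Phi> p \<partial>(\<gamma> \<Otimes>\<^sub>M \<gamma>)) = (\<integral>x. ?J x \<partial>\<gamma>) - (\<integral>x. (norm (?A' x))\<^sup>2 / ?A x \<partial>\<gamma>)" by simp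
  have s: "s\<^sup>2 = 1 - c\<^sup>2" using cs by simp
  have "(\<integral>x. F x * ln (F x) \<partial>\<gamma>) - (\<integral>x. F x \<partial>\<gamma>) * ln (\<integral>x. F x \<partial>\<gamma>)
     \<le> s\<^sup>2 / 2 * (\<integral>x. ?J x \<partial>\<gamma>) + c\<^sup>2 / 2 * (\<integral>x. (norm (?A' x))\<^sup>2 / ?A x \<partial>\<gamma>)"
    using s1 s2 by linarith
  also have "\<dots> = (\<integral>x. ?J x \<partial>\<gamma>) / 2 - c\<^sup>2 / 2 * (\<integral>p. \<Phi> p \<partial>(\<gamma> \<Otimes>\<^sub>M \<gamma>))"
    unfolding s \<Phi>e by (simp add: field_simps)
  finally show "(\<integral>x. F x * ln (F x) \<partial>\<gamma>) - (\<integral>x. F x \<partial>\<gamma>) * ln (\<integral>x. F x \<partial>\<gamma>)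
    \<le> (\<integral>x. (norm (G x))\<^sup>2 / F x \<partial>\<gamma>) / 2
      - c\<^sup>2 / 2 * (\<integral>p. F (fst p) * (norm (G (fst p) /\<^sub>R F (fst p) - v (c *\<^sub>R fst p - s *\<^sub>R snd p)))\<^sup>2 \<partial>(\<gamma> \<Otimes>\<^sub>M \<gamma>))"
    unfolding \<Phi>_def .
qed

lemma Cauchy_Schwarz_integral:
  fixes f g :: "'a \<Rightarrow> real"
  assumes [measurable]: "f \<in> borel_measurable M" "g \<in> borel_measurable M"
    and f: "integrable M (\<lambda>x. (f x)\<^sup>2)" and g: "integrable M (\<lambda>x. (g x)\<^sup>2)"
  shows "integrable M (\<lambda>x. f x * g x)" "(\<integral>x. \<bar>f x * g x\<bar> \<partial>M)\<^sup>2 \<le> (\<integral>x. (f x)\<^sup>2 \<partial>M) * (\<integral>x. (g x)\<^sup>2 \<partial>M)"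
proof -
  show i: "integrable M (\<lambda>x. f x * g x)"
  proof (rule Bochner_Integration.integrable_bound[OF Bochner_Integration.integrable_add[OF f g]])
    show "AE x in M. norm (f x * g x) \<le> norm ((f x)\<^sup>2 + (g x)\<^sup>2)"
    proof (rule AE_I2)
      fix x
      have "2 * \<bar>f x\<bar> * \<bar>g x\<bar> \<le> (f x)\<^sup>2 + (g x)\<^sup>2"
        using sum_squares_bound[of "\<bar>f x\<bar>" "\<bar>g x\<bar>"] by simp
      moreover have "\<bar>f x\<bar> * \<bar>g x\<bar> \<ge> 0" by simp
      ultimately have "\<bar>f x\<bar> * \<bar>g x\<bar> \<le> (f x)\<^sup>2 + (g x)\<^sup>2" by linarith
      then show "norm (f x * g x) \<le> norm ((f x)\<^sup>2 + (g x)\<^sup>2)" by (simp add: abs_mult)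
    qed
  qed simp
  have "ennreal ((\<integral>x. \<bar>f x * g x\<bar> \<partial>M)\<^sup>2) = (\<integral>\<^sup>+x. ennreal \<bar>f x\<bar> * ennreal \<bar>g x\<bar> \<partial>M)\<^sup>2"
  proof -
    have "ennreal (\<integral>x. \<bar>f x * g x\<bar> \<partial>M) = (\<integral>\<^sup>+x. ennreal \<bar>f x * g x\<bar> \<partial>M)"
      using i by (intro nn_integral_eq_integral[symmetric]) auto
    then show ?thesis by (simp add: ennreal_power[symmetric] abs_mult ennreal_mult)
  qed
  also have "\<dots> \<le> (\<integral>\<^sup>+x. (ennreal \<bar>f x\<bar>)\<^sup>2 \<partial>M) * (\<integral>\<^sup>+x. (ennreal \<bar>g x\<bar>)\<^sup>2 \<partial>M)"
    by (rule Cauchy_Schwarz_nn_integral) auto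
  also have "\<dots> = ennreal ((\<integral>x. (f x)\<^sup>2 \<partial>M) * (\<integral>x. (g x)\<^sup>2 \<partial>M))"
    using f g by (simp add: ennreal_power nn_integral_eq_integral ennreal_mult)
  finally show "(\<integral>x. \<bar>f x * g x\<bar> \<partial>M)\<^sup>2 \<le> (\<integral>x. (f x)\<^sup>2 \<partial>M) * (\<integral>x. (g x)\<^sup>2 \<partial>M)"
    by (subst (asm) ennreal_le_iff) auto
qed

text \<open>The number \<open>R\<close> is the integrated Jensen gap for the pair \<open>(c, s)\<close> with
  \<open>c\<^sup>2/s\<^sup>2 = a\<close>. It says how far the score \<open>\<nabla>F / F\<close> is from a function of
  \<open>c u - s z\<close>. After the Cameron-Martin shift in \<open>z\<close> that function is integrated to a vector
  \<open>W\<close> not depending on \<open>u\<close>, and the Cauchy-Schwarz inequality gives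
  \<open>\<integral> |\<nabla>F - F W| d\<gamma> \<le> (R Q)\<close> to the power \<open>1/2\<close>. Integrating the vectors themselves
  bounds \<open>|W| \<integral> F d\<gamma>\<close> by the same quantity plus the norm of \<open>\<integral> \<nabla>F d\<gamma> = \<integral> x F d\<gamma>\<close>.\<close>

theorem gradient_L1_bound:
  fixes F :: "real^'n \<Rightarrow> real"
  assumes FG: "bounded_C1 F G" and m: "m > 0" "\<And>x. m \<le> F x" and a: "a > 0" "a < 1 / 2"
  shows "\<exists>R\<ge>0. (\<integral>x. norm (G x) \<partial>\<gamma>) \<le> 2 * sqrt (R * (\<integral>x. F x * exp (a * (norm x)\<^sup>2) \<partial>\<gamma>)) + norm (\<integral>x. F x *\<^sub>R x \<partial>\<gamma>)
    \<and> (\<integral>x. F x * ln (F x) \<partial>\<gamma>) - (\<integral>x. F x \<partial>\<gamma>) * ln (\<integral>x. F x \<partial>\<gamma>)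
       \<le> (\<integral>x. (norm (G x))\<^sup>2 / F x \<partial>\<gamma>) / 2 - a / (2 * (1 + a)) * R"
proof -
  obtain B where B: "B > 0" "\<And>x. \<bar>F x\<bar> \<le> B" "\<And>x. norm (G x) \<le> B"
    using bounded_C1_bound[OF FG] by blast
  note [measurable] = bounded_C1_measurable[OF FG]
  have F0: "F y > 0" for y using m by (meson less_le_trans)
  \<comment> \<open>The point of the unit circle with \<open>c\<^sup>2/s\<^sup>2 = a\<close>.\<close>
  define c where "c = sqrt (a / (1 + a))"
  define s where "s = 1 / sqrt (1 + a)"
  have c2: "c\<^sup>2 = a / (1 + a)" and s2: "s\<^sup>2 = 1 / (1 + a)" using a by (auto simp: c_def s_def power_divide)
  have cs: "c\<^sup>2 + s\<^sup>2 = 1" "c \<noteq> 0" using a by (auto simp: c2 s2 add_divide_distrib[symmetric]) (auto simp: c_def)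
  have s0: "s \<noteq> 0" using a by (auto simp: s_def)
  have cs2: "(c / s)\<^sup>2 = a" using a by (simp add: power_divide c2 s2)
  define v where "v x = mehler c s G x /\<^sub>R mehler c s F x" for x
  note D = log_sobolev_deficit_lower_bound[OF FG m cs, folded v_def]
  note [measurable] = D(2)
  obtain V where V: "\<And>x. norm (v x) \<le> V" using D(3) by blast
  let ?w = "\<lambda>u. G u /\<^sub>R F u"
  let ?f = "\<lambda>u z. ?w u - v (c *\<^sub>R u - s *\<^sub>R z)"
  let ?h = "\<lambda>u. (c / s) *\<^sub>R u"
  let ?e = "\<lambda>u z. exp (?h u \<bullet> z - (norm (?h u))\<^sup>2 / 2)"
  define R where "R = (\<integral>p. F (fst p) * (norm (?f (fst p) (snd p)))\<^sup>2 \<partial>(\<gamma> \<Otimes>\<^sub>M \<gamma>))"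
  define Q where "Q = (\<integral>x. F x * exp (a * (norm x)\<^sup>2) \<partial>\<gamma>)"
  define W where "W = (\<integral>z. v (- s *\<^sub>R z) \<partial>\<gamma>)"
  have R0: "R \<ge> 0" unfolding R_def using F0 by (intro integral_nonneg_AE AE_I2 mult_nonneg_nonneg) (auto intro: less_imp_le)
  have iv: "integrable \<gamma> (\<lambda>z. v (- s *\<^sub>R z))"
    by (rule integrable_gaussian_bounded[of _ V]) (use V in auto)
  have ee: "?e u z = exp (- ((norm (?h u))\<^sup>2 / 2)) * exp (?h u \<bullet> z)" for u z :: "real^'n"
    by (simp add: exp_add[symmetric])
  have iQ: "integrable \<gamma> (\<lambda>x. F x * exp (a * (norm x)\<^sup>2))"
    by (rule Bochner_Integration.integrable_bound[OF integrable_mult_right[OF integrable_gaussian_exp_square[OF a(2)], of B]])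
       (use B in \<open>auto intro!: AE_I2 simp: abs_mult mult_right_mono\<close>)
  \<comment> \<open>The square of the Cameron-Martin density for \<open>h\<close> is the one for \<open>2 h\<close> times
    \<open>exp |h|\<^sup>2\<close>.\<close>
  have e2: "(\<integral>\<^sup>+z. ennreal ((?e u z)\<^sup>2) \<partial>\<gamma>) = ennreal (exp (a * (norm u)\<^sup>2))" for u :: "real^'n"
  proof -
    have "2 * (?h u \<bullet> z - (norm (?h u))\<^sup>2 / 2) = ((2 *\<^sub>R ?h u) \<bullet> z - (norm (2 *\<^sub>R ?h u))\<^sup>2 / 2) + a * (norm u)\<^sup>2" for z
    proof -
      have h1: "(2 *\<^sub>R h) \<bullet> z = 2 * (h \<bullet> z)" "(norm (2 *\<^sub>R h))\<^sup>2 = 4 * (norm h)\<^sup>2" for h :: "real^'n"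
        by (simp_all add: power_mult_distrib)
      have "(norm (?h u))\<^sup>2 = a * (norm u)\<^sup>2" by (simp only: norm_scaleR power_mult_distrib power2_abs cs2)
      moreover have "N = A \<Longrightarrow> 2 * (I - N / 2) = 2 * I - 4 * N / 2 + A" for I N A :: real by simp
      ultimately show ?thesis unfolding h1 by blast
    qed
    then have "(?e u z)\<^sup>2 = exp (a * (norm u)\<^sup>2) * exp ((2 *\<^sub>R ?h u) \<bullet> z - (norm (2 *\<^sub>R ?h u))\<^sup>2 / 2)" for z
      by (simp only: exp_double[symmetric] exp_add[symmetric] add.commute)
    then have "(\<integral>\<^sup>+z. ennreal ((?e u z)\<^sup>2) \<partial>\<gamma>) = (\<integral>\<^sup>+z. ennreal (exp (a * (norm u)\<^sup>2)) * ennreal (exp ((2 *\<^sub>R ?h u) \<bullet> z - (norm (2 *\<^sub>R ?h u))\<^sup>2 / 2)) \<partial>\<gamma>)"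
      by (simp only: ennreal_mult' exp_ge_zero)
    also have "\<dots> = ennreal (exp (a * (norm u)\<^sup>2))"
      by (subst nn_integral_cmult) (simp_all only: nn_integral_gaussian_exp_inner, auto)
    finally show ?thesis .
  qed
  have em[measurable]: "(\<lambda>p::(real^'n) \<times> (real^'n). ?e (fst p) (snd p)) \<in> borel_measurable (borel \<Otimes>\<^sub>M borel)" by measurable
  \<comment> \<open>Replacing \<open>z\<close> by \<open>z + (c/s) u\<close> turns \<open>v (c u - s z)\<close> into \<open>v (- s z)\<close>, whose mean
    \<open>W\<close> does not depend on \<open>u\<close>.\<close>
  have shift: "norm (?w u - W) \<le> (\<integral>z. ?e u z * norm (?f u z) \<partial>\<gamma>)" for u
  proof -
    have "(\<integral>z. ?f u (z + ?h u) \<partial>\<gamma>) = (\<integral>z. ?e u z *\<^sub>R ?f u z \<partial>\<gamma>)"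
      by (rule integral_cameron_martin) measurable
    moreover have "?f u (z + ?h u) = ?w u - v (- s *\<^sub>R z)" for z
      using s0 by (simp add: scaleR_add_right)
    ultimately have "?w u - W = (\<integral>z. ?e u z *\<^sub>R ?f u z \<partial>\<gamma>)"
      using iv by (simp add: W_def gaussian.prob_space[simplified])
    then show ?thesis using integral_norm_bound[of \<gamma> "\<lambda>z. ?e u z *\<^sub>R ?f u z"] by simp
  qed
  have V0: "V \<ge> 0" using V[of 0] norm_ge_zero order_trans by blast
  have nw: "norm (?w u) \<le> inverse m * B" for u
    unfolding norm_scaleR using m F0[of u] B by (intro mult_mono) (auto intro: le_imp_inverse_le)
  have nf: "norm (?f u z) \<le> inverse m * B + V" for u z
    using norm_triangle_ineq4[of "?w u"] nw V add_mono order_trans by meson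
  have ie: "integrable \<gamma> (\<lambda>z. ?e u z * norm (?f u z))" for u
    by (rule Bochner_Integration.integrable_bound[OF integrable_mult_left[OF integrable_gaussian_exp_inner[of "?h u"], of "inverse m * B + V"]])
       (use nf in \<open>auto intro!: AE_I2 mult_left_mono order_trans[OF _ abs_ge_self]\<close>)
  define X where "X = (\<integral>u. F u * norm (?w u - W) \<partial>\<gamma>)"
  have iX: "integrable \<gamma> (\<lambda>u. F u * norm (?w u - W))"
  proof (rule integrable_gaussian_bounded[of _ "B * (inverse m * B + norm W)"])
    fix u
    have "norm (?w u - W) \<le> inverse m * B + norm W"
      using norm_triangle_ineq4[of "?w u" W] nw[of u] by linarith
    then show "norm (F u * norm (?w u - W)) \<le> B * (inverse m * B + norm W)"
      unfolding norm_mult using B by (intro mult_mono) auto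
  qed simp
  have X0: "X \<ge> 0" unfolding X_def using F0 by (intro integral_nonneg_AE AE_I2 mult_nonneg_nonneg) (auto intro: less_imp_le)
  have "ennreal X = (\<integral>\<^sup>+u. ennreal (F u * norm (?w u - W)) \<partial>\<gamma>)"
    unfolding X_def using iX less_imp_le[OF F0] by (intro nn_integral_eq_integral[symmetric]) (auto intro!: AE_I2 mult_nonneg_nonneg)
  also have "\<dots> \<le> (\<integral>\<^sup>+u. \<integral>\<^sup>+z. ennreal (sqrt (F u) * norm (?f u z)) * ennreal (sqrt (F u) * ?e u z) \<partial>\<gamma> \<partial>\<gamma>)"
  proof (rule nn_integral_mono)
    fix u
    have "ennreal (F u * norm (?w u - W)) \<le> ennreal (F u * (\<integral>z. ?e u z * norm (?f u z) \<partial>\<gamma>))"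
      using shift[of u] F0[of u] by (intro ennreal_leI mult_left_mono) auto
    also have "\<dots> = ennreal (F u) * (\<integral>\<^sup>+z. ennreal (?e u z * norm (?f u z)) \<partial>\<gamma>)"
    proof -
      have "(\<integral>\<^sup>+z. ennreal (?e u z * norm (?f u z)) \<partial>\<gamma>) = ennreal (\<integral>z. ?e u z * norm (?f u z) \<partial>\<gamma>)"
        by (rule nn_integral_eq_integral[OF ie]) (auto intro!: AE_I2)
      then show ?thesis using less_imp_le[OF F0[of u]] by (simp only: ennreal_mult')
    qed
    also have "\<dots> = (\<integral>\<^sup>+z. ennreal (F u) * ennreal (?e u z * norm (?f u z)) \<partial>\<gamma>)"
      by (subst nn_integral_cmult) measurable
    also have "\<dots> = (\<integral>\<^sup>+z. ennreal (sqrt (F u) * norm (?f u z)) * ennreal (sqrt (F u) * ?e u z) \<partial>\<gamma>)"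
    proof (rule nn_integral_cong)
      fix z
      have "sqrt (F u) * sqrt (F u) = F u" using F0[of u] by simp
      moreover have "r * r = q \<Longrightarrow> q * (e * n) = r * n * (r * e)" for r q e n :: real by (simp add: mult_ac)
      ultimately have "F u * (?e u z * norm (?f u z)) = sqrt (F u) * norm (?f u z) * (sqrt (F u) * ?e u z)"
        by blast
      then show "ennreal (F u) * ennreal (?e u z * norm (?f u z)) = ennreal (sqrt (F u) * norm (?f u z)) * ennreal (sqrt (F u) * ?e u z)"
        using F0[of u] by (simp only: ennreal_mult'[symmetric] less_imp_le mult_nonneg_nonneg real_sqrt_ge_zero norm_ge_zero exp_ge_zero)
    qed
    finally show "ennreal (F u * norm (?w u - W)) \<le> \<dots>" .
  qed
  also have "\<dots> = (\<integral>\<^sup>+p. ennreal (sqrt (F (fst p)) * norm (?f (fst p) (snd p))) * ennreal (sqrt (F (fst p)) * ?e (fst p) (snd p)) \<partial>(\<gamma> \<Otimes>\<^sub>M \<gamma>))"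
    by (subst gaussian.nn_integral_fst[symmetric]) auto
  finally have "(ennreal X)\<^sup>2 \<le> (\<integral>\<^sup>+p. ennreal (sqrt (F (fst p)) * norm (?f (fst p) (snd p))) * ennreal (sqrt (F (fst p)) * ?e (fst p) (snd p)) \<partial>(\<gamma> \<Otimes>\<^sub>M \<gamma>))\<^sup>2"
    by (rule power_mono) simp
  also have "\<dots> \<le> (\<integral>\<^sup>+p. (ennreal (sqrt (F (fst p)) * norm (?f (fst p) (snd p))))\<^sup>2 \<partial>(\<gamma> \<Otimes>\<^sub>M \<gamma>)) *
      (\<integral>\<^sup>+p. (ennreal (sqrt (F (fst p)) * ?e (fst p) (snd p)))\<^sup>2 \<partial>(\<gamma> \<Otimes>\<^sub>M \<gamma>))"
    by (rule Cauchy_Schwarz_nn_integral) auto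
  also have "(\<integral>\<^sup>+p. (ennreal (sqrt (F (fst p)) * norm (?f (fst p) (snd p))))\<^sup>2 \<partial>(\<gamma> \<Otimes>\<^sub>M \<gamma>)) = ennreal R"
    unfolding R_def using F0
    by (subst nn_integral_eq_integral[OF D(4), symmetric])
       (auto intro!: AE_I2 mult_nonneg_nonneg nn_integral_cong simp: ennreal_power power_mult_distrib less_imp_le)
  also have "(\<integral>\<^sup>+p. (ennreal (sqrt (F (fst p)) * ?e (fst p) (snd p)))\<^sup>2 \<partial>(\<gamma> \<Otimes>\<^sub>M \<gamma>)) = ennreal Q"
  proof -
    have "(\<integral>\<^sup>+p. (ennreal (sqrt (F (fst p)) * ?e (fst p) (snd p)))\<^sup>2 \<partial>(\<gamma> \<Otimes>\<^sub>M \<gamma>))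
       = (\<integral>\<^sup>+u. \<integral>\<^sup>+z. (ennreal (sqrt (F u) * ?e u z))\<^sup>2 \<partial>\<gamma> \<partial>\<gamma>)"
      by (subst gaussian.nn_integral_fst[symmetric]) auto
    also have "\<dots> = (\<integral>\<^sup>+u. \<integral>\<^sup>+z. ennreal (F u) * ennreal ((?e u z)\<^sup>2) \<partial>\<gamma> \<partial>\<gamma>)"
      using F0 by (intro nn_integral_cong) (simp add: ennreal_power power_mult_distrib ennreal_mult' less_imp_le)
    also have "\<dots> = (\<integral>\<^sup>+u. ennreal (F u) * ennreal (exp (a * (norm u)\<^sup>2)) \<partial>\<gamma>)"
      by (intro nn_integral_cong, subst nn_integral_cmult) (simp_all only: e2, auto)
    also have "\<dots> = ennreal Q"
      unfolding Q_def using iQ F0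
      by (simp add: ennreal_mult'[symmetric] less_imp_le nn_integral_eq_integral)
    finally show ?thesis .
  qed
  finally have "X\<^sup>2 \<le> R * Q"
    using X0 R0 F0 by (simp add: ennreal_power ennreal_mult'[symmetric] Q_def integral_nonneg_AE less_imp_le)
  then have XRQ: "X \<le> sqrt (R * Q)" using X0 by (simp add: real_le_rsqrt)
  have iG: "integrable \<gamma> G" by (rule integrable_gaussian_bounded[of _ B]) (use B in auto)
  have iF: "integrable \<gamma> F" by (rule integrable_gaussian_bounded[of _ B]) (use B in auto)
  have iFx: "integrable \<gamma> (\<lambda>x. F x *\<^sub>R x)"
    by (rule Bochner_Integration.integrable_bound[OF integrable_mult_right[OF integrable_gaussian_norm, of B]])
       (use B in \<open>auto intro!: AE_I2 mult_right_mono\<close>)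
  have GF: "G u - F u *\<^sub>R W = F u *\<^sub>R (?w u - W)" for u using F0[of u] by (simp add: scaleR_diff_right)
  have nGF: "norm (G u - F u *\<^sub>R W) = F u * norm (?w u - W)" for u
    unfolding GF norm_scaleR using F0[of u] by simp
  have IG: "(\<integral>x. G x \<partial>\<gamma>) = (\<integral>x. F x *\<^sub>R x \<partial>\<gamma>)"
  proof (rule vector_eq_rdot[THEN iffD1], rule allI)
    fix h
    show "(\<integral>x. G x \<partial>\<gamma>) \<bullet> h = (\<integral>x. F x *\<^sub>R x \<partial>\<gamma>) \<bullet> h"
    proof -
      have "(\<integral>x. G x \<partial>\<gamma>) \<bullet> h = (\<integral>x. G x \<bullet> h \<partial>\<gamma>)"
        by (rule integral_inner_left[symmetric]) (rule iG)
      also have "\<dots> = (\<integral>x. (F x *\<^sub>R x) \<bullet> h \<partial>\<gamma>)"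
        unfolding gaussian_integration_by_parts[OF FG, of h, symmetric] inner_scaleR_left
        by (simp only: inner_commute)
      also have "\<dots> = (\<integral>x. F x *\<^sub>R x \<partial>\<gamma>) \<bullet> h"
        by (rule integral_inner_left) (rule iFx)
      finally show ?thesis .
    qed
  qed
  have "norm (\<integral>x. G x - F x *\<^sub>R W \<partial>\<gamma>) \<le> X"
    unfolding X_def nGF[symmetric] by (rule integral_norm_bound)
  then have "norm ((\<integral>x. G x \<partial>\<gamma>) - (\<integral>x. F x \<partial>\<gamma>) *\<^sub>R W) \<le> X"
    using iG iF by simp
  then have mW: "norm ((\<integral>x. F x \<partial>\<gamma>) *\<^sub>R W) \<le> X + norm (\<integral>x. F x *\<^sub>R x \<partial>\<gamma>)"
    unfolding IG using norm_triangle_ineq3[of "\<integral>x. F x *\<^sub>R x \<partial>\<gamma>" "(\<integral>x. F x \<partial>\<gamma>) *\<^sub>R W"] by linarith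
  have IF0: "(\<integral>x. F x \<partial>\<gamma>) \<ge> 0" using F0 by (intro integral_nonneg_AE AE_I2) (auto intro: less_imp_le)
  have "(\<integral>x. norm (G x) \<partial>\<gamma>) \<le> (\<integral>x. F x * norm (?w x - W) + F x * norm W \<partial>\<gamma>)"
  proof (rule integral_mono)
    show "norm (G x) \<le> F x * norm (?w x - W) + F x * norm W" for x
      using norm_triangle_ineq[of "G x - F x *\<^sub>R W" "F x *\<^sub>R W"] F0[of x] unfolding nGF by simp
  qed (use iG iX iF in auto)
  also have "\<dots> = X + norm ((\<integral>x. F x \<partial>\<gamma>) *\<^sub>R W)"
    using iX iF IF0 by (simp add: X_def)
  also have "\<dots> \<le> 2 * sqrt (R * Q) + norm (\<integral>x. F x *\<^sub>R x \<partial>\<gamma>)"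
    using mW XRQ by linarith
  finally have main: "(\<integral>x. norm (G x) \<partial>\<gamma>) \<le> 2 * sqrt (R * Q) + norm (\<integral>x. F x *\<^sub>R x \<partial>\<gamma>)" .
  have "c\<^sup>2 / 2 = a / (2 * (1 + a))" using a by (simp add: c2)
  with D(1) have "(\<integral>x. F x * ln (F x) \<partial>\<gamma>) - (\<integral>x. F x \<partial>\<gamma>) * ln (\<integral>x. F x \<partial>\<gamma>)
       \<le> (\<integral>x. (norm (G x))\<^sup>2 / F x \<partial>\<gamma>) / 2 - a / (2 * (1 + a)) * R"
    unfolding R_def by simp
  with main R0 show ?thesis unfolding Q_def by blast
qed

text \<open>The oscillation is \<open>E \<sigma>(X, Z) (F (Z) - F (X))\<close> for a sign \<open>\<sigma>\<close>, which is kept fixed while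
  \<open>X\<close> is rotated into \<open>Z\<close>. The derivative along the rotation is at most \<open>E |\<nabla>F (U)| |W|\<close>, and
  \<open>U\<close> and \<open>W\<close> are independent standard Gaussians at every angle.\<close>

theorem gaussian_L1_poincare:
  fixes F :: "real^'n \<Rightarrow> real"
  assumes FG: "bounded_C1 F G"
  shows "(\<integral>p. \<bar>F (fst p) - F (snd p)\<bar> \<partial>(\<gamma> \<Otimes>\<^sub>M \<gamma>)) \<le> pi / 2 * (\<integral>x. norm (x::real^'n) \<partial>\<gamma>) * (\<integral>x. norm (G x) \<partial>\<gamma>)"
proof -
  obtain B where B: "B > 0" "\<And>x. \<bar>F x\<bar> \<le> B" "\<And>x. norm (G x) \<le> B"
    using bounded_C1_bound[OF FG] by blast
  note [measurable] = bounded_C1_measurable[OF FG]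
  define \<sigma> where "\<sigma> p = sgn (F (snd p) - F (fst p))" for p :: "(real^'n) \<times> (real^'n)"
  have \<sigma>m[measurable]: "\<sigma> \<in> borel_measurable (borel \<Otimes>\<^sub>M borel)" unfolding \<sigma>_def by measurable
  have \<sigma>1: "\<bar>\<sigma> p\<bar> \<le> 1" for p by (simp add: \<sigma>_def abs_sgn_eq)
  let ?U = "\<lambda>\<theta> p. cos \<theta> *\<^sub>R fst p + sin \<theta> *\<^sub>R snd p"
  let ?W = "\<lambda>\<theta> p. cos \<theta> *\<^sub>R snd p - sin \<theta> *\<^sub>R fst p"
  define \<kappa> where "\<kappa> \<theta> = (\<integral>p. \<sigma> p * F (?U \<theta> p) \<partial>(\<gamma> \<Otimes>\<^sub>M \<gamma>))" for \<theta>
  define \<kappa>' where "\<kappa>' \<theta> = (\<integral>p. \<sigma> p * (G (?U \<theta> p) \<bullet> ?W \<theta> p) \<partial>(\<gamma> \<Otimes>\<^sub>M \<gamma>))" for \<theta>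
  let ?b = "\<lambda>p::(real^'n) \<times> (real^'n). B * (norm (fst p) + norm (snd p))"
  have bd: "\<bar>\<sigma> p * (G (?U \<theta> p) \<bullet> ?W \<theta> p)\<bar> \<le> norm (G (?U \<theta> p)) * norm (?W \<theta> p)" for p \<theta>
    using mult_mono[OF \<sigma>1[of p] Cauchy_Schwarz_ineq2[of "G (?U \<theta> p)" "?W \<theta> p"]] by (simp add: abs_mult)
  have bd2: "norm (G (?U \<theta> p)) * norm (?W \<theta> p) \<le> ?b p" for p \<theta>
    by (rule mult_mono[OF B(3) norm_rotated_le]) (use B in auto)
  have ib: "integrable (\<gamma> \<Otimes>\<^sub>M \<gamma>) ?b" by (rule integrable_mult_right[OF integrable_gaussian2_norm])
  have iF: "integrable (\<gamma> \<Otimes>\<^sub>M \<gamma>) (\<lambda>p. \<sigma> p * F (?U \<theta> p))" for \<theta>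
    by (rule integrable_gaussian2_bounded[of _ B])
       (use mult_mono[OF \<sigma>1 B(2)] B in \<open>auto simp: abs_mult\<close>)
  have "(\<kappa> has_derivative (\<lambda>t. \<integral>p. t * (\<sigma> p * (G (?U \<theta> p) \<bullet> ?W \<theta> p)) \<partial>(\<gamma> \<Otimes>\<^sub>M \<gamma>))) (at \<theta>)" for \<theta>
    unfolding \<kappa>_def
  proof (rule has_derivative_integral[where e = 1, OF iF ib])
    show "((\<lambda>\<theta>. \<sigma> p * F (?U \<theta> p)) has_derivative (\<lambda>t. t * (\<sigma> p * (G (?U \<theta> p) \<bullet> ?W \<theta> p)))) (at \<theta>)" for p
      by (rule derivative_eq_intros has_derivative_along_angle[OF FG] refl)+ (auto simp: fun_eq_iff)
    show "\<bar>\<sigma> p * F (?U t p) - \<sigma> p * F (?U \<theta> p)\<bar> \<le> ?b p * norm (t - \<theta>)" for t p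
    proof -
      have "\<bar>F (?U t p) - F (?U \<theta> p)\<bar> \<le> ?b p * \<bar>t - \<theta>\<bar>"
        using order_trans[OF bounded_C1_lipschitz[OF FG B(3)] mult_left_mono[OF angle_curve_lipschitz less_imp_le[OF B(1)]]]
        by (simp add: mult.assoc)
      from mult_mono[OF \<sigma>1[of p] this] show ?thesis by (simp add: abs_mult[symmetric] right_diff_distrib)
    qed
    show "\<bar>t * (\<sigma> p * (G (?U \<theta> p) \<bullet> ?W \<theta> p))\<bar> \<le> ?b p * norm t" for p t
      using mult_left_mono[OF order_trans[OF bd[of p \<theta>] bd2[of \<theta> p]], of "\<bar>t\<bar>"] by (simp add: abs_mult mult_ac)
  qed auto
  then have der: "(\<kappa> has_real_derivative \<kappa>' \<theta>) (at \<theta>)" for \<theta>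
    by (rule has_derivative_imp_has_field_derivative) (simp add: \<kappa>'_def)
  \<comment> \<open>The mean value theorem provides an angle with \<open>cos \<theta> \<noteq> 0\<close>, as rotation invariance
    requires.\<close>
  obtain \<theta> where \<theta>: "0 < \<theta>" "\<theta> < pi / 2" "\<kappa> (pi / 2) - \<kappa> 0 = (pi / 2 - 0) * \<kappa>' \<theta>"
    using MVT2[of 0 "pi / 2" \<kappa> \<kappa>'] der by auto
  have c: "cos \<theta> \<noteq> 0" using \<theta> cos_gt_zero[of \<theta>] by auto
  have cs: "(cos \<theta>)\<^sup>2 + (sin \<theta>)\<^sup>2 = 1" by simp
  define \<Phi> where "\<Phi> p = norm (G (fst p)) * norm (snd p)" for p :: "(real^'n) \<times> (real^'n)"
  have \<Phi>m[measurable]: "\<Phi> \<in> borel_measurable (borel \<Otimes>\<^sub>M borel)" unfolding \<Phi>_def by measurable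
  have \<Phi>i: "integrable (\<gamma> \<Otimes>\<^sub>M \<gamma>) \<Phi>"
    by (rule Bochner_Integration.integrable_bound[OF ib])
       (use B in \<open>auto intro!: AE_I2 mult_mono simp: \<Phi>_def\<close>)
  note \<Phi>ri = iffD2[OF integral_gaussian2_rotate(2)[OF \<Phi>m cs c] \<Phi>i]
  have "\<kappa>' \<theta> \<le> (\<integral>p. \<Phi> (?U \<theta> p, ?W \<theta> p) \<partial>(\<gamma> \<Otimes>\<^sub>M \<gamma>))"
    unfolding \<kappa>'_def
  proof (rule integral_mono[OF _ \<Phi>ri])
    show "integrable (\<gamma> \<Otimes>\<^sub>M \<gamma>) (\<lambda>p. \<sigma> p * (G (?U \<theta> p) \<bullet> ?W \<theta> p))"
      by (rule Bochner_Integration.integrable_bound[OF \<Phi>ri]) (use bd in \<open>auto intro!: AE_I2 simp: \<Phi>_def\<close>)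
    show "\<sigma> p * (G (?U \<theta> p) \<bullet> ?W \<theta> p) \<le> \<Phi> (?U \<theta> p, ?W \<theta> p)" for p
      using bd[of p \<theta>] by (simp add: \<Phi>_def)
  qed
  also have "\<dots> = (\<integral>p. \<Phi> p \<partial>(\<gamma> \<Otimes>\<^sub>M \<gamma>))" by (rule integral_gaussian2_rotate(1)[OF \<Phi>m cs c])
  also have "\<dots> = (\<integral>x. norm (x::real^'n) \<partial>\<gamma>) * (\<integral>x. norm (G x) \<partial>\<gamma>)"
    unfolding gaussian2.integral_fst'[OF \<Phi>i, symmetric] by (simp add: \<Phi>_def mult.commute)
  finally have le: "\<kappa>' \<theta> \<le> (\<integral>x. norm (x::real^'n) \<partial>\<gamma>) * (\<integral>x. norm (G x) \<partial>\<gamma>)" .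
  have "(\<integral>p. \<bar>F (fst p) - F (snd p)\<bar> \<partial>(\<gamma> \<Otimes>\<^sub>M \<gamma>)) = \<kappa> (pi / 2) - \<kappa> 0"
  proof -
    have "\<bar>F (fst p) - F (snd p)\<bar> = \<sigma> p * F (?U (pi / 2) p) - \<sigma> p * F (?U 0 p)" for p
      by (simp add: \<sigma>_def sgn_if)
    then show ?thesis unfolding \<kappa>_def using iF[of "pi / 2"] iF[of 0] by simp
  qed
  also have "\<dots> \<le> pi / 2 * ((\<integral>x. norm (x::real^'n) \<partial>\<gamma>) * (\<integral>x. norm (G x) \<partial>\<gamma>))"
    unfolding \<theta>(3) using le by simp
  finally show ?thesis by simp
qed

section \<open>Calculus of test functions\<close>

definition grad :: "(real^'n \<Rightarrow> real) \<Rightarrow> real^'n \<Rightarrow> real^'n" where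
  "grad u x = (\<chi> i. partial_deriv i u x)"

lemma partial_deriv_eq: "(u has_derivative D) (at x) \<Longrightarrow> partial_deriv i u x = D (axis i 1)"
  unfolding partial_deriv_def using frechet_derivative_at[of u D x] by simp

lemma linear_eq_inner: 
  fixes D :: "real^'n \<Rightarrow> real"
  assumes "linear D" shows "D h = (\<chi> i. D (axis i 1)) \<bullet> h"
proof -
  have "D h = D (\<Sum>i\<in>UNIV. (h $ i) *\<^sub>R axis i 1)"
    using basis_expansion[of h] by (simp add: scalar_mult_eq_scaleR)
  also have "\<dots> = (\<Sum>i\<in>UNIV. h $ i * D (axis i 1))"
    by (simp add: linear_sum[OF assms] linear_cmul[OF assms])
  finally show ?thesis by (simp add: inner_vec_def mult.commute)
qed

lemma has_derivative_grad:
  fixes u :: "real^'n \<Rightarrow> real"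
  assumes "u differentiable (at x)"
  shows "(u has_derivative (\<lambda>h. grad u x \<bullet> h)) (at x)"
proof -
  obtain D where D: "(u has_derivative D) (at x)" using assms unfolding differentiable_def by blast
  have "D h = grad u x \<bullet> h" for h
    unfolding grad_def partial_deriv_eq[OF D] by (rule linear_eq_inner[OF has_derivative_linear[OF D]])
  then have "D = (\<lambda>h. grad u x \<bullet> h)" by (rule ext)
  with D show ?thesis by (simp only:)
qed

text \<open>Reduces membership in the next smoothness class to any explicit formula for the derivative.\<close>

lemma C_k_SucI:
  assumes "\<And>x. (u has_derivative D x) (at x)" and "\<And>i. C_k k (\<lambda>x. D x (axis i 1))"
  shows "C_k (Suc k) u"
proof -
  have "partial_deriv i u = (\<lambda>x. D x (axis i 1))" for i using partial_deriv_eq[OF assms(1)] by auto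
  then show ?thesis using assms by (auto simp: differentiable_on_def intro: differentiableI differentiable_at_withinI)
qed

lemma C_k_SucD:
  assumes "C_k (Suc k) u"
  shows "(u has_derivative (\<lambda>h. grad u x \<bullet> h)) (at x)" "C_k k (partial_deriv i u)"
  using assms by (auto intro!: has_derivative_grad simp: differentiable_on_def)

lemma grad_axis [simp]: "grad u x \<bullet> axis i 1 = partial_deriv i u x"
  by (simp add: grad_def inner_axis)

lemma C_k_Suc_imp: "C_k (Suc k) u \<Longrightarrow> C_k k u"
proof (induction k arbitrary: u)
  case 0 then show ?case by (auto intro: differentiable_imp_continuous_on)
next
  case (Suc k) then show ?case by auto
qed

lemma C_k_imp_continuous: "C_k k u \<Longrightarrow> continuous_on UNIV u"
  by (cases k) (auto intro: differentiable_imp_continuous_on)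

lemma C_k_zero: "C_k k (\<lambda>_. 0)"
proof (induction k)
  case (Suc k) then show ?case by (intro C_k_SucI[where D = "\<lambda>_ _. 0"]) auto
qed simp

lemma C_k_const: "C_k k (\<lambda>_. c)"
  by (cases k) (auto intro!: C_k_SucI[where D = "\<lambda>_ _. 0"] C_k_zero simp del: C_k.simps(2))

lemma C_k_add: "C_k k u \<Longrightarrow> C_k k v \<Longrightarrow> C_k k (\<lambda>x. u x + v x)"
proof (induction k arbitrary: u v)
  case 0 then show ?case by (auto intro: continuous_intros)
next
  case (Suc k)
  show ?case
  proof (rule C_k_SucI)
    show "((\<lambda>x. u x + v x) has_derivative (\<lambda>h. grad u x \<bullet> h + grad v x \<bullet> h)) (at x)" for x
      using Suc.prems by (intro has_derivative_add C_k_SucD)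
  qed (use Suc C_k_SucD(2) in simp)
qed

lemma C_k_mult: "C_k k u \<Longrightarrow> C_k k v \<Longrightarrow> C_k k (\<lambda>x. u x * v x)"
proof (induction k arbitrary: u v)
  case 0 then show ?case by (auto intro: continuous_intros)
next
  case (Suc k)
  show ?case
  proof (rule C_k_SucI)
    show "((\<lambda>x. u x * v x) has_derivative (\<lambda>h. u x * (grad v x \<bullet> h) + (grad u x \<bullet> h) * v x)) (at x)" for x
      using Suc.prems by (intro has_derivative_mult C_k_SucD)
  next
    fix i
    have "C_k k (\<lambda>x. u x * partial_deriv i v x)" "C_k k (\<lambda>x. partial_deriv i u x * v x)"
      using Suc.IH C_k_SucD(2) C_k_Suc_imp Suc.prems by blast+
    then show "C_k k (\<lambda>x. u x * (grad v x \<bullet> axis i 1) + (grad u x \<bullet> axis i 1) * v x)"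
      unfolding grad_axis by (rule C_k_add)
  qed
qed

lemma C_k_affine: "C_k k u \<Longrightarrow> C_k k (\<lambda>x. u (b + a *\<^sub>R x))"
proof (induction k arbitrary: u)
  case 0 then show ?case by (auto intro!: continuous_on_compose2[of UNIV u] continuous_intros)
next
  case (Suc k)
  show ?case
  proof (rule C_k_SucI)
    show "((\<lambda>x. u (b + a *\<^sub>R x)) has_derivative (\<lambda>h. grad u (b + a *\<^sub>R x) \<bullet> (a *\<^sub>R h))) (at x)" for x
      by (rule has_derivative_compose[OF _ C_k_SucD(1)[OF Suc.prems]]) (auto intro!: derivative_eq_intros)
  next
    fix i
    show "C_k k (\<lambda>x. grad u (b + a *\<^sub>R x) \<bullet> (a *\<^sub>R axis i 1))"
      using C_k_mult[OF C_k_const[of k a] Suc.IH[OF C_k_SucD(2)[OF Suc.prems, of i]]] by simp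
  qed
qed

lemma C_k_coordinate: "C_k k (\<lambda>x. x $ i)"
proof (cases k)
  case (Suc m)
  show ?thesis unfolding Suc
    by (rule C_k_SucI[where D = "\<lambda>x h. h $ i"])
       (auto intro!: C_k_const bounded_linear_imp_has_derivative bounded_linear_vec_nth)
qed (auto intro: continuous_intros)

section \<open>Smooth bumps and mollifiers\<close>

text \<open>For \<open>p = 1\<close> this is the classical smooth function that vanishes to infinite order at \<open>0\<close>.
  Allowing a polynomial in \<open>1/t\<close> in front of the exponential makes the family closed under
  differentiation.\<close>

definition flat :: "real poly \<Rightarrow> real \<Rightarrow> real" where
  "flat p t = (if t > 0 then poly p (1 / t) * exp (- (1 / t)) else 0)"

text \<open>Needed at \<open>t = 0\<close>, where the difference quotient of a flat function becomes such an expression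
  in \<open>1/t\<close>.\<close>

lemma poly_times_exp_minus_tendsto: "((\<lambda>s. poly q s * exp (- s)) \<longlongrightarrow> 0) at_top" for q :: "real poly"
proof -
  have "((\<lambda>s. \<Sum>i\<le>degree q. coeff q i * (s ^ i / exp s)) \<longlongrightarrow> (\<Sum>i\<le>degree q. coeff q i * 0)) at_top"
    by (intro tendsto_intros tendsto_power_div_exp_0)
  then show ?thesis by (simp add: poly_altdef sum_distrib_right exp_minus divide_inverse mult.assoc)
qed

lemma flat_has_derivative:
  "(flat p has_real_derivative flat ([:0, 0, 1:] * (p - pderiv p)) t) (at t)"
proof -
  consider "t > 0" | "t < 0" | "t = 0" by linarith
  then show ?thesis
  proof cases
    case 1
    have "((\<lambda>t. poly p (1 / t) * exp (- (1 / t))) has_real_derivative flat ([:0, 0, 1:] * (p - pderiv p)) t) (at t)"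
      using 1 by (auto intro!: derivative_eq_intros poly_DERIV[THEN DERIV_chain2] simp: flat_def field_simps power2_eq_square)
    then show ?thesis
      by (rule has_field_derivative_transform_within_open[where S = "{0<..}"]) (use 1 in \<open>auto simp: flat_def\<close>)
  next
    case 2
    have "((\<lambda>t. 0) has_real_derivative flat ([:0, 0, 1:] * (p - pderiv p)) t) (at t)"
      using 2 by (auto simp: flat_def)
    then show ?thesis
      by (rule has_field_derivative_transform_within_open[where S = "{..<0}"]) (use 2 in \<open>auto simp: flat_def\<close>)
  next
    case 3
    have "((\<lambda>y. (flat p y - flat p 0) / (y - 0)) \<longlongrightarrow> 0) (at 0)"
      unfolding filterlim_at_split
    proof
      show "((\<lambda>y. (flat p y - flat p 0) / (y - 0)) \<longlongrightarrow> 0) (at_left 0)"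
        by (rule tendsto_eventually) (auto simp: flat_def eventually_at_filter)
      have "((\<lambda>y. poly ([:0, 1:] * p) (inverse y) * exp (- inverse y)) \<longlongrightarrow> 0) (at_right 0)"
        by (rule filterlim_compose[OF poly_times_exp_minus_tendsto filterlim_inverse_at_top_right])
      then show "((\<lambda>y. (flat p y - flat p 0) / (y - 0)) \<longlongrightarrow> 0) (at_right 0)"
        by (rule Lim_transform_eventually) (auto simp: flat_def eventually_at_filter field_simps)
    qed
    then show ?thesis using 3 by (simp add: has_field_derivative_iff flat_def)
  qed
qed

definition bump :: "real^'n \<Rightarrow> real" where
  "bump x = flat 1 (1 - (norm x)\<^sup>2)"

text \<open>Each derivative of \<open>flat p (1 - |x|\<^sup>2)\<close> is a function of the same kind times a
  coordinate, so the induction runs over all polynomials \<open>p\<close> simultaneously.\<close>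

lemma C_k_flat_norm: "C_k k (\<lambda>x::real^'n. flat p (1 - (norm x)\<^sup>2))"
proof (induction k arbitrary: p)
  case 0
  have "continuous_on UNIV (flat p)"
    by (meson flat_has_derivative DERIV_isCont continuous_at_imp_continuous_on)
  then show ?case by (auto intro!: continuous_on_compose2[of UNIV "flat p"] continuous_intros)
next
  case (Suc k)
  let ?q = "[:0, 0, 1:] * (p - pderiv p)"
  show ?case
  proof (rule C_k_SucI)
    fix x :: "real^'n"
    have "((\<lambda>x. 1 - x \<bullet> x) has_derivative (\<lambda>h. - 2 * (x \<bullet> h))) (at x)"
      by (auto intro!: derivative_eq_intros simp: inner_commute)
    then have "((\<lambda>x. 1 - (norm x)\<^sup>2) has_derivative (\<lambda>h. - 2 * (x \<bullet> h))) (at x)"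
      by (simp only: power2_norm_eq_inner)
    from has_derivative_compose[OF this flat_has_derivative[unfolded has_field_derivative_def]]
    show "((\<lambda>x. flat p (1 - (norm x)\<^sup>2)) has_derivative (\<lambda>h. flat ?q (1 - (norm x)\<^sup>2) * (- 2 * (x \<bullet> h)))) (at x)" .
  next
    fix i :: 'n
    have "C_k k (\<lambda>x. flat ?q (1 - (norm x)\<^sup>2) * (- 2 * (x $ i)))"
      by (intro C_k_mult Suc.IH C_k_const C_k_coordinate)
    then show "C_k k (\<lambda>x. flat ?q (1 - (norm x)\<^sup>2) * (- 2 * (x \<bullet> axis i 1)))"
      by (simp only: inner_axis inner_real_def mult_1_right)
  qed
qed

lemma C_k_bump: "C_k k bump"
  unfolding bump_def[abs_def] by (rule C_k_flat_norm)

lemma bump_nonneg: "bump x \<ge> 0"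
  by (simp add: bump_def flat_def)

lemma bump_pos: "norm x < 1 \<Longrightarrow> bump x > 0"
  using power_strict_mono[of "norm x" 1 2] by (simp add: bump_def flat_def)

lemma bump_eq_0: "norm x \<ge> 1 \<Longrightarrow> bump x = 0"
proof -
  assume "norm x \<ge> 1"
  then have "1 \<le> (norm x)\<^sup>2" by (rule one_le_power)
  then have "\<not> 1 - (norm x)\<^sup>2 > 0" by linarith
  then show ?thesis unfolding bump_def flat_def by (simp only: if_False)
qed

lemma test_functionI:
  assumes "\<And>k. C_k k \<phi>" and "\<And>x. norm x > R \<Longrightarrow> \<phi> x = 0"
  shows "test_function \<phi>"
proof -
  have "bounded {x. \<phi> x \<noteq> 0}"
    using assms(2) by (auto simp: bounded_iff intro!: exI[of _ R]) (meson not_le_imp_less)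
  then show ?thesis using assms(1) by (simp add: test_function_def)
qed

lemma test_functionE:
  assumes "test_function \<phi>"
  obtains R where "R > 0" "\<And>x. norm x > R \<Longrightarrow> \<phi> x = 0"
proof -
  have "bounded (closure {x. \<phi> x \<noteq> 0})" using assms by (auto simp: test_function_def compact_imp_bounded)
  then obtain R where R: "R > 0" "\<And>x. x \<in> closure {x. \<phi> x \<noteq> 0} \<Longrightarrow> norm x \<le> R"
    by (auto simp: bounded_pos)
  have "\<phi> x = 0" if "norm x > R" for x
    using R(2)[of x] closure_subset[of "{x. \<phi> x \<noteq> 0}"] that by force
  with R(1) show ?thesis by (rule that)
qed

lemma bounded_of_compact_support:
  fixes \<phi> :: "real^'n \<Rightarrow> 'b::real_normed_vector"
  assumes "continuous_on UNIV \<phi>" "\<And>x. norm x > R \<Longrightarrow> \<phi> x = 0"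
  obtains B where "B > 0" "\<And>x. norm (\<phi> x) \<le> B"
proof -
  have "compact (\<phi> ` cball 0 R)"
    by (rule compact_continuous_image) (use assms(1) continuous_on_subset in auto)
  then obtain B where B: "B > 0" "\<And>x. norm x \<le> R \<Longrightarrow> norm (\<phi> x) \<le> B"
    using compact_imp_bounded[of "\<phi> ` cball 0 R"] by (auto simp: bounded_pos)
  have "norm (\<phi> x) \<le> B" for x
    using B assms(2)[of x] by (cases "norm x \<le> R") auto
  with B(1) show ?thesis by (rule that)
qed

lemma test_function_has_derivative: "test_function \<phi> \<Longrightarrow> (\<phi> has_derivative (\<lambda>h. grad \<phi> x \<bullet> h)) (at x)"
  using C_k_SucD(1)[of 0 \<phi>] by (auto simp: test_function_def simp del: C_k.simps)

lemma test_function_grad_eq_0: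
  assumes "\<And>x. norm x > R \<Longrightarrow> \<phi> x = 0" "norm x > R"
  shows "partial_deriv i \<phi> x = 0"
proof -
  have "((\<lambda>_. 0) has_derivative (\<lambda>_. 0)) (at x)" by simp
  then have "(\<phi> has_derivative (\<lambda>_. 0)) (at x)"
  proof (rule has_derivative_transform_within_open[where s = "- cball 0 R"])
    show "open (- cball (0::real^'a) R)" by (intro open_Compl closed_cball)
  qed (use assms in auto)
  from partial_deriv_eq[OF this] show ?thesis by simp
qed

lemma test_function_partial: "test_function \<phi> \<Longrightarrow> test_function (partial_deriv i \<phi>)"
proof -
  assume \<phi>: "test_function \<phi>"
  then obtain R where "R > 0" "\<And>x. norm x > R \<Longrightarrow> \<phi> x = 0" by (rule test_functionE) blast
  then have "partial_deriv i \<phi> x = 0" if "norm x > R" for x using test_function_grad_eq_0 that by blast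
  moreover have "C_k k (partial_deriv i \<phi>)" for k
    using \<phi> C_k_SucD(2)[of k \<phi>] by (auto simp: test_function_def simp del: C_k.simps)
  ultimately show ?thesis by (intro test_functionI)
qed

lemma test_function_continuous: "test_function \<phi> \<Longrightarrow> continuous_on UNIV \<phi>"
  using C_k_imp_continuous[of 0 \<phi>] by (auto simp: test_function_def simp del: C_k.simps)

lemma test_function_measurable: "test_function \<phi> \<Longrightarrow> \<phi> \<in> borel_measurable borel"
  by (rule borel_measurable_continuous_onI[OF test_function_continuous])

lemma continuous_on_grad:
  assumes "\<And>i. continuous_on UNIV (partial_deriv i \<phi>)" shows "continuous_on UNIV (grad \<phi>)"
  unfolding grad_def[abs_def] using assms by (intro continuous_on_vec_lambda)

lemma test_function_bounded_C1: "test_function \<phi> \<Longrightarrow> bounded_C1 \<phi> (grad \<phi>)"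
proof -
  assume \<phi>: "test_function \<phi>"
  obtain R where R: "R > 0" "\<And>x. norm x > R \<Longrightarrow> \<phi> x = 0" using test_functionE[OF \<phi>] by blast
  have R2: "grad \<phi> x = 0" if "norm x > R" for x
    using test_function_grad_eq_0[OF R(2) that] by (simp add: grad_def vec_eq_iff)
  have c: "continuous_on UNIV (grad \<phi>)"
    by (intro continuous_on_grad test_function_continuous test_function_partial \<phi>)
  obtain B where B: "\<And>x. norm (\<phi> x) \<le> B"
    using bounded_of_compact_support[OF test_function_continuous[OF \<phi>] R(2)] by blast
  obtain B' where B': "\<And>x. norm (grad \<phi> x) \<le> B'"
    using bounded_of_compact_support[OF c R2] by blast
  show ?thesis unfolding bounded_C1_def
  proof (intro conjI allI c exI[of _ "max B B'"] test_function_has_derivative[OF \<phi>])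
    show "\<bar>\<phi> x\<bar> \<le> max B B'" "norm (grad \<phi> x) \<le> max B B'" for x
      using B[of x] B'[of x] by auto
  qed
qed

lemma test_function_mult:
  assumes "test_function \<phi>" "test_function \<psi>" shows "test_function (\<lambda>x. \<phi> x * \<psi> x)"
proof -
  obtain R where R: "R > 0" "\<And>x. norm x > R \<Longrightarrow> \<phi> x = 0" using test_functionE[OF assms(1)] by blast
  show ?thesis
    by (rule test_functionI[where R = R]) (use R assms in \<open>auto intro!: C_k_mult simp: test_function_def\<close>)
qed

text \<open>Makes \<open>y \<mapsto> \<phi> (x - y)\<close> available as a test function, so that a convolution can be
  differentiated through the definition of the weak gradient.\<close>

lemma test_function_reflect:
  assumes "test_function \<phi>" shows "test_function (\<lambda>y. \<phi> (x - y))"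
proof -
  obtain R where R: "R > 0" "\<And>x. norm x > R \<Longrightarrow> \<phi> x = 0" using test_functionE[OF assms] by blast
  show ?thesis
  proof (rule test_functionI[where R = "R + norm x"])
    show "C_k k (\<lambda>y. \<phi> (x - y))" for k
      using C_k_affine[of k \<phi> x "-1"] assms by (simp add: test_function_def)
    show "\<phi> (x - y) = 0" if "norm y > R + norm x" for y
      using norm_triangle_ineq2[of y x] that by (intro R(2)) (simp add: norm_minus_commute)
  qed
qed

definition mollifier :: "nat \<Rightarrow> real^'n \<Rightarrow> real" where
  "mollifier m x = bump (real (Suc m) *\<^sub>R x) / (\<integral>y. bump (real (Suc m) *\<^sub>R (y::real^'n)) \<partial>lborel)"

lemma integrable_compact_support:
  fixes \<phi> :: "real^'n \<Rightarrow> 'b::{banach,second_countable_topology}"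
  assumes "continuous_on UNIV \<phi>" "\<And>x. norm x > R \<Longrightarrow> \<phi> x = 0"
  shows "integrable lborel \<phi>"
proof -
  have "integrable lborel (\<lambda>x. indicator (cball 0 R) x *\<^sub>R \<phi> x)"
    by (rule borel_integrable_compact[OF compact_cball continuous_on_subset[OF assms(1)]]) simp
  moreover have "(\<lambda>x. indicator (cball 0 R) x *\<^sub>R \<phi> x) = \<phi>"
    using assms(2) by (auto simp: fun_eq_iff indicator_def)
  ultimately show ?thesis by simp
qed

text \<open>The integrand is positive on a ball, and nonempty open sets are not negligible.\<close>

lemma integral_bump_pos:
  assumes "r > 0" shows "(\<integral>y. bump (r *\<^sub>R (y::real^'n)) \<partial>lborel) > 0"
proof -
  have c: "continuous_on UNIV (\<lambda>y::real^'n. bump (r *\<^sub>R y))"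
    by (rule continuous_on_compose2[OF C_k_imp_continuous[OF C_k_bump[of 0]]]) (auto intro: continuous_intros)
  have i: "integrable lborel (\<lambda>y::real^'n. bump (r *\<^sub>R y))"
    by (rule integrable_compact_support[OF c, of "1 / r"]) (use assms in \<open>auto intro!: bump_eq_0 simp: field_simps\<close>)
  have "(\<integral>y. bump (r *\<^sub>R (y::real^'n)) \<partial>lborel) \<noteq> 0"
  proof
    assume "(\<integral>y. bump (r *\<^sub>R (y::real^'n)) \<partial>lborel) = 0"
    then have "AE y in lborel. bump (r *\<^sub>R (y::real^'n)) = 0"
      using integral_nonneg_eq_0_iff_AE[OF i] bump_nonneg by auto
    then have "AE y in lborel. (y::real^'n) \<notin> ball 0 (1 / r)"
    proof eventually_elim
      case (elim y)
      have "\<not> norm (r *\<^sub>R y) < 1" using bump_pos[of "r *\<^sub>R y"] elim by auto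
      then show ?case using assms by (auto simp: field_simps)
    qed
    then have "ball (0::real^'n) (1 / r) \<in> null_sets lborel"
      by (subst AE_iff_null_sets) auto
    then have "negligible (ball (0::real^'n) (1 / r))"
      unfolding negligible_iff_null_sets by (rule null_sets_completionI)
    then show False using assms open_not_negligible[of "ball (0::real^'n) (1 / r)"] by auto
  qed
  moreover have "(\<integral>y. bump (r *\<^sub>R (y::real^'n)) \<partial>lborel) \<ge> 0"
    by (simp add: bump_nonneg)
  ultimately show ?thesis by linarith
qed

lemma mollifier_nonneg: "mollifier m x \<ge> 0"
  using integral_bump_pos[of "real (Suc m)"] bump_nonneg unfolding mollifier_def by (intro divide_nonneg_nonneg) (auto intro: less_imp_le)

lemma mollifier_eq_0: "norm x \<ge> 1 / real (Suc m) \<Longrightarrow> mollifier m x = 0"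
proof -
  assume "norm x \<ge> 1 / real (Suc m)"
  then have "1 \<le> real (Suc m) * norm x"
    using divide_le_eq[of 1 "real (Suc m)" "norm x"] by (simp only: of_nat_0_less_iff zero_less_Suc if_True mult.commute)
  then have "1 \<le> norm (real (Suc m) *\<^sub>R x)" by (simp only: norm_scaleR abs_of_nat)
  from bump_eq_0[OF this] show ?thesis by (simp only: mollifier_def div_0)
qed

lemma test_function_mollifier: "test_function (mollifier m :: real^'n \<Rightarrow> real)"
proof (rule test_functionI[where R = "1 / real (Suc m)"])
  show "C_k k (mollifier m :: real^'n \<Rightarrow> real)" for k
    unfolding mollifier_def[abs_def] divide_inverse
    using C_k_mult[OF C_k_affine[OF C_k_bump, of k 0 "real (Suc m)"] C_k_const] by simp
  show "mollifier m x = 0" if "norm x > 1 / real (Suc m)" for x :: "real^'n"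
    using mollifier_eq_0[OF less_imp_le[OF that]] .
qed

lemma integrable_mollifier: "integrable lborel (mollifier m :: real^'n \<Rightarrow> real)"
  by (rule integrable_compact_support[OF test_function_continuous[OF test_function_mollifier], of "1 / real (Suc m)"])
     (auto intro: mollifier_eq_0)

lemma integral_mollifier: "(\<integral>x. mollifier m (x::real^'n) \<partial>lborel) = 1"
  unfolding mollifier_def using integral_bump_pos[of "real (Suc m)", where 'n='n] by simp

lemma measurable_mollifier [measurable]: "mollifier m \<in> borel_measurable borel"
  by (rule test_function_measurable[OF test_function_mollifier])

lemma prob_space_mollifier: "prob_space (density lborel (\<lambda>x::real^'n. ennreal (mollifier m x)))"
proof
  have "(\<integral>\<^sup>+x. ennreal (mollifier m (x::real^'n)) \<partial>lborel) = 1"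
    by (subst nn_integral_eq_integral[OF integrable_mollifier]) (auto simp: mollifier_nonneg integral_mollifier)
  then show "emeasure (density lborel (\<lambda>x::real^'n. ennreal (mollifier m x))) (space (density lborel (\<lambda>x::real^'n. ennreal (mollifier m x)))) = 1"
    unfolding space_density
    by (subst emeasure_density) auto
qed

section \<open>Mollification and the fundamental lemma of the calculus of variations\<close>

text \<open>The \<open>p\<close>-th power of the \<open>L\<^sup>p\<close> norm for Lebesgue measure, with values in \<open>ennreal\<close> so that
  no integrability has to be known beforehand.\<close>

definition Lp_power :: "nat \<Rightarrow> (real^'n \<Rightarrow> real) \<Rightarrow> ennreal" where
  "Lp_power p f = (\<integral>\<^sup>+x. ennreal (\<bar>f x\<bar> ^ p) \<partial>lborel)"

lemma Lp_power_add:
  assumes [measurable]: "f \<in> borel_measurable borel" "g \<in> borel_measurable borel"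
  shows "Lp_power p (\<lambda>x. f x + g x) \<le> ennreal (2 ^ p) * (Lp_power p f + Lp_power p g)"
proof -
  have *: "\<bar>a + b\<bar> ^ p \<le> 2 ^ p * (\<bar>a\<bar> ^ p + \<bar>b\<bar> ^ p)" for a b :: real
  proof -
    have "\<bar>a + b\<bar> ^ p \<le> (2 * max \<bar>a\<bar> \<bar>b\<bar>) ^ p" by (intro power_mono) auto
    also have "\<dots> = 2 ^ p * max \<bar>a\<bar> \<bar>b\<bar> ^ p" by (simp add: power_mult_distrib)
    also have "\<dots> \<le> 2 ^ p * (\<bar>a\<bar> ^ p + \<bar>b\<bar> ^ p)"
      by (intro mult_left_mono) (auto simp: max_def)
    finally show ?thesis .
  qed
  have "Lp_power p (\<lambda>x. f x + g x) \<le> (\<integral>\<^sup>+x. ennreal (2 ^ p) * (ennreal (\<bar>f x\<bar> ^ p) + ennreal (\<bar>g x\<bar> ^ p)) \<partial>lborel)"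
    unfolding Lp_power_def
  proof (rule nn_integral_mono)
    fix x
    have "ennreal (\<bar>f x + g x\<bar> ^ p) \<le> ennreal (2 ^ p * (\<bar>f x\<bar> ^ p + \<bar>g x\<bar> ^ p))" by (rule ennreal_leI[OF *])
    then show "ennreal (\<bar>f x + g x\<bar> ^ p) \<le> ennreal (2 ^ p) * (ennreal (\<bar>f x\<bar> ^ p) + ennreal (\<bar>g x\<bar> ^ p))"
      by (simp add: ennreal_mult ennreal_plus[symmetric] del: ennreal_plus)
  qed
  also have "\<dots> = ennreal (2 ^ p) * (Lp_power p f + Lp_power p g)"
    unfolding Lp_power_def by (subst nn_integral_cmult) (auto simp: nn_integral_add)
  finally show ?thesis .
qed

lemma Lp_power_translate:
  assumes [measurable]: "f \<in> borel_measurable borel"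
  shows "Lp_power p (\<lambda>x. f (x - t)) = Lp_power p f"
proof -
  have "Lp_power p f = (\<integral>\<^sup>+x. ennreal (\<bar>f x\<bar> ^ p) \<partial>distr lborel borel ((+) (- t)))"
    by (simp add: lborel_distr_plus Lp_power_def)
  also have "\<dots> = Lp_power p (\<lambda>x. f (x - t))"
    unfolding Lp_power_def by (subst nn_integral_distr) auto
  finally show ?thesis by simp
qed

text \<open>Truncate \<open>w\<close> to a bounded function supported in a ball. A measurable function is an almost
  everywhere limit of continuous ones; clipping these at the truncation level and multiplying
  them with a cutoff makes dominated convergence applicable.\<close>

lemma continuous_compact_support_approx:
  fixes w :: "real^'n \<Rightarrow> real"
  assumes [measurable]: "w \<in> borel_measurable borel" and fin: "Lp_power p w < \<infinity>" and p: "p \<ge> 1" and \<eta>: "\<eta> > 0"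
  obtains h R where "continuous_on UNIV h" "R > 0" "\<And>x. norm x > R \<Longrightarrow> h x = 0" "Lp_power p (\<lambda>x. w x - h x) \<le> ennreal \<eta>"
proof -
  define \<eta>' where "\<eta>' = \<eta> / (2 ^ p * 2)"
  have \<eta>': "\<eta>' > 0" "2 ^ p * (\<eta>' + \<eta>') = \<eta>" using \<eta> by (auto simp: \<eta>'_def)
  \<comment> \<open>Truncation in size and in space by setting \<open>w\<close> to \<open>0\<close>, so that \<open>w - T N\<close> is dominated by
    \<open>w\<close>.\<close>
  define T where "T N x = (if norm x \<le> real N \<and> \<bar>w x\<bar> \<le> real N then w x else 0)" for N x
  have Tm[measurable]: "T N \<in> borel_measurable borel" for N unfolding T_def by measurable
  have "(\<lambda>N. \<integral>\<^sup>+x. ennreal (\<bar>w x - T N x\<bar> ^ p) \<partial>lborel) \<longlonglongrightarrow> (\<integral>\<^sup>+(x::real^'n). 0 \<partial>lborel)"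
  proof (rule nn_integral_dominated_convergence[where w = "\<lambda>x. ennreal (\<bar>w x\<bar> ^ p)"])
    show "AE x in lborel. (\<lambda>N. ennreal (\<bar>w x - T N x\<bar> ^ p)) \<longlonglongrightarrow> 0"
    proof (rule AE_I2)
      fix x
      obtain N0 where N0: "max (norm x) \<bar>w x\<bar> \<le> real N0" using real_arch_simple by blast
      have "ennreal (\<bar>w x - T N x\<bar> ^ p) = 0" if "N \<ge> N0" for N
      proof -
        have "real N0 \<le> real N" using that by simp
        then have "T N x = w x" using N0 unfolding T_def by (auto simp: max_def split: if_splits)
        then show ?thesis using p by (simp add: power_0_left)
      qed
      then have "\<forall>\<^sub>F N in sequentially. ennreal (\<bar>w x - T N x\<bar> ^ p) = 0"
        unfolding eventually_sequentially by blast
      then show "(\<lambda>N. ennreal (\<bar>w x - T N x\<bar> ^ p)) \<longlonglongrightarrow> 0" by (rule tendsto_eventually)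
    qed
    show "AE x in lborel. ennreal (\<bar>w x - T N x\<bar> ^ p) \<le> ennreal (\<bar>w x\<bar> ^ p)" for N
      by (intro AE_I2 ennreal_leI power_mono) (auto simp: T_def)
    show "(\<integral>\<^sup>+x. ennreal (\<bar>w x\<bar> ^ p) \<partial>lborel) < \<infinity>" using fin by (simp add: Lp_power_def)
  qed auto
  then have "(\<lambda>N. Lp_power p (\<lambda>x. w x - T N x)) \<longlonglongrightarrow> 0" by (simp add: Lp_power_def)
  then have "\<forall>\<^sub>F N in sequentially. Lp_power p (\<lambda>x. w x - T N x) < ennreal \<eta>'"
    using \<eta>' by (intro order_tendstoD) auto
  then obtain N where N: "Lp_power p (\<lambda>x. w x - T N x) < ennreal \<eta>'" by (auto simp: eventually_sequentially)
  have "T N \<in> borel_measurable lebesgue" by (rule measurable_completion) simp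
  then have "T N measurable_on UNIV" by (intro lebesgue_measurable_imp_measurable_on) auto
  then obtain K g where K: "negligible K" and gc: "\<And>n. continuous_on UNIV (g n)"
    and gl: "\<And>x. x \<notin> K \<Longrightarrow> (\<lambda>n. g n x) \<longlonglongrightarrow> T N x"
    unfolding measurable_on_def by auto
  define c where "c x = max 0 (min 1 (real N + 1 - norm x))" for x :: "real^'n"
  define h where "h n x = max (- real N) (min (real N) (g n x)) * c x" for n x
  have hc: "continuous_on UNIV (h n)" for n
    unfolding h_def c_def by (intro continuous_intros gc)
  have hm[measurable]: "h n \<in> borel_measurable borel" for n
    by (rule borel_measurable_continuous_onI[OF hc])
  have h0: "h n x = 0" if "norm x > real N + 1" for n x
    using that by (simp add: h_def c_def)
  have AEK: "AE x in lborel. x \<notin> K"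
    using K unfolding negligible_iff_null_sets by (subst AE_completion_iff[symmetric]) (rule AE_not_in)
  have c01: "0 \<le> c x" "c x \<le> 1" for x by (auto simp: c_def)
  have "(\<lambda>n. \<integral>\<^sup>+x. ennreal (\<bar>T N x - h n x\<bar> ^ p) \<partial>lborel) \<longlonglongrightarrow> (\<integral>\<^sup>+(x::real^'n). 0 \<partial>lborel)"
  proof (rule nn_integral_dominated_convergence[where w = "\<lambda>x. ennreal ((2 * real N) ^ p) * indicator (cball 0 (real N + 1)) x"])
    show "AE x in lborel. (\<lambda>n. ennreal (\<bar>T N x - h n x\<bar> ^ p)) \<longlonglongrightarrow> 0"
      using AEK
    proof eventually_elim
      case (elim x)
      have "(\<lambda>n. h n x) \<longlonglongrightarrow> max (- real N) (min (real N) (T N x)) * c x"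
        unfolding h_def by (intro tendsto_intros gl elim)
      also have "max (- real N) (min (real N) (T N x)) * c x = T N x"
        by (auto simp: T_def c_def max_def min_def)
      finally have "(\<lambda>n. ennreal (\<bar>T N x - h n x\<bar> ^ p)) \<longlonglongrightarrow> ennreal (\<bar>T N x - T N x\<bar> ^ p)"
        by (intro tendsto_intros)
      then show ?case using p by (simp add: power_0_left)
    qed
    show "AE x in lborel. ennreal (\<bar>T N x - h n x\<bar> ^ p) \<le> ennreal ((2 * real N) ^ p) * indicator (cball 0 (real N + 1)) x" for n
    proof (rule AE_I2)
      fix x
      show "ennreal (\<bar>T N x - h n x\<bar> ^ p) \<le> ennreal ((2 * real N) ^ p) * indicator (cball 0 (real N + 1)) x"
      proof (cases "norm x \<le> real N + 1")
        case True
        have "\<bar>T N x\<bar> \<le> real N" by (auto simp: T_def)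
        moreover have "\<bar>h n x\<bar> \<le> real N * 1"
          unfolding h_def abs_mult using c01[of x] by (intro mult_mono) auto
        ultimately have "\<bar>T N x - h n x\<bar> \<le> 2 * real N" by linarith
        from power_mono[OF this, of p] have "\<bar>T N x - h n x\<bar> ^ p \<le> (2 * real N) ^ p" by simp
        then show ?thesis using True by (auto intro!: ennreal_leI)
      next
        case False
        then have "h n x = 0" "T N x = 0" by (auto simp: h0 T_def)
        then show ?thesis using p by (simp add: power_0_left)
      qed
    qed
    show "(\<lambda>x. ennreal ((2 * real N) ^ p) * indicator (cball 0 (real N + 1)) x) \<in> borel_measurable (lborel :: (real^'n) measure)"
    proof -
      have [measurable]: "cball (0::real^'n) (real N + 1) \<in> sets borel" by (rule borel_closed) simp
      show ?thesis by measurable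
    qed
    have "emeasure lborel (cball (0::real^'n) (real N + 1)) < \<infinity>"
      by (rule emeasure_lborel_cball_finite)
    then show "(\<integral>\<^sup>+x. ennreal ((2 * real N) ^ p) * indicator (cball (0::real^'n) (real N + 1)) x \<partial>lborel) < \<infinity>"
      by (subst nn_integral_cmult_indicator) (auto simp: ennreal_mult_less_top)
  qed auto
  then have "(\<lambda>n. Lp_power p (\<lambda>x. T N x - h n x)) \<longlonglongrightarrow> 0" by (simp add: Lp_power_def)
  then have "\<forall>\<^sub>F n in sequentially. Lp_power p (\<lambda>x. T N x - h n x) < ennreal \<eta>'"
    using \<eta>' by (intro order_tendstoD) auto
  then obtain n where n: "Lp_power p (\<lambda>x. T N x - h n x) < ennreal \<eta>'" by (auto simp: eventually_sequentially)
  have "Lp_power p (\<lambda>x. w x - h n x) = Lp_power p (\<lambda>x. (w x - T N x) + (T N x - h n x))" by simp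
  also have "\<dots> \<le> ennreal (2 ^ p) * (Lp_power p (\<lambda>x. w x - T N x) + Lp_power p (\<lambda>x. T N x - h n x))"
    by (rule Lp_power_add) auto
  also have "\<dots> \<le> ennreal (2 ^ p) * (ennreal \<eta>' + ennreal \<eta>')"
    using N n by (intro mult_left_mono add_mono) auto
  also have "\<dots> = ennreal \<eta>"
    using \<eta>' by (simp add: ennreal_mult[symmetric] ennreal_plus[symmetric] del: ennreal_plus)
  finally show ?thesis using hc h0 by (intro that[of "h n" "real N + 1"]) auto
qed

text \<open>For continuous functions of compact support this is uniform continuity; the general case follows
  by approximation, because translations preserve the norm.\<close>

lemma Lp_power_translation_continuous:
  fixes w :: "real^'n \<Rightarrow> real"
  assumes w[measurable]: "w \<in> borel_measurable borel" and fin: "Lp_power p w < \<infinity>" and p: "p \<ge> 1" and \<eta>: "\<eta> > 0"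
  shows "\<exists>d>0. \<forall>t. norm t < d \<longrightarrow> Lp_power p (\<lambda>x. w (x - t) - w x) \<le> ennreal \<eta>"
proof -
  define q where "q = (2::real) ^ p"
  have q0: "q > 0" by (simp add: q_def)
  define D where "D = q * (1 + q * 2)"
  have D: "D > 0" unfolding D_def using q0 by (simp add: add_pos_pos)
  define \<eta>' where "\<eta>' = \<eta> / D"
  have \<eta>': "\<eta>' > 0" "q * (\<eta>' + q * (\<eta>' + \<eta>')) = \<eta>"
  proof -
    show "\<eta>' > 0" using \<eta> D by (simp add: \<eta>'_def)
    have "q * (\<eta>' + q * (\<eta>' + \<eta>')) = D * \<eta>'" unfolding D_def by (simp add: algebra_simps)
    also have "\<dots> = \<eta>" using D by (simp add: \<eta>'_def)
    finally show "q * (\<eta>' + q * (\<eta>' + \<eta>')) = \<eta>" .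
  qed
  obtain h R where h: "continuous_on UNIV h" "R > 0" "\<And>x. norm x > R \<Longrightarrow> h x = 0" "Lp_power p (\<lambda>x. w x - h x) \<le> ennreal \<eta>'"
    using continuous_compact_support_approx[OF w fin p \<eta>'(1)] by blast
  have hm[measurable]: "h \<in> borel_measurable borel" by (rule borel_measurable_continuous_onI[OF h(1)])
  define V where "V = measure lborel (cball (0::real^'n) (R + 1))"
  have V: "emeasure lborel (cball (0::real^'n) (R + 1)) = ennreal V" "V \<ge> 0"
    unfolding V_def using emeasure_lborel_cball_finite[of "0::real^'n" "R + 1"] by (auto intro!: emeasure_eq_ennreal_measure)
  define e where "e = min 1 (\<eta>' / (V + 1))"
  have e: "e > 0" "e \<le> 1" "e * V \<le> \<eta>'"
  proof -
    show "e > 0" "e \<le> 1" using \<eta>' V by (auto simp: e_def)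
    have "e * V \<le> \<eta>' / (V + 1) * V" unfolding e_def using V by (intro mult_right_mono) auto
    also have "\<dots> \<le> \<eta>'" using V \<eta>' by (simp add: field_simps)
    finally show "e * V \<le> \<eta>'" .
  qed
  have "uniformly_continuous_on (cball 0 (R + 2)) h"
    by (rule compact_uniformly_continuous) (use h(1) continuous_on_subset in auto)
  then obtain d where d: "d > 0" "\<And>x y. norm x \<le> R + 2 \<Longrightarrow> norm y \<le> R + 2 \<Longrightarrow> norm (x - y) < d \<Longrightarrow> \<bar>h x - h y\<bar> < e"
    unfolding uniformly_continuous_on_def using e(1) by (auto simp: dist_norm)
  show ?thesis
  proof (intro exI[of _ "min d 1"] conjI allI impI)
    show "min d 1 > 0" using d by simp
    fix t :: "real^'n" assume t: "norm t < min d 1"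
    have "Lp_power p (\<lambda>x. h (x - t) - h x) \<le> (\<integral>\<^sup>+x. ennreal e * indicator (cball (0::real^'n) (R + 1)) x \<partial>lborel)"
      unfolding Lp_power_def
    proof (rule nn_integral_mono)
      fix x :: "real^'n"
      have nt: "norm (x - t) \<le> norm x + 1" "norm x - 1 \<le> norm (x - t)"
        using t norm_triangle_ineq4[of x t] norm_triangle_ineq2[of x t] by auto
      show "ennreal (\<bar>h (x - t) - h x\<bar> ^ p) \<le> ennreal e * indicator (cball (0::real^'n) (R + 1)) x"
      proof (cases "norm x \<le> R + 1")
        case True
        have "\<bar>h (x - t) - h x\<bar> < e" by (rule d(2)) (use True nt t in auto)
        then have "\<bar>h (x - t) - h x\<bar> ^ p \<le> e ^ p" by (intro power_mono) auto
        also have "\<dots> \<le> e ^ 1" by (rule power_decreasing) (use p e in auto)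
        finally show ?thesis using True by (auto intro: ennreal_leI)
      next
        case False
        then have "h x = 0" "h (x - t) = 0" using nt by (auto intro!: h(3))
        then show ?thesis using p by (simp add: power_0_left)
      qed
    qed
    also have "\<dots> = ennreal (e * V)" using e V by (subst nn_integral_cmult_indicator) (auto simp: ennreal_mult)
    also have "\<dots> \<le> ennreal \<eta>'" by (rule ennreal_leI[OF e(3)])
    finally have 1: "Lp_power p (\<lambda>x. h (x - t) - h x) \<le> ennreal \<eta>'" .
    have 2: "Lp_power p (\<lambda>x. w (x - t) - h (x - t)) \<le> ennreal \<eta>'"
      using Lp_power_translate[of "\<lambda>x. w x - h x" p t] h(4) by simp
    have 3: "Lp_power p (\<lambda>x. h x - w x) \<le> ennreal \<eta>'" using h(4) by (simp add: Lp_power_def abs_minus_commute)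
    have "Lp_power p (\<lambda>x. w (x - t) - w x) = Lp_power p (\<lambda>x. (w (x - t) - h (x - t)) + ((h (x - t) - h x) + (h x - w x)))" by simp
    also have "\<dots> \<le> ennreal q * (Lp_power p (\<lambda>x. w (x - t) - h (x - t)) + Lp_power p (\<lambda>x. (h (x - t) - h x) + (h x - w x)))"
      unfolding q_def by (rule Lp_power_add) auto
    also have "\<dots> \<le> ennreal q * (Lp_power p (\<lambda>x. w (x - t) - h (x - t)) + ennreal q * (Lp_power p (\<lambda>x. h (x - t) - h x) + Lp_power p (\<lambda>x. h x - w x)))"
      unfolding q_def by (intro mult_left_mono add_left_mono Lp_power_add) auto
    also have "\<dots> \<le> ennreal q * (ennreal \<eta>' + ennreal q * (ennreal \<eta>' + ennreal \<eta>'))"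
      by (intro mult_left_mono add_mono 1 2 3) auto
    also have "\<dots> = ennreal \<eta>"
      using \<eta>' q0 by (simp add: ennreal_mult[symmetric] ennreal_plus[symmetric] del: ennreal_plus)
    finally show "Lp_power p (\<lambda>x. w (x - t) - w x) \<le> ennreal \<eta>" .
  qed
qed

text \<open>The exponents \<open>1\<close> and \<open>2\<close> are the ones that occur: \<open>1\<close> for uniqueness of weak gradients, \<open>2\<close> for
  approximation in the Sobolev space.\<close>

lemma prob_power_jensen:
  assumes "prob_space M" and X: "integrable M (X :: 'a \<Rightarrow> real)" and p: "p = 1 \<or> p = (2::nat)"
  shows "ennreal (\<bar>\<integral>x. X x \<partial>M\<bar> ^ p) \<le> (\<integral>\<^sup>+x. ennreal (\<bar>X x\<bar> ^ p) \<partial>M)"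
proof -
  interpret prob_space M by fact
  have [measurable]: "X \<in> borel_measurable M" using X by simp
  have 1: "ennreal \<bar>\<integral>x. X x \<partial>M\<bar> \<le> (\<integral>\<^sup>+x. ennreal \<bar>X x\<bar> \<partial>M)"
    using integral_norm_bound_ennreal[OF X] by simp
  have "ennreal (\<bar>\<integral>x. X x \<partial>M\<bar> ^ 2) \<le> (\<integral>\<^sup>+x. ennreal (\<bar>X x\<bar> ^ 2) \<partial>M)"
  proof -
    have "ennreal (\<bar>\<integral>x. X x \<partial>M\<bar> ^ 2) = (ennreal \<bar>\<integral>x. X x \<partial>M\<bar>)\<^sup>2" by (simp add: ennreal_power)
    also have "\<dots> \<le> (\<integral>\<^sup>+x. ennreal \<bar>X x\<bar> * 1 \<partial>M)\<^sup>2" using 1 by (intro power_mono) auto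
    also have "\<dots> \<le> (\<integral>\<^sup>+x. (ennreal \<bar>X x\<bar>)\<^sup>2 \<partial>M) * (\<integral>\<^sup>+x. 1\<^sup>2 \<partial>M)"
      by (rule Cauchy_Schwarz_nn_integral) auto
    finally show ?thesis by (simp add: ennreal_power emeasure_space_1)
  qed
  with 1 p show ?thesis by auto
qed

lemma lborel_distr_reflect: "distr lborel borel (\<lambda>z. x - z) = (lborel :: (real^'n) measure)"
proof -
  have "(lborel :: (real^'n) measure) = density (distr lborel borel (\<lambda>z. x + (- 1) *\<^sub>R z)) (\<lambda>_. ennreal (\<bar>- 1 :: real\<bar> ^ DIM(real^'n)))"
    using lborel_affine[of "-1" x] by simp
  also have "\<dots> = distr lborel borel (\<lambda>z. x - z)" by (simp add: density_1)
  finally show ?thesis by simp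
qed

lemma integrable_lborel_reflect:
  fixes f :: "real^'n \<Rightarrow> 'b::{banach,second_countable_topology}"
  assumes f: "integrable lborel f" shows "integrable lborel (\<lambda>z. f (x - z))"
proof -
  have "integrable (distr lborel borel (\<lambda>z. x - z)) f" by (simp add: lborel_distr_reflect f)
  then show ?thesis by (subst (asm) integrable_distr_eq) (use borel_measurable_integrable[OF f] in auto)
qed

lemma integral_lborel_reflect:
  fixes f :: "real^'n \<Rightarrow> 'b::{banach,second_countable_topology}"
  assumes [measurable]: "f \<in> borel_measurable borel" shows "(\<integral>z. f (x - z) \<partial>lborel) = (\<integral>z. f z \<partial>lborel)"
  using integral_distr[of "\<lambda>z. x - z" lborel borel f] by (simp add: lborel_distr_reflect)

definition mollify :: "nat \<Rightarrow> (real^'n \<Rightarrow> real) \<Rightarrow> real^'n \<Rightarrow> real" where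
  "mollify m w x = (\<integral>y. mollifier m (x - y) * w y \<partial>lborel)"

lemma mollifier_bounded_C1:
  obtains B where "B > 0" "\<And>x. \<bar>mollifier m (x::real^'n)\<bar> \<le> B" "\<And>x::real^'n. norm (grad (mollifier m) x) \<le> B"
  using bounded_C1_bound[OF test_function_bounded_C1[OF test_function_mollifier]] by blast

text \<open>The mollification is an average of translates of \<open>w\<close> by less than \<open>1/(m+1)\<close>, so Jensen's
  inequality and Fubini reduce the claim to continuity of translations.\<close>

lemma mollify_Lp_power:
  fixes w :: "real^'n \<Rightarrow> real"
  assumes w: "integrable lborel w" and fin: "Lp_power p w < \<infinity>" and p: "p = 1 \<or> p = 2" and \<eta>: "\<eta> > 0"
  shows "\<forall>\<^sub>F m in sequentially. Lp_power p (\<lambda>x. mollify m w x - w x) \<le> ennreal \<eta>"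
proof -
  have wm[measurable]: "w \<in> borel_measurable borel" using borel_measurable_integrable[OF w] by simp
  have p1: "p \<ge> 1" using p by auto
  obtain d where d: "d > 0" "\<And>t. norm t < d \<Longrightarrow> Lp_power p (\<lambda>x. w (x - t) - w x) \<le> ennreal \<eta>"
    using Lp_power_translation_continuous[OF wm fin p1 \<eta>] by blast
  have "\<forall>\<^sub>F m in sequentially. 1 / real (Suc m) < d"
    using order_tendstoD(2)[OF LIMSEQ_inverse_real_of_nat d(1)] by (simp add: inverse_eq_divide)
  then show ?thesis
  proof eventually_elim
    case (elim m)
    let ?k = "mollifier m :: real^'n \<Rightarrow> real"
    let ?M = "density lborel (\<lambda>x. ennreal (?k x))"
    interpret M: prob_space ?M by (rule prob_space_mollifier)
    obtain B where B: "B > 0" "\<And>x. \<bar>?k x\<bar> \<le> B" "\<And>x. norm (grad ?k x) \<le> B"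
      using mollifier_bounded_C1[of m, where 'n = 'n] by blast
    have iM: "integrable ?M (\<lambda>z. w (x - z))" for x
    proof (subst integrable_density)
      show "integrable lborel (\<lambda>z. ?k z *\<^sub>R w (x - z))"
        by (rule Bochner_Integration.integrable_bound[OF integrable_mult_right[OF integrable_lborel_reflect[OF w, of x], of B]])
           (use B in \<open>auto intro!: AE_I2 mult_right_mono simp: abs_mult\<close>)
    qed (simp_all add: mollifier_nonneg)
    have eq: "mollify m w x = (\<integral>z. w (x - z) \<partial>?M)" for x
    proof -
      have "mollify m w x = (\<integral>z. ?k (x - (x - z)) * w (x - z) \<partial>lborel)"
        unfolding mollify_def by (rule integral_lborel_reflect[symmetric]) measurable
      also have "\<dots> = (\<integral>z. w (x - z) \<partial>?M)"
        by (subst integral_density) (auto simp: mollifier_nonneg)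
      finally show ?thesis .
    qed
    have "Lp_power p (\<lambda>x. mollify m w x - w x) \<le> (\<integral>\<^sup>+x. \<integral>\<^sup>+z. ennreal (?k z) * ennreal (\<bar>w (x - z) - w x\<bar> ^ p) \<partial>lborel \<partial>lborel)"
      unfolding Lp_power_def
    proof (rule nn_integral_mono)
      fix x
      have "mollify m w x - w x = (\<integral>z. w (x - z) - w x \<partial>?M)"
        using iM[of x] M.prob_space by (simp add: eq)
      then have "ennreal (\<bar>mollify m w x - w x\<bar> ^ p) \<le> (\<integral>\<^sup>+z. ennreal (\<bar>w (x - z) - w x\<bar> ^ p) \<partial>?M)"
        using prob_power_jensen[OF prob_space_mollifier _ p, of m "\<lambda>z. w (x - z) - w x"] iM[of x] by simp
      also have "\<dots> = (\<integral>\<^sup>+z. ennreal (?k z) * ennreal (\<bar>w (x - z) - w x\<bar> ^ p) \<partial>lborel)"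
        by (subst nn_integral_density) auto
      finally show "ennreal (\<bar>mollify m w x - w x\<bar> ^ p) \<le> \<dots>" .
    qed
    also have "\<dots> = (\<integral>\<^sup>+z. \<integral>\<^sup>+x. ennreal (?k z) * ennreal (\<bar>w (x - z) - w x\<bar> ^ p) \<partial>lborel \<partial>lborel)"
      by (rule lborel_pair.Fubini'[symmetric]) measurable
    also have "\<dots> = (\<integral>\<^sup>+z. ennreal (?k z) * Lp_power p (\<lambda>x. w (x - z) - w x) \<partial>lborel)"
      unfolding Lp_power_def by (intro nn_integral_cong nn_integral_cmult) measurable
    also have "\<dots> \<le> (\<integral>\<^sup>+z. ennreal (?k z) * ennreal \<eta> \<partial>lborel)"
    proof (rule nn_integral_mono)
      fix z :: "real^'n"
      show "ennreal (?k z) * Lp_power p (\<lambda>x. w (x - z) - w x) \<le> ennreal (?k z) * ennreal \<eta>"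
      proof (cases "norm z < d")
        case True then show ?thesis using d(2) by (intro mult_left_mono) auto
      next
        case False
        then have "?k z = 0" using elim by (intro mollifier_eq_0) auto
        then show ?thesis by simp
      qed
    qed
    also have "\<dots> = ennreal \<eta>"
      by (subst nn_integral_multc) (auto simp: nn_integral_eq_integral[OF integrable_mollifier] mollifier_nonneg integral_mollifier)
    finally show ?case .
  qed
qed

lemma mollify_has_derivative:
  fixes w :: "real^'n \<Rightarrow> real"
  assumes w: "integrable lborel w"
  shows "(mollify m w has_derivative (\<lambda>h. \<integral>y. (grad (mollifier m) (x - y) \<bullet> h) * w y \<partial>lborel)) (at x)"
    and "integrable lborel (\<lambda>y. partial_deriv i (mollifier m) (x - y) * w y)"
    and "integrable lborel (\<lambda>y. mollifier m (x - y) * w y)"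
    and "\<exists>B. \<forall>x. \<bar>mollify m w x\<bar> \<le> B"
proof -
  let ?k = "mollifier m :: real^'n \<Rightarrow> real"
  have [measurable]: "w \<in> borel_measurable borel" using borel_measurable_integrable[OF w] by simp
  note C1 = test_function_bounded_C1[OF test_function_mollifier[of m, where 'n = 'n]]
  obtain B where B: "B > 0" "\<And>x. \<bar>?k x\<bar> \<le> B" "\<And>x. norm (grad ?k x) \<le> B" using bounded_C1_bound[OF C1] by blast
  note [measurable] = bounded_C1_measurable[OF C1]
  have ib: "integrable lborel (\<lambda>y. B * \<bar>w y\<bar>)" using w by simp
  have int: "integrable lborel (\<lambda>y. ?k (x - y) * w y)" for x
    by (rule Bochner_Integration.integrable_bound[OF ib]) (use B in \<open>auto intro!: AE_I2 mult_right_mono simp: abs_mult\<close>)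
  then show "integrable lborel (\<lambda>y. ?k (x - y) * w y)" .
  have bg: "\<bar>grad ?k z \<bullet> h\<bar> \<le> B * norm h" for z h
    by (rule order_trans[OF Cauchy_Schwarz_ineq2 mult_right_mono[OF B(3)]]) simp
  have "((\<lambda>x. \<integral>y. ?k (x - y) * w y \<partial>lborel) has_derivative (\<lambda>h. \<integral>y. (grad ?k (x - y) \<bullet> h) * w y \<partial>lborel)) (at x)"
  proof (rule has_derivative_integral[where e = 1, OF int ib])
    show "((\<lambda>x. ?k (x - y) * w y) has_derivative (\<lambda>h. (grad ?k (x - y) \<bullet> h) * w y)) (at x)" for y
    proof -
      have "((\<lambda>x. ?k (x - y)) has_derivative (\<lambda>h. grad ?k (x - y) \<bullet> h)) (at x)"
        by (rule has_derivative_compose[OF _ bounded_C1_has_derivative[OF C1]]) (auto intro!: derivative_eq_intros)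
      then show ?thesis by (rule has_derivative_mult_left)
    qed
    show "\<bar>?k (x' - y) * w y - ?k (x - y) * w y\<bar> \<le> B * \<bar>w y\<bar> * norm (x' - x)" for x' y
    proof -
      have "\<bar>?k (x' - y) - ?k (x - y)\<bar> \<le> B * norm (x' - x)"
        using bounded_C1_lipschitz[OF C1 B(3), of "x' - y" "x - y"] by simp
      from mult_right_mono[OF this, of "\<bar>w y\<bar>"]
      have "\<bar>(?k (x' - y) - ?k (x - y)) * w y\<bar> \<le> B * \<bar>w y\<bar> * norm (x' - x)"
        by (simp only: abs_mult mult_ac abs_ge_zero)
      then show ?thesis by (simp only: left_diff_distrib)
    qed
    show "\<bar>(grad ?k (x - y) \<bullet> h) * w y\<bar> \<le> B * \<bar>w y\<bar> * norm h" for y h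
      using mult_right_mono[OF bg[of "x - y" h], of "\<bar>w y\<bar>"] by (simp add: abs_mult mult_ac)
  qed auto
  then show "(mollify m w has_derivative (\<lambda>h. \<integral>y. (grad ?k (x - y) \<bullet> h) * w y \<partial>lborel)) (at x)"
    unfolding mollify_def[abs_def] .
  have [measurable]: "partial_deriv i ?k \<in> borel_measurable borel"
    by (rule test_function_measurable[OF test_function_partial[OF test_function_mollifier]])
  show "integrable lborel (\<lambda>y. partial_deriv i ?k (x - y) * w y)"
  proof (rule Bochner_Integration.integrable_bound[OF ib])
    show "AE y in lborel. norm (partial_deriv i ?k (x - y) * w y) \<le> norm (B * \<bar>w y\<bar>)"
      using bg[of _ "axis i 1"] B(1) by (auto intro!: AE_I2 mult_right_mono simp: abs_mult)
  qed measurable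
  have "\<bar>mollify m w x\<bar> \<le> (\<integral>y. B * \<bar>w y\<bar> \<partial>lborel)" for x
  proof -
    have "norm (mollify m w x) \<le> (\<integral>y. norm (?k (x - y) * w y) \<partial>lborel)"
      unfolding mollify_def by (rule integral_norm_bound)
    also have "\<dots> \<le> (\<integral>y. B * \<bar>w y\<bar> \<partial>lborel)"
      by (rule integral_mono[OF integrable_norm[OF int] ib]) (use B in \<open>auto intro!: mult_right_mono simp: abs_mult\<close>)
    finally show ?thesis by simp
  qed
  then show "\<exists>B. \<forall>x. \<bar>mollify m w x\<bar> \<le> B" by blast
qed

text \<open>Derivatives of the mollification fall on the kernel, and \<open>y \<mapsto> k (x - y)\<close> is a test
  function; hence the mollification of a weak gradient is the classical gradient of the
  mollification.\<close>

lemma mollify_bounded_C1: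
  fixes w :: "real^'n \<Rightarrow> real"
  assumes w: "integrable lborel w" and g: "\<And>i. integrable lborel (\<lambda>x. g x $ i)"
    and wg: "\<And>\<phi> i. test_function \<phi> \<Longrightarrow> (\<integral>x. w x * partial_deriv i \<phi> x \<partial>lborel) = - (\<integral>x. g x $ i * \<phi> x \<partial>lborel)"
  shows "bounded_C1 (mollify m w) (\<lambda>x. \<chi> i. mollify m (\<lambda>y. g y $ i) x)"
proof -
  let ?k = "mollifier m :: real^'n \<Rightarrow> real"
  have pd: "(\<integral>y. partial_deriv i ?k (x - y) * w y \<partial>lborel) = mollify m (\<lambda>y. g y $ i) x" for i x
  proof -
    have "partial_deriv i (\<lambda>y. ?k (x - y)) y = - partial_deriv i ?k (x - y)" for y
    proof -
      have "((\<lambda>y. ?k (x - y)) has_derivative (\<lambda>h. grad ?k (x - y) \<bullet> (- h))) (at y)"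
        by (rule has_derivative_compose[OF _ test_function_has_derivative[OF test_function_mollifier]])
           (auto intro!: derivative_eq_intros)
      from partial_deriv_eq[OF this, of i] show ?thesis by simp
    qed
    then have "- (\<integral>y. partial_deriv i ?k (x - y) * w y \<partial>lborel) = - (\<integral>y. g y $ i * ?k (x - y) \<partial>lborel)"
      using wg[OF test_function_reflect[OF test_function_mollifier[of m], of x], of i] by (simp add: mult.commute)
    then show ?thesis by (simp add: mollify_def mult.commute)
  qed
  obtain Bw where Bw: "\<And>x. \<bar>mollify m w x\<bar> \<le> Bw" using mollify_has_derivative(4)[OF w] by blast
  have "\<forall>i. \<exists>B. \<forall>x. \<bar>mollify m (\<lambda>y. g y $ i) x\<bar> \<le> B" using mollify_has_derivative(4)[OF g] by blast
  then obtain Bg where Bg: "\<And>i x. \<bar>mollify m (\<lambda>y. g y $ i) x\<bar> \<le> Bg i" by metis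
  show ?thesis unfolding bounded_C1_def
  proof (intro conjI allI exI[of _ "max Bw (\<Sum>i\<in>UNIV. Bg i)"])
    fix x
    have "(\<integral>y. (grad ?k (x - y) \<bullet> h) * w y \<partial>lborel) = (\<chi> i. mollify m (\<lambda>y. g y $ i) x) \<bullet> h" for h
    proof -
      have "(\<integral>y. (grad ?k (x - y) \<bullet> h) * w y \<partial>lborel) = (\<integral>y. (\<Sum>i\<in>UNIV. (partial_deriv i ?k (x - y) * w y) * h $ i) \<partial>lborel)"
        by (simp add: inner_vec_def grad_def sum_distrib_left sum_distrib_right mult_ac)
      also have "\<dots> = (\<Sum>i\<in>UNIV. (\<integral>y. partial_deriv i ?k (x - y) * w y \<partial>lborel) * h $ i)"
        by (subst Bochner_Integration.integral_sum) (auto intro!: mollify_has_derivative(2)[OF w])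
      finally show ?thesis by (simp add: pd inner_vec_def)
    qed
    with mollify_has_derivative(1)[OF w, of m x]
    show "(mollify m w has_derivative (\<lambda>h. (\<chi> i. mollify m (\<lambda>y. g y $ i) x) \<bullet> h)) (at x)" by (simp only:)
    show "\<bar>mollify m w x\<bar> \<le> max Bw (\<Sum>i\<in>UNIV. Bg i)" using Bw[of x] by simp
    have "norm (\<chi> i. mollify m (\<lambda>y. g y $ i) x) \<le> (\<Sum>i\<in>UNIV. \<bar>(\<chi> i. mollify m (\<lambda>y. g y $ i) x) $ i\<bar>)" by (rule norm_le_l1_cart)
    also have "\<dots> \<le> (\<Sum>i\<in>UNIV. Bg i)" using Bg by (intro sum_mono) simp
    finally show "norm (\<chi> i. mollify m (\<lambda>y. g y $ i) x) \<le> max Bw (\<Sum>i\<in>UNIV. Bg i)" by simp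
  next
    show "continuous_on UNIV (\<lambda>x. \<chi> i. mollify m (\<lambda>y. g y $ i) x)"
      by (intro continuous_on_vec_lambda continuous_at_imp_continuous_on ballI has_derivative_continuous[OF mollify_has_derivative(1)[OF g]])
  qed
qed

text \<open>The function is the pointwise limit of its restrictions to the balls of integer radius.\<close>

lemma locally_integrable_measurable:
  fixes h :: "real^'n \<Rightarrow> 'b::{banach,second_countable_topology}"
  assumes "locally_integrable h" shows "h \<in> borel_measurable borel"
proof (rule borel_measurable_LIMSEQ_metric)
  have "set_integrable lborel (cball 0 (real n)) h" for n
    using assms by (simp add: locally_integrable_def)
  then show "(\<lambda>x. indicator (cball 0 (real n)) x *\<^sub>R h x) \<in> borel_measurable borel" for n
    unfolding set_integrable_def using borel_measurable_integrable by fastforce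
  fix x :: "real^'n"
  obtain N where N: "norm x \<le> real N" using real_arch_simple by blast
  have "\<forall>\<^sub>F n in sequentially. indicator (cball 0 (real n)) x *\<^sub>R h x = h x"
    unfolding eventually_sequentially
  proof (intro exI[of _ N] allI impI)
    fix n assume "N \<le> n"
    then have "norm x \<le> real n" using N by (meson of_nat_mono order_trans)
    then show "indicator (cball 0 (real n)) x *\<^sub>R h x = h x" by simp
  qed
  then show "(\<lambda>n. indicator (cball 0 (real n)) x *\<^sub>R h x) \<longlonglongrightarrow> h x" by (rule tendsto_eventually)
qed

lemma integrable_test_function_mult:
  fixes h :: "real^'n \<Rightarrow> real"
  assumes h: "locally_integrable h" and \<phi>: "test_function \<phi>"
  shows "integrable lborel (\<lambda>x. h x * \<phi> x)"
proof -
  obtain R where R: "R > 0" "\<And>x. norm x > R \<Longrightarrow> \<phi> x = 0" using test_functionE[OF \<phi>] by blast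
  obtain B where B: "B > 0" "\<And>x. norm (\<phi> x) \<le> B"
    using bounded_of_compact_support[OF test_function_continuous[OF \<phi>] R(2)] by blast
  have [measurable]: "h \<in> borel_measurable borel" "\<phi> \<in> borel_measurable borel"
    using locally_integrable_measurable[OF h] test_function_measurable[OF \<phi>] .
  have "integrable lborel (\<lambda>x. indicator (cball 0 R) x *\<^sub>R h x)"
    using h by (simp add: locally_integrable_def set_integrable_def)
  from integrable_mult_right[OF this, of B] show ?thesis
  proof (rule Bochner_Integration.integrable_bound)
    show "AE x in lborel. norm (h x * \<phi> x) \<le> norm (B * indicator (cball 0 R) x *\<^sub>R h x)"
    proof (rule AE_I2)
      fix x
      show "norm (h x * \<phi> x) \<le> norm (B * indicator (cball 0 R) x *\<^sub>R h x)"
        using mult_right_mono[OF B(2)[of x], of "\<bar>h x\<bar>"] R(2)[of x] B(1)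
        by (cases "norm x \<le> R") (auto simp: abs_mult mult.commute)
    qed
  qed measurable
qed

text \<open>Multiplied by a bump, \<open>h\<close> becomes integrable and still integrates to \<open>0\<close> against all test
  functions. Thus all its mollifications vanish, and they converge to it in \<open>L\<^sup>1\<close>.\<close>

theorem fundamental_lemma_calculus_of_variations:
  fixes h :: "real^'n \<Rightarrow> real"
  assumes h: "locally_integrable h" and 0: "\<And>\<phi>. test_function \<phi> \<Longrightarrow> (\<integral>x. h x * \<phi> x \<partial>lborel) = 0"
  shows "AE x in lborel. h x = 0"
proof -
  have [measurable]: "h \<in> borel_measurable borel" by (rule locally_integrable_measurable[OF h])
  have "AE x in lborel. h x * bump (r *\<^sub>R x) = 0" if "r > 0" for r
  proof -
    have b: "test_function (\<lambda>x::real^'n. bump (r *\<^sub>R x))"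
    proof (rule test_functionI[where R = "1 / r"])
      show "C_k k (\<lambda>x::real^'n. bump (r *\<^sub>R x))" for k using C_k_affine[OF C_k_bump, of k 0 r] by simp
      show "bump (r *\<^sub>R x) = 0" if "norm x > 1 / r" for x :: "real^'n"
        using that \<open>r > 0\<close> by (intro bump_eq_0) (simp add: field_simps)
    qed
    let ?w = "\<lambda>x. h x * bump (r *\<^sub>R x)"
    have w: "integrable lborel ?w" by (rule integrable_test_function_mult[OF h b])
    have [measurable]: "?w \<in> borel_measurable borel" using borel_measurable_integrable[OF w] by simp
    have m0: "mollify m ?w x = 0" for m x
    proof -
      have "mollify m ?w x = (\<integral>y. h y * (bump (r *\<^sub>R y) * mollifier m (x - y)) \<partial>lborel)"
        unfolding mollify_def by (simp add: mult_ac)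
      also have "\<dots> = 0" by (rule 0[OF test_function_mult[OF b test_function_reflect[OF test_function_mollifier]]])
      finally show ?thesis .
    qed
    have fin: "Lp_power 1 ?w < \<infinity>" using w unfolding integrable_iff_bounded by (simp add: Lp_power_def)
    have "Lp_power 1 ?w \<le> ennreal \<eta>" if "\<eta> > 0" for \<eta>
      using eventually_happens[OF mollify_Lp_power[OF w fin _ that]] by (auto simp: m0 Lp_power_def)
    then have "Lp_power 1 ?w = 0"
      by (metis ennreal_le_epsilon add_0 le_zero_eq)
    then show ?thesis unfolding Lp_power_def by (subst (asm) nn_integral_0_iff_AE) auto
  qed
  then have "AE x in lborel. \<forall>n. h x * bump ((1 / real (Suc n)) *\<^sub>R x) = 0"
    unfolding AE_all_countable by simp
  then show ?thesis
  proof eventually_elim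
    case (elim x)
    obtain n where "norm x < real n" using reals_Archimedean2 by blast
    then have "norm ((1 / real (Suc n)) *\<^sub>R x) < 1" by (simp add: field_simps)
    from bump_pos[OF this] show ?case using elim[rule_format, of n] by auto
  qed
qed

section \<open>Smooth approximation in the Gaussian Sobolev space\<close>

lemma measurable_vec_component [measurable (raw)]:
  fixes f :: "'a \<Rightarrow> real^'n"
  assumes "f \<in> borel_measurable M" shows "(\<lambda>x. f x $ i) \<in> borel_measurable M"
  by (rule measurable_compose[OF assms]) (auto intro!: borel_measurable_continuous_onI continuous_intros)

text \<open>Convergence in \<open>L\<^sup>2\<close> for Lebesgue measure therefore implies convergence in all the
  weighted Gaussian spaces used below.\<close>

lemma weighted_gauss_density_le_1:
  assumes "a \<le> 1 / 2" shows "gauss_density (x::real^'n) * exp (a * (norm x)\<^sup>2) \<le> 1"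
proof -
  have "(2 * pi) powr (- real CARD('n) / 2) \<le> (2 * pi) powr 0"
    using pi_gt3 by (intro powr_mono) auto
  moreover have "exp (- (norm x)\<^sup>2 / 2) * exp (a * (norm x)\<^sup>2) \<le> 1"
    using mult_right_mono[OF assms, of "(norm x)\<^sup>2"] by (simp add: exp_add[symmetric])
  ultimately have "(2 * pi) powr (- real CARD('n) / 2) * (exp (- (norm x)\<^sup>2 / 2) * exp (a * (norm x)\<^sup>2)) \<le> 1 * 1"
    by (intro mult_mono) (use pi_gt3 in auto)
  then show ?thesis by (simp add: gauss_density_def mult.assoc)
qed

text \<open>The reason why Gaussian integrability implies Lebesgue integrability on bounded sets.\<close>

lemma gauss_density_lower:
  obtains \<delta> where "\<delta> > 0" "\<And>x::real^'n. norm x \<le> R \<Longrightarrow> \<delta> \<le> gauss_density x"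
proof -
  let ?\<delta> = "(2 * pi) powr (- real CARD('n) / 2) * exp (- R\<^sup>2 / 2)"
  have "?\<delta> \<le> gauss_density x" if "norm x \<le> R" for x :: "real^'n"
    using power_mono[OF that norm_ge_zero, of 2] unfolding gauss_density_def by (intro mult_left_mono) auto
  moreover have "?\<delta> > 0" by simp
  ultimately show ?thesis using that by blast
qed

text \<open>The weight \<open>exp (a |x|\<^sup>2)\<close> makes exponential moments of order \<open>a\<close> pass to the limit
  together with the approximation.\<close>

definition weighted_L2 :: "real \<Rightarrow> (real^'n \<Rightarrow> 'b::real_normed_vector) \<Rightarrow> ennreal" where
  "weighted_L2 a f = (\<integral>\<^sup>+x. ennreal ((norm (f x))\<^sup>2 * exp (a * (norm x)\<^sup>2)) \<partial>\<gamma>)"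

lemma weighted_L2_add:
  fixes f g :: "real^'n \<Rightarrow> 'b::{real_normed_vector,second_countable_topology}"
  assumes [measurable]: "f \<in> borel_measurable borel" "g \<in> borel_measurable borel"
  shows "weighted_L2 a (\<lambda>x. f x + g x) \<le> 2 * (weighted_L2 a f + weighted_L2 a g)"
proof -
  have *: "(norm (u + v))\<^sup>2 * e \<le> 2 * ((norm u)\<^sup>2 * e + (norm v)\<^sup>2 * e)" if "e \<ge> 0" for u v :: 'b and e :: real
  proof -
    have "(norm (u + v))\<^sup>2 \<le> (norm u + norm v)\<^sup>2" by (intro power_mono norm_triangle_ineq) auto
    also have "\<dots> \<le> 2 * ((norm u)\<^sup>2 + (norm v)\<^sup>2)"
      using sum_squares_bound[of "norm u" "norm v"] by (simp add: power2_sum)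
    finally show ?thesis using mult_right_mono[OF _ that] by (fastforce simp: algebra_simps)
  qed
  have "weighted_L2 a (\<lambda>x. f x + g x) \<le> (\<integral>\<^sup>+x. 2 * (ennreal ((norm (f x))\<^sup>2 * exp (a * (norm x)\<^sup>2)) + ennreal ((norm (g x))\<^sup>2 * exp (a * (norm x)\<^sup>2))) \<partial>\<gamma>)"
    unfolding weighted_L2_def
  proof (rule nn_integral_mono)
    fix x :: "real^'n"
    let ?e = "exp (a * (norm x)\<^sup>2)"
    have "ennreal ((norm (f x + g x))\<^sup>2 * ?e) \<le> ennreal (2 * ((norm (f x))\<^sup>2 * ?e + (norm (g x))\<^sup>2 * ?e))"
      by (rule ennreal_leI[OF *]) simp
    also have "\<dots> = 2 * (ennreal ((norm (f x))\<^sup>2 * ?e) + ennreal ((norm (g x))\<^sup>2 * ?e))"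
      by (subst ennreal_mult) (auto simp: ennreal_plus[symmetric] simp del: ennreal_plus)
    finally show "ennreal ((norm (f x + g x))\<^sup>2 * ?e) \<le> \<dots>" .
  qed
  also have "\<dots> = 2 * (weighted_L2 a f + weighted_L2 a g)"
    unfolding weighted_L2_def by (subst nn_integral_cmult) (auto simp: nn_integral_add)
  finally show ?thesis .
qed

lemma weighted_L2_real:
  fixes f :: "real^'n \<Rightarrow> 'b::{real_normed_vector,second_countable_topology}"
  assumes [measurable]: "f \<in> borel_measurable borel" and r: "weighted_L2 a f \<le> ennreal r" "r \<ge> 0"
  shows "integrable \<gamma> (\<lambda>x. (norm (f x))\<^sup>2 * exp (a * (norm x)\<^sup>2))" "(\<integral>x. (norm (f x))\<^sup>2 * exp (a * (norm x)\<^sup>2) \<partial>\<gamma>) \<le> r"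
proof -
  show i: "integrable \<gamma> (\<lambda>x. (norm (f x))\<^sup>2 * exp (a * (norm x)\<^sup>2))"
    by (rule integrableI_bounded) (use r in \<open>auto simp: weighted_L2_def intro: le_less_trans\<close>)
  have eq: "ennreal (\<integral>x. (norm (f x))\<^sup>2 * exp (a * (norm x)\<^sup>2) \<partial>\<gamma>) = weighted_L2 a f"
    unfolding weighted_L2_def using i by (intro nn_integral_eq_integral[symmetric]) auto
  show "(\<integral>x. (norm (f x))\<^sup>2 * exp (a * (norm x)\<^sup>2) \<partial>\<gamma>) \<le> r"
    using r(1) unfolding eq[symmetric] ennreal_le_iff[OF r(2)] .
qed

lemma weighted_L2_0_real:
  fixes f :: "real^'n \<Rightarrow> 'b::{real_normed_vector,second_countable_topology}"
  assumes "f \<in> borel_measurable borel" and "weighted_L2 0 f \<le> ennreal r" "r \<ge> 0"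
  shows "integrable \<gamma> (\<lambda>x. (norm (f x))\<^sup>2)" "(\<integral>x. (norm (f x))\<^sup>2 \<partial>\<gamma>) \<le> r"
  using weighted_L2_real[OF assms] by simp_all

lemma weighted_L2_le_Lp_power:
  fixes f :: "real^'n \<Rightarrow> real"
  assumes [measurable]: "f \<in> borel_measurable borel" and a: "a \<le> 1 / 2"
  shows "weighted_L2 a f \<le> Lp_power 2 f"
proof -
  have "weighted_L2 a f = (\<integral>\<^sup>+x. ennreal (gauss_density x * ((norm (f x))\<^sup>2 * exp (a * (norm x)\<^sup>2))) \<partial>lborel)"
    unfolding weighted_L2_def by (simp add: nn_integral_gaussian ennreal_mult')
  also have "\<dots> \<le> Lp_power 2 f"
    unfolding Lp_power_def
  proof (intro nn_integral_mono ennreal_leI)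
    fix x
    show "gauss_density x * ((norm (f x))\<^sup>2 * exp (a * (norm x)\<^sup>2)) \<le> \<bar>f x\<bar> ^ 2"
      using mult_right_mono[OF weighted_gauss_density_le_1[OF a, of x], of "(f x)\<^sup>2"] by (simp add: mult_ac)
  qed
  finally show ?thesis .
qed

text \<open>On the support the Gaussian density is bounded below; integrability then follows from
  \<open>|t| \<le> 1 + t\<^sup>2\<close>.\<close>

lemma compact_support_L2:
  fixes f :: "real^'n \<Rightarrow> real"
  assumes [measurable]: "f \<in> borel_measurable borel" and fin: "weighted_L2 0 f < \<infinity>" and R: "\<And>x. norm x > R \<Longrightarrow> f x = 0"
  shows "Lp_power 2 f < \<infinity>" "integrable lborel f"
proof -
  obtain \<delta> where \<delta>: "\<delta> > 0" "\<And>x::real^'n. norm x \<le> R \<Longrightarrow> \<delta> \<le> gauss_density x" using gauss_density_lower by blast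
  have "Lp_power 2 f \<le> (\<integral>\<^sup>+x. ennreal (1 / \<delta>) * ennreal (gauss_density x * (norm (f x))\<^sup>2) \<partial>lborel)"
    unfolding Lp_power_def
  proof (rule nn_integral_mono)
    fix x
    have "\<bar>f x\<bar> ^ 2 \<le> 1 / \<delta> * (gauss_density x * (norm (f x))\<^sup>2)"
    proof (cases "norm x \<le> R")
      case True
      have "1 \<le> 1 / \<delta> * gauss_density x" using \<delta> True by (simp add: field_simps)
      from mult_right_mono[OF this, of "(f x)\<^sup>2"] show ?thesis by (simp add: mult_ac)
    qed (use R in auto)
    then show "ennreal (\<bar>f x\<bar> ^ 2) \<le> ennreal (1 / \<delta>) * ennreal (gauss_density x * (norm (f x))\<^sup>2)"
      using \<delta>(1) by (subst ennreal_mult[symmetric]) (auto intro: ennreal_leI)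
  qed
  also have "\<dots> = ennreal (1 / \<delta>) * weighted_L2 0 f"
    unfolding weighted_L2_def by (subst nn_integral_cmult) (auto simp: nn_integral_gaussian ennreal_mult')
  also have "\<dots> < \<infinity>" using fin by (simp add: ennreal_mult_less_top)
  finally show p: "Lp_power 2 f < \<infinity>" .
  have [measurable]: "cball (0::real^'n) R \<in> sets borel" by (rule borel_closed) simp
  have "(\<integral>\<^sup>+x. ennreal (norm (f x)) \<partial>lborel) \<le> (\<integral>\<^sup>+x. indicator (cball 0 R) x + ennreal (\<bar>f x\<bar> ^ 2) \<partial>lborel)"
  proof (rule nn_integral_mono)
    fix x
    have "\<bar>t\<bar> \<le> 1 + t\<^sup>2" for t :: real
    proof (cases "\<bar>t\<bar> \<le> 1")
      case True then show ?thesis using zero_le_power2[of t] by linarith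
    next
      case False
      then have "\<bar>t\<bar> * 1 \<le> \<bar>t\<bar> * \<bar>t\<bar>" by (intro mult_left_mono) auto
      then show ?thesis by (simp add: power2_eq_square)
    qed
    then have "ennreal \<bar>f x\<bar> \<le> ennreal (1 + (f x)\<^sup>2)" by (rule ennreal_leI)
    then show "ennreal (norm (f x)) \<le> indicator (cball 0 R) x + ennreal (\<bar>f x\<bar> ^ 2)"
      using R[of x] by (cases "norm x \<le> R") auto
  qed
  also have "\<dots> = emeasure lborel (cball (0::real^'n) R) + Lp_power 2 f"
    unfolding Lp_power_def by (subst nn_integral_add) auto
  also have "\<dots> < \<infinity>" using p emeasure_lborel_cball_finite[of "0::real^'n" R] by simp
  finally show "integrable lborel f" by (intro integrableI_bounded) auto
qed

lemma gaussian_integrable_imp_locally_integrable: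
  fixes f :: "real^'n \<Rightarrow> 'b::{banach,second_countable_topology}"
  assumes [measurable]: "f \<in> borel_measurable borel" and f: "integrable \<gamma> f"
  shows "locally_integrable f"
  unfolding locally_integrable_def set_integrable_def
proof (intro allI impI)
  fix K :: "(real^'n) set" assume K: "compact K"
  from compact_imp_bounded[OF K] obtain R where R: "\<And>x. x \<in> K \<Longrightarrow> norm x \<le> R" by (auto simp: bounded_iff)
  obtain \<delta> where \<delta>: "\<delta> > 0" "\<And>x::real^'n. norm x \<le> R \<Longrightarrow> \<delta> \<le> gauss_density x" using gauss_density_lower by blast
  have [measurable]: "K \<in> sets borel" using K compact_imp_closed by (intro borel_closed)
  have "integrable lborel (\<lambda>x. gauss_density x *\<^sub>R f x)"
    using f by (simp add: integrable_gaussian_iff)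
  then have "integrable lborel (\<lambda>x. (1 / \<delta>) *\<^sub>R (gauss_density x *\<^sub>R f x))"
    by (rule integrable_scaleR_right)
  then show "integrable lborel (\<lambda>x. indicator K x *\<^sub>R f x)"
  proof (rule Bochner_Integration.integrable_bound)
    show "AE x in lborel. norm (indicator K x *\<^sub>R f x) \<le> norm ((1 / \<delta>) *\<^sub>R (gauss_density x *\<^sub>R f x))"
    proof (rule AE_I2)
      fix x
      show "norm (indicator K x *\<^sub>R f x) \<le> norm ((1 / \<delta>) *\<^sub>R (gauss_density x *\<^sub>R f x))"
      proof (cases "x \<in> K")
        case True
        have "1 \<le> 1 / \<delta> * gauss_density x" using \<delta> R True by (simp add: field_simps)
        from mult_right_mono[OF this, of "norm (f x)"] show ?thesis using True \<delta>(1) by simp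
      qed simp
    qed
  qed measurable
qed

lemma locally_integrable_component:
  fixes g :: "real^'n \<Rightarrow> real^'m"
  assumes "locally_integrable g" shows "locally_integrable (\<lambda>x. g x $ i)"
  unfolding locally_integrable_def set_integrable_def
proof (intro allI impI)
  fix K :: "(real^'n) set" assume "compact K"
  then have "integrable lborel (\<lambda>x. indicator K x *\<^sub>R g x)"
    using assms by (simp add: locally_integrable_def set_integrable_def)
  from integrable_bounded_linear[OF bounded_linear_vec_nth this, of i]
  show "integrable lborel (\<lambda>x. indicator K x *\<^sub>R g x $ i)" by simp
qed

lemma has_weak_gradientD:
  assumes "has_weak_gradient u g"
  shows "locally_integrable u" "locally_integrable g"
    "test_function \<phi> \<Longrightarrow> (\<integral>x. u x * partial_deriv i \<phi> x \<partial>lborel) = - (\<integral>x. g x $ i * \<phi> x \<partial>lborel)"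
  using assms by (auto simp: has_weak_gradient_def)

text \<open>The product of two test functions is a test function; the product rule moves the derivative of
  the cutoff to the other side.\<close>

lemma weak_gradient_cutoff:
  assumes ug: "has_weak_gradient u g" and \<chi>: "test_function \<zeta>" and \<phi>: "test_function \<phi>"
  shows "(\<integral>x. (\<zeta> x * u x) * partial_deriv i \<phi> x \<partial>lborel) = - (\<integral>x. (\<zeta> x *\<^sub>R g x + u x *\<^sub>R grad \<zeta> x) $ i * \<phi> x \<partial>lborel)"
proof -
  note u = has_weak_gradientD(1)[OF ug] and g = locally_integrable_component[OF has_weak_gradientD(2)[OF ug], of i]
  have "partial_deriv i (\<lambda>x. \<zeta> x * \<phi> x) x = \<zeta> x * partial_deriv i \<phi> x + partial_deriv i \<zeta> x * \<phi> x" for x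
    using partial_deriv_eq[OF has_derivative_mult[OF test_function_has_derivative[OF \<chi>] test_function_has_derivative[OF \<phi>]]] by simp
  then have 1: "(\<integral>x. u x * (\<zeta> x * partial_deriv i \<phi> x + partial_deriv i \<zeta> x * \<phi> x) \<partial>lborel) = - (\<integral>x. g x $ i * (\<zeta> x * \<phi> x) \<partial>lborel)"
    using has_weak_gradientD(3)[OF ug test_function_mult[OF \<chi> \<phi>], of i] by simp
  have i1: "integrable lborel (\<lambda>x. u x * (\<zeta> x * partial_deriv i \<phi> x))"
    by (intro integrable_test_function_mult[OF u] test_function_mult \<chi> \<phi> test_function_partial)
  have i2: "integrable lborel (\<lambda>x. u x * (partial_deriv i \<zeta> x * \<phi> x))"
    by (intro integrable_test_function_mult[OF u] test_function_mult \<chi> \<phi> test_function_partial)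
  have i3: "integrable lborel (\<lambda>x. g x $ i * (\<zeta> x * \<phi> x))"
    by (intro integrable_test_function_mult[OF g] test_function_mult \<chi> \<phi>)
  have "(\<integral>x. u x * (\<zeta> x * partial_deriv i \<phi> x) \<partial>lborel) + (\<integral>x. u x * (partial_deriv i \<zeta> x * \<phi> x) \<partial>lborel) = - (\<integral>x. g x $ i * (\<zeta> x * \<phi> x) \<partial>lborel)"
    using 1 i1 i2 by (simp add: distrib_left)
  moreover have "(\<integral>x. (\<zeta> x *\<^sub>R g x + u x *\<^sub>R grad \<zeta> x) $ i * \<phi> x \<partial>lborel)
     = (\<integral>x. g x $ i * (\<zeta> x * \<phi> x) + u x * (partial_deriv i \<zeta> x * \<phi> x) \<partial>lborel)"
    by (rule Bochner_Integration.integral_cong) (auto simp: grad_def algebra_simps)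
  moreover have "\<dots> = (\<integral>x. g x $ i * (\<zeta> x * \<phi> x) \<partial>lborel) + (\<integral>x. u x * (partial_deriv i \<zeta> x * \<phi> x) \<partial>lborel)"
    using i2 i3 by simp
  moreover have "(\<integral>x. (\<zeta> x * u x) * partial_deriv i \<phi> x \<partial>lborel) = (\<integral>x. u x * (\<zeta> x * partial_deriv i \<phi> x) \<partial>lborel)"
    by (simp add: mult_ac)
  ultimately show ?thesis by linarith
qed

text \<open>The value at a point tends to \<open>1\<close> while the gradient is of order \<open>1/(j+1)\<close>, so multiplication by
  the cutoff changes a Sobolev function arbitrarily little.\<close>

definition cutoff :: "nat \<Rightarrow> real^'n \<Rightarrow> real" where
  "cutoff j x = bump ((1 / real (Suc j)) *\<^sub>R x) / bump (0::real^'n)"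

lemma test_function_bump: "test_function bump"
  by (rule test_functionI[of _ 1]) (auto simp: C_k_bump intro: bump_eq_0)

lemma bump_0_pos: "bump (0::real^'n) > 0" by (rule bump_pos) simp

lemma cutoff_eq_0: "norm x > real (Suc j) \<Longrightarrow> cutoff j x = 0"
proof -
  assume "norm x > real (Suc j)"
  then have "1 \<le> norm ((1 / real (Suc j)) *\<^sub>R x)" by (simp add: field_simps)
  from bump_eq_0[OF this] show ?thesis by (simp only: cutoff_def div_0)
qed

lemma test_function_cutoff: "test_function (cutoff j :: real^'n \<Rightarrow> real)"
proof (rule test_functionI[where R = "real (Suc j)"])
  show "C_k k (cutoff j :: real^'n \<Rightarrow> real)" for k
    unfolding cutoff_def[abs_def] divide_inverse[of "bump _"]
    using C_k_mult[OF C_k_affine[OF C_k_bump, of k 0 "1 / real (Suc j)"] C_k_const] by simp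
  show "cutoff j x = 0" if "norm x > real (Suc j)" for x :: "real^'n"
    by (rule cutoff_eq_0[OF that])
qed

lemma grad_nth [simp]: "grad u x $ i = partial_deriv i u x"
  by (simp add: grad_def)

lemma cutoff_bounds:
  obtains C where "C > 0" "\<And>j x. \<bar>cutoff j (x::real^'n)\<bar> \<le> C" "\<And>j x. norm (grad (cutoff j) (x::real^'n)) \<le> C / real (Suc j)"
proof -
  obtain B where B: "B > 0" "\<And>x::real^'n. \<bar>bump x\<bar> \<le> B" "\<And>x::real^'n. norm (grad bump x) \<le> B"
    using bounded_C1_bound[OF test_function_bounded_C1[OF test_function_bump]] by blast
  let ?b = "bump (0::real^'n)"
  note b0 = bump_0_pos[where 'n = 'n]
  have g: "grad (cutoff j) x = ((1 / ?b) * (1 / real (Suc j))) *\<^sub>R grad bump ((1 / real (Suc j)) *\<^sub>R x)" for j and x :: "real^'n"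
  proof -
    have "((\<lambda>x. bump ((1 / real (Suc j)) *\<^sub>R x)) has_derivative (\<lambda>h. grad bump ((1 / real (Suc j)) *\<^sub>R x) \<bullet> ((1 / real (Suc j)) *\<^sub>R h))) (at x)"
      by (rule has_derivative_compose[OF _ test_function_has_derivative[OF test_function_bump]])
         (auto intro!: derivative_eq_intros)
    from has_derivative_mult_right[OF this, of "1 / ?b"]
    have "(cutoff j has_derivative (\<lambda>h. (1 / ?b) * (grad bump ((1 / real (Suc j)) *\<^sub>R x) \<bullet> ((1 / real (Suc j)) *\<^sub>R h)))) (at x)"
      by (simp add: cutoff_def[abs_def])
    from partial_deriv_eq[OF this] show ?thesis by (simp add: vec_eq_iff)
  qed
  have "norm (grad (cutoff j) x) \<le> (B / ?b) / real (Suc j)" for j and x :: "real^'n"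
  proof -
    have "norm (grad (cutoff j) x) \<le> (1 / ?b * (1 / real (Suc j))) * B"
      unfolding g norm_scaleR using b0 B(3) by (intro mult_mono) (auto simp: abs_mult)
    then show ?thesis by simp
  qed
  moreover have "\<bar>cutoff j x\<bar> \<le> B / ?b" for j and x :: "real^'n"
    unfolding cutoff_def abs_divide using b0 B(2) by (simp add: divide_right_mono)
  ultimately show ?thesis using B(1) b0 by (intro that[of "B / ?b"]) auto
qed

lemma cutoff_tendsto: "(\<lambda>j. cutoff j (x::real^'n)) \<longlonglongrightarrow> 1"
proof -
  have "(\<lambda>j. (1 / real (Suc j)) *\<^sub>R x) \<longlonglongrightarrow> 0 *\<^sub>R x"
    by (intro tendsto_intros) (use LIMSEQ_inverse_real_of_nat in \<open>simp add: inverse_eq_divide\<close>)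
  then have "(\<lambda>j. (1 / real (Suc j)) *\<^sub>R x) \<longlonglongrightarrow> 0" by (simp only: scaleR_zero_left)
  then have "(\<lambda>j. bump ((1 / real (Suc j)) *\<^sub>R x)) \<longlonglongrightarrow> bump (0::real^'n)"
    by (rule continuous_on_tendsto_compose[OF test_function_continuous[OF test_function_bump]]) auto
  from tendsto_divide[OF this tendsto_const, of "bump (0::real^'n)"] show ?thesis
    unfolding cutoff_def using bump_0_pos[where 'n='n] by simp
qed

text \<open>First cut off, with dominated convergence for \<open>u\<close> and for \<open>cutoff * g + u * \<nabla>cutoff\<close>. The
  result has compact support, so it and its weak gradient belong to \<open>L\<^sup>2\<close> for Lebesgue
  measure and can be mollified there; the weighted Gaussian norms are dominated by the Lebesgue
  norm.\<close>

theorem weak_gradient_approximation: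
  fixes u :: "real^'n \<Rightarrow> real"
  assumes ug: "has_weak_gradient u g" and a: "0 \<le> a" "a \<le> 1 / 2"
    and fu: "weighted_L2 a u < \<infinity>" and fg: "weighted_L2 0 g < \<infinity>" and \<eta>: "\<eta> > 0"
  shows "\<exists>v V. bounded_C1 v V \<and> weighted_L2 a (\<lambda>x. v x - u x) \<le> ennreal \<eta> \<and> weighted_L2 0 (\<lambda>x. V x - g x) \<le> ennreal \<eta>"
proof -
  have [measurable]: "u \<in> borel_measurable borel" "g \<in> borel_measurable borel"
    using has_weak_gradientD(1,2)[OF ug] locally_integrable_measurable by blast+
  have [measurable]: "cutoff j \<in> borel_measurable borel" for j
    by (rule test_function_measurable[OF test_function_cutoff])
  have [measurable]: "grad (cutoff j) \<in> borel_measurable borel" for j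
    by (rule bounded_C1_measurable(2)[OF test_function_bounded_C1[OF test_function_cutoff]])
  obtain C where C: "C > 0" "\<And>j x. \<bar>cutoff j (x::real^'n)\<bar> \<le> C" "\<And>j x. norm (grad (cutoff j) (x::real^'n)) \<le> C / real (Suc j)"
    using cutoff_bounds by blast
  define w where "w j x = cutoff j x * u x" for j x
  define h where "h j x = cutoff j x *\<^sub>R g x + u x *\<^sub>R grad (cutoff j) x" for j x
  have [measurable]: "w j \<in> borel_measurable borel" "h j \<in> borel_measurable borel" for j
    unfolding w_def h_def by measurable
  have fu0: "weighted_L2 0 u < \<infinity>"
  proof (rule le_less_trans[OF _ fu])
    show "weighted_L2 0 u \<le> weighted_L2 a u" unfolding weighted_L2_def
      by (intro nn_integral_mono ennreal_leI mult_left_mono) (use a in auto)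
  qed
  have cw: "(\<lambda>j. weighted_L2 a (\<lambda>x. w j x - u x)) \<longlonglongrightarrow> (\<integral>\<^sup>+(x::real^'n). 0 \<partial>\<gamma>)"
    unfolding weighted_L2_def
  proof (rule nn_integral_dominated_convergence[where w = "\<lambda>x. ennreal ((C + 1)\<^sup>2) * ennreal ((norm (u x))\<^sup>2 * exp (a * (norm x)\<^sup>2))"])
    show "AE x in \<gamma>. (\<lambda>j. ennreal ((norm (w j x - u x))\<^sup>2 * exp (a * (norm x)\<^sup>2))) \<longlonglongrightarrow> 0"
    proof (rule AE_I2)
      fix x :: "real^'n"
      have "(\<lambda>j. ennreal ((norm (w j x - u x))\<^sup>2 * exp (a * (norm x)\<^sup>2))) \<longlonglongrightarrow> ennreal ((norm (1 * u x - u x))\<^sup>2 * exp (a * (norm x)\<^sup>2))"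
        unfolding w_def by (intro tendsto_intros cutoff_tendsto)
      then show "(\<lambda>j. ennreal ((norm (w j x - u x))\<^sup>2 * exp (a * (norm x)\<^sup>2))) \<longlonglongrightarrow> 0" by simp
    qed
    show "AE x in \<gamma>. ennreal ((norm (w j x - u x))\<^sup>2 * exp (a * (norm x)\<^sup>2)) \<le> ennreal ((C + 1)\<^sup>2) * ennreal ((norm (u x))\<^sup>2 * exp (a * (norm x)\<^sup>2))" for j
    proof (rule AE_I2)
      fix x :: "real^'n"
      have "w j x - u x = (cutoff j x - 1) * u x" by (simp add: w_def left_diff_distrib)
      moreover have "\<bar>cutoff j x - 1\<bar> \<le> C + 1" using C(2)[of j x] by linarith
      ultimately have "norm (w j x - u x) \<le> (C + 1) * norm (u x)" by (simp add: abs_mult mult_right_mono)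
      from mult_right_mono[OF power_mono[OF this norm_ge_zero, of 2], of "exp (a * (norm x)\<^sup>2)"]
      have "(norm (w j x - u x))\<^sup>2 * exp (a * (norm x)\<^sup>2) \<le> (C + 1)\<^sup>2 * ((norm (u x))\<^sup>2 * exp (a * (norm x)\<^sup>2))"
        by (simp add: power_mult_distrib mult.assoc)
      then show "ennreal ((norm (w j x - u x))\<^sup>2 * exp (a * (norm x)\<^sup>2)) \<le> ennreal ((C + 1)\<^sup>2) * ennreal ((norm (u x))\<^sup>2 * exp (a * (norm x)\<^sup>2))"
        by (subst ennreal_mult[symmetric]) (auto intro: ennreal_leI)
    qed
    show "(\<integral>\<^sup>+x. ennreal ((C + 1)\<^sup>2) * ennreal ((norm (u x))\<^sup>2 * exp (a * (norm x)\<^sup>2)) \<partial>\<gamma>) < \<infinity>"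
      using fu unfolding weighted_L2_def by (subst nn_integral_cmult) (auto simp: ennreal_mult_less_top)
  qed measurable
  have ch: "(\<lambda>j. weighted_L2 0 (\<lambda>x. h j x - g x)) \<longlonglongrightarrow> (\<integral>\<^sup>+(x::real^'n). 0 \<partial>\<gamma>)"
    unfolding weighted_L2_def
  proof (rule nn_integral_dominated_convergence[where w = "\<lambda>x. ennreal (2 * (C + 1)\<^sup>2) * ennreal ((norm (g x))\<^sup>2) + ennreal (2 * C\<^sup>2) * ennreal ((norm (u x))\<^sup>2)"])
    show "AE x in \<gamma>. (\<lambda>j. ennreal ((norm (h j x - g x))\<^sup>2 * exp (0 * (norm x)\<^sup>2))) \<longlonglongrightarrow> 0"
    proof (rule AE_I2)
      fix x :: "real^'n"
      have "(\<lambda>j. C / real (Suc j)) \<longlonglongrightarrow> 0"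
        using tendsto_mult_left[OF LIMSEQ_inverse_real_of_nat, of C] by (simp add: divide_inverse)
      then have "(\<lambda>j. grad (cutoff j) x) \<longlonglongrightarrow> 0"
        by (rule Lim_null_comparison[rotated]) (intro always_eventually allI C(3))
      then have "(\<lambda>j. ennreal ((norm (h j x - g x))\<^sup>2 * exp (0 * (norm x)\<^sup>2))) \<longlonglongrightarrow> ennreal ((norm (1 *\<^sub>R g x + u x *\<^sub>R 0 - g x))\<^sup>2 * exp (0 * (norm x)\<^sup>2))"
        unfolding h_def by (intro tendsto_intros cutoff_tendsto)
      then show "(\<lambda>j. ennreal ((norm (h j x - g x))\<^sup>2 * exp (0 * (norm x)\<^sup>2))) \<longlonglongrightarrow> 0" by simp
    qed
    show "AE x in \<gamma>. ennreal ((norm (h j x - g x))\<^sup>2 * exp (0 * (norm x)\<^sup>2)) \<le> ennreal (2 * (C + 1)\<^sup>2) * ennreal ((norm (g x))\<^sup>2) + ennreal (2 * C\<^sup>2) * ennreal ((norm (u x))\<^sup>2)" for j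
    proof (rule AE_I2)
      fix x :: "real^'n"
      have e: "h j x - g x = (cutoff j x - 1) *\<^sub>R g x + u x *\<^sub>R grad (cutoff j) x" by (simp add: h_def algebra_simps)
      have "\<bar>cutoff j x - 1\<bar> \<le> C + 1" using C(2)[of j x] by linarith
      moreover have "norm (grad (cutoff j) x) \<le> C"
      proof -
        have "C / real (Suc j) \<le> C / 1" using C(1) by (intro divide_left_mono) auto
        then show ?thesis using C(3)[of j x] by simp
      qed
      ultimately have "norm (h j x - g x) \<le> (C + 1) * norm (g x) + C * norm (u x)"
        unfolding e by (intro order_trans[OF norm_triangle_ineq add_mono])
          (auto simp: mult_right_mono mult_left_mono mult.commute[of C])
      from power_mono[OF this norm_ge_zero, of 2]
      have "(norm (h j x - g x))\<^sup>2 \<le> ((C + 1) * norm (g x) + C * norm (u x))\<^sup>2" .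
      also have "\<dots> \<le> 2 * ((C + 1) * norm (g x))\<^sup>2 + 2 * (C * norm (u x))\<^sup>2"
        using sum_squares_bound[of "(C + 1) * norm (g x)" "C * norm (u x)"] by (simp add: power2_sum)
      finally have "(norm (h j x - g x))\<^sup>2 \<le> 2 * (C + 1)\<^sup>2 * (norm (g x))\<^sup>2 + 2 * C\<^sup>2 * (norm (u x))\<^sup>2"
        by (simp add: power_mult_distrib mult.assoc)
      then show "ennreal ((norm (h j x - g x))\<^sup>2 * exp (0 * (norm x)\<^sup>2)) \<le> ennreal (2 * (C + 1)\<^sup>2) * ennreal ((norm (g x))\<^sup>2) + ennreal (2 * C\<^sup>2) * ennreal ((norm (u x))\<^sup>2)"
        by (subst (1 2) ennreal_mult[symmetric]) (auto simp: ennreal_plus[symmetric] intro: ennreal_leI simp del: ennreal_plus)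
    qed
    show "(\<integral>\<^sup>+x. ennreal (2 * (C + 1)\<^sup>2) * ennreal ((norm (g x))\<^sup>2) + ennreal (2 * C\<^sup>2) * ennreal ((norm (u x))\<^sup>2) \<partial>\<gamma>) < \<infinity>"
      using fu0 fg unfolding weighted_L2_def by (subst nn_integral_add; simp add: nn_integral_cmult ennreal_mult_less_top)
  qed measurable
  define \<eta>' where "\<eta>' = \<eta> / 4"
  have \<eta>': "\<eta>' > 0" using \<eta> by (simp add: \<eta>'_def)
  \<comment> \<open>A quarter of the tolerance for each of the two errors, because the triangle inequality for
    squares costs a factor \<open>2\<close>.\<close>
  have "\<forall>\<^sub>F j in sequentially. weighted_L2 a (\<lambda>x. w j x - u x) < ennreal \<eta>' \<and> weighted_L2 0 (\<lambda>x. h j x - g x) < ennreal \<eta>'"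
    using cw ch \<eta>' by (intro eventually_conj order_tendstoD) auto
  then obtain j where j: "weighted_L2 a (\<lambda>x. w j x - u x) \<le> ennreal \<eta>'" "weighted_L2 0 (\<lambda>x. h j x - g x) \<le> ennreal \<eta>'"
    by (auto simp: eventually_sequentially intro: less_imp_le)
  have w0: "w j x = 0" if "norm x > real (Suc j)" for x using cutoff_eq_0[OF that] by (simp add: w_def)
  have h0: "h j x = 0" if "norm x > real (Suc j)" for x
  proof -
    have "partial_deriv i (cutoff j) x = 0" for i
      by (rule test_function_grad_eq_0[OF cutoff_eq_0 that])
    then show ?thesis using cutoff_eq_0[OF that] by (simp add: h_def vec_eq_iff)
  qed
  have fw: "weighted_L2 0 (w j) < \<infinity>"
  proof -
    have "weighted_L2 0 (w j) \<le> (\<integral>\<^sup>+x. ennreal (C\<^sup>2) * ennreal ((norm (u x))\<^sup>2 * exp (0 * (norm x)\<^sup>2)) \<partial>\<gamma>)"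
      unfolding weighted_L2_def
    proof (rule nn_integral_mono)
      fix x :: "real^'n"
      have "norm (w j x) \<le> C * norm (u x)" using C(2)[of j x] by (simp add: w_def abs_mult mult_right_mono)
      from power_mono[OF this norm_ge_zero, of 2]
      show "ennreal ((norm (w j x))\<^sup>2 * exp (0 * (norm x)\<^sup>2)) \<le> ennreal (C\<^sup>2) * ennreal ((norm (u x))\<^sup>2 * exp (0 * (norm x)\<^sup>2))"
        by (subst ennreal_mult[symmetric]) (auto simp: power_mult_distrib intro: ennreal_leI)
    qed
    also have "\<dots> < \<infinity>" using fu0 unfolding weighted_L2_def by (subst nn_integral_cmult) (auto simp: ennreal_mult_less_top)
    finally show ?thesis .
  qed
  have fh: "weighted_L2 0 (\<lambda>x. h j x $ i) < \<infinity>" for i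
  proof -
    have "weighted_L2 0 (\<lambda>x. h j x $ i) \<le> weighted_L2 0 (h j)"
      unfolding weighted_L2_def by (intro nn_integral_mono ennreal_leI mult_right_mono power_mono) (auto simp: component_le_norm_cart)
    also have "weighted_L2 0 (h j) \<le> 2 * (weighted_L2 0 (\<lambda>x. h j x - g x) + weighted_L2 0 g)"
      using weighted_L2_add[of "\<lambda>x. h j x - g x" g 0] by simp
    also have "\<dots> < \<infinity>" using fg j(2) by (auto simp: ennreal_mult_less_top intro: le_less_trans)
    finally show ?thesis .
  qed
  have wm: "w j \<in> borel_measurable borel" and hm: "\<And>i. (\<lambda>x. h j x $ i) \<in> borel_measurable borel" by measurable
  note sw = compact_support_L2[OF wm fw w0]
  have sh: "Lp_power 2 (\<lambda>x. h j x $ i) < \<infinity>" "integrable lborel (\<lambda>x. h j x $ i)" for i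
    using compact_support_L2[OF hm fh, of "real (Suc j)"] h0 by auto
  have \<eta>n: "\<eta>' / real CARD('n) > 0" using \<eta>' by simp
  have "\<forall>\<^sub>F m in sequentially. Lp_power 2 (\<lambda>x. mollify m (w j) x - w j x) \<le> ennreal \<eta>' \<and>
     (\<forall>i\<in>UNIV. Lp_power 2 (\<lambda>x. mollify m (\<lambda>y. h j y $ i) x - h j x $ i) \<le> ennreal (\<eta>' / real CARD('n)))"
    by (intro eventually_conj eventually_ball_finite ballI finite mollify_Lp_power[OF sw(2,1) _ \<eta>'] mollify_Lp_power[OF sh(2,1) _ \<eta>n]) auto
  then obtain m where m: "Lp_power 2 (\<lambda>x. mollify m (w j) x - w j x) \<le> ennreal \<eta>'"
     "\<And>i. Lp_power 2 (\<lambda>x. mollify m (\<lambda>y. h j y $ i) x - h j x $ i) \<le> ennreal (\<eta>' / real CARD('n))"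
    by (auto simp: eventually_sequentially)
  define v where "v = mollify m (w j)"
  define V where "V x = (\<chi> i. mollify m (\<lambda>y. h j y $ i) x)" for x
  have vV: "bounded_C1 v V"
    unfolding v_def V_def
  proof (rule mollify_bounded_C1[OF sw(2) sh(2)])
    show "test_function \<phi> \<Longrightarrow> (\<integral>x. w j x * partial_deriv i \<phi> x \<partial>lborel) = - (\<integral>x. h j x $ i * \<phi> x \<partial>lborel)" for \<phi> i
      unfolding w_def h_def by (rule weak_gradient_cutoff[OF ug test_function_cutoff])
  qed
  note [measurable] = bounded_C1_measurable[OF vV]
  have four: "2 * (ennreal \<eta>' + ennreal \<eta>') = ennreal \<eta>"
    using \<eta>' by (simp add: ennreal_plus[symmetric] ennreal_mult'[symmetric] \<eta>'_def del: ennreal_plus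
        flip: ennreal_numeral)
  have "weighted_L2 a (\<lambda>x. v x - u x) = weighted_L2 a (\<lambda>x. (v x - w j x) + (w j x - u x))" by simp
  also have "\<dots> \<le> 2 * (weighted_L2 a (\<lambda>x. v x - w j x) + weighted_L2 a (\<lambda>x. w j x - u x))" by (rule weighted_L2_add) auto
  also have "\<dots> \<le> 2 * (ennreal \<eta>' + ennreal \<eta>')"
  proof (intro mult_left_mono add_mono j(1))
    have "weighted_L2 a (\<lambda>x. v x - w j x) \<le> Lp_power 2 (\<lambda>x. v x - w j x)" by (rule weighted_L2_le_Lp_power[OF _ a(2)]) measurable
    then show "weighted_L2 a (\<lambda>x. v x - w j x) \<le> ennreal \<eta>'" using m(1) unfolding v_def by (rule order_trans)
  qed simp
  also note four
  finally have 1: "weighted_L2 a (\<lambda>x. v x - u x) \<le> ennreal \<eta>" .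
  have Vh: "weighted_L2 0 (\<lambda>x. V x - h j x) \<le> ennreal \<eta>'"
  proof -
    have "(norm (y::real^'n))\<^sup>2 = (\<Sum>i\<in>UNIV. (norm (y $ i))\<^sup>2)" for y
      by (simp add: norm_vec_def L2_set_def sum_nonneg)
    then have "weighted_L2 0 (\<lambda>x. V x - h j x) = (\<integral>\<^sup>+x. (\<Sum>i\<in>UNIV. ennreal ((norm (V x $ i - h j x $ i))\<^sup>2 * exp (0 * (norm x)\<^sup>2))) \<partial>\<gamma>)"
      unfolding weighted_L2_def by (simp add: sum_ennreal)
    also have "\<dots> = (\<Sum>i\<in>UNIV. weighted_L2 0 (\<lambda>x. V x $ i - h j x $ i))"
      unfolding weighted_L2_def by (rule nn_integral_sum) measurable
    also have "\<dots> \<le> (\<Sum>(i::'n)\<in>UNIV. ennreal (\<eta>' / real CARD('n)))"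
    proof (rule sum_mono)
      fix i
      have "weighted_L2 0 (\<lambda>x. V x $ i - h j x $ i) \<le> Lp_power 2 (\<lambda>x. V x $ i - h j x $ i)" by (rule weighted_L2_le_Lp_power) auto
      then show "weighted_L2 0 (\<lambda>x. V x $ i - h j x $ i) \<le> ennreal (\<eta>' / real CARD('n))"
        using m(2)[of i] by (simp add: V_def)
    qed
    also have "\<dots> = ennreal \<eta>'" using \<eta>' by (subst sum_ennreal) auto
    finally show ?thesis .
  qed
  have "weighted_L2 0 (\<lambda>x. V x - g x) = weighted_L2 0 (\<lambda>x. (V x - h j x) + (h j x - g x))" by simp
  also have "\<dots> \<le> 2 * (weighted_L2 0 (\<lambda>x. V x - h j x) + weighted_L2 0 (\<lambda>x. h j x - g x))" by (rule weighted_L2_add) auto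
  also have "\<dots> \<le> 2 * (ennreal \<eta>' + ennreal \<eta>')"
    by (intro mult_left_mono add_mono j(2) Vh) simp
  also note four
  finally have 2: "weighted_L2 0 (\<lambda>x. V x - g x) \<le> ennreal \<eta>" .
  from vV 1 2 show ?thesis by blast
qed

section \<open>The chain rule for weak gradients\<close>

text \<open>The integral of \<open>\<psi>(x + t h)\<close> does not depend on \<open>t\<close>; differentiate it at \<open>t = 0\<close>.\<close>

lemma integral_gradient_compact_support:
  fixes \<psi> :: "real^'n \<Rightarrow> real"
  assumes der: "\<And>x. (\<psi> has_derivative (\<lambda>h. D x \<bullet> h)) (at x)" and D: "continuous_on UNIV D"
    and \<psi>0: "\<And>x. norm x > R \<Longrightarrow> \<psi> x = 0" and D0: "\<And>x. norm x > R \<Longrightarrow> D x = 0"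
  shows "(\<integral>x. D x \<bullet> h \<partial>lborel) = 0"
proof -
  have c: "continuous_on UNIV \<psi>"
    by (meson der has_derivative_continuous continuous_at_imp_continuous_on)
  obtain B1 where B1: "B1 > 0" "\<And>x. norm (\<psi> x) \<le> B1" using bounded_of_compact_support[OF c \<psi>0] by blast
  obtain B where B: "B > 0" "\<And>x. norm (D x) \<le> B" using bounded_of_compact_support[OF D D0] by blast
  have C1: "bounded_C1 \<psi> D" unfolding bounded_C1_def
    by (intro conjI allI der D exI[of _ "max B1 B"]) (use B1(2) B(2) in \<open>auto simp: le_max_iff_disj\<close>)
  have [measurable]: "\<psi> \<in> borel_measurable borel" "D \<in> borel_measurable borel"
    using bounded_C1_measurable[OF C1] .
  define K where "K = cball (0::real^'n) (R + norm h)"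
  have [measurable]: "K \<in> sets borel" unfolding K_def by (rule borel_closed) simp
  have tr: "(\<integral>x. \<psi> (x + t *\<^sub>R h) \<partial>lborel) = (\<integral>x. \<psi> x \<partial>lborel)" for t
    using integral_distr[of "(+) (t *\<^sub>R h)" lborel borel \<psi>] by (simp add: lborel_distr_plus add.commute)
  have i\<psi>: "integrable lborel \<psi>" by (rule integrable_compact_support[OF c \<psi>0])
  have "((\<lambda>t::real. \<integral>x. \<psi> (x + t *\<^sub>R h) \<partial>lborel) has_derivative (\<lambda>t. \<integral>x. t * (D x \<bullet> h) \<partial>lborel)) (at 0)"
  proof (rule has_derivative_integral[where b = "\<lambda>x. (B * norm h) * indicator K x" and e = 1])
    show "integrable lborel (\<lambda>x. \<psi> (x + t *\<^sub>R h))" for t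
    proof -
      have "integrable (distr lborel borel ((+) (t *\<^sub>R h))) \<psi>" by (simp add: lborel_distr_plus i\<psi>)
      then show ?thesis by (subst (asm) integrable_distr_eq) (auto simp: add.commute)
    qed
    have "integrable lborel (indicator K :: real^'n \<Rightarrow> real)"
      unfolding K_def using emeasure_lborel_cball_finite[of "0::real^'n" "R + norm h"]
      by (intro integrable_real_indicator) auto
    then show "integrable lborel (\<lambda>x. (B * norm h) * indicator K x)" by simp
    have "((\<lambda>t. \<psi> (z + t *\<^sub>R h)) has_derivative (\<lambda>t. D (z + 0 *\<^sub>R h) \<bullet> (t *\<^sub>R h))) (at 0)" for z
      by (rule has_derivative_compose[OF _ der]) (auto intro!: derivative_eq_intros)
    then show "((\<lambda>t. \<psi> (z + t *\<^sub>R h)) has_derivative (\<lambda>t. t * (D z \<bullet> h))) (at 0)" for z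
      by simp
    show "\<bar>\<psi> (z + t *\<^sub>R h) - \<psi> (z + 0 *\<^sub>R h)\<bar> \<le> B * norm h * indicator K z * norm (t - 0)" if "norm (t - 0) < 1" for t z
    proof (cases "z \<in> K")
      case True
      then show ?thesis using bounded_C1_lipschitz[OF C1 B(2), of "z + t *\<^sub>R h" z] by (simp add: mult_ac)
    next
      case False
      then have z: "norm z > R + norm h" by (simp add: K_def)
      have "norm (t *\<^sub>R h) \<le> norm h" using that mult_right_mono[of "\<bar>t\<bar>" 1 "norm h"] by simp
      then have "norm (z + t *\<^sub>R h) > R" using z norm_diff_ineq[of z "t *\<^sub>R h"] by linarith
      moreover have "norm z > R" using z norm_ge_zero[of h] by linarith
      ultimately show ?thesis using \<psi>0 B(1) by (auto intro!: mult_nonneg_nonneg)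
    qed
    show "\<bar>t * (D z \<bullet> h)\<bar> \<le> B * norm h * indicator K z * norm t" for z t
    proof (cases "z \<in> K")
      case True
      have "\<bar>D z \<bullet> h\<bar> \<le> B * norm h"
        by (rule order_trans[OF Cauchy_Schwarz_ineq2 mult_right_mono[OF B(2)]]) simp
      from mult_right_mono[OF this, of "\<bar>t\<bar>"] show ?thesis using True by (simp add: abs_mult mult_ac)
    next
      case False
      then have "norm z > R + norm h" by (simp add: K_def)
      then have "norm z > R" using norm_ge_zero[of h] by linarith
      then show ?thesis using B(1) by (simp add: D0)
    qed
  qed auto
  then have "((\<lambda>t::real. \<integral>x. \<psi> x \<partial>lborel) has_derivative (\<lambda>t. \<integral>x. t * (D x \<bullet> h) \<partial>lborel)) (at 0)"
    by (simp only: tr)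
  from fun_cong[OF has_derivative_unique[OF this has_derivative_const], of 1] show ?thesis by simp
qed

text \<open>Converts Gaussian \<open>L\<^sup>1\<close> convergence into convergence of Lebesgue integrals against test
  functions.\<close>

lemma test_function_le_gauss_density:
  fixes \<phi> :: "real^'n \<Rightarrow> real"
  assumes "test_function \<phi>"
  obtains C where "C > 0" "\<And>x. \<bar>\<phi> x\<bar> \<le> C * gauss_density x"
proof -
  obtain R where R: "R > 0" "\<And>x. norm x > R \<Longrightarrow> \<phi> x = 0" using test_functionE[OF assms] by blast
  obtain B where B: "B > 0" "\<And>x. norm (\<phi> x) \<le> B"
    using bounded_of_compact_support[OF test_function_continuous[OF assms] R(2)] by blast
  obtain \<delta> where \<delta>: "\<delta> > 0" "\<And>x::real^'n. norm x \<le> R \<Longrightarrow> \<delta> \<le> gauss_density x" using gauss_density_lower by blast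
  have "\<bar>\<phi> x\<bar> \<le> B / \<delta> * gauss_density x" for x
  proof (cases "norm x \<le> R")
    case True
    have "B / \<delta> * \<delta> \<le> B / \<delta> * gauss_density x" using \<delta> B(1) True by (intro mult_left_mono) auto
    then show ?thesis using B(2)[of x] \<delta>(1) by simp
  next
    case False then show ?thesis using R B(1) \<delta>(1) by simp
  qed
  then show ?thesis using B(1) \<delta>(1) by (intro that[of "B / \<delta>"]) auto
qed

lemma tendsto_integral_test_function:
  fixes F :: "real^'n \<Rightarrow> real"
  assumes [measurable]: "F \<in> borel_measurable borel" "\<And>k. Fk k \<in> borel_measurable borel"
    and F: "integrable \<gamma> F" and Fk: "\<And>k. integrable \<gamma> (Fk k)"
    and lim: "(\<lambda>k. \<integral>x. \<bar>Fk k x - F x\<bar> \<partial>\<gamma>) \<longlonglongrightarrow> 0" and \<phi>: "test_function \<phi>"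
  shows "(\<lambda>k. \<integral>x. Fk k x * \<phi> x \<partial>lborel) \<longlonglongrightarrow> (\<integral>x. F x * \<phi> x \<partial>lborel)"
proof -
  obtain C where C: "C > 0" "\<And>x. \<bar>\<phi> x\<bar> \<le> C * gauss_density x" using test_function_le_gauss_density[OF \<phi>] by blast
  have [measurable]: "\<phi> \<in> borel_measurable borel" by (rule test_function_measurable[OF \<phi>])
  have i: "integrable lborel (\<lambda>x. F x * \<phi> x)" "\<And>k. integrable lborel (\<lambda>x. Fk k x * \<phi> x)"
    by (intro integrable_test_function_mult[OF gaussian_integrable_imp_locally_integrable \<phi>] F Fk; measurable)+
  have bd: "norm ((\<integral>x. Fk k x * \<phi> x \<partial>lborel) - (\<integral>x. F x * \<phi> x \<partial>lborel)) \<le> C * (\<integral>x. \<bar>Fk k x - F x\<bar> \<partial>\<gamma>)" for k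
  proof -
    have ig: "integrable lborel (\<lambda>x. gauss_density x *\<^sub>R \<bar>Fk k x - F x\<bar>)"
      using F Fk[of k] by (subst integrable_gaussian_iff[symmetric]) auto
    have "norm ((\<integral>x. Fk k x * \<phi> x \<partial>lborel) - (\<integral>x. F x * \<phi> x \<partial>lborel)) = norm (\<integral>x. Fk k x * \<phi> x - F x * \<phi> x \<partial>lborel)"
      using i by simp
    also have "\<dots> \<le> (\<integral>x. norm (Fk k x * \<phi> x - F x * \<phi> x) \<partial>lborel)" by (rule integral_norm_bound)
    also have "\<dots> \<le> (\<integral>x. C * (gauss_density x *\<^sub>R \<bar>Fk k x - F x\<bar>) \<partial>lborel)"
    proof (rule integral_mono)
      show "norm (Fk k x * \<phi> x - F x * \<phi> x) \<le> C * (gauss_density x *\<^sub>R \<bar>Fk k x - F x\<bar>)" for x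
      proof -
        have "norm (Fk k x * \<phi> x - F x * \<phi> x) = \<bar>Fk k x - F x\<bar> * \<bar>\<phi> x\<bar>"
          by (simp only: left_diff_distrib[symmetric] abs_mult real_norm_def)
        also have "\<dots> \<le> \<bar>Fk k x - F x\<bar> * (C * gauss_density x)" by (rule mult_left_mono[OF C(2)]) simp
        finally show ?thesis by (simp add: mult_ac)
      qed
    qed (use i ig in auto)
    also have "\<dots> = C * (\<integral>x. \<bar>Fk k x - F x\<bar> \<partial>\<gamma>)"
      using ig by (simp add: integral_gaussian)
    finally show ?thesis .
  qed
  have "(\<lambda>k. (\<integral>x. Fk k x * \<phi> x \<partial>lborel) - (\<integral>x. F x * \<phi> x \<partial>lborel)) \<longlonglongrightarrow> 0"
    by (rule Lim_null_comparison[OF _ tendsto_mult_right_zero[OF lim, of C]]) (intro always_eventually allI bd)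
  then show ?thesis by (simp add: LIM_zero_iff)
qed

lemma L2_product:
  fixes f d :: "real^'n \<Rightarrow> real"
  assumes [measurable]: "f \<in> borel_measurable borel" "d \<in> borel_measurable borel"
    and f: "integrable \<gamma> (\<lambda>x. (f x)\<^sup>2)" and d: "integrable \<gamma> (\<lambda>x. (d x)\<^sup>2)"
  shows "integrable \<gamma> (\<lambda>x. f x * d x)"
    "(\<integral>x. \<bar>f x * d x\<bar> \<partial>\<gamma>) \<le> sqrt (\<integral>x. (f x)\<^sup>2 \<partial>\<gamma>) * sqrt (\<integral>x. (d x)\<^sup>2 \<partial>\<gamma>)"
proof -
  note c = Cauchy_Schwarz_integral[OF _ _ f d, simplified]
  show "integrable \<gamma> (\<lambda>x. f x * d x)" by (rule c(1)) measurable
  have "(\<integral>x. \<bar>f x * d x\<bar> \<partial>\<gamma>)\<^sup>2 \<le> (\<integral>x. (f x)\<^sup>2 \<partial>\<gamma>) * (\<integral>x. (d x)\<^sup>2 \<partial>\<gamma>)"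
    by (rule Cauchy_Schwarz_integral(2)[OF _ _ f d]) auto
  then show "(\<integral>x. \<bar>f x * d x\<bar> \<partial>\<gamma>) \<le> sqrt (\<integral>x. (f x)\<^sup>2 \<partial>\<gamma>) * sqrt (\<integral>x. (d x)\<^sup>2 \<partial>\<gamma>)"
    unfolding real_sqrt_mult[symmetric] by (rule real_le_rsqrt)
qed

lemma bounded_C1_chain_test_function:
  fixes v :: "real^'n \<Rightarrow> real"
  assumes vV: "bounded_C1 v V" and \<Theta>: "\<And>t. (\<Theta> has_real_derivative \<Theta>' t) (at t)" and \<Theta>': "continuous_on UNIV \<Theta>'"
    and \<phi>: "test_function \<phi>"
  shows "(\<integral>x. \<Theta> (v x) * partial_deriv i \<phi> x \<partial>lborel) = - (\<integral>x. (\<Theta>' (v x) * V x $ i) * \<phi> x \<partial>lborel)"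
proof -
  obtain R where R: "R > 0" "\<And>x. norm x > R \<Longrightarrow> \<phi> x = 0" using test_functionE[OF \<phi>] by blast
  have p0: "partial_deriv j \<phi> x = 0" if "norm x > R" for x j using test_function_grad_eq_0[OF R(2) that] .
  have gc: "continuous_on UNIV (grad \<phi>)"
    by (intro continuous_on_grad test_function_continuous test_function_partial \<phi>)
  note vc = bounded_C1_continuous[OF vV] and Vc = bounded_C1_continuous_grad[OF vV]
  have \<Theta>c: "continuous_on UNIV (\<lambda>x. \<Theta> (v x))"
    by (rule continuous_on_compose2[OF _ vc, of UNIV]) (auto intro: continuous_at_imp_continuous_on DERIV_isCont[OF \<Theta>])
  have \<Theta>'c: "continuous_on UNIV (\<lambda>x. \<Theta>' (v x))" by (rule continuous_on_compose2[OF \<Theta>' vc]) auto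
  define D where "D x = \<Theta> (v x) *\<^sub>R grad \<phi> x + (\<Theta>' (v x) * \<phi> x) *\<^sub>R V x" for x
  have "(\<integral>x. D x \<bullet> axis i 1 \<partial>lborel) = 0"
  proof (rule integral_gradient_compact_support[where \<psi> = "\<lambda>x. \<Theta> (v x) * \<phi> x" and R = R])
    fix x
    have "((\<lambda>x. \<Theta> (v x)) has_derivative (\<lambda>h. \<Theta>' (v x) * (V x \<bullet> h))) (at x)"
      using has_derivative_compose[OF bounded_C1_has_derivative[OF vV] \<Theta>[unfolded has_field_derivative_def]] .
    from has_derivative_mult[OF this test_function_has_derivative[OF \<phi>]]
    show "((\<lambda>x. \<Theta> (v x) * \<phi> x) has_derivative (\<lambda>h. D x \<bullet> h)) (at x)"
      by (simp add: D_def inner_add_left algebra_simps)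
  next
    show "continuous_on UNIV D" unfolding D_def
      by (intro continuous_intros \<Theta>c \<Theta>'c gc Vc test_function_continuous[OF \<phi>])
  qed (use R p0 in \<open>auto simp: D_def vec_eq_iff\<close>)
  then have "(\<integral>x. \<Theta> (v x) * partial_deriv i \<phi> x + (\<Theta>' (v x) * V x $ i) * \<phi> x \<partial>lborel) = 0"
    by (simp add: D_def inner_add_left inner_axis mult_ac)
  moreover have "integrable lborel (\<lambda>x. \<Theta> (v x) * partial_deriv i \<phi> x)"
    by (rule integrable_compact_support[where R = R])
       (auto intro!: continuous_on_mult \<Theta>c test_function_continuous[OF test_function_partial[OF \<phi>]] simp: p0)
  moreover have "integrable lborel (\<lambda>x. (\<Theta>' (v x) * V x $ i) * \<phi> x)"
    by (rule integrable_compact_support[where R = R])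
       (auto intro!: continuous_intros \<Theta>'c Vc test_function_continuous[OF \<phi>] simp: R)
  ultimately show ?thesis by simp
qed

text \<open>The identity holds for the smooth approximants of \<open>u\<close>. With a Lipschitz derivative,
  \<open>\<Theta>(v\<^sub>k) \<rightarrow> \<Theta>(u)\<close> and \<open>\<Theta>'(v\<^sub>k) \<nabla>v\<^sub>k \<rightarrow> \<Theta>'(u) g\<close> in \<open>L\<^sup>1(\<gamma>)\<close> follow
  from products of \<open>L\<^sup>2\<close> convergences.\<close>

theorem weak_chain_rule:
  fixes u :: "real^'n \<Rightarrow> real"
  assumes ug: "has_weak_gradient u g" and fu: "weighted_L2 0 u < \<infinity>" and fg: "weighted_L2 0 g < \<infinity>"
    and \<Theta>: "\<And>t. (\<Theta> has_real_derivative \<Theta>' t) (at t)" and lip: "\<And>s t. \<bar>\<Theta>' s - \<Theta>' t\<bar> \<le> L * \<bar>s - t\<bar>"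
  shows "has_weak_gradient (\<lambda>x. \<Theta> (u x)) (\<lambda>x. \<Theta>' (u x) *\<^sub>R g x)"
proof -
  have [measurable]: "u \<in> borel_measurable borel" "g \<in> borel_measurable borel"
    using has_weak_gradientD(1,2)[OF ug] locally_integrable_measurable by blast+
  have L0: "L \<ge> 0" using lip[of 1 0] by simp
  have \<Theta>'c: "continuous_on UNIV \<Theta>'"
  proof -
    have "L-lipschitz_on UNIV \<Theta>'" using lip L0 by (auto simp: lipschitz_on_def dist_real_def)
    then show ?thesis by (rule lipschitz_on_continuous_on)
  qed
  have \<Theta>c: "continuous_on UNIV \<Theta>" by (auto intro: continuous_at_imp_continuous_on DERIV_isCont[OF \<Theta>])
  have [measurable]: "\<Theta> \<in> borel_measurable borel" "\<Theta>' \<in> borel_measurable borel"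
    using \<Theta>c \<Theta>'c borel_measurable_continuous_onI by auto
  \<comment> \<open>A bound for \<open>|\<Theta>'(t)|\<close> of linear growth; \<open>b (u)\<close> is therefore square integrable.\<close>
  define b where "b t = \<bar>\<Theta>' 0\<bar> + L * \<bar>t\<bar>" for t
  have b0: "b t \<ge> 0" for t using L0 by (simp add: b_def)
  have [measurable]: "b \<in> borel_measurable borel" unfolding b_def by measurable
  have \<Theta>'b: "\<bar>\<Theta>' t\<bar> \<le> b t" for t using lip[of t 0] by (simp add: b_def)
  have \<Theta>'st: "\<bar>\<Theta>' t\<bar> \<le> b s + L * \<bar>t - s\<bar>" for s t using lip[of t s] \<Theta>'b[of s] by linarith
  have \<Theta>d: "\<bar>\<Theta> t - \<Theta> s\<bar> \<le> b s * \<bar>t - s\<bar> + L * (t - s)\<^sup>2" for s t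
  proof -
    have "norm (\<Theta> t - \<Theta> s) \<le> (b s + L * \<bar>t - s\<bar>) * norm (t - s)"
    proof (rule field_differentiable_bound[where S = "closed_segment s t" and f' = \<Theta>'])
      fix z assume "z \<in> closed_segment s t"
      then have "\<bar>z - s\<bar> \<le> \<bar>t - s\<bar>" by (auto simp: closed_segment_eq_real_ivl split: if_splits)
      then have "L * \<bar>z - s\<bar> \<le> L * \<bar>t - s\<bar>" using L0 by (rule mult_left_mono)
      then show "norm (\<Theta>' z) \<le> b s + L * \<bar>t - s\<bar>" using \<Theta>'st[of z s] by simp
    qed (auto intro: has_field_derivative_at_within \<Theta>)
    then show ?thesis by (simp add: distrib_right power2_eq_square abs_mult mult.assoc)
  qed
  obtain r where r: "r \<ge> 0" "weighted_L2 0 u \<le> ennreal r"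
    using fu by (cases "weighted_L2 0 u") auto
  obtain r' where r': "r' \<ge> 0" "weighted_L2 0 g \<le> ennreal r'"
    using fg by (cases "weighted_L2 0 g") auto
  have iu: "integrable \<gamma> (\<lambda>x. (u x)\<^sup>2)" using weighted_L2_0_real(1)[OF _ r(2,1)] by simp
  have ig: "integrable \<gamma> (\<lambda>x. (norm (g x))\<^sup>2)" using weighted_L2_0_real(1)[OF _ r'(2,1)] by simp
  have ib: "integrable \<gamma> (\<lambda>x. (b (u x))\<^sup>2)"
  proof (rule Bochner_Integration.integrable_bound)
    show "integrable \<gamma> (\<lambda>x. 2 * \<bar>\<Theta>' 0\<bar>\<^sup>2 + 2 * L\<^sup>2 * (u x)\<^sup>2)" using iu by simp
    show "AE x in \<gamma>. norm ((b (u x))\<^sup>2) \<le> norm (2 * \<bar>\<Theta>' 0\<bar>\<^sup>2 + 2 * L\<^sup>2 * (u x)\<^sup>2)"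
    proof (rule AE_I2)
      fix x
      have "(b (u x))\<^sup>2 \<le> 2 * \<bar>\<Theta>' 0\<bar>\<^sup>2 + 2 * (L * \<bar>u x\<bar>)\<^sup>2"
        unfolding b_def power2_sum using sum_squares_bound[of "\<bar>\<Theta>' 0\<bar>" "L * \<bar>u x\<bar>"] by simp
      then show "norm ((b (u x))\<^sup>2) \<le> norm (2 * \<bar>\<Theta>' 0\<bar>\<^sup>2 + 2 * L\<^sup>2 * (u x)\<^sup>2)"
        by (simp add: power_mult_distrib)
    qed
  qed measurable
  have "\<exists>p. bounded_C1 (fst p) (snd p) \<and> weighted_L2 0 (\<lambda>x. fst p x - u x) \<le> ennreal (1 / real (Suc k)) \<and> weighted_L2 0 (\<lambda>x. snd p x - g x) \<le> ennreal (1 / real (Suc k))" for k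
    using weak_gradient_approximation[OF ug _ _ fu fg, of "1 / real (Suc k)"] by simp
  then obtain P where P: "\<forall>k. bounded_C1 (fst (P k)) (snd (P k)) \<and> weighted_L2 0 (\<lambda>x. fst (P k) x - u x) \<le> ennreal (1 / real (Suc k)) \<and> weighted_L2 0 (\<lambda>x. snd (P k) x - g x) \<le> ennreal (1 / real (Suc k))"
    using choice[of "\<lambda>k p. bounded_C1 (fst p) (snd p) \<and> weighted_L2 0 (\<lambda>x. fst p x - u x) \<le> ennreal (1 / real (Suc k)) \<and> weighted_L2 0 (\<lambda>x. snd p x - g x) \<le> ennreal (1 / real (Suc k))"] by blast
  define v V where "v k = fst (P k)" and "V k = snd (P k)" for k
  have vV: "bounded_C1 (v k) (V k)" and vu: "weighted_L2 0 (\<lambda>x. v k x - u x) \<le> ennreal (1 / real (Suc k))"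
    and Vg: "weighted_L2 0 (\<lambda>x. V k x - g x) \<le> ennreal (1 / real (Suc k))" for k
    using P[rule_format, of k] unfolding v_def V_def by blast+
  note [measurable] = bounded_C1_measurable[OF vV]
  define e where "e k = sqrt (1 / real (Suc k))" for k
  have e0: "e \<longlonglongrightarrow> 0"
  proof -
    have "(\<lambda>k. 1 / real (Suc k)) \<longlonglongrightarrow> 0" using LIMSEQ_inverse_real_of_nat by (simp add: inverse_eq_divide)
    from tendsto_real_sqrt[OF this] show ?thesis unfolding e_def[abs_def] by (simp only: real_sqrt_zero)
  qed
  define d where "d k x = \<bar>v k x - u x\<bar>" for k x
  define D where "D k x = norm (V k x - g x)" for k x
  have [measurable]: "d k \<in> borel_measurable borel" "D k \<in> borel_measurable borel" for k
    unfolding d_def D_def by measurable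
  have id: "integrable \<gamma> (\<lambda>x. (d k x)\<^sup>2)" and ed: "sqrt (\<integral>x. (d k x)\<^sup>2 \<partial>\<gamma>) \<le> e k" for k
    using weighted_L2_0_real[OF _ vu[of k]] by (auto simp: d_def e_def)
  have iD: "integrable \<gamma> (\<lambda>x. (D k x)\<^sup>2)" and eD: "sqrt (\<integral>x. (D k x)\<^sup>2 \<partial>\<gamma>) \<le> e k" for k
    using weighted_L2_0_real[OF _ Vg[of k]] by (auto simp: D_def e_def)
  have ed2: "(\<integral>x. (d k x)\<^sup>2 \<partial>\<gamma>) \<le> e k * e k" for k
    using weighted_L2_0_real(2)[OF _ vu[of k]] by (simp add: d_def e_def)
  let ?nb = "sqrt (\<integral>x. (b (u x))\<^sup>2 \<partial>\<gamma>)" and ?ng = "sqrt (\<integral>x. (norm (g x))\<^sup>2 \<partial>\<gamma>)"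
  have nn: "?nb \<ge> 0" "?ng \<ge> 0" "\<And>k. e k \<ge> 0" by (auto simp: e_def)
  note bd = L2_product[OF _ _ ib id] and bD = L2_product[OF _ _ ib iD] and dD = L2_product[OF _ _ id iD]
    and dg = L2_product[OF _ _ id ig]
  have i\<Theta>: "integrable \<gamma> (\<lambda>x. \<Theta> (u x))"
  proof (rule Bochner_Integration.integrable_bound)
    show "integrable \<gamma> (\<lambda>x. \<bar>\<Theta> 0\<bar> + (\<bar>\<Theta>' 0\<bar> * (1 + (u x)\<^sup>2) + L * (u x)\<^sup>2))" using iu by simp
    show "AE x in \<gamma>. norm (\<Theta> (u x)) \<le> norm (\<bar>\<Theta> 0\<bar> + (\<bar>\<Theta>' 0\<bar> * (1 + (u x)\<^sup>2) + L * (u x)\<^sup>2))"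
    proof (rule AE_I2)
      fix x
      have "2 * \<bar>u x\<bar> \<le> 1 + (u x)\<^sup>2" using sum_squares_bound[of 1 "\<bar>u x\<bar>"] by simp
      then have "\<bar>u x\<bar> \<le> 1 + (u x)\<^sup>2" by linarith
      then have "\<bar>\<Theta>' 0\<bar> * \<bar>u x\<bar> \<le> \<bar>\<Theta>' 0\<bar> * (1 + (u x)\<^sup>2)" by (rule mult_left_mono) simp
      then have "\<bar>\<Theta> (u x)\<bar> \<le> \<bar>\<Theta> 0\<bar> + (\<bar>\<Theta>' 0\<bar> * (1 + (u x)\<^sup>2) + L * (u x)\<^sup>2)"
        using \<Theta>d[of "u x" 0] by (simp add: b_def)
      then show "norm (\<Theta> (u x)) \<le> norm (\<bar>\<Theta> 0\<bar> + (\<bar>\<Theta>' 0\<bar> * (1 + (u x)\<^sup>2) + L * (u x)\<^sup>2))"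
        unfolding real_norm_def by (rule order_trans[OF _ abs_ge_self])
    qed
  qed measurable
  have ibg: "integrable \<gamma> (\<lambda>x. b (u x) * norm (g x))" by (rule L2_product(1)[OF _ _ ib ig]) measurable
  have i\<Theta>g: "integrable \<gamma> (\<lambda>x. \<Theta>' (u x) *\<^sub>R g x)"
    by (rule Bochner_Integration.integrable_bound[OF ibg]) (use \<Theta>'b b0 in \<open>auto intro!: AE_I2 mult_right_mono\<close>)
  have i\<Theta>k: "integrable \<gamma> (\<lambda>x. \<Theta> (v k x))" for k
  proof -
    obtain B where B: "B > 0" "\<And>x. \<bar>v k x\<bar> \<le> B" "\<And>x. norm (V k x) \<le> B" using bounded_C1_bound[OF vV] by blast
    have "norm (\<Theta> (v k x)) \<le> \<bar>\<Theta> 0\<bar> + (b 0 * B + L * B\<^sup>2)" for x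
    proof -
      have "b 0 * \<bar>v k x\<bar> \<le> b 0 * B" using B(2) b0 by (intro mult_left_mono)
      moreover have "L * (v k x)\<^sup>2 \<le> L * B\<^sup>2"
        using B(2)[of x] L0 by (intro mult_left_mono) (auto simp: abs_le_square_iff[symmetric])
      ultimately show ?thesis using \<Theta>d[of "v k x" 0] by simp
    qed
    then show ?thesis by (intro integrable_gaussian_bounded) measurable
  qed
  have i\<Theta>gk: "integrable \<gamma> (\<lambda>x. \<Theta>' (v k x) * V k x $ i)" for k i
  proof -
    obtain B where B: "B > 0" "\<And>x. \<bar>v k x\<bar> \<le> B" "\<And>x. norm (V k x) \<le> B" using bounded_C1_bound[OF vV] by blast
    have "norm (\<Theta>' (v k x) * V k x $ i) \<le> (b 0 + L * B) * B" for x
    proof -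
      have "L * \<bar>v k x - 0\<bar> \<le> L * B" using B(2) L0 by (simp add: mult_left_mono)
      then have "\<bar>\<Theta>' (v k x)\<bar> \<le> b 0 + L * B" using \<Theta>'st[of "v k x" 0] by linarith
      moreover have "\<bar>V k x $ i\<bar> \<le> B" using B(3) component_le_norm_cart order_trans by blast
      ultimately show ?thesis unfolding norm_mult using b0 L0 B(1) by (intro mult_mono) auto
    qed
    then show ?thesis by (intro integrable_gaussian_bounded) measurable
  qed
  have lim1: "(\<lambda>k. \<integral>x. \<bar>\<Theta> (v k x) - \<Theta> (u x)\<bar> \<partial>\<gamma>) \<longlonglongrightarrow> 0"
  proof (rule Lim_null_comparison)
    have "norm (\<integral>x. \<bar>\<Theta> (v k x) - \<Theta> (u x)\<bar> \<partial>\<gamma>) \<le> ?nb * e k + L * (e k * e k)" for k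
    proof -
      have i1: "integrable \<gamma> (\<lambda>x. b (u x) * d k x)" by (rule bd(1)) measurable
      have "(\<integral>x. \<bar>\<Theta> (v k x) - \<Theta> (u x)\<bar> \<partial>\<gamma>) \<le> (\<integral>x. \<bar>b (u x) * d k x\<bar> + L * (d k x)\<^sup>2 \<partial>\<gamma>)"
      proof (rule integral_mono)
        show "\<bar>\<Theta> (v k x) - \<Theta> (u x)\<bar> \<le> \<bar>b (u x) * d k x\<bar> + L * (d k x)\<^sup>2" for x
          using \<Theta>d[of "v k x" "u x"] b0[of "u x"] by (simp add: d_def abs_mult)
      qed (use i\<Theta> i\<Theta>k i1 id in auto)
      also have "\<dots> = (\<integral>x. \<bar>b (u x) * d k x\<bar> \<partial>\<gamma>) + L * (\<integral>x. (d k x)\<^sup>2 \<partial>\<gamma>)" using i1 id by simp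
      also have "\<dots> \<le> ?nb * e k + L * (e k * e k)"
      proof (intro add_mono mult_left_mono ed2 L0)
        have "(\<integral>x. \<bar>b (u x) * d k x\<bar> \<partial>\<gamma>) \<le> ?nb * sqrt (\<integral>x. (d k x)\<^sup>2 \<partial>\<gamma>)" by (rule bd(2)) measurable
        also have "\<dots> \<le> ?nb * e k" using ed nn by (intro mult_left_mono)
        finally show "(\<integral>x. \<bar>b (u x) * d k x\<bar> \<partial>\<gamma>) \<le> ?nb * e k" .
      qed
      finally show ?thesis by simp
    qed
    then show "\<forall>\<^sub>F k in sequentially. norm (\<integral>x. \<bar>\<Theta> (v k x) - \<Theta> (u x)\<bar> \<partial>\<gamma>) \<le> ?nb * e k + L * (e k * e k)" by simp
    have "(\<lambda>k. ?nb * e k + L * (e k * e k)) \<longlonglongrightarrow> ?nb * 0 + L * (0 * 0)" by (intro tendsto_intros e0)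
    then show "(\<lambda>k. ?nb * e k + L * (e k * e k)) \<longlonglongrightarrow> 0" by simp
  qed
  have lim2: "(\<lambda>k. \<integral>x. \<bar>\<Theta>' (v k x) * V k x $ i - \<Theta>' (u x) * g x $ i\<bar> \<partial>\<gamma>) \<longlonglongrightarrow> 0" for i
  proof (rule Lim_null_comparison)
    have "norm (\<integral>x. \<bar>\<Theta>' (v k x) * V k x $ i - \<Theta>' (u x) * g x $ i\<bar> \<partial>\<gamma>) \<le> ?nb * e k + L * (e k * e k) + L * (e k * ?ng)" for k
    proof -
      have i1: "integrable \<gamma> (\<lambda>x. b (u x) * D k x)" by (rule bD(1)) measurable
      have i2: "integrable \<gamma> (\<lambda>x. d k x * D k x)" by (rule dD(1)) measurable
      have i3: "integrable \<gamma> (\<lambda>x. d k x * norm (g x))" by (rule dg(1)) measurable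
      have i4: "integrable \<gamma> (\<lambda>x. \<Theta>' (u x) * g x $ i)"
        using integrable_bounded_linear[OF bounded_linear_vec_nth i\<Theta>g, of i] by simp
      have "(\<integral>x. \<bar>\<Theta>' (v k x) * V k x $ i - \<Theta>' (u x) * g x $ i\<bar> \<partial>\<gamma>)
          \<le> (\<integral>x. \<bar>b (u x) * D k x\<bar> + L * \<bar>d k x * D k x\<bar> + L * \<bar>d k x * norm (g x)\<bar> \<partial>\<gamma>)"
      proof (rule integral_mono)
        fix x
        have "\<Theta>' (v k x) * V k x $ i - \<Theta>' (u x) * g x $ i = \<Theta>' (v k x) * (V k x - g x) $ i + (\<Theta>' (v k x) - \<Theta>' (u x)) * g x $ i"
          by (simp add: algebra_simps)
        also have "\<bar>\<dots>\<bar> \<le> \<bar>\<Theta>' (v k x)\<bar> * \<bar>(V k x - g x) $ i\<bar> + \<bar>\<Theta>' (v k x) - \<Theta>' (u x)\<bar> * \<bar>g x $ i\<bar>"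
          unfolding abs_mult[symmetric] by (rule abs_triangle_ineq)
        also have "\<dots> \<le> (b (u x) + L * d k x) * D k x + (L * d k x) * norm (g x)"
        proof (intro add_mono mult_mono)
          show "\<bar>\<Theta>' (v k x)\<bar> \<le> b (u x) + L * d k x" using \<Theta>'st[of "v k x" "u x"] by (simp add: d_def)
          show "\<bar>(V k x - g x) $ i\<bar> \<le> D k x" unfolding D_def by (rule component_le_norm_cart)
          show "\<bar>\<Theta>' (v k x) - \<Theta>' (u x)\<bar> \<le> L * d k x" using lip by (simp add: d_def)
          show "\<bar>g x $ i\<bar> \<le> norm (g x)" by (rule component_le_norm_cart)
        qed (use b0 L0 in \<open>auto simp: d_def\<close>)
        also have "\<dots> = \<bar>b (u x) * D k x\<bar> + L * \<bar>d k x * D k x\<bar> + L * \<bar>d k x * norm (g x)\<bar>"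
          using b0[of "u x"] by (simp add: d_def D_def abs_mult algebra_simps)
        finally show "\<bar>\<Theta>' (v k x) * V k x $ i - \<Theta>' (u x) * g x $ i\<bar> \<le> \<dots>" .
      qed (use i\<Theta>gk[of k i] i1 i2 i3 i4 in auto)
      also have "\<dots> = (\<integral>x. \<bar>b (u x) * D k x\<bar> \<partial>\<gamma>) + L * (\<integral>x. \<bar>d k x * D k x\<bar> \<partial>\<gamma>) + L * (\<integral>x. \<bar>d k x * norm (g x)\<bar> \<partial>\<gamma>)"
        using i1 i2 i3 by simp
      also have "\<dots> \<le> ?nb * e k + L * (e k * e k) + L * (e k * ?ng)"
      proof (intro add_mono mult_left_mono L0)
        have "(\<integral>x. \<bar>b (u x) * D k x\<bar> \<partial>\<gamma>) \<le> ?nb * sqrt (\<integral>x. (D k x)\<^sup>2 \<partial>\<gamma>)" by (rule bD(2)) measurable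
        also have "\<dots> \<le> ?nb * e k" using eD nn by (intro mult_left_mono)
        finally show "(\<integral>x. \<bar>b (u x) * D k x\<bar> \<partial>\<gamma>) \<le> ?nb * e k" .
        have "(\<integral>x. \<bar>d k x * D k x\<bar> \<partial>\<gamma>) \<le> sqrt (\<integral>x. (d k x)\<^sup>2 \<partial>\<gamma>) * sqrt (\<integral>x. (D k x)\<^sup>2 \<partial>\<gamma>)" by (rule dD(2)) measurable
        also have "\<dots> \<le> e k * e k" using eD ed nn by (intro mult_mono) auto
        finally show "(\<integral>x. \<bar>d k x * D k x\<bar> \<partial>\<gamma>) \<le> e k * e k" .
        have "(\<integral>x. \<bar>d k x * norm (g x)\<bar> \<partial>\<gamma>) \<le> sqrt (\<integral>x. (d k x)\<^sup>2 \<partial>\<gamma>) * ?ng" by (rule dg(2)) measurable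
        also have "\<dots> \<le> e k * ?ng" using ed nn by (intro mult_right_mono) auto
        finally show "(\<integral>x. \<bar>d k x * norm (g x)\<bar> \<partial>\<gamma>) \<le> e k * ?ng" .
      qed
      finally show ?thesis by simp
    qed
    then show "\<forall>\<^sub>F k in sequentially. norm (\<integral>x. \<bar>\<Theta>' (v k x) * V k x $ i - \<Theta>' (u x) * g x $ i\<bar> \<partial>\<gamma>) \<le> ?nb * e k + L * (e k * e k) + L * (e k * ?ng)" by simp
    have "(\<lambda>k. ?nb * e k + L * (e k * e k) + L * (e k * ?ng)) \<longlonglongrightarrow> ?nb * 0 + L * (0 * 0) + L * (0 * ?ng)" by (intro tendsto_intros e0)
    then show "(\<lambda>k. ?nb * e k + L * (e k * e k) + L * (e k * ?ng)) \<longlonglongrightarrow> 0" by simp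
  qed
  show ?thesis unfolding has_weak_gradient_def
  proof (intro conjI allI impI)
    show "locally_integrable (\<lambda>x. \<Theta> (u x))" by (rule gaussian_integrable_imp_locally_integrable[OF _ i\<Theta>]) measurable
    show "locally_integrable (\<lambda>x. \<Theta>' (u x) *\<^sub>R g x)" by (rule gaussian_integrable_imp_locally_integrable[OF _ i\<Theta>g]) measurable
    fix \<phi> :: "real^'n \<Rightarrow> real" and i assume \<phi>: "test_function \<phi>"
    have i4: "integrable \<gamma> (\<lambda>x. \<Theta>' (u x) * g x $ i)"
      using integrable_bounded_linear[OF bounded_linear_vec_nth i\<Theta>g, of i] by simp
    have "(\<lambda>k. \<integral>x. \<Theta> (v k x) * partial_deriv i \<phi> x \<partial>lborel) \<longlonglongrightarrow> (\<integral>x. \<Theta> (u x) * partial_deriv i \<phi> x \<partial>lborel)"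
      by (rule tendsto_integral_test_function[OF _ _ i\<Theta> i\<Theta>k lim1 test_function_partial[OF \<phi>]]) measurable
    moreover have "(\<lambda>k. - (\<integral>x. (\<Theta>' (v k x) * V k x $ i) * \<phi> x \<partial>lborel)) \<longlonglongrightarrow> - (\<integral>x. (\<Theta>' (u x) * g x $ i) * \<phi> x \<partial>lborel)"
      by (rule tendsto_minus[OF tendsto_integral_test_function[OF _ _ i4 i\<Theta>gk lim2 \<phi>]]) measurable
    ultimately show "(\<integral>x. \<Theta> (u x) * partial_deriv i \<phi> x \<partial>lborel) = - (\<integral>x. (\<Theta>' (u x) *\<^sub>R g x) $ i * \<phi> x \<partial>lborel)"
      unfolding bounded_C1_chain_test_function[OF vV \<Theta> \<Theta>'c \<phi>] by (simp add: LIMSEQ_unique)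
  qed
qed

lemma weak_gradient_unique:
  fixes u :: "real^'n \<Rightarrow> real"
  assumes 1: "has_weak_gradient u g1" and 2: "has_weak_gradient u g2"
  shows "AE x in lborel. g1 x = g2 x"
proof -
  have "AE x in lborel. g1 x $ i - g2 x $ i = 0" for i
  proof (rule fundamental_lemma_calculus_of_variations)
    note l1 = locally_integrable_component[OF has_weak_gradientD(2)[OF 1], of i]
      and l2 = locally_integrable_component[OF has_weak_gradientD(2)[OF 2], of i]
    show "locally_integrable (\<lambda>x. g1 x $ i - g2 x $ i)"
      unfolding locally_integrable_def
    proof (intro allI impI)
      fix K :: "(real^'n) set" assume K: "compact K"
      show "set_integrable lborel K (\<lambda>x. g1 x $ i - g2 x $ i)"
        by (rule set_integral_diff(1)) (use l1 l2 K in \<open>simp_all add: locally_integrable_def\<close>)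
    qed
    fix \<phi> :: "real^'n \<Rightarrow> real" assume \<phi>: "test_function \<phi>"
    show "(\<integral>x. (g1 x $ i - g2 x $ i) * \<phi> x \<partial>lborel) = 0"
      using has_weak_gradientD(3)[OF 1 \<phi>, of i] has_weak_gradientD(3)[OF 2 \<phi>, of i]
        integrable_test_function_mult[OF l1 \<phi>] integrable_test_function_mult[OF l2 \<phi>]
      by (simp add: left_diff_distrib)
  qed
  then have "AE x in lborel. \<forall>i\<in>UNIV. g1 x $ i - g2 x $ i = 0"
    by (intro AE_finite_allI) auto
  then show ?thesis by eventually_elim (simp add: vec_eq_iff)
qed

text \<open>The functions \<open>(u\<^sup>2 + \<epsilon>\<^sup>2)\<close> to the power \<open>1/2\<close> converge to \<open>|u| = u\<close>, while the
  chain rule gives their gradients, which converge to \<open>sgn u * g\<close>. So \<open>sgn u * g\<close> is a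
  weak gradient of \<open>u\<close> as well, and it vanishes where \<open>u\<close> does.\<close>

theorem weak_gradient_zero_set:
  fixes u :: "real^'n \<Rightarrow> real"
  assumes ug: "has_weak_gradient u g" and fu: "weighted_L2 0 u < \<infinity>" and fg: "weighted_L2 0 g < \<infinity>"
    and nn: "AE x in lborel. u x \<ge> 0"
  shows "AE x in lborel. u x = 0 \<longrightarrow> g x = 0"
proof -
  have [measurable]: "u \<in> borel_measurable borel" "g \<in> borel_measurable borel"
    using has_weak_gradientD(1,2)[OF ug] locally_integrable_measurable by blast+
  define \<epsilon> where "\<epsilon> k = 1 / real (Suc k)" for k
  have \<epsilon>: "\<epsilon> k > 0" "\<epsilon> k \<le> 1" for k by (auto simp: \<epsilon>_def)
  have \<epsilon>0: "\<epsilon> \<longlonglongrightarrow> 0" unfolding \<epsilon>_def using LIMSEQ_inverse_real_of_nat by (simp add: inverse_eq_divide)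
  let ?s = "\<lambda>k t. sqrt (t\<^sup>2 + (\<epsilon> k)\<^sup>2)"
  have sp: "?s k t > 0" for k t using \<epsilon>(1)[of k] by (simp add: add_nonneg_pos)
  have sa: "\<bar>t\<bar> \<le> ?s k t" for k t by (rule real_le_rsqrt) simp
  have der: "((\<lambda>t. ?s k t) has_real_derivative t / ?s k t) (at t)" for k t
  proof -
    have "t\<^sup>2 + (\<epsilon> k)\<^sup>2 > 0" using \<epsilon>(1)[of k] by (simp add: add_nonneg_pos)
    then show ?thesis by (auto intro!: derivative_eq_intros simp: field_simps)
  qed
  have der2: "((\<lambda>t. t / ?s k t) has_real_derivative (\<epsilon> k)\<^sup>2 / (?s k t) ^ 3) (at t)" for k t
  proof -
    have s2: "(?s k t)\<^sup>2 = t\<^sup>2 + (\<epsilon> k)\<^sup>2" by simp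
    have "((\<lambda>t. t / ?s k t) has_real_derivative (1 * ?s k t - t * (t / ?s k t)) / (?s k t * ?s k t)) (at t)"
      by (rule DERIV_divide[OF DERIV_ident der]) (use sp[of t k] in auto)
    moreover have "(1 * ?s k t - t * (t / ?s k t)) / (?s k t * ?s k t) = (\<epsilon> k)\<^sup>2 / (?s k t) ^ 3"
    proof -
      have "S > 0 \<Longrightarrow> S\<^sup>2 = t\<^sup>2 + E \<Longrightarrow> (1 * S - t * (t / S)) / (S * S) = E / S ^ 3" for S E :: real
        by (simp add: field_simps power2_eq_square power3_eq_cube)
      from this[OF sp s2] show ?thesis .
    qed
    ultimately show ?thesis by simp
  qed
  have lip: "\<bar>s / ?s k s - t / ?s k t\<bar> \<le> (1 / \<epsilon> k) * \<bar>s - t\<bar>" for k s t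
  proof -
    have "norm (s / ?s k s - t / ?s k t) \<le> (1 / \<epsilon> k) * norm (s - t)"
    proof (rule field_differentiable_bound[where S = UNIV and f' = "\<lambda>t. (\<epsilon> k)\<^sup>2 / (?s k t) ^ 3"])
      fix t
      have "\<epsilon> k \<le> ?s k t" by (rule real_le_rsqrt) simp
      then have "(\<epsilon> k) ^ 3 \<le> (?s k t) ^ 3" using \<epsilon>(1)[of k] by (intro power_mono) auto
      then have "(\<epsilon> k)\<^sup>2 / (?s k t) ^ 3 \<le> (\<epsilon> k)\<^sup>2 / (\<epsilon> k) ^ 3"
        using \<epsilon>(1)[of k] sp[of t k] by (intro divide_left_mono) auto
      also have "\<dots> = 1 / \<epsilon> k" using \<epsilon>(1)[of k] by (simp add: power2_eq_square power3_eq_cube)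
      finally show "norm ((\<epsilon> k)\<^sup>2 / (?s k t) ^ 3) \<le> 1 / \<epsilon> k" using sp[of t k] by (simp add: abs_of_pos)
    qed (use der2 in auto)
    then show ?thesis by simp
  qed
  have chain: "has_weak_gradient (\<lambda>x. ?s k (u x)) (\<lambda>x. (u x / ?s k (u x)) *\<^sub>R g x)" for k
    by (rule weak_chain_rule[OF ug fu fg der lip])
  have "has_weak_gradient u (\<lambda>x. sgn (u x) *\<^sub>R g x)"
    unfolding has_weak_gradient_def
  proof (intro conjI allI impI has_weak_gradientD(1)[OF ug])
    have gl: "locally_integrable g" by (rule has_weak_gradientD(2)[OF ug])
    show "locally_integrable (\<lambda>x. sgn (u x) *\<^sub>R g x)"
      unfolding locally_integrable_def
    proof (intro allI impI)
      fix K :: "(real^'n) set" assume K: "compact K"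
      then have [measurable]: "K \<in> sets borel" using compact_imp_closed by (intro borel_closed)
      have "set_integrable lborel K g" using gl K by (simp add: locally_integrable_def)
      then show "set_integrable lborel K (\<lambda>x. sgn (u x) *\<^sub>R g x)"
        unfolding set_integrable_def
        by (rule Bochner_Integration.integrable_bound) (auto intro!: AE_I2 simp: abs_sgn_eq indicator_def)
    qed
    fix \<phi> :: "real^'n \<Rightarrow> real" and i assume \<phi>: "test_function \<phi>"
    have [measurable]: "\<phi> \<in> borel_measurable borel" "partial_deriv i \<phi> \<in> borel_measurable borel"
      using test_function_measurable \<phi> test_function_partial by blast+
    have i1: "integrable lborel (\<lambda>x. \<bar>u x * partial_deriv i \<phi> x\<bar> + \<bar>partial_deriv i \<phi> x\<bar>)"
      using integrable_test_function_mult[OF has_weak_gradientD(1)[OF ug] test_function_partial[OF \<phi>]]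
        test_functionE[OF test_function_partial[OF \<phi>]]
        integrable_compact_support[OF test_function_continuous[OF test_function_partial[OF \<phi>]]]
      by (metis Bochner_Integration.integrable_add integrable_abs)
    have l1: "(\<lambda>k. \<integral>x. ?s k (u x) * partial_deriv i \<phi> x \<partial>lborel) \<longlonglongrightarrow> (\<integral>x. u x * partial_deriv i \<phi> x \<partial>lborel)"
    proof (rule integral_dominated_convergence[OF _ _ i1])
      show "AE x in lborel. (\<lambda>k. ?s k (u x) * partial_deriv i \<phi> x) \<longlonglongrightarrow> u x * partial_deriv i \<phi> x"
        using nn
      proof eventually_elim
        case (elim x)
        have "(\<lambda>k. ?s k (u x) * partial_deriv i \<phi> x) \<longlonglongrightarrow> sqrt ((u x)\<^sup>2 + 0\<^sup>2) * partial_deriv i \<phi> x"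
          by (intro tendsto_intros \<epsilon>0)
        then show ?case using elim by simp
      qed
      show "AE x in lborel. norm (?s k (u x) * partial_deriv i \<phi> x) \<le> \<bar>u x * partial_deriv i \<phi> x\<bar> + \<bar>partial_deriv i \<phi> x\<bar>" for k
      proof (rule AE_I2)
        fix x
        have "?s k (u x) \<le> \<bar>u x\<bar> + \<epsilon> k" using real_sqrt_sum_squares_triangle_ineq[of "u x" 0 0 "\<epsilon> k"] \<epsilon>(1)[of k] by simp
        then have "?s k (u x) \<le> \<bar>u x\<bar> + 1" using \<epsilon>(2)[of k] by linarith
        from mult_right_mono[OF this, of "\<bar>partial_deriv i \<phi> x\<bar>"]
        show "norm (?s k (u x) * partial_deriv i \<phi> x) \<le> \<bar>u x * partial_deriv i \<phi> x\<bar> + \<bar>partial_deriv i \<phi> x\<bar>"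
          by (simp add: abs_mult distrib_right)
      qed
    qed measurable
    have i2: "integrable lborel (\<lambda>x. \<bar>g x $ i * \<phi> x\<bar>)"
      using integrable_test_function_mult[OF locally_integrable_component[OF gl] \<phi>, of i] by simp
    have l2: "(\<lambda>k. \<integral>x. ((u x / ?s k (u x)) *\<^sub>R g x) $ i * \<phi> x \<partial>lborel) \<longlonglongrightarrow> (\<integral>x. (sgn (u x) *\<^sub>R g x) $ i * \<phi> x \<partial>lborel)"
    proof (rule integral_dominated_convergence[OF _ _ i2])
      show "AE x in lborel. (\<lambda>k. ((u x / ?s k (u x)) *\<^sub>R g x) $ i * \<phi> x) \<longlonglongrightarrow> (sgn (u x) *\<^sub>R g x) $ i * \<phi> x"
      proof (rule AE_I2)
        fix x
        have "(\<lambda>k. u x / ?s k (u x)) \<longlonglongrightarrow> sgn (u x)"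
        proof (cases "u x = 0")
          case False
          have "(\<lambda>k. u x / ?s k (u x)) \<longlonglongrightarrow> u x / sqrt ((u x)\<^sup>2 + 0\<^sup>2)"
            by (intro tendsto_intros \<epsilon>0) (use False in auto)
          then show ?thesis by (simp add: sgn_div_norm divide_inverse mult.commute)
        qed simp
        then show "(\<lambda>k. ((u x / ?s k (u x)) *\<^sub>R g x) $ i * \<phi> x) \<longlonglongrightarrow> (sgn (u x) *\<^sub>R g x) $ i * \<phi> x"
          unfolding vector_scaleR_component real_scaleR_def by (intro tendsto_intros)
      qed
      show "AE x in lborel. norm (((u x / ?s k (u x)) *\<^sub>R g x) $ i * \<phi> x) \<le> \<bar>g x $ i * \<phi> x\<bar>" for k
      proof (rule AE_I2)
        fix x
        have "\<bar>u x / ?s k (u x)\<bar> \<le> 1" using sa[of "u x" k] sp[of "u x" k] by (simp add: abs_divide)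
        from mult_right_mono[OF this, of "\<bar>g x $ i * \<phi> x\<bar>"]
        show "norm (((u x / ?s k (u x)) *\<^sub>R g x) $ i * \<phi> x) \<le> \<bar>g x $ i * \<phi> x\<bar>"
          by (simp add: abs_mult mult.assoc)
      qed
    qed measurable
    have "(\<lambda>k. \<integral>x. ?s k (u x) * partial_deriv i \<phi> x \<partial>lborel) \<longlonglongrightarrow> - (\<integral>x. (sgn (u x) *\<^sub>R g x) $ i * \<phi> x \<partial>lborel)"
      unfolding has_weak_gradientD(3)[OF chain \<phi>] by (rule tendsto_minus[OF l2])
    with l1 show "(\<integral>x. u x * partial_deriv i \<phi> x \<partial>lborel) = - (\<integral>x. (sgn (u x) *\<^sub>R g x) $ i * \<phi> x \<partial>lborel)"
      by (rule LIMSEQ_unique)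
  qed
  from weak_gradient_unique[OF ug this] show ?thesis by eventually_elim auto
qed

section \<open>Fisher information and entropy of Sobolev densities\<close>

lemma sqrt_density_facts:
  fixes f :: "real^'n \<Rightarrow> real"
  assumes f: "gaussian_prob_density f" and W: "gaussian_W12 (\<lambda>x. sqrt (f x))"
  shows "f \<in> borel_measurable borel" "AE x in lborel. f x \<ge> 0" "integrable \<gamma> f" "(\<integral>x. f x \<partial>\<gamma>) = 1"
    "weighted_L2 0 (\<lambda>x. sqrt (f x)) < \<infinity>"
    "\<exists>g. has_weak_gradient (\<lambda>x. sqrt (f x)) g \<and> weighted_L2 0 g < \<infinity>"
proof -
  show [measurable]: "f \<in> borel_measurable borel" and nn: "AE x in lborel. f x \<ge> 0"
    using f by (auto simp: gaussian_prob_density_def AE_gaussian_iff)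
  have nn': "AE x in \<gamma>. f x \<ge> 0" using nn by (simp add: AE_gaussian_iff)
  interpret D: prob_space "density \<gamma> (\<lambda>x. ennreal (f x))"
    using f by (simp add: gaussian_prob_density_def)
  have 1: "(\<integral>\<^sup>+x. ennreal (f x) \<partial>\<gamma>) = 1"
    using D.emeasure_space_1 by (simp add: emeasure_density)
  show i: "integrable \<gamma> f" using nn' by (intro integrableI_nonneg) (auto simp: 1)
  have "ennreal (\<integral>x. f x \<partial>\<gamma>) = 1" using nn_integral_eq_integral[OF i nn'] 1 by simp
  then show "(\<integral>x. f x \<partial>\<gamma>) = 1" by simp
  show "weighted_L2 0 (\<lambda>x. sqrt (f x)) < \<infinity>"
  proof -
    have "weighted_L2 0 (\<lambda>x. sqrt (f x)) = (\<integral>\<^sup>+x. ennreal (f x) \<partial>\<gamma>)"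
      unfolding weighted_L2_def by (rule nn_integral_cong_AE) (use nn' in eventually_elim, simp)
    then show ?thesis by (simp add: 1)
  qed
  obtain g where g: "has_weak_gradient (\<lambda>x. sqrt (f x)) g" "Lp_space \<gamma> 2 g"
    using W by (auto simp: gaussian_W12_def)
  have "weighted_L2 0 g < \<infinity>"
  proof -
    have "integrable \<gamma> (\<lambda>x. norm (g x) powr 2)" using g(2) by (simp add: Lp_space_def)
    then have "integrable \<gamma> (\<lambda>x. (norm (g x))\<^sup>2)" by simp
    then show ?thesis unfolding weighted_L2_def integrable_iff_bounded by simp
  qed
  with g(1) show "\<exists>g. has_weak_gradient (\<lambda>x. sqrt (f x)) g \<and> weighted_L2 0 g < \<infinity>" by blast
qed

text \<open>The square of \<open>\<surd>f\<close> is \<open>f\<close> only almost everywhere: where \<open>f\<close> is negative it is \<open>- f\<close>.\<close>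

lemma has_weak_gradient_cong_AE:
  fixes u v :: "real^'n \<Rightarrow> real"
  assumes ug: "has_weak_gradient u g" and [measurable]: "v \<in> borel_measurable borel" and uv: "AE x in lborel. u x = v x"
  shows "has_weak_gradient v g"
  unfolding has_weak_gradient_def
proof (intro conjI allI impI has_weak_gradientD(2)[OF ug])
  have [measurable]: "u \<in> borel_measurable borel"
    by (rule locally_integrable_measurable[OF has_weak_gradientD(1)[OF ug]])
  show "locally_integrable v" unfolding locally_integrable_def
  proof (intro allI impI)
    fix K :: "(real^'n) set" assume K: "compact K"
    then have [measurable]: "K \<in> sets borel" using compact_imp_closed by (intro borel_closed)
    have "integrable lborel (\<lambda>x. indicator K x *\<^sub>R u x)"
      using has_weak_gradientD(1)[OF ug] K by (simp add: locally_integrable_def set_integrable_def)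
    moreover have "integrable lborel (\<lambda>x. indicator K x *\<^sub>R u x) \<longleftrightarrow> integrable lborel (\<lambda>x. indicator K x *\<^sub>R v x)"
      by (rule integrable_cong_AE) (measurable, use uv in eventually_elim, simp)
    ultimately show "set_integrable lborel K v" by (simp add: set_integrable_def)
  qed
  fix \<phi> :: "real^'n \<Rightarrow> real" and i assume \<phi>: "test_function \<phi>"
  have [measurable]: "partial_deriv i \<phi> \<in> borel_measurable borel"
    by (rule test_function_measurable[OF test_function_partial[OF \<phi>]])
  have "(\<integral>x. v x * partial_deriv i \<phi> x \<partial>lborel) = (\<integral>x. u x * partial_deriv i \<phi> x \<partial>lborel)"
    by (rule integral_cong_AE) (measurable, use uv in eventually_elim, simp)
  then show "(\<integral>x. v x * partial_deriv i \<phi> x \<partial>lborel) = - (\<integral>x. g x $ i * \<phi> x \<partial>lborel)"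
    using has_weak_gradientD(3)[OF ug \<phi>] by simp
qed

text \<open>The chain rule for the square gives \<open>\<nabla>f = 2 \<surd>f g\<close>. On \<open>{f > 0}\<close> the two integrands agree;
  on \<open>{f = 0}\<close> the left one is \<open>0\<close> because division by \<open>0\<close> yields \<open>0\<close>, and the right one is
  \<open>0\<close> because \<open>g\<close> vanishes there almost everywhere.\<close>

theorem fisher_information_eq:
  fixes f :: "real^'n \<Rightarrow> real"
  assumes [measurable]: "f \<in> borel_measurable borel" and nn: "AE x in lborel. f x \<ge> 0"
    and ug: "has_weak_gradient (\<lambda>x. sqrt (f x)) g" and fu: "weighted_L2 0 (\<lambda>x. sqrt (f x)) < \<infinity>" and fg: "weighted_L2 0 g < \<infinity>"
  shows "fisher_information f = 4 * (\<integral>x. (norm (g x))\<^sup>2 \<partial>\<gamma>)"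
proof -
  have "has_weak_gradient (\<lambda>x. (sqrt (f x))\<^sup>2) (\<lambda>x. (2 * sqrt (f x)) *\<^sub>R g x)"
  proof (rule weak_chain_rule[OF ug fu fg])
    show "((\<lambda>t. t\<^sup>2) has_real_derivative 2 * t) (at t)" for t :: real
      by (auto intro!: derivative_eq_intros)
    show "\<bar>2 * s - 2 * t\<bar> \<le> 2 * \<bar>s - t\<bar>" for s t :: real by (simp add: abs_if)
  qed
  then have w: "has_weak_gradient f (\<lambda>x. (2 * sqrt (f x)) *\<^sub>R g x)"
    by (rule has_weak_gradient_cong_AE) (measurable, use nn in eventually_elim, simp)
  have wf: "has_weak_gradient f (weak_gradient f)"
    unfolding weak_gradient_def by (rule someI[of "has_weak_gradient f", OF w])
  have [measurable]: "g \<in> borel_measurable borel" "weak_gradient f \<in> borel_measurable borel"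
    using has_weak_gradientD(2)[OF ug] has_weak_gradientD(2)[OF wf] locally_integrable_measurable by blast+
  have "AE x in lborel. sqrt (f x) \<ge> 0" using nn by eventually_elim simp
  note z = weak_gradient_zero_set[OF ug fu fg this]
  have "fisher_information f = (\<integral>x. 4 * (norm (g x))\<^sup>2 \<partial>\<gamma>)"
    unfolding fisher_information_def
  proof (rule integral_cong_AE)
    show "AE x in \<gamma>. (norm (weak_gradient f x))\<^sup>2 / f x = 4 * (norm (g x))\<^sup>2"
      unfolding AE_gaussian_iff using nn z weak_gradient_unique[OF wf w]
    proof eventually_elim
      case (elim x)
      show ?case
      proof (cases "f x = 0")
        case True then show ?thesis using elim by simp
      next
        case False
        then have "f x > 0" using elim by simp
        then show ?thesis using elim by (simp add: power_mult_distrib)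
      qed
    qed
  qed measurable
  then show ?thesis by simp
qed

lemma xlnx_ge: "t * ln t \<ge> - 1" if "t \<ge> 0" for t :: real
proof (cases "t = 0")
  case False
  then have t: "t > 0" using that by simp
  have "1 - 1 / t \<le> ln t" using ln_le_minus_one[of "1 / t"] t by (simp add: ln_div)
  from mult_left_mono[OF this that] show ?thesis using t by (simp add: algebra_simps)
qed simp

text \<open>At the limit \<open>0\<close> continuity comes from \<open>|t ln t| \<le> 2 \<surd>t\<close> for \<open>0 < t < 1\<close>.\<close>

lemma tendsto_xlnx:
  fixes X :: "nat \<Rightarrow> real"
  assumes X: "X \<longlonglongrightarrow> t" and pos: "\<And>n. X n > 0"
  shows "(\<lambda>n. X n * ln (X n)) \<longlonglongrightarrow> t * ln t"
proof -
  have "t \<ge> 0" by (rule LIMSEQ_le_const[OF X]) (use pos in \<open>auto intro: less_imp_le\<close>)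
  show ?thesis
  proof (cases "t = 0")
    case False
    then show ?thesis by (intro tendsto_intros X)
  next
    case True
    have "(\<lambda>n. X n * ln (X n)) \<longlonglongrightarrow> 0"
    proof (rule Lim_null_comparison)
      have "\<forall>\<^sub>F n in sequentially. X n < 1" using order_tendstoD(2)[OF X, of 1] True by simp
      then show "\<forall>\<^sub>F n in sequentially. norm (X n * ln (X n)) \<le> 2 * sqrt (X n)"
      proof eventually_elim
        case (elim n)
        define r where "r = sqrt (X n)"
        have r: "r > 0" "X n = r * r" using pos[of n] by (auto simp: r_def)
        have "ln (1 / r) \<le> 1 / r - 1" using r by (intro ln_le_minus_one) simp
        then have l: "- ln r \<le> 1 / r" using r by (simp add: ln_div)
        have "ln (X n) \<le> 0" using elim pos[of n] by simp
        then have "norm (X n * ln (X n)) = r * r * (2 * (- ln r))"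
          using r by (simp add: abs_mult ln_mult)
        also have "\<dots> \<le> r * r * (2 * (1 / r))" using l r by (intro mult_left_mono) auto
        also have "\<dots> = 2 * r" using r by simp
        finally show ?case by (simp add: r_def)
      qed
      have "(\<lambda>n. 2 * sqrt (X n)) \<longlonglongrightarrow> 2 * sqrt 0" using X True by (intro tendsto_intros) simp
      then show "(\<lambda>n. 2 * sqrt (X n)) \<longlonglongrightarrow> 0" by simp
    qed
    then show ?thesis using True by simp
  qed
qed

text \<open>Fatou's lemma along an almost everywhere convergent subsequence, applied to \<open>t ln t + 1\<close>,
  which is nonnegative. It also shows that \<open>f ln f\<close> is integrable, so that the Bochner
  integral on the left is the true entropy and not a default value.\<close>

lemma entropy_lower_semicontinuous:
  fixes f :: "real^'n \<Rightarrow> real"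
  assumes [measurable]: "f \<in> borel_measurable borel" "\<And>k. F k \<in> borel_measurable borel"
    and nn: "AE x in \<gamma>. f x \<ge> 0" and pos: "\<And>k x. F k x > 0"
    and i: "integrable \<gamma> f" "\<And>k. integrable \<gamma> (F k)" and iE: "\<And>k. integrable \<gamma> (\<lambda>x. F k x * ln (F k x))"
    and L1: "(\<lambda>k. \<integral>x. \<bar>F k x - f x\<bar> \<partial>\<gamma>) \<longlonglongrightarrow> 0"
    and U: "\<And>k. (\<integral>x. F k x * ln (F k x) \<partial>\<gamma>) \<le> U k" "U \<longlonglongrightarrow> U0"
  shows "(\<integral>x. f x * ln (f x) \<partial>\<gamma>) \<le> U0"
proof -
  have L1': "(\<lambda>k. \<integral>x. norm (F k x - f x) \<partial>\<gamma>) \<longlonglongrightarrow> 0" using L1 by simp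
  obtain r where r: "strict_mono r" "AE x in \<gamma>. (\<lambda>n. F (r n) x) \<longlonglongrightarrow> f x"
  proof -
    have "\<exists>r. strict_mono r \<and> (AE x in \<gamma>. (\<lambda>n. F (r n) x - f x) \<longlonglongrightarrow> 0)"
      using tendsto_L1_AE_subseq[of \<gamma> "\<lambda>k x. F k x - f x"] i L1' by simp
    then obtain r where r: "strict_mono r" "AE x in \<gamma>. (\<lambda>n. F (r n) x - f x) \<longlonglongrightarrow> 0" by blast
    from r(2) have "AE x in \<gamma>. (\<lambda>n. F (r n) x) \<longlonglongrightarrow> f x" by eventually_elim (simp add: LIM_zero_iff)
    with r(1) show ?thesis by (rule that)
  qed
  have pos1: "F k x * ln (F k x) + 1 \<ge> 0" for k x using xlnx_ge[OF less_imp_le[OF pos[of k x]]] by linarith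
  have "(\<integral>\<^sup>+x. ennreal (f x * ln (f x) + 1) \<partial>\<gamma>) = (\<integral>\<^sup>+x. liminf (\<lambda>n. ennreal (F (r n) x * ln (F (r n) x) + 1)) \<partial>\<gamma>)"
  proof (rule nn_integral_cong_AE)
    show "AE x in \<gamma>. ennreal (f x * ln (f x) + 1) = liminf (\<lambda>n. ennreal (F (r n) x * ln (F (r n) x) + 1))"
      using r(2)
    proof eventually_elim
      case (elim x)
      have "(\<lambda>n. ennreal (F (r n) x * ln (F (r n) x) + 1)) \<longlonglongrightarrow> ennreal (f x * ln (f x) + 1)"
        by (intro tendsto_intros tendsto_xlnx elim pos)
      from lim_imp_Liminf[OF _ this] show ?case by simp
    qed
  qed
  also have "\<dots> \<le> liminf (\<lambda>n. \<integral>\<^sup>+x. ennreal (F (r n) x * ln (F (r n) x) + 1) \<partial>\<gamma>)"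
    by (rule nn_integral_liminf) measurable
  also have "\<dots> \<le> liminf (\<lambda>n. ennreal (U (r n) + 1))"
  proof (intro Liminf_mono always_eventually allI)
    fix n
    have "(\<integral>\<^sup>+x. ennreal (F (r n) x * ln (F (r n) x) + 1) \<partial>\<gamma>) = ennreal (\<integral>x. F (r n) x * ln (F (r n) x) + 1 \<partial>\<gamma>)"
      using iE[of "r n"] pos1 by (intro nn_integral_eq_integral) auto
    also have "(\<integral>x. F (r n) x * ln (F (r n) x) + 1 \<partial>\<gamma>) = (\<integral>x. F (r n) x * ln (F (r n) x) \<partial>\<gamma>) + 1"
      using iE[of "r n"] by (simp add: gaussian.prob_space[simplified])
    also have "ennreal \<dots> \<le> ennreal (U (r n) + 1)" using U(1)[of "r n"] by (intro ennreal_leI) simp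
    finally show "(\<integral>\<^sup>+x. ennreal (F (r n) x * ln (F (r n) x) + 1) \<partial>\<gamma>) \<le> ennreal (U (r n) + 1)" .
  qed
  also have "\<dots> = ennreal (U0 + 1)"
  proof -
    have "(\<lambda>n. U (r n)) \<longlonglongrightarrow> U0" using LIMSEQ_subseq_LIMSEQ[OF U(2) r(1)] by (simp add: o_def)
    then have "(\<lambda>n. ennreal (U (r n) + 1)) \<longlonglongrightarrow> ennreal (U0 + 1)" by (intro tendsto_intros)
    from lim_imp_Liminf[OF _ this] show ?thesis by simp
  qed
  finally have le: "(\<integral>\<^sup>+x. ennreal (f x * ln (f x) + 1) \<partial>\<gamma>) \<le> ennreal (U0 + 1)" .
  have "U0 + 1 \<ge> 0"
  proof (rule LIMSEQ_le_const)
    show "(\<lambda>n. U n + 1) \<longlonglongrightarrow> U0 + 1" by (intro tendsto_intros U(2))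
    have "0 \<le> (\<integral>x. F n x * ln (F n x) + 1 \<partial>\<gamma>)" for n using pos1 by (intro integral_nonneg_AE AE_I2)
    moreover have "(\<integral>x. F n x * ln (F n x) + 1 \<partial>\<gamma>) = (\<integral>x. F n x * ln (F n x) \<partial>\<gamma>) + 1" for n
      using iE[of n] by (simp add: gaussian.prob_space[simplified])
    ultimately have "0 \<le> U n + 1" for n using U(1)[of n] by (metis add_mono_thms_linordered_semiring(3) order_trans)
    then show "\<exists>N. \<forall>n\<ge>N. 0 \<le> U n + 1" by blast
  qed
  have nn1: "AE x in \<gamma>. 0 \<le> f x * ln (f x) + 1"
    using nn by eventually_elim (use xlnx_ge in \<open>fastforce\<close>)
  have i1: "integrable \<gamma> (\<lambda>x. f x * ln (f x) + 1)"
    by (rule integrableI_nonneg[OF _ nn1]) (use le in \<open>auto intro: le_less_trans\<close>)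
  then have "integrable \<gamma> (\<lambda>x. (f x * ln (f x) + 1) - 1)" by (rule Bochner_Integration.integrable_diff) simp
  then have i2: "integrable \<gamma> (\<lambda>x. f x * ln (f x))" by simp
  have "ennreal (\<integral>x. f x * ln (f x) + 1 \<partial>\<gamma>) \<le> ennreal (U0 + 1)"
    using le unfolding nn_integral_eq_integral[OF i1 nn1] .
  then have "(\<integral>x. f x * ln (f x) + 1 \<partial>\<gamma>) \<le> U0 + 1"
    unfolding ennreal_le_iff[OF \<open>U0 + 1 \<ge> 0\<close>] .
  then show ?thesis using i2 by (simp add: gaussian.prob_space[simplified])
qed

section \<open>Stability of the logarithmic Sobolev inequality in \<open>L\<^sup>1\<close>\<close>

lemma bounded_C1_square_plus:
  assumes vV: "bounded_C1 v V" and m: "m \<ge> 0"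
  shows "bounded_C1 (\<lambda>x. (v x)\<^sup>2 + m) (\<lambda>x. (2 * v x) *\<^sub>R V x)"
proof -
  obtain B where B: "B > 0" "\<And>x. \<bar>v x\<bar> \<le> B" "\<And>x. norm (V x) \<le> B" using bounded_C1_bound[OF vV] by blast
  show ?thesis unfolding bounded_C1_def
  proof (intro conjI allI exI[of _ "2 * B\<^sup>2 + m"])
    fix x
    have "((\<lambda>x. (v x)\<^sup>2 + m) has_derivative (\<lambda>h. 2 * v x * (V x \<bullet> h))) (at x)"
      by (auto intro!: derivative_eq_intros bounded_C1_has_derivative[OF vV])
    then show "((\<lambda>x. (v x)\<^sup>2 + m) has_derivative (\<lambda>h. ((2 * v x) *\<^sub>R V x) \<bullet> h)) (at x)" by simp
    have "(v x)\<^sup>2 \<le> B\<^sup>2" using power_mono[OF B(2)[of x], of 2] by simp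
    then have "(v x)\<^sup>2 + m \<le> 2 * B\<^sup>2 + m" using zero_le_power2[of B] by linarith
    then show "\<bar>(v x)\<^sup>2 + m\<bar> \<le> 2 * B\<^sup>2 + m" using m by (simp add: abs_of_nonneg)
    have "norm ((2 * v x) *\<^sub>R V x) = 2 * (\<bar>v x\<bar> * norm (V x))" by (simp add: abs_mult)
    also have "\<dots> \<le> 2 * (B * B)" using B by (intro mult_left_mono mult_mono) auto
    finally show "norm ((2 * v x) *\<^sub>R V x) \<le> 2 * B\<^sup>2 + m" using m by (simp add: power2_eq_square)
  next
    show "continuous_on UNIV (\<lambda>x. (2 * v x) *\<^sub>R V x)"
      by (intro continuous_intros bounded_C1_continuous[OF vV] bounded_C1_continuous_grad[OF vV])
  qed
qed

text \<open>The constant \<open>m\<close> provides the positive lower bound that the smooth theory needs, at no cost in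
  Fisher information:
  \<open>|\<nabla>F|\<^sup>2 / F = 4 v\<^sup>2 |\<nabla>v|\<^sup>2 / (v\<^sup>2 + m) \<le> 4 |\<nabla>v|\<^sup>2\<close>.
  The gap \<open>R\<close> is eliminated in favour of the oscillation of \<open>F\<close>, a quantity that is continuous
  in \<open>L\<^sup>1\<close>.\<close>

theorem deficit_bound_bounded_C1:
  fixes v :: "real^'n \<Rightarrow> real"
  assumes vV: "bounded_C1 v V" and m: "m > 0" and a: "a > 0" "a < 1 / 2"
    and F: "\<And>x. F x = (v x)\<^sup>2 + m" and c: "c = pi / 2 * (\<integral>x. norm (x::real^'n) \<partial>\<gamma>) + 1"
    and Q: "Q = (\<integral>x. F x * exp (a * (norm x)\<^sup>2) \<partial>\<gamma>)"
    and S: "S = max 0 ((\<integral>p. \<bar>F (fst p) - F (snd p)\<bar> \<partial>(\<gamma> \<Otimes>\<^sub>M \<gamma>)) - c * norm (\<integral>x. F x *\<^sub>R x \<partial>\<gamma>))"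
  shows "Q > 0" "(\<integral>x. F x * ln (F x) \<partial>\<gamma>) \<le> 2 * (\<integral>x. (norm (V x))\<^sup>2 \<partial>\<gamma>) + (\<integral>x. F x \<partial>\<gamma>) * ln (\<integral>x. F x \<partial>\<gamma>)
     - a / (2 * (1 + a)) * (S\<^sup>2 / (4 * c\<^sup>2 * Q))"
proof -
  let ?G = "\<lambda>x. (2 * v x) *\<^sub>R V x"
  have "F = (\<lambda>x. (v x)\<^sup>2 + m)" using F by auto
  then have FG: "bounded_C1 F ?G" using bounded_C1_square_plus[OF vV, of m] m by simp
  have mF: "m \<le> F x" for x by (simp add: F)
  have F0: "F x > 0" for x using mF[of x] m by linarith
  obtain B where B: "B > 0" "\<And>x. \<bar>F x\<bar> \<le> B" "\<And>x. norm (?G x) \<le> B" using bounded_C1_bound[OF FG] by blast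
  obtain BV where BV: "BV > 0" "\<And>x. \<bar>v x\<bar> \<le> BV" "\<And>x. norm (V x) \<le> BV" using bounded_C1_bound[OF vV] by blast
  note [measurable] = bounded_C1_measurable[OF FG] bounded_C1_measurable[OF vV]
  have iQ: "integrable \<gamma> (\<lambda>x. F x * exp (a * (norm x)\<^sup>2))"
    by (rule Bochner_Integration.integrable_bound[OF integrable_mult_right[OF integrable_gaussian_exp_square[OF a(2)], of B]])
       (use B in \<open>auto intro!: AE_I2 simp: abs_mult mult_right_mono\<close>)
  have "m \<le> Q" unfolding Q
  proof (rule gaussian.integral_ge_const[OF iQ], rule AE_I2)
    fix x :: "real^'n"
    have "m * 1 \<le> F x * exp (a * (norm x)\<^sup>2)" using mF[of x] m a by (intro mult_mono) auto
    then show "m \<le> F x * exp (a * (norm x)\<^sup>2)" by simp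
  qed
  then show Q0: "Q > 0" using m by linarith
  have Z0: "(\<integral>x. norm (x::real^'n) \<partial>\<gamma>) \<ge> 0" by simp
  have c1: "c \<ge> 1" using Z0 unfolding c by simp
  obtain R where R: "R \<ge> 0" "(\<integral>x. norm (?G x) \<partial>\<gamma>) \<le> 2 * sqrt (R * Q) + norm (\<integral>x. F x *\<^sub>R x \<partial>\<gamma>)"
    "(\<integral>x. F x * ln (F x) \<partial>\<gamma>) - (\<integral>x. F x \<partial>\<gamma>) * ln (\<integral>x. F x \<partial>\<gamma>)
       \<le> (\<integral>x. (norm (?G x))\<^sup>2 / F x \<partial>\<gamma>) / 2 - a / (2 * (1 + a)) * R"
    using gradient_L1_bound[OF FG m mF a] unfolding Q by blast
  have "(\<integral>p. \<bar>F (fst p) - F (snd p)\<bar> \<partial>(\<gamma> \<Otimes>\<^sub>M \<gamma>)) \<le> (c - 1) * (\<integral>x. norm (?G x) \<partial>\<gamma>)"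
    using gaussian_L1_poincare[OF FG] by (simp add: c)
  also have "\<dots> \<le> c * (\<integral>x. norm (?G x) \<partial>\<gamma>)" by (intro mult_right_mono) auto
  also have "\<dots> \<le> c * (2 * sqrt (R * Q) + norm (\<integral>x. F x *\<^sub>R x \<partial>\<gamma>))" using R(2) c1 by (intro mult_left_mono) auto
  finally have "S \<le> 2 * c * sqrt (R * Q)"
    unfolding S using c1 R(1) Q0 by (simp add: algebra_simps)
  moreover have "S \<ge> 0" by (simp add: S)
  ultimately have "S\<^sup>2 \<le> (2 * c * sqrt (R * Q))\<^sup>2" by (intro power_mono)
  also have "\<dots> = R * (4 * c\<^sup>2 * Q)" using R(1) Q0 by (simp add: power_mult_distrib)
  finally have SR: "S\<^sup>2 / (4 * c\<^sup>2 * Q) \<le> R" using c1 Q0 by (simp add: divide_le_eq)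
  have "(\<integral>x. (norm (?G x))\<^sup>2 / F x \<partial>\<gamma>) \<le> (\<integral>x. 4 * (norm (V x))\<^sup>2 \<partial>\<gamma>)"
  proof (rule integral_mono)
    show "integrable \<gamma> (\<lambda>x. (norm (?G x))\<^sup>2 / F x)"
      by (rule integrable_gaussian_bounded[of _ "B\<^sup>2 / m"]) (use fisher_bounds[OF FG m mF B(3)] in auto)
    show "integrable \<gamma> (\<lambda>x. 4 * (norm (V x))\<^sup>2)"
      by (rule integrable_gaussian_bounded[of _ "4 * BV\<^sup>2"]) (use BV in \<open>auto intro: power_mono\<close>)
    fix x
    have "(norm (?G x))\<^sup>2 = (4 * (norm (V x))\<^sup>2) * (v x)\<^sup>2" by (simp add: power_mult_distrib)
    also have "\<dots> \<le> (4 * (norm (V x))\<^sup>2) * F x" using m by (intro mult_left_mono) (auto simp: F)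
    finally show "(norm (?G x))\<^sup>2 / F x \<le> 4 * (norm (V x))\<^sup>2" using F0[of x] by (simp add: divide_le_eq)
  qed
  then have "(\<integral>x. (norm (?G x))\<^sup>2 / F x \<partial>\<gamma>) / 2 \<le> 2 * (\<integral>x. (norm (V x))\<^sup>2 \<partial>\<gamma>)" by simp
  moreover have "a / (2 * (1 + a)) * (S\<^sup>2 / (4 * c\<^sup>2 * Q)) \<le> a / (2 * (1 + a)) * R"
    using SR a by (intro mult_left_mono) auto
  ultimately show "(\<integral>x. F x * ln (F x) \<partial>\<gamma>) \<le> 2 * (\<integral>x. (norm (V x))\<^sup>2 \<partial>\<gamma>) + (\<integral>x. F x \<partial>\<gamma>) * ln (\<integral>x. F x \<partial>\<gamma>)
     - a / (2 * (1 + a)) * (S\<^sup>2 / (4 * c\<^sup>2 * Q))"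
    using R(3) by linarith
qed

text \<open>All terms of the smooth estimate converge along the approximation: the oscillations, moments and
  barycentres because the squares converge in \<open>L\<^sup>1\<close> with weight \<open>exp (a |x|\<^sup>2)\<close>,
  the Fisher informations up to an upper bound. The entropy is bounded in the limit by lower
  semicontinuity. Finally, \<open>\<integral> |f - 1| d\<gamma>\<close> is at most the oscillation since \<open>1\<close> is the mean
  of \<open>f\<close>.\<close>

theorem log_sobolev_L1_stability:
  assumes a: "a > 0" "a < 1 / 2"
  shows "\<exists>K>0. \<forall>(f :: real^'n \<Rightarrow> real) Q. gaussian_prob_density f \<longrightarrow> centered (density \<gamma> (\<lambda>x. ennreal (f x)))
     \<longrightarrow> gaussian_W12 (\<lambda>x. sqrt (f x)) \<longrightarrow> (\<integral>\<^sup>+x. ennreal (f x * exp (a * (norm x)\<^sup>2)) \<partial>\<gamma>) \<le> ennreal Q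
     \<longrightarrow> Q \<ge> 0 \<longrightarrow> (\<integral>x. \<bar>f x - 1\<bar> \<partial>\<gamma>)\<^sup>2 \<le> K * Q * log_sobolev_deficit f"
proof -
  \<comment> \<open>The Poincare constant; adding \<open>1\<close> makes it visibly positive.\<close>
  define c where "c = pi / 2 * (\<integral>x. norm (x::real^'n) \<partial>\<gamma>) + 1"
  define \<kappa> where "\<kappa> = a / (2 * (1 + a))"
  have c0: "c > 0" unfolding c_def by (intro add_nonneg_pos mult_nonneg_nonneg) auto
  have \<kappa>0: "\<kappa> > 0" unfolding \<kappa>_def using a by simp
  define K where "K = 4 * c\<^sup>2 / \<kappa>"
  have K0: "K > 0" unfolding K_def using c0 \<kappa>0 by simp
  show ?thesis
  proof (intro exI[of _ K] conjI K0 allI impI)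
    fix f :: "real^'n \<Rightarrow> real" and Q
    assume f: "gaussian_prob_density f" and cen: "centered (density \<gamma> (\<lambda>x. ennreal (f x)))"
      and W: "gaussian_W12 (\<lambda>x. sqrt (f x))" and Qf: "(\<integral>\<^sup>+x. ennreal (f x * exp (a * (norm x)\<^sup>2)) \<partial>\<gamma>) \<le> ennreal Q" and Q0: "Q \<ge> 0"
    note fs = sqrt_density_facts[OF f W]
    note [measurable] = fs(1)
    define u where "u x = sqrt (f x)" for x
    have [measurable]: "u \<in> borel_measurable borel" unfolding u_def by measurable
    obtain g where ug: "has_weak_gradient u g" and fg: "weighted_L2 0 g < \<infinity>"
      using fs(6) unfolding u_def[abs_def] by blast
    have [measurable]: "g \<in> borel_measurable borel"
      by (rule locally_integrable_measurable[OF has_weak_gradientD(2)[OF ug]])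
    have nn: "AE x in \<gamma>. f x \<ge> 0" using fs(2) by (simp add: AE_gaussian_iff)
    have uf: "AE x in \<gamma>. (u x)\<^sup>2 = f x" using nn by eventually_elim (simp add: u_def)
    let ?w = "\<lambda>x::real^'n. exp (a * (norm x)\<^sup>2)"
    have w1: "?w x \<ge> 1" for x using a by simp
    have wi: "integrable \<gamma> ?w" by (rule integrable_gaussian_exp_square[OF a(2)])
    have fu: "weighted_L2 a u \<le> ennreal Q"
    proof -
      have "weighted_L2 a u = (\<integral>\<^sup>+x. ennreal (f x * ?w x) \<partial>\<gamma>)"
        unfolding weighted_L2_def by (rule nn_integral_cong_AE) (use uf in eventually_elim, simp)
      then show ?thesis using Qf by simp
    qed
    then have fu': "weighted_L2 a u < \<infinity>" by (auto intro: le_less_trans)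
    note uw = weighted_L2_real[OF _ fu Q0, simplified]
    have fw: "integrable \<gamma> (\<lambda>x. f x * ?w x)"
    proof -
      have "integrable \<gamma> (\<lambda>x. f x * ?w x) \<longleftrightarrow> integrable \<gamma> (\<lambda>x. (u x)\<^sup>2 * ?w x)"
        by (rule integrable_cong_AE) (measurable, use uf in eventually_elim, simp)
      then show ?thesis using uw(1) by simp
    qed
    define Qt where "Qt = (\<integral>x. f x * ?w x \<partial>\<gamma>)"
    have Qt: "Qt = (\<integral>x. (u x)\<^sup>2 * ?w x \<partial>\<gamma>)"
      unfolding Qt_def by (rule integral_cong_AE) (measurable, use uf in eventually_elim, simp)
    have QtQ: "Qt \<le> Q" unfolding Qt using uw(2) by simp
    have Qt1: "Qt \<ge> 1"
    proof -
      have "(\<integral>x. f x \<partial>\<gamma>) \<le> Qt" unfolding Qt_def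
      proof (rule integral_mono_AE[OF fs(3) fw])
        show "AE x in \<gamma>. f x \<le> f x * ?w x" using nn
          by eventually_elim (use w1 in \<open>metis mult.right_neutral mult_left_mono\<close>)
      qed
      then show ?thesis using fs(4) by simp
    qed
    define \<epsilon> where "\<epsilon> k = 1 / real (Suc k)" for k
    have \<epsilon>0: "\<epsilon> \<longlonglongrightarrow> 0" unfolding \<epsilon>_def using LIMSEQ_inverse_real_of_nat by (simp add: inverse_eq_divide)
    have \<epsilon>p: "\<epsilon> k > 0" for k by (simp add: \<epsilon>_def)
    have "\<exists>p. bounded_C1 (fst p) (snd p) \<and> weighted_L2 a (\<lambda>x. fst p x - u x) \<le> ennreal (\<epsilon> k) \<and> weighted_L2 0 (\<lambda>x. snd p x - g x) \<le> ennreal (\<epsilon> k)" for k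
      using weak_gradient_approximation[OF ug _ _ fu' fg \<epsilon>p[of k]] a by simp
    then obtain P where P: "\<forall>k. bounded_C1 (fst (P k)) (snd (P k)) \<and> weighted_L2 a (\<lambda>x. fst (P k) x - u x) \<le> ennreal (\<epsilon> k) \<and> weighted_L2 0 (\<lambda>x. snd (P k) x - g x) \<le> ennreal (\<epsilon> k)"
      using choice[of "\<lambda>k p. bounded_C1 (fst p) (snd p) \<and> weighted_L2 a (\<lambda>x. fst p x - u x) \<le> ennreal (\<epsilon> k) \<and> weighted_L2 0 (\<lambda>x. snd p x - g x) \<le> ennreal (\<epsilon> k)"] by blast
    define v V where "v k = fst (P k)" and "V k = snd (P k)" for k
    have vV: "bounded_C1 (v k) (V k)" and vu: "weighted_L2 a (\<lambda>x. v k x - u x) \<le> ennreal (\<epsilon> k)"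
      and Vg: "weighted_L2 0 (\<lambda>x. V k x - g x) \<le> ennreal (\<epsilon> k)" for k
      using P[rule_format, of k] unfolding v_def V_def by blast+
    note [measurable] = bounded_C1_measurable[OF vV]
    define F where "F k x = (v k x)\<^sup>2 + \<epsilon> k" for k x
    have FC1: "bounded_C1 (F k) (\<lambda>x. (2 * v k x) *\<^sub>R V k x)" for k
      unfolding F_def using bounded_C1_square_plus[OF vV] \<epsilon>p[of k] by simp
    note [measurable] = bounded_C1_measurable[OF FC1]
    have F0: "F k x > 0" for k x unfolding F_def using \<epsilon>p by (simp add: add_nonneg_pos)
    define e where "e k = sqrt (\<epsilon> k)" for k
    have e0: "e \<longlonglongrightarrow> 0" using tendsto_real_sqrt[OF \<epsilon>0] unfolding e_def[abs_def] by (simp only: real_sqrt_zero)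
    have ep: "e k \<ge> 0" "e k * e k = \<epsilon> k" for k using \<epsilon>p[of k] by (auto simp: e_def)
    let ?W = "\<integral>x. ?w x \<partial>\<gamma>"
    define E where "E k = 2 * (sqrt Qt * e k) + \<epsilon> k + \<epsilon> k * ?W" for k
    have E0: "E \<longlonglongrightarrow> 0"
    proof -
      have "E \<longlonglongrightarrow> 2 * (sqrt Qt * 0) + 0 + 0 * ?W" unfolding E_def by (intro tendsto_intros e0 \<epsilon>0)
      then show ?thesis by simp
    qed
    \<comment> \<open>With \<open>f = u\<^sup>2\<close>, the difference is \<open>2 u (v - u) + (v - u)\<^sup>2 + \<epsilon>\<close>;
      half of the weight goes to each factor of the product.\<close>
    have Ff: "integrable \<gamma> (\<lambda>x. \<bar>F k x - f x\<bar> * ?w x)" "(\<integral>x. \<bar>F k x - f x\<bar> * ?w x \<partial>\<gamma>) \<le> E k" for k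
    proof -
      define h where "h x = exp (a * (norm x)\<^sup>2 / 2)" for x :: "real^'n"
      have [measurable]: "h \<in> borel_measurable borel" unfolding h_def by measurable
      have h: "h x > 0" "h x * h x = ?w x" "(h x)\<^sup>2 = ?w x" for x by (auto simp: h_def exp_add[symmetric] power2_eq_square)
      define d where "d x = \<bar>v k x - u x\<bar> * h x" for x
      have [measurable]: "d \<in> borel_measurable borel" unfolding d_def by measurable
      have du: "integrable \<gamma> (\<lambda>x. (d x)\<^sup>2)" "(\<integral>x. (d x)\<^sup>2 \<partial>\<gamma>) \<le> \<epsilon> k"
        using weighted_L2_real[OF _ vu[of k]] \<epsilon>p[of k] by (auto simp: d_def power_mult_distrib h)
      have uh: "integrable \<gamma> (\<lambda>x. (\<bar>u x\<bar> * h x)\<^sup>2)" "(\<integral>x. (\<bar>u x\<bar> * h x)\<^sup>2 \<partial>\<gamma>) = Qt"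
        using uw(1) unfolding Qt by (simp_all add: power_mult_distrib h)
      have p: "integrable \<gamma> (\<lambda>x. (\<bar>u x\<bar> * h x) * d x)" by (rule L2_product(1)[OF _ _ uh(1) du(1)]) measurable
      have "(\<integral>x. \<bar>(\<bar>u x\<bar> * h x) * d x\<bar> \<partial>\<gamma>) \<le> sqrt (\<integral>x. (\<bar>u x\<bar> * h x)\<^sup>2 \<partial>\<gamma>) * sqrt (\<integral>x. (d x)\<^sup>2 \<partial>\<gamma>)"
        by (rule L2_product(2)[OF _ _ uh(1) du(1)]) measurable
      also have "\<dots> \<le> sqrt Qt * e k" unfolding uh(2) e_def using du(2) Qt1 by (intro mult_left_mono) auto
      finally have p2: "(\<integral>x. \<bar>(\<bar>u x\<bar> * h x) * d x\<bar> \<partial>\<gamma>) \<le> sqrt Qt * e k" .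
      let ?b = "\<lambda>x. 2 * \<bar>(\<bar>u x\<bar> * h x) * d x\<bar> + (d x)\<^sup>2 + \<epsilon> k * ?w x"
      have ib: "integrable \<gamma> ?b" using p du(1) wi by simp
      have le: "AE x in \<gamma>. \<bar>F k x - f x\<bar> * ?w x \<le> ?b x"
        using uf
      proof eventually_elim
        case (elim x)
        have "F k x - f x = 2 * u x * (v k x - u x) + (v k x - u x)\<^sup>2 + \<epsilon> k"
          unfolding F_def elim[symmetric] by (simp add: power2_eq_square algebra_simps)
        then have "\<bar>F k x - f x\<bar> \<le> 2 * \<bar>u x\<bar> * \<bar>v k x - u x\<bar> + (v k x - u x)\<^sup>2 + \<epsilon> k"
          using abs_triangle_ineq[of "2 * u x * (v k x - u x) + (v k x - u x)\<^sup>2" "\<epsilon> k"]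
            abs_triangle_ineq[of "2 * u x * (v k x - u x)" "(v k x - u x)\<^sup>2"] \<epsilon>p[of k] by (simp add: abs_mult)
        from mult_right_mono[OF this, of "?w x"]
        have "\<bar>F k x - f x\<bar> * ?w x \<le> (2 * \<bar>u x\<bar> * \<bar>v k x - u x\<bar> + (v k x - u x)\<^sup>2 + \<epsilon> k) * ?w x" by simp
        also have "\<dots> = ?b x" using h(1)[of x] unfolding d_def h(2)[symmetric]
          by (simp add: abs_mult power2_eq_square algebra_simps)
        finally show ?case .
      qed
      show i: "integrable \<gamma> (\<lambda>x. \<bar>F k x - f x\<bar> * ?w x)"
        by (rule Bochner_Integration.integrable_bound[OF ib]) (measurable, use le in eventually_elim, auto)
      have "(\<integral>x. \<bar>F k x - f x\<bar> * ?w x \<partial>\<gamma>) \<le> (\<integral>x. ?b x \<partial>\<gamma>)" by (rule integral_mono_AE[OF i ib le])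
      also have "\<dots> = 2 * (\<integral>x. \<bar>(\<bar>u x\<bar> * h x) * d x\<bar> \<partial>\<gamma>) + (\<integral>x. (d x)\<^sup>2 \<partial>\<gamma>) + \<epsilon> k * ?W"
        using p du(1) wi by simp
      also have "\<dots> \<le> E k" unfolding E_def using p2 du(2) by simp
      finally show "(\<integral>x. \<bar>F k x - f x\<bar> * ?w x \<partial>\<gamma>) \<le> E k" .
    qed
    have iF: "integrable \<gamma> (F k)" for k
    proof -
      obtain B where "B > 0" "\<And>x. \<bar>F k x\<bar> \<le> B" "\<And>x. norm ((2 * v k x) *\<^sub>R V k x) \<le> B" using bounded_C1_bound[OF FC1] by blast
      then show ?thesis by (intro integrable_gaussian_bounded[of _ B]) auto
    qed
    have iFx: "integrable \<gamma> (\<lambda>x. F k x *\<^sub>R x)" for k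
    proof -
      obtain B where B: "B > 0" "\<And>x. \<bar>F k x\<bar> \<le> B" "\<And>x. norm ((2 * v k x) *\<^sub>R V k x) \<le> B" using bounded_C1_bound[OF FC1] by blast
      show ?thesis
        by (rule Bochner_Integration.integrable_bound[OF integrable_mult_right[OF integrable_gaussian_norm, of B]])
           (use B in \<open>auto intro!: AE_I2 mult_right_mono\<close>)
    qed
    have iFw: "integrable \<gamma> (\<lambda>x. F k x * ?w x)" for k
    proof -
      obtain B where B: "B > 0" "\<And>x. \<bar>F k x\<bar> \<le> B" "\<And>x. norm ((2 * v k x) *\<^sub>R V k x) \<le> B" using bounded_C1_bound[OF FC1] by blast
      show ?thesis
        by (rule Bochner_Integration.integrable_bound[OF integrable_mult_right[OF wi, of B]])
           (use B in \<open>auto intro!: AE_I2 mult_right_mono simp: abs_mult\<close>)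
    qed
    have iE: "integrable \<gamma> (\<lambda>x. F k x * ln (F k x))" for k
    proof -
      obtain B where B: "B > 0" "\<And>x. \<bar>F k x\<bar> \<le> B" "\<And>x. norm ((2 * v k x) *\<^sub>R V k x) \<le> B" using bounded_C1_bound[OF FC1] by blast
      show ?thesis by (rule integrable_xlnx(2)[of _ "\<epsilon> k" B]) (use B(2) \<epsilon>p[of k] in \<open>auto simp: F_def abs_le_iff\<close>)
    qed
    have iFf: "integrable \<gamma> (\<lambda>x. \<bar>F k x - f x\<bar>)" for k using iF[of k] fs(3) by simp
    have L1b: "(\<integral>x. \<bar>F k x - f x\<bar> \<partial>\<gamma>) \<le> E k" for k
    proof -
      have "(\<integral>x. \<bar>F k x - f x\<bar> \<partial>\<gamma>) \<le> (\<integral>x. \<bar>F k x - f x\<bar> * ?w x \<partial>\<gamma>)"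
      proof (rule integral_mono[OF iFf Ff(1)])
        show "\<bar>F k x - f x\<bar> \<le> \<bar>F k x - f x\<bar> * ?w x" for x
          using mult_left_mono[OF w1[of x], of "\<bar>F k x - f x\<bar>"] by simp
      qed
      then show ?thesis using Ff(2)[of k] by linarith
    qed
    have L1: "(\<lambda>k. \<integral>x. \<bar>F k x - f x\<bar> \<partial>\<gamma>) \<longlonglongrightarrow> 0"
      by (rule Lim_null_comparison[OF _ E0]) (use L1b in auto)
    have M: "(\<lambda>k. \<integral>x. F k x \<partial>\<gamma>) \<longlonglongrightarrow> 1"
    proof -
      have "norm ((\<integral>x. F k x \<partial>\<gamma>) - 1) \<le> E k" for k
      proof -
        have "(\<integral>x. F k x \<partial>\<gamma>) - 1 = (\<integral>x. F k x - f x \<partial>\<gamma>)" using iF[of k] fs(3,4) by simp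
        also have "norm \<dots> \<le> (\<integral>x. norm (F k x - f x) \<partial>\<gamma>)" by (rule integral_norm_bound)
        also have "\<dots> \<le> E k" using L1b[of k] by (simp only: real_norm_def)
        finally show ?thesis .
      qed
      then have "(\<lambda>k. (\<integral>x. F k x \<partial>\<gamma>) - 1) \<longlonglongrightarrow> 0" by (intro Lim_null_comparison[OF _ E0]) auto
      then show ?thesis by (simp add: LIM_zero_iff)
    qed
    define Qk where "Qk k = (\<integral>x. F k x * ?w x \<partial>\<gamma>)" for k
    have Qk: "Qk \<longlonglongrightarrow> Qt"
    proof -
      have "norm (Qk k - Qt) \<le> E k" for k
      proof -
        have "Qk k - Qt = (\<integral>x. F k x * ?w x - f x * ?w x \<partial>\<gamma>)" unfolding Qk_def Qt_def using iFw[of k] fw by simp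
        also have "norm \<dots> \<le> (\<integral>x. norm (F k x * ?w x - f x * ?w x) \<partial>\<gamma>)" by (rule integral_norm_bound)
        also have "\<dots> = (\<integral>x. \<bar>F k x - f x\<bar> * ?w x \<partial>\<gamma>)"
          by (simp add: left_diff_distrib[symmetric] abs_mult)
        finally show ?thesis using Ff(2)[of k] by simp
      qed
      then have "(\<lambda>k. Qk k - Qt) \<longlonglongrightarrow> 0" by (intro Lim_null_comparison[OF _ E0]) auto
      then show ?thesis by (simp add: LIM_zero_iff)
    qed
    have cenf: "integrable \<gamma> (\<lambda>x. f x *\<^sub>R x)" "(\<integral>x. f x *\<^sub>R x \<partial>\<gamma>) = 0"
    proof -
      show "integrable \<gamma> (\<lambda>x. f x *\<^sub>R x)"
        using cen nn unfolding centered_def by (subst (asm) integrable_density) auto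
      show "(\<integral>x. f x *\<^sub>R x \<partial>\<gamma>) = 0"
        using cen nn unfolding centered_def by (subst (asm) integral_density) auto
    qed
    define \<beta> where "\<beta> k = norm (\<integral>x. F k x *\<^sub>R x \<partial>\<gamma>)" for k
    have \<beta>: "\<beta> \<longlonglongrightarrow> 0"
    proof -
      have "norm (\<beta> k) \<le> (1 + 1 / a) * E k" for k
      proof -
        have "(\<integral>x. F k x *\<^sub>R x \<partial>\<gamma>) = (\<integral>x. F k x *\<^sub>R x - f x *\<^sub>R x \<partial>\<gamma>)" using iFx[of k] cenf by simp
        then have "\<beta> k = norm (\<integral>x. F k x *\<^sub>R x - f x *\<^sub>R x \<partial>\<gamma>)" by (simp only: \<beta>_def)
        also have "\<dots> \<le> (\<integral>x. norm (F k x *\<^sub>R x - f x *\<^sub>R x) \<partial>\<gamma>)" by (rule integral_norm_bound)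
        also have "\<dots> \<le> (\<integral>x. (1 + 1 / a) * (\<bar>F k x - f x\<bar> * ?w x) \<partial>\<gamma>)"
        proof (rule integral_mono)
          show "integrable \<gamma> (\<lambda>x. norm (F k x *\<^sub>R x - f x *\<^sub>R x))" using iFx[of k] cenf(1) by simp
          show "integrable \<gamma> (\<lambda>x. (1 + 1 / a) * (\<bar>F k x - f x\<bar> * ?w x))" using Ff(1)[of k] by (rule integrable_mult_right)
          show "norm (F k x *\<^sub>R x - f x *\<^sub>R x) \<le> (1 + 1 / a) * (\<bar>F k x - f x\<bar> * ?w x)" for x
          proof -
            have "norm (F k x *\<^sub>R x - f x *\<^sub>R x) = \<bar>F k x - f x\<bar> * norm x" by (simp add: scaleR_diff_left[symmetric])
            also have "\<dots> \<le> \<bar>F k x - f x\<bar> * ((1 + 1 / a) * ?w x)"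
              by (rule mult_left_mono[OF norm_le_exp_square[OF a(1)]]) simp
            finally show ?thesis by (simp add: mult_ac)
          qed
        qed
        also have "\<dots> = (1 + 1 / a) * (\<integral>x. \<bar>F k x - f x\<bar> * ?w x \<partial>\<gamma>)" by (rule integral_mult_right_zero)
        also have "\<dots> \<le> (1 + 1 / a) * E k" using Ff(2)[of k] a by (intro mult_left_mono) auto
        finally show ?thesis by (simp add: \<beta>_def)
      qed
      moreover have "(\<lambda>k. (1 + 1 / a) * E k) \<longlonglongrightarrow> (1 + 1 / a) * 0" by (intro tendsto_intros E0)
      ultimately show ?thesis by (intro Lim_null_comparison[where f = \<beta> and g = "\<lambda>k. (1 + 1 / a) * E k"]) auto
    qed
    define Pk where "Pk k = (\<integral>p. \<bar>F k (fst p) - F k (snd p)\<bar> \<partial>(\<gamma> \<Otimes>\<^sub>M \<gamma>))" for k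
    define Pf where "Pf = (\<integral>p. \<bar>f (fst p) - f (snd p)\<bar> \<partial>(\<gamma> \<Otimes>\<^sub>M \<gamma> :: ((real^'n) \<times> (real^'n)) measure))"
    have pf: "integrable (\<gamma> \<Otimes>\<^sub>M \<gamma> :: ((real^'n) \<times> (real^'n)) measure) (\<lambda>p. h (fst p))" "integrable (\<gamma> \<Otimes>\<^sub>M \<gamma> :: ((real^'n) \<times> (real^'n)) measure) (\<lambda>p. h (snd p))"
      "(\<integral>p. h (fst p) \<partial>(\<gamma> \<Otimes>\<^sub>M \<gamma> :: ((real^'n) \<times> (real^'n)) measure)) = (\<integral>x. h x \<partial>\<gamma>)"
      "(\<integral>p. h (snd p) \<partial>(\<gamma> \<Otimes>\<^sub>M \<gamma> :: ((real^'n) \<times> (real^'n)) measure)) = (\<integral>x. h x \<partial>\<gamma>)"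
      if h: "integrable \<gamma> h" for h :: "real^'n \<Rightarrow> real"
    proof -
      have [measurable]: "h \<in> borel_measurable borel" using borel_measurable_integrable[OF h] by simp
      show i1: "integrable (\<gamma> \<Otimes>\<^sub>M \<gamma> :: ((real^'n) \<times> (real^'n)) measure) (\<lambda>p. h (fst p))"
        by (rule gaussian2.Fubini_integrable) (use h in \<open>auto simp: gaussian.prob_space[simplified]\<close>)
      show i2: "integrable (\<gamma> \<Otimes>\<^sub>M \<gamma> :: ((real^'n) \<times> (real^'n)) measure) (\<lambda>p. h (snd p))"
        by (rule gaussian2.Fubini_integrable) (use h in \<open>auto simp: gaussian.prob_space[simplified]\<close>)
      show "(\<integral>p. h (fst p) \<partial>(\<gamma> \<Otimes>\<^sub>M \<gamma> :: ((real^'n) \<times> (real^'n)) measure)) = (\<integral>x. h x \<partial>\<gamma>)"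
        using gaussian2.integral_fst'[OF i1] by (simp add: gaussian.prob_space[simplified])
      show "(\<integral>p. h (snd p) \<partial>(\<gamma> \<Otimes>\<^sub>M \<gamma> :: ((real^'n) \<times> (real^'n)) measure)) = (\<integral>x. h x \<partial>\<gamma>)"
        using gaussian2.integral_fst'[OF i2] by (simp add: gaussian.prob_space[simplified])
    qed
    have Pk: "Pk \<longlonglongrightarrow> Pf"
    proof -
      have "norm (Pk k - Pf) \<le> 2 * E k" for k
      proof -
        note i1 = pf(1,2)[OF iF[of k]] and i2 = pf(1,2)[OF fs(3)] and i3 = pf(1,2)[OF iFf[of k]]
        have "Pk k - Pf = (\<integral>p. \<bar>F k (fst p) - F k (snd p)\<bar> - \<bar>f (fst p) - f (snd p)\<bar> \<partial>(\<gamma> \<Otimes>\<^sub>M \<gamma>))"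
          unfolding Pk_def Pf_def using i1 i2 by simp
        also have "norm \<dots> \<le> (\<integral>p. norm (\<bar>F k (fst p) - F k (snd p)\<bar> - \<bar>f (fst p) - f (snd p)\<bar>) \<partial>(\<gamma> \<Otimes>\<^sub>M \<gamma>))"
          by (rule integral_norm_bound)
        also have "\<dots> \<le> (\<integral>p. \<bar>F k (fst p) - f (fst p)\<bar> + \<bar>F k (snd p) - f (snd p)\<bar> \<partial>(\<gamma> \<Otimes>\<^sub>M \<gamma>))"
        proof (rule integral_mono)
          show "norm (\<bar>F k (fst p) - F k (snd p)\<bar> - \<bar>f (fst p) - f (snd p)\<bar>) \<le> \<bar>F k (fst p) - f (fst p)\<bar> + \<bar>F k (snd p) - f (snd p)\<bar>" for p
          proof -
            have *: "\<bar>\<bar>s - t\<bar> - \<bar>s' - t'\<bar>\<bar> \<le> \<bar>s - s'\<bar> + \<bar>t - t'\<bar>" for s t s' t' :: real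
            proof -
              have "\<bar>\<bar>s - t\<bar> - \<bar>s' - t'\<bar>\<bar> \<le> \<bar>(s - t) - (s' - t')\<bar>" by (rule abs_triangle_ineq3)
              also have "(s - t) - (s' - t') = (s - s') - (t - t')" by simp
              also have "\<bar>\<dots>\<bar> \<le> \<bar>s - s'\<bar> + \<bar>t - t'\<bar>" by (rule abs_triangle_ineq4)
              finally show ?thesis .
            qed
            show ?thesis unfolding real_norm_def by (rule *)
          qed
        qed (use i1 i2 i3 in auto)
        also have "\<dots> = 2 * (\<integral>x. \<bar>F k x - f x\<bar> \<partial>\<gamma>)" using i3 pf(3,4)[OF iFf[of k]] by simp
        finally show ?thesis using L1b[of k] by simp
      qed
      then have "(\<lambda>k. Pk k - Pf) \<longlonglongrightarrow> 0"
        by (intro Lim_null_comparison[OF _ tendsto_mult_right_zero[OF E0, of 2]]) auto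
      then show ?thesis by (simp add: LIM_zero_iff)
    qed
    have Pf0: "Pf \<ge> 0" unfolding Pf_def by simp
    \<comment> \<open>The maximum makes \<open>S k\<close> nonnegative, so that it may be squared; the limit is nonnegative
      anyway.\<close>
    define S where "S k = max 0 (Pk k - c * \<beta> k)" for k
    have S: "S \<longlonglongrightarrow> Pf"
    proof -
      have "S \<longlonglongrightarrow> max 0 (Pf - c * 0)" unfolding S_def by (intro tendsto_intros Pk \<beta>)
      then show ?thesis using Pf0 by simp
    qed
    define I where "I = (\<integral>x. (norm (g x))\<^sup>2 \<partial>\<gamma>)"
    define J where "J k = I + 2 * (sqrt I * e k) + \<epsilon> k" for k
    have ig: "integrable \<gamma> (\<lambda>x. (norm (g x))\<^sup>2)"
      using fg unfolding weighted_L2_def by (intro integrableI_bounded) auto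
    have VJ: "(\<integral>x. (norm (V k x))\<^sup>2 \<partial>\<gamma>) \<le> J k" for k
    proof -
      define D where "D x = norm (V k x - g x)" for x
      have [measurable]: "D \<in> borel_measurable borel" unfolding D_def by measurable
      have iD: "integrable \<gamma> (\<lambda>x. (D x)\<^sup>2)" "(\<integral>x. (D x)\<^sup>2 \<partial>\<gamma>) \<le> \<epsilon> k"
        using weighted_L2_0_real[OF _ Vg[of k]] \<epsilon>p[of k] by (auto simp: D_def)
      have p: "integrable \<gamma> (\<lambda>x. norm (g x) * D x)" by (rule L2_product(1)[OF _ _ ig iD(1)]) measurable
      have "(\<integral>x. \<bar>norm (g x) * D x\<bar> \<partial>\<gamma>) \<le> sqrt I * sqrt (\<integral>x. (D x)\<^sup>2 \<partial>\<gamma>)"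
        unfolding I_def by (rule L2_product(2)[OF _ _ ig iD(1)]) measurable
      also have "\<dots> \<le> sqrt I * e k" unfolding e_def using iD(2) by (intro mult_left_mono) (auto simp: I_def)
      finally have p2: "(\<integral>x. \<bar>norm (g x) * D x\<bar> \<partial>\<gamma>) \<le> sqrt I * e k" .
      have "(\<integral>x. (norm (V k x))\<^sup>2 \<partial>\<gamma>) \<le> (\<integral>x. (norm (g x))\<^sup>2 + 2 * \<bar>norm (g x) * D x\<bar> + (D x)\<^sup>2 \<partial>\<gamma>)"
      proof (rule integral_mono)
        obtain B where B: "B > 0" "\<And>x. \<bar>v k x\<bar> \<le> B" "\<And>x. norm (V k x) \<le> B" using bounded_C1_bound[OF vV] by blast
        show "integrable \<gamma> (\<lambda>x. (norm (V k x))\<^sup>2)"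
          by (rule integrable_gaussian_bounded[of _ "B\<^sup>2"]) (use B in \<open>auto intro: power_mono\<close>)
        show "integrable \<gamma> (\<lambda>x. (norm (g x))\<^sup>2 + 2 * \<bar>norm (g x) * D x\<bar> + (D x)\<^sup>2)" using ig p iD(1) by simp
        fix x
        have "norm (V k x) \<le> norm (g x) + D x" using norm_triangle_ineq[of "g x" "V k x - g x"] by (simp add: D_def)
        from power_mono[OF this norm_ge_zero, of 2]
        show "(norm (V k x))\<^sup>2 \<le> (norm (g x))\<^sup>2 + 2 * \<bar>norm (g x) * D x\<bar> + (D x)\<^sup>2"
          by (simp add: power2_sum D_def abs_mult)
      qed
      also have "\<dots> = I + 2 * (\<integral>x. \<bar>norm (g x) * D x\<bar> \<partial>\<gamma>) + (\<integral>x. (D x)\<^sup>2 \<partial>\<gamma>)"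
        using ig p iD(1) by (simp add: I_def)
      also have "\<dots> \<le> J k" unfolding J_def using p2 iD(2) by simp
      finally show ?thesis .
    qed
    have J: "J \<longlonglongrightarrow> I"
    proof -
      have "J \<longlonglongrightarrow> I + 2 * (sqrt I * 0) + 0" unfolding J_def by (intro tendsto_intros e0 \<epsilon>0)
      then show ?thesis by simp
    qed
    define U where "U k = 2 * J k + (\<integral>x. F k x \<partial>\<gamma>) * ln (\<integral>x. F k x \<partial>\<gamma>) - \<kappa> * ((S k)\<^sup>2 / (4 * c\<^sup>2 * Qk k))" for k
    have "U \<longlonglongrightarrow> 2 * I + 1 * ln 1 - \<kappa> * (Pf\<^sup>2 / (4 * c\<^sup>2 * Qt))"
      unfolding U_def by (intro tendsto_intros J M S Qk) (use c0 Qt1 in auto)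
    then have U: "U \<longlonglongrightarrow> 2 * I - \<kappa> * (Pf\<^sup>2 / (4 * c\<^sup>2 * Qt))" by simp
    have EU: "(\<integral>x. F k x * ln (F k x) \<partial>\<gamma>) \<le> U k" for k
    proof -
      have "(\<integral>x. F k x * ln (F k x) \<partial>\<gamma>) \<le> 2 * (\<integral>x. (norm (V k x))\<^sup>2 \<partial>\<gamma>) + (\<integral>x. F k x \<partial>\<gamma>) * ln (\<integral>x. F k x \<partial>\<gamma>)
          - a / (2 * (1 + a)) * ((S k)\<^sup>2 / (4 * c\<^sup>2 * Qk k))"
        by (rule deficit_bound_bounded_C1(2)[OF vV[of k] \<epsilon>p[of k] a F_def[of k] c_def Qk_def[of k]])
           (simp only: S_def Pk_def \<beta>_def)
      then show ?thesis using VJ[of k] unfolding U_def \<kappa>_def by linarith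
    qed
    have "relative_entropy f \<le> 2 * I - \<kappa> * (Pf\<^sup>2 / (4 * c\<^sup>2 * Qt))"
      unfolding relative_entropy_def
      by (rule entropy_lower_semicontinuous[OF _ _ nn F0 fs(3) iF iE L1 EU U]) measurable
    moreover have "fisher_information f = 4 * I"
      unfolding I_def by (rule fisher_information_eq[OF fs(1,2) _ fs(5) fg]) (use ug in \<open>simp add: u_def[abs_def]\<close>)
    ultimately have \<delta>: "\<kappa> * (Pf\<^sup>2 / (4 * c\<^sup>2 * Qt)) \<le> log_sobolev_deficit f"
      by (simp add: log_sobolev_deficit_def)
    have "\<kappa> * (Pf\<^sup>2 / (4 * c\<^sup>2 * Q)) \<le> \<kappa> * (Pf\<^sup>2 / (4 * c\<^sup>2 * Qt))"
      using \<kappa>0 c0 QtQ Qt1 by (intro mult_left_mono divide_left_mono mult_pos_pos) auto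
    with \<delta> have "\<kappa> * (Pf\<^sup>2 / (4 * c\<^sup>2 * Q)) \<le> log_sobolev_deficit f" by linarith
    then have PK: "Pf\<^sup>2 \<le> K * Q * log_sobolev_deficit f"
      unfolding K_def using \<kappa>0 c0 QtQ Qt1 by (simp add: field_simps)
    have "(\<integral>x. \<bar>f x - 1\<bar> \<partial>\<gamma>) \<le> Pf"
    proof -
      have ip: "integrable (\<gamma> \<Otimes>\<^sub>M \<gamma>) (\<lambda>p. \<bar>f (fst p) - f (snd p)\<bar>)" using pf(1,2)[OF fs(3)] by simp
      have "(\<integral>x. \<bar>f x - 1\<bar> \<partial>\<gamma>) \<le> (\<integral>x. \<integral>y. \<bar>f x - f y\<bar> \<partial>\<gamma> \<partial>\<gamma>)"
      proof (rule integral_mono)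
        show "integrable \<gamma> (\<lambda>x. \<bar>f x - 1\<bar>)" using fs(3) by simp
        show "integrable \<gamma> (\<lambda>x. \<integral>y. \<bar>f x - f y\<bar> \<partial>\<gamma>)" using gaussian2.integrable_fst'[OF ip] by simp
        fix x
        have "f x - 1 = (\<integral>y. f x - f y \<partial>\<gamma>)" using fs(3,4) by (simp add: gaussian.prob_space[simplified])
        then show "\<bar>f x - 1\<bar> \<le> (\<integral>y. \<bar>f x - f y\<bar> \<partial>\<gamma>)" using integral_norm_bound[of \<gamma> "\<lambda>y. f x - f y"] by simp
      qed
      also have "\<dots> = Pf" unfolding Pf_def using gaussian2.integral_fst'[OF ip] by simp
      finally show ?thesis .
    qed
    then have "(\<integral>x. \<bar>f x - 1\<bar> \<partial>\<gamma>)\<^sup>2 \<le> Pf\<^sup>2" by (intro power_mono) auto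
    with PK show "(\<integral>x. \<bar>f x - 1\<bar> \<partial>\<gamma>)\<^sup>2 \<le> K * Q * log_sobolev_deficit f" by linarith
  qed
qed

section \<open>Convergence in \<open>L\<^sup>p\<close>\<close>

theorem corollary1p11:
  fixes f :: "nat \<Rightarrow> real^'n \<Rightarrow> real" and p \<epsilon> C N :: real
  assumes "p \<ge> 1" and "\<epsilon> > 0" and "C > 0" and "N > 0"
    and "\<And>k. gaussian_prob_density (f k)"
    and "\<And>k. centered (density gaussian_measure (\<lambda>x. ennreal (f k x)))"
    and "\<And>k. gaussian_W12 (\<lambda>x. sqrt (f k x))"
    and "\<And>k. (\<integral>\<^sup>+x. ennreal (f k x * exp (- (1 / 2 - \<epsilon> / (4 * pi)) * (norm x)\<^sup>2)) \<partial>lborel) \<le> ennreal C"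
    and "\<And>k. (\<integral>\<^sup>+x. ennreal (\<bar>f k x\<bar> powr (2 * p - 1)) \<partial>gaussian_measure) \<le> ennreal N"
    and "(\<lambda>k. log_sobolev_deficit (f k)) \<longlonglongrightarrow> 0"
  shows "tendsto_Lp gaussian_measure p f (\<lambda>_. 1)"
proof -
  note fs = sqrt_density_facts[OF assms(5,7)]
  note [measurable] = fs(1)
  \<comment> \<open>Any value below \<open>1/2\<close> keeps \<open>exp (a |x|\<^sup>2)\<close> integrable; lowering \<open>a\<close> only weakens the
    moment hypothesis.\<close>
  define a where "a = min (1 / 4) (\<epsilon> / (4 * pi))"
  have a: "a > 0" "a < 1 / 2" "a \<le> \<epsilon> / (4 * pi)" using assms(2) by (auto simp: a_def)
  obtain K where K: "K > 0" "\<And>(f :: real^'n \<Rightarrow> real) Q. gaussian_prob_density f \<Longrightarrow> centered (density \<gamma> (\<lambda>x. ennreal (f x)))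
     \<Longrightarrow> gaussian_W12 (\<lambda>x. sqrt (f x)) \<Longrightarrow> (\<integral>\<^sup>+x. ennreal (f x * exp (a * (norm x)\<^sup>2)) \<partial>\<gamma>) \<le> ennreal Q
     \<Longrightarrow> Q \<ge> 0 \<Longrightarrow> (\<integral>x. \<bar>f x - 1\<bar> \<partial>\<gamma>)\<^sup>2 \<le> K * Q * log_sobolev_deficit f"
    using log_sobolev_L1_stability[OF a(1,2), where 'n = 'n] by blast
  have mom: "(\<integral>\<^sup>+x. ennreal (f k x * exp (a * (norm x)\<^sup>2)) \<partial>\<gamma>) \<le> ennreal C" for k
  proof -
    have "(\<integral>\<^sup>+x. ennreal (f k x * exp (a * (norm x)\<^sup>2)) \<partial>\<gamma>) = (\<integral>\<^sup>+x. ennreal (gauss_density x) * ennreal (f k x * exp (a * (norm x)\<^sup>2)) \<partial>lborel)"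
      by (rule nn_integral_gaussian) measurable
    also have "\<dots> \<le> (\<integral>\<^sup>+x. ennreal (f k x * exp (- (1 / 2 - \<epsilon> / (4 * pi)) * (norm x)\<^sup>2)) \<partial>lborel)"
    proof (rule nn_integral_mono_AE)
      show "AE x in lborel. ennreal (gauss_density x) * ennreal (f k x * exp (a * (norm x)\<^sup>2)) \<le> ennreal (f k x * exp (- (1 / 2 - \<epsilon> / (4 * pi)) * (norm x)\<^sup>2))"
        using fs(2)[of k]
      proof eventually_elim
        case (elim x)
        let ?c = "(2 * pi) powr (- real CARD('n) / 2)"
        have c1: "?c \<le> 1"
        proof -
          have "?c \<le> (2 * pi) powr 0" using pi_gt3 by (intro powr_mono) auto
          then show ?thesis using pi_gt3 by simp
        qed
        have "gauss_density x * exp (a * (norm x)\<^sup>2) = ?c * exp (- (1 / 2 - a) * (norm x)\<^sup>2)"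
          by (simp add: gauss_density_def mult.assoc exp_add[symmetric] left_diff_distrib)
        also have "\<dots> \<le> 1 * exp (- (1 / 2 - \<epsilon> / (4 * pi)) * (norm x)\<^sup>2)"
        proof (rule mult_mono[OF c1])
          have "- (1 / 2 - a) * (norm x)\<^sup>2 \<le> - (1 / 2 - \<epsilon> / (4 * pi)) * (norm x)\<^sup>2"
            using a(3) by (intro mult_right_mono) auto
          then show "exp (- (1 / 2 - a) * (norm x)\<^sup>2) \<le> exp (- (1 / 2 - \<epsilon> / (4 * pi)) * (norm x)\<^sup>2)" by (simp only: exp_le_cancel_iff)
        qed auto
        finally have "f k x * (gauss_density x * exp (a * (norm x)\<^sup>2)) \<le> f k x * exp (- (1 / 2 - \<epsilon> / (4 * pi)) * (norm x)\<^sup>2)"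
          using elim by (intro mult_left_mono) auto
        then show ?case using elim by (subst ennreal_mult[symmetric]) (auto intro!: ennreal_leI simp: mult_ac)
      qed
    qed
    also have "\<dots> \<le> ennreal C" by (rule assms(8))
    finally show ?thesis .
  qed
  define D where "D k = (\<integral>x. \<bar>f k x - 1\<bar> \<partial>\<gamma>)" for k
  have D0: "D k \<ge> 0" for k by (simp add: D_def)
  have "(\<lambda>k. (D k)\<^sup>2) \<longlonglongrightarrow> 0"
  proof (rule tendsto_sandwich[OF _ _ tendsto_const])
    show "\<forall>\<^sub>F k in sequentially. (D k)\<^sup>2 \<le> K * C * log_sobolev_deficit (f k)"
      unfolding D_def using K(2)[OF assms(5,6,7) mom] assms(3) by simp
    show "(\<lambda>k. K * C * log_sobolev_deficit (f k)) \<longlonglongrightarrow> 0"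
      by (rule tendsto_mult_right_zero[OF assms(10)])
  qed simp
  then have DL: "D \<longlonglongrightarrow> 0" using tendsto_real_sqrt[of "\<lambda>k. (D k)\<^sup>2" 0] D0 by simp
  \<comment> \<open>The midpoint of \<open>1\<close> and \<open>q\<close> is \<open>p\<close>, so \<open>|t|\<^sup>p\<close> is the product of \<open>|t|\<close> to the powers
    \<open>1/2\<close> and \<open>q/2\<close>.\<close>
  define q where "q = 2 * p - 1"
  have q: "q \<ge> 1" using assms(1) by (simp add: q_def)
  have iq: "integrable \<gamma> (\<lambda>x. \<bar>f k x\<bar> powr q)" "(\<integral>x. \<bar>f k x\<bar> powr q \<partial>\<gamma>) \<le> N" for k
  proof -
    show i: "integrable \<gamma> (\<lambda>x. \<bar>f k x\<bar> powr q)"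
      using assms(9)[of k] by (intro integrableI_bounded) (auto simp: q_def intro: le_less_trans)
    have "ennreal (\<integral>x. \<bar>f k x\<bar> powr q \<partial>\<gamma>) \<le> ennreal N"
      using nn_integral_eq_integral[OF i] assms(9)[of k] by (simp add: q_def)
    then show "(\<integral>x. \<bar>f k x\<bar> powr q \<partial>\<gamma>) \<le> N" using assms(4) by (subst (asm) ennreal_le_iff) auto
  qed
  define N' where "N' = 2 powr q * (N + 1)"
  have diffq: "\<bar>t - 1\<bar> powr q \<le> 2 powr q * (\<bar>t\<bar> powr q + 1)" for t :: real
  proof -
    have "\<bar>t - 1\<bar> powr q \<le> (2 * max \<bar>t\<bar> 1) powr q" using q by (intro powr_mono2) auto
    also have "\<dots> = 2 powr q * (max \<bar>t\<bar> 1) powr q" by (simp add: powr_mult)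
    also have "\<dots> \<le> 2 powr q * (\<bar>t\<bar> powr q + 1)" by (intro mult_left_mono) (auto simp: max_def)
    finally show ?thesis .
  qed
  have iq1: "integrable \<gamma> (\<lambda>x. \<bar>f k x - 1\<bar> powr q)" "(\<integral>x. \<bar>f k x - 1\<bar> powr q \<partial>\<gamma>) \<le> N'" for k
  proof -
    have ib: "integrable \<gamma> (\<lambda>x. 2 powr q * (\<bar>f k x\<bar> powr q + 1))" using iq(1)[of k] by simp
    show i: "integrable \<gamma> (\<lambda>x. \<bar>f k x - 1\<bar> powr q)"
      by (rule Bochner_Integration.integrable_bound[OF ib]) (use diffq in \<open>auto intro!: AE_I2 order_trans[OF _ abs_ge_self]\<close>)
    have "(\<integral>x. \<bar>f k x - 1\<bar> powr q \<partial>\<gamma>) \<le> (\<integral>x. 2 powr q * (\<bar>f k x\<bar> powr q + 1) \<partial>\<gamma>)"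
      by (rule integral_mono[OF i ib diffq])
    also have "\<dots> = 2 powr q * ((\<integral>x. \<bar>f k x\<bar> powr q \<partial>\<gamma>) + 1)"
      using iq(1)[of k] by (simp add: gaussian.prob_space[simplified])
    also have "\<dots> \<le> N'" unfolding N'_def using iq(2)[of k] by (intro mult_left_mono) auto
    finally show "(\<integral>x. \<bar>f k x - 1\<bar> powr q \<partial>\<gamma>) \<le> N'" .
  qed
  have interp: "(\<integral>x. \<bar>f k x - 1\<bar> powr p \<partial>\<gamma>) \<le> sqrt (D k) * sqrt N'" for k
  proof -
    let ?g = "\<lambda>x. \<bar>f k x - 1\<bar>"
    have "(\<integral>x. \<bar>?g x powr (1 / 2) * ?g x powr (q / 2)\<bar> \<partial>\<gamma>)
       \<le> sqrt (\<integral>x. (?g x powr (1 / 2))\<^sup>2 \<partial>\<gamma>) * sqrt (\<integral>x. (?g x powr (q / 2))\<^sup>2 \<partial>\<gamma>)"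
    proof (rule L2_product(2))
      show "integrable \<gamma> (\<lambda>x. (?g x powr (1 / 2))\<^sup>2)" using fs(3)[of k] by (simp add: powr_half_sqrt)
      show "integrable \<gamma> (\<lambda>x. (?g x powr (q / 2))\<^sup>2)" using iq1(1)[of k] by (simp add: powr_powr power2_eq_square powr_add[symmetric])
    qed measurable
    moreover have "\<bar>?g x powr (1 / 2) * ?g x powr (q / 2)\<bar> = ?g x powr p" for x
    proof -
      have "1 / 2 + q / 2 = p" by (simp add: q_def field_simps)
      then show ?thesis by (simp add: powr_add[symmetric])
    qed
    moreover have "(?g x powr (1 / 2))\<^sup>2 = ?g x" for x by (simp add: powr_half_sqrt)
    moreover have "(?g x powr (q / 2))\<^sup>2 = ?g x powr q" for x by (simp add: power2_eq_square powr_add[symmetric])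
    ultimately have "(\<integral>x. ?g x powr p \<partial>\<gamma>) \<le> sqrt (D k) * sqrt (\<integral>x. ?g x powr q \<partial>\<gamma>)" by (simp add: D_def)
    also have "\<dots> \<le> sqrt (D k) * sqrt N'" using iq1(2)[of k] D0 by (intro mult_left_mono) auto
    finally show ?thesis .
  qed
  have lim: "(\<lambda>k. \<integral>x. \<bar>f k x - 1\<bar> powr p \<partial>\<gamma>) \<longlonglongrightarrow> 0"
  proof (rule tendsto_sandwich[OF _ _ tendsto_const])
    have "(\<lambda>k. sqrt (D k) * sqrt N') \<longlonglongrightarrow> sqrt 0 * sqrt N'" by (intro tendsto_intros DL)
    then show "(\<lambda>k. sqrt (D k) * sqrt N') \<longlonglongrightarrow> 0" by simp
  qed (use interp in auto)
  have "Lp_space \<gamma> p (f k)" for k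
    unfolding Lp_space_def
  proof
    have "integrable \<gamma> (\<lambda>x. 1 + \<bar>f k x\<bar> powr q)" using iq(1)[of k] by simp
    then show "integrable \<gamma> (\<lambda>x. norm (f k x) powr p)"
    proof (rule Bochner_Integration.integrable_bound)
      show "AE x in \<gamma>. norm (norm (f k x) powr p) \<le> norm (1 + \<bar>f k x\<bar> powr q)"
      proof (rule AE_I2)
        fix x
        show "norm (norm (f k x) powr p) \<le> norm (1 + \<bar>f k x\<bar> powr q)"
        proof (cases "\<bar>f k x\<bar> \<le> 1")
          case True
          then have "\<bar>f k x\<bar> powr p \<le> 1 powr p" using assms(1) by (intro powr_mono2) auto
          then show ?thesis by (simp add: add_increasing2)
        next
          case False
          then have "\<bar>f k x\<bar> powr p \<le> \<bar>f k x\<bar> powr q" using assms(1) by (intro powr_mono) (auto simp: q_def)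
          then show ?thesis by simp
        qed
      qed
    qed measurable
  qed measurable
  moreover have "Lp_space \<gamma> p (\<lambda>_::real^'n. 1 :: real)" by (simp add: Lp_space_def)
  moreover have "(\<lambda>k. Lp_norm \<gamma> p (\<lambda>x. f k x - 1)) \<longlonglongrightarrow> 0"
  proof -
    have "(\<lambda>k. (\<integral>x. \<bar>f k x - 1\<bar> powr p \<partial>\<gamma>) powr (1 / p)) \<longlonglongrightarrow> 0 powr (1 / p)"
      by (rule tendsto_powr'[OF lim tendsto_const]) (use assms(1) in auto)
    then show ?thesis by (simp add: Lp_norm_def)
  qed
  ultimately show ?thesis unfolding tendsto_Lp_def by blast
qed

end
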